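(* Let $q\geq 3$ be fixed and let $a$ be an integer with $(a,q)=1$. For $k\geq 2$ let $\mathbf{a}=(a,a,\dots,a)$ ($k$ coordinates). Then: (i) For fixed $k\geq 2$, $$\frac{M_k(x;\mathbf{a})}{\frac{1}{\phi^k(q)}S_k(x)}=1+\frac{(k-1)C(q,a)}{\log\log x}+O_{q,k}\left(\frac{1}{(\log\log x)^2}\right).$$ (ii) If $k=o(\log\log x)$ as $x\to\infty$, then $$\frac{M_k(x;\mathbf{a})}{\frac{1}{\phi^k(q)}S_k(x)}=1+\frac{(k-1)(C(q,a)+o(1))}{\log\log x}.$$ (iii) For fixed $A>0$ and $k\sim A\log\log x$, as $x\to\infty$, $$\frac{M_k(x;\mathbf{a})}{\frac{1}{\phi^k(q)}S_k(x)}\sim\prod_p\frac{1+\frac{A\phi(q)\mathbb{1}_{p\equiv a \bmod q}(p)}{p}}{1+\frac{A\chi_0(p)}{p}},$$ the product being over all primes $p$.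
   Context: For $\mathbf{a}=(a_1,\dots,a_k)$ with $(a_j,q)=1$, $M_k(x;\mathbf{a})$ denotes the number of integers $n\leq x$ that can be written as $n=p_1p_2\cdots p_k$ with $p_1,\dots,p_k$ distinct primes and $p_j\equiv a_j \bmod q$ for $1\leq j\leq k$ (any ordering of the prime factors is allowed; each such $n$ is counted once). $S_k(x)$ denotes the number of integers $n\leq x$ of the form $n=p_1\cdots p_k$ with $p_1,\dots,p_k$ distinct primes and $(p_1\cdots p_k,q)=1$. $\phi$ is Euler's function, $\chi_0$ is the principal Dirichlet character modulo $q$, and $\mathbb{1}_{p\equiv a\bmod q}(p)$ is $1$ if $p\equiv a\bmod q$ and $0$ otherwise. The constant $C(q,a)$ is $$C(q,a)=\lim_{x\to\infty}\Big(\phi(q)\sum_{\substack{p\leq x\\ p\equiv a\bmod q}}\frac1p-\sum_{\substack{p\leq x\\(p,q)=1}}\frac1p\Big)=\sum_{\chi\neq\chi_0}\bar\chi(a)\sum_p\frac{\chi(p)}{p},$$ the sum over $\chi$ being over non-principal Dirichlet characters modulo $q$. *)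

theory Defs
  imports
    "HOL-Analysis.Infinite_Products"
    "HOL-Library.Landau_Symbols"
    "HOL-Number_Theory.Number_Theory"
begin

text \<open>A vector \<open>(a\<^sub>1, \<dots>, a\<^sub>k)\<close> is a function on indices of which only the values on \<open>{1..k}\<close>
  matter. The numbers \<open>n\<close> counted are products of primes, hence positive, so they range over
  the natural numbers.\<close>

definition M_count :: "nat \<Rightarrow> nat \<Rightarrow> real \<Rightarrow> (nat \<Rightarrow> int) \<Rightarrow> nat" where
  "M_count q k x a = card {n :: nat. real n \<le> x \<and>
     (\<exists>p :: nat \<Rightarrow> nat. n = (\<Prod>j=1..k. p j) \<and> inj_on p {1..k} \<and>
        (\<forall>j\<in>{1..k}. prime (p j) \<and> [int (p j) = a j] (mod int q)))}"

definition S_count :: "nat \<Rightarrow> nat \<Rightarrow> real \<Rightarrow> nat" where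
  "S_count q k x = card {n :: nat. real n \<le> x \<and>
     (\<exists>p :: nat \<Rightarrow> nat. n = (\<Prod>j=1..k. p j) \<and> inj_on p {1..k} \<and>
        (\<forall>j\<in>{1..k}. prime (p j)) \<and> coprime (\<Prod>j=1..k. p j) q)}"

definition C_const :: "nat \<Rightarrow> int \<Rightarrow> real" where
  "C_const q a = Lim at_top (\<lambda>x :: real.
     real (totient q) *
       (\<Sum>p | prime p \<and> real p \<le> x \<and> [int p = a] (mod int q). 1 / real p)
     - (\<Sum>p | prime p \<and> real p \<le> x \<and> coprime p q. 1 / real p))"

definition principal_char :: "nat \<Rightarrow> nat \<Rightarrow> real" where
  "principal_char q n = (if coprime n q then 1 else 0)"

definition residue_indicator :: "nat \<Rightarrow> int \<Rightarrow> nat \<Rightarrow> real" where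
  "residue_indicator q a n = (if [int n = a] (mod int q) then 1 else 0)"

text \<open>In general the product converges only conditionally, so the primes are taken in increasing
  order: the product runs over all natural numbers, with factor 1 at the non-primes.\<close>

definition euler_prod :: "nat \<Rightarrow> int \<Rightarrow> real \<Rightarrow> real" where
  "euler_prod q a A = (\<Prod>p. if prime p
     then (1 + A * real (totient q) * residue_indicator q a p / real p)
            / (1 + A * principal_char q p / real p)
     else 1)"

end

theory Submission
  imports Defs "HOL-Complex_Analysis.Complex_Analysis" "HOL-Real_Asymp.Real_Asymp"
begin

text \<open>
  Give every prime the weight \<open>w\<^sub>1 p = \<phi> q\<close> if \<open>p \<equiv> a\<close> and \<open>0\<close> otherwise, or the weight \<open>w\<^sub>0 p = 1\<close> if
  \<open>p\<close> is coprime to \<open>q\<close> and \<open>0\<close> otherwise. Then \<open>\<phi>\<^sup>k M\<^sub>k\<close> and \<open>S\<^sub>k\<close> are the sums \<open>N\<^sub>k(x)\<close> of the products of weights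
  over the sets of \<open>k\<close> primes with product at most \<open>x\<close>. Let \<open>L\<^sub>k(x)\<close> be the same sum with the weights
  \<open>w p / p\<close>. Pointing at one prime \<open>p\<close> of a set gives
  \<open>(k + 1) L\<^sub>k\<^sub>+\<^sub>1 = (\<Sum>\<^sub>Q w(Q) / \<Prod>Q \<sqdot> \<Sum>\<^sub>p\<^sub>\<le>\<^sub>x\<^sub>/\<^sub>\<Prod>\<^sub>Q w p / p) \<approx> (ln ln x + b) L\<^sub>k\<close>, where \<open>b\<close> is the Mertens constant of
  the weight and \<open>b\<^sub>1 - b\<^sub>0 = C(q, a)\<close>; weighting by \<open>ln (\<Prod>P)\<close> and the prime number theorem for
  progressions give \<open>N\<^sub>k\<^sub>+\<^sub>1 ln x / x \<approx> L\<^sub>k\<close>. Iterating the recursion for both weights compares the two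
  sums \<open>L\<^sub>k\<close> for \<open>k \<le> ln ln x\<close>, which gives (i) and (ii). For (iii) the weight is changed from \<open>w\<^sub>0\<close> to \<open>w\<^sub>1\<close> one
  prime at a time up to \<open>y\<close>, each change contributing an Euler factor; the remaining primes change
  \<open>L\<^sub>k\<close> little because \<open>\<Sum>\<^sub>p (w\<^sub>1 p - w\<^sub>0 p) / p\<close> converges. The prime number theorem for progressions,
  with a saving of a small power of \<open>ln x\<close>, comes from an effective zero-free region (the 3-4-1
  inequality and Monsky's proof of \<open>L(1, \<chi>) \<noteq> 0\<close>) and Newman's contour method.\<close>

unbundle no vec_syntax

section \<open>Dirichlet characters\<close>

text \<open>The two counts are compared with each other rather than evaluated: in the quotient of
  consecutive quotients the common main term cancels and the difference of the Mertens constants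
  survives. Passing from \<open>N\<close> to \<open>L\<close> lowers the index by one, which is the
  source of the factor k - 1 in (i) and (ii). One step of the recursion has relative error of order
  k / (ln ln x)^2, so k steps give (k / ln ln x)^2. This is good for k = o(ln ln x), but of constant
  size for k ~ A ln ln x; hence the different route for (iii). The obstacle throughout is the sets
  whose product is close to x: there the remaining range x / \<Prod>Q is short and Mertens' estimate
  says nothing, so such sets must be shown to carry little weight, which Chebyshev's bound and
  logarithmic weights achieve. The recursion works with errors 1 / ln ln u in Mertens' estimate, so
  a saving of any fixed power of ln u in the prime number theorem is enough. This is why the
  zero-free region may have the crude width const / (2 + |t|)^15, obtained from polynomial bounds
  alone.\<close>

definition partial_char :: "nat => nat set => (nat => complex) => bool" where
 "partial_char q H \<chi> \<longleftrightarrow> 1 \<in> H & \<chi> 1 = 1 & (\<forall>x\<in>H. coprime x q) &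
  (\<forall>x\<in>H. \<forall>y\<in>H. x * y \<in> H & \<chi> (x * y) = \<chi> x * \<chi> y) &
  (\<forall>x\<in>H. ALL y. [x = y] (mod q) --> y \<in> H & \<chi> y = \<chi> x)"

lemma partial_charD:
 assumes "partial_char q H \<chi>"
 shows "1 \<in> H" "\<chi> 1 = 1" "x \<in> H ==> coprime x q"
  "x \<in> H ==> y \<in> H ==> x * y \<in> H & \<chi> (x * y) = \<chi> x * \<chi> y"
  "x \<in> H ==> [x = y] (mod q) ==> y \<in> H & \<chi> y = \<chi> x"
 using assms unfolding partial_char_def by blast+

lemma partial_char_power:
 assumes "partial_char q H \<chi>" "x \<in> H"
 shows "x ^ k \<in> H & \<chi> (x ^ k) = \<chi> x ^ k"
proof (induction k)
 case 0
 show ?case using partial_charD(1,2)[OF assms(1)] by simp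
next
 case (Suc k)
 thus ?case using partial_charD(4)[OF assms(1) assms(2), of "x ^ k"] by simp
qed

text \<open>The set \<open>H\<close> stands for a subgroup of the unit group, given as a union of
  residue classes and only assumed closed under products. Euler's theorem supplies the inverses:
  multiplying by \<open>h ^ (totient q - 1)\<close> undoes multiplication by
  \<open>h\<close>.\<close>

lemma partial_char_cancel:
 assumes H: "partial_char q H \<chi>" and q: "q > 1" and h: "h \<in> H" and gh: "g * h \<in> H"
 shows "g \<in> H"
proof -
 have cop: "coprime h q" using partial_charD(3)[OF H h] .
 have "totient q > 0" using q by simp
 hence eq: "g * h * h ^ (totient q - 1) = g * h ^ totient q"
  by (cases "totient q") (auto simp: mult_ac)
 have "[g * h ^ totient q = g * 1] (mod q)"
  by (intro cong_mult cong_refl euler_theorem cop)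
 moreover have "g * h * h ^ (totient q - 1) \<in> H"
  using partial_charD(4)[OF H gh] partial_char_power[OF H h] by blast
 ultimately show ?thesis using partial_charD(5)[OF H] eq by (metis mult.right_neutral)
qed

text \<open>Adjoining one unit: \<open>m\<close> is the order of \<open>g\<close> modulo
  \<open>H\<close>, and every \<open>m\<close>-th root \<open>\<zeta>\<close> of the value already
  fixed at \<open>g ^ m\<close> is a possible value at \<open>g\<close>. This freedom later produces
  a character that is not 1 at a given residue.\<close>

lemma partial_char_extend1:
 assumes H: "partial_char q H \<chi>" and q: "q > 1" and g: "coprime g q"
  and m: "m > 0" "g ^ m \<in> H" "!!i. 0 < i ==> i < m ==> g ^ i \<notin> H"
  and \<zeta>: "\<zeta> ^ m = \<chi> (g ^ m)"
 shows "\<exists>H' \<chi>'. partial_char q H' \<chi>' & H <= H' & g \<in> H' & \<chi>' g = \<zeta> & (\<forall>h\<in>H. \<chi>' h = \<chi> h)"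
proof -
 have H1: "1 \<in> H" "\<chi> 1 = 1" and Hmult: "!!x y. x \<in> H ==> y \<in> H ==> x * y \<in> H & \<chi> (x * y) = \<chi> x * \<chi> y"
  and Hcop: "!!x. x \<in> H ==> coprime x q"
  and Hcong: "!!x y. x \<in> H ==> [x = y] (mod q) ==> y \<in> H & \<chi> y = \<chi> x"
  using partial_charD[OF H] by blast+
 \<comment> \<open>The values at powers of \<open>g\<close> lying in \<open>H\<close> are forced:
   minimality of \<open>m\<close> gives \<open>d >= m\<close>, and cancelling \<open>g ^ m\<close>
   reduces \<open>d\<close> to \<open>d - m\<close>.\<close>
 have pow: "\<chi> (g ^ d) = \<zeta> ^ d" if "g ^ d \<in> H" for d
  using that
 proof (induction d rule: less_induct)
  case (less d)
  show ?case
  proof (cases "d = 0")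
   case True thus ?thesis using H1 by simp
  next
   case False
   hence "d >= m" using m(3)[of d] less.prems by (meson not_le neq0_conv)
   hence d: "g ^ (d - m) * g ^ m = g ^ d" by (simp flip: power_add)
   hence in': "g ^ (d - m) \<in> H"
    using partial_char_cancel[OF H q m(2), of "g ^ (d - m)"] less.prems by simp
   have "\<chi> (g ^ (d - m)) = \<zeta> ^ (d - m)"
    using less.IH[of "d - m"] in' False m(1) by simp
   hence "\<chi> (g ^ d) = \<zeta> ^ (d - m) * \<zeta> ^ m"
    using Hmult[OF in' m(2)] d \<zeta> by simp
   thus ?thesis using \<open>d >= m\<close> by (simp flip: power_add)
  qed
 qed
 have wd1: "\<chi> h * \<zeta> ^ i = \<chi> h' * \<zeta> ^ j"
  if hh: "h \<in> H" "h' \<in> H" "[h * g ^ i = h' * g ^ j] (mod q)" "i <= j" for h h' i j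
 proof -
  have "[h * g ^ i = (h' * g ^ (j - i)) * g ^ i] (mod q)"
   using that by (simp add: mult.assoc flip: power_add)
  hence c: "[h = h' * g ^ (j - i)] (mod q)"
   using cong_mult_rcancel_nat[of "g ^ i" q] g by auto
  hence "h' * g ^ (j - i) \<in> H" "\<chi> (h' * g ^ (j - i)) = \<chi> h" using Hcong[OF hh(1)] by blast+
  moreover from this have in': "g ^ (j - i) \<in> H"
   using partial_char_cancel[OF H q hh(2), of "g ^ (j - i)"] by (simp add: mult.commute)
  ultimately have "\<chi> h = \<chi> h' * \<zeta> ^ (j - i)"
   using Hmult[OF hh(2) in'] pow[OF in'] by simp
  thus ?thesis using hh(4) by (simp add: mult.assoc flip: power_add)
 qed
 have wd: "\<chi> h * \<zeta> ^ i = \<chi> h' * \<zeta> ^ j"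
  if "h \<in> H" "h' \<in> H" "[h * g ^ i = h' * g ^ j] (mod q)" for h h' i j
  using wd1[OF that] wd1[OF that(2,1)] that(3) by (metis cong_sym nle_le)
 \<comment> \<open>The subgroup generated by \<open>H\<close> and \<open>g\<close>. The value of
   \<open>\<chi>'\<close> comes from an arbitrary representation \<open>h * g ^ i\<close>;
   \<open>wd\<close> makes it independent of the choice.\<close>
 define H' where "H' = {y. \<exists>h\<in>H. EX i. [y = h * g ^ i] (mod q)}"
 define \<chi>' where "\<chi>' = (%y. SOME c. \<exists>h\<in>H. EX i. [y = h * g ^ i] (mod q) & c = \<chi> h * \<zeta> ^ i)"
 have val: "y \<in> H' & \<chi>' y = \<chi> h * \<zeta> ^ i" if "h \<in> H" "[y = h * g ^ i] (mod q)" for y h i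
 proof -
  have "\<exists>h\<in>H. EX i. [y = h * g ^ i] (mod q) & \<chi>' y = \<chi> h * \<zeta> ^ i"
   unfolding \<chi>'_def by (rule someI_ex) (use that in blast)
  then obtain h' j where "h' \<in> H" "[y = h' * g ^ j] (mod q)" "\<chi>' y = \<chi> h' * \<zeta> ^ j" by blast
  moreover from this that have "[h * g ^ i = h' * g ^ j] (mod q)" by (meson cong_sym cong_trans)
  ultimately show ?thesis using that wd unfolding H'_def by auto
 qed
 have "partial_char q H' \<chi>'"
  unfolding partial_char_def
 proof (intro conjI ballI allI impI)
  show "1 \<in> H'" "\<chi>' 1 = 1" using val[of 1 1 0] H1 by auto
 next
  fix x assume "x \<in> H'"
  then obtain h i where "h \<in> H" "[x = h * g ^ i] (mod q)" by (auto simp: H'_def)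
  thus "coprime x q" using Hcop g by (metis cong_imp_coprime cong_sym coprime_mult_left_iff coprime_power_left_iff)
 next
  fix x y assume "x \<in> H'" "y \<in> H'"
  then obtain h i h' j where *: "h \<in> H" "[x = h * g ^ i] (mod q)" "h' \<in> H" "[y = h' * g ^ j] (mod q)"
   by (auto simp: H'_def)
  have "[x * y = (h * g ^ i) * (h' * g ^ j)] (mod q)" using * by (intro cong_mult)
  hence "[x * y = (h * h') * g ^ (i + j)] (mod q)" by (simp add: power_add mult_ac)
  hence "x * y \<in> H' & \<chi>' (x * y) = \<chi> (h * h') * \<zeta> ^ (i + j)" using val Hmult *(1,3) by blast
  thus "x * y \<in> H'" "\<chi>' (x * y) = \<chi>' x * \<chi>' y"
   using val[OF *(1,2)] val[OF *(3,4)] Hmult[OF *(1,3)] by (auto simp: power_add)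
 next
  fix x y assume "x \<in> H'" "[x = y] (mod q)"
  then obtain h i where *: "h \<in> H" "[x = h * g ^ i] (mod q)" by (auto simp: H'_def)
  hence "[y = h * g ^ i] (mod q)" using \<open>[x = y] (mod q)\<close> by (meson cong_sym cong_trans)
  thus "y \<in> H'" "\<chi>' y = \<chi>' x" using val *(1,2) by auto
 qed
 moreover have "h \<in> H' & \<chi>' h = \<chi> h" if "h \<in> H" for h using val[of h h 0] that by simp
 moreover have "g \<in> H' & \<chi>' g = \<zeta>" using val[of 1 g 1] H1 by simp
 ultimately show ?thesis by blast
qed

lemma least_power_in:
 assumes H: "partial_char q H \<chi>" and q: "q > 1" and g: "coprime g q"
 obtains m where "m > 0" "g ^ m \<in> H" "!!i. 0 < i ==> i < m ==> g ^ i \<notin> H"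
proof -
 have "[g ^ totient q = 1] (mod q)" by (intro euler_theorem g)
 hence "g ^ totient q \<in> H" using H unfolding partial_char_def by (metis cong_sym)
 hence ex: "totient q > 0 & g ^ totient q \<in> H" using q by simp
 define m where "m = (LEAST m. m > 0 & g ^ m \<in> H)"
 show ?thesis
  by (rule that[of m]) (use LeastI[of "%m. m > 0 & g ^ m \<in> H", OF ex] not_less_Least in \<open>auto simp: m_def\<close>)
qed

lemma complex_root_exists:
 assumes "m > 0" shows "\<exists>z::complex. z ^ m = w"
proof (cases "w = 0")
 case True thus ?thesis using assms by (intro exI[of _ 0]) simp
next
 case False
 hence "exp (ln w / of_nat m) ^ m = w" using assms by (simp flip: exp_of_nat_mult)
 thus ?thesis by blast
qed

text \<open>Adjoining a missing unit strictly enlarges \<open>H\<close> among the \<open>q\<close>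
  residues, so the number of residues outside \<open>H\<close> is an induction measure.\<close>

lemma partial_char_extend:
 assumes "partial_char q H \<chi>" and q: "q > 1"
 shows "\<exists>\<chi>'. partial_char q {n. coprime n q} \<chi>' & (\<forall>h\<in>H. \<chi>' h = \<chi> h)"
 using assms(1)
proof (induction "card ({..<q} - H)" arbitrary: H \<chi> rule: less_induct)
 case less
 show ?case
 proof (cases "EX g. coprime g q & g \<notin> H")
  case False
  hence "H = {n. coprime n q}" using partial_charD(3)[OF less.prems] by blast
  thus ?thesis using less.prems by blast
 next
  case True
  then obtain g where g: "coprime g q" "g \<notin> H" by blast
  obtain m where m: "m > 0" "g ^ m \<in> H" "!!i. 0 < i ==> i < m ==> g ^ i \<notin> H"
   using least_power_in[OF less.prems q g(1)] by blast
  obtain \<zeta> where "\<zeta> ^ m = \<chi> (g ^ m)" using complex_root_exists[OF m(1)] by blast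
  from partial_char_extend1[OF less.prems q g(1) m this] obtain H' \<chi>' where
   H': "partial_char q H' \<chi>'" "H <= H'" "g \<in> H'" "\<forall>h\<in>H. \<chi>' h = \<chi> h" by blast
  have "g mod q \<in> H'" using H'(1,3) unfolding partial_char_def by (metis cong_mod_right cong_refl)
  moreover have "g mod q \<notin> H"
   using g(2) less.prems unfolding partial_char_def by (metis cong_mod_left cong_refl)
  ultimately have "{..<q} - H' \<subset> {..<q} - H" using H'(2) q by auto
  hence "card ({..<q} - H') < card ({..<q} - H)" by (intro psubset_card_mono) auto
  from less.hyps[OF this H'(1)] H'(2,4) show ?thesis by (metis subsetD)
 qed
qed

definition dirichlet_char :: "nat => (nat => complex) => bool" where
 "dirichlet_char q \<chi> \<longleftrightarrow> \<chi> 1 = 1 & (ALL m n. \<chi> (m * n) = \<chi> m * \<chi> n) &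
  (ALL n. \<chi> (n mod q) = \<chi> n) & (ALL n. \<chi> n ~= 0 \<longleftrightarrow> coprime n q)"

definition trivial_char :: "nat => nat => complex" where
 "trivial_char q n = (if coprime n q then 1 else 0)"

lemma dirichlet_char_separates:
 assumes q: "q > 1" and g: "coprime g q" "\<not> [g = 1] (mod q)"
 shows "\<exists>\<chi>. dirichlet_char q \<chi> & \<chi> g ~= 1"
proof -
 \<comment> \<open>Starting from the trivial subgroup, \<open>m\<close> is the multiplicative order
   of \<open>g\<close>. It is at least 2 by assumption, so a primitive \<open>m\<close>-th root of
   unity is a value at \<open>g\<close> different from 1.\<close>
 define H where "H = {n::nat. [n = 1] (mod q)}"
 have H: "partial_char q H (%_. 1)"
  unfolding partial_char_def H_def
 proof (intro conjI ballI allI impI)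
  fix x assume "x \<in> {n::nat. [n = 1] (mod q)}"
  hence x: "[x = 1] (mod q)" by simp
  thus "coprime x q" by (metis cong_imp_coprime cong_sym coprime_1_left)
  show "x * y \<in> {n. [n = 1] (mod q)}" if "y \<in> {n::nat. [n = 1] (mod q)}" for y
   using cong_mult[OF x, of y 1] that by simp
  show "y \<in> {n. [n = 1] (mod q)}" if "[x = y] (mod q)" for y
   using that x cong_sym cong_trans by blast
 qed auto
 obtain m where m: "m > 0" "g ^ m \<in> H" "!!i. 0 < i ==> i < m ==> g ^ i \<notin> H"
  using least_power_in[OF H q g(1)] by blast
 have "m ~= 1" using m(2) g(2) by (auto simp: H_def)
 hence "m >= 2" using m(1) by simp
 define \<zeta> where "\<zeta> = cis (2 * pi / real m)"
 have "\<zeta> ^ m = cis (real m * (2 * pi / real m))" unfolding \<zeta>_def by (rule Complex.DeMoivre)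
 hence \<zeta>1: "\<zeta> ^ m = 1" using m(1) by (simp add: cis_2pi)
 have "\<zeta> ~= 1"
 proof
  assume "\<zeta> = 1"
  hence "cos (2 * pi / real m) = 1" by (simp add: \<zeta>_def complex_eq_iff)
  then obtain n :: int where "2 * pi / real m = of_int n * 2 * pi"
   using cos_one_2pi_int by auto
  hence "1 = of_int n * real m" using m(1) by (simp add: field_simps)
  hence "1 = n * int m" by (metis of_int_1 of_int_eq_iff of_int_mult of_int_of_nat_eq)
  thus False using \<open>m >= 2\<close> by (metis dvd_triv_right int_dvd_int_iff nat_dvd_1_iff_1 of_nat_1 numeral_le_one_iff semiring_norm(69))
 qed
 from partial_char_extend1[OF H q g(1) m \<zeta>1] obtain H' \<chi>1 where
  1: "partial_char q H' \<chi>1" "g \<in> H'" "\<chi>1 g = \<zeta>" by auto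
 from partial_char_extend[OF 1(1) q] obtain \<chi>2 where
  2: "partial_char q {n. coprime n q} \<chi>2" "\<chi>2 g = \<zeta>" using 1 by auto
 have nz: "\<chi>2 n ~= 0" if "coprime n q" for n
 proof -
  have "[n ^ totient q = 1] (mod q)" using that by (rule euler_theorem)
  hence "\<chi>2 (n ^ totient q) = 1" using partial_charD(1,2,5)[OF 2(1)] cong_sym by metis
  hence "\<chi>2 n ^ totient q = 1" using partial_char_power[OF 2(1)] that by simp
  thus ?thesis using q by (metis power_0_left totient_gt_0_iff zero_neq_one not_less0 power_eq_0_iff less_trans zero_less_one)
 qed
 have "dirichlet_char q (%n. if coprime n q then \<chi>2 n else 0)"
  unfolding dirichlet_char_def
 proof (intro conjI allI)
  fix n
  show "(if coprime (n mod q) q then \<chi>2 (n mod q) else 0) = (if coprime n q then \<chi>2 n else 0)"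
   using partial_charD(5)[OF 2(1), of n "n mod q"] q by (auto simp: coprime_mod_left_iff Cong.cong_def)
 qed (use partial_charD(2,4)[OF 2(1)] nz in auto)
 thus ?thesis using 2(2) \<open>\<zeta> ~= 1\<close> g(1) by (intro exI) auto
qed

section \<open>Finiteness and orthogonality of the characters modulo \<open>q\<close>\<close>

context
 fixes q :: nat assumes q: "q > 1"
begin

lemma dirichlet_char_trivial: "dirichlet_char q (trivial_char q)"
 using q by (auto simp: dirichlet_char_def trivial_char_def)

lemma dirichlet_char_root:
 assumes "dirichlet_char q \<chi>" "coprime n q"
 shows "\<chi> n ^ totient q = 1"
proof -
 have pow: "\<chi> (n ^ k) = \<chi> n ^ k" for k using assms by (induction k) (auto simp: dirichlet_char_def)
 have "n ^ totient q mod q = 1" using euler_theorem[OF assms(2)] q by (simp add: Cong.cong_def)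
 hence "\<chi> (n ^ totient q) = 1" using assms(1) unfolding dirichlet_char_def by metis
 thus ?thesis using pow by simp
qed

lemma dirichlet_char_norm:
 assumes "dirichlet_char q \<chi>" shows "norm (\<chi> n) = (if coprime n q then 1 else 0)"
proof (cases "coprime n q")
 case True
 have "norm (\<chi> n) ^ totient q = 1" using dirichlet_char_root[OF assms True] by (metis norm_one norm_power)
 thus ?thesis using True q by (metis norm_ge_zero power_eq_1_iff totient_gt_0_iff less_trans zero_less_one power_eq_iff_eq_base power_one zero_le_one)
qed (use assms in \<open>auto simp: dirichlet_char_def\<close>)

lemma dirichlet_char_norm_le: "dirichlet_char q \<chi> ==> norm (\<chi> n) <= 1"
 by (simp add: dirichlet_char_norm)

lemma finite_dirichlet_chars: "finite {\<chi>. dirichlet_char q \<chi>}"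
proof -
 define R where "R = insert 0 {z::complex. z ^ totient q = 1}"
 have fin: "finite (PiE {..<q} (%_. R))"
  using q by (intro finite_PiE) (auto simp: R_def intro: finite_roots_unity)
 have "inj_on (%\<chi>. restrict \<chi> {..<q}) {\<chi>. dirichlet_char q \<chi>}"
 proof (rule inj_onI)
  fix \<chi> \<psi> :: "nat => complex"
  assume *: "\<chi> \<in> {\<chi>. dirichlet_char q \<chi>}" "\<psi> \<in> {\<chi>. dirichlet_char q \<chi>}"
   "restrict \<chi> {..<q} = restrict \<psi> {..<q}"
  have "\<chi> n = \<psi> n" for n
  proof -
   have "\<chi> (n mod q) = \<psi> (n mod q)" using fun_cong[OF *(3), of "n mod q"] q by simp
   thus ?thesis using * by (simp add: dirichlet_char_def)
  qed
  thus "\<chi> = \<psi>" by blast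
 qed
 moreover have "(%\<chi>. restrict \<chi> {..<q}) ` {\<chi>. dirichlet_char q \<chi>} <= PiE {..<q} (%_. R)"
  using dirichlet_char_root by (force simp: R_def dirichlet_char_def)
 ultimately show ?thesis using fin by (meson finite_imageD finite_subset)
qed

lemma dirichlet_char_mult:
 "dirichlet_char q \<chi> ==> dirichlet_char q \<psi> ==> dirichlet_char q (%n. \<chi> n * \<psi> n)"
 by (simp add: dirichlet_char_def)

lemma dirichlet_char_cnj:
 assumes "dirichlet_char q \<chi>" shows "cnj (\<chi> n) = inverse (\<chi> n)"
proof (cases "\<chi> n = 0")
 case False
 hence "norm (\<chi> n) = 1" using dirichlet_char_norm[OF assms] assms by (auto simp: dirichlet_char_def)
 thus ?thesis using False by (simp add: complex_div_cnj divide_inverse inverse_complex_def complex_eq_iff cmod_def)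
qed simp

lemma bij_mult_residues:
 assumes g: "coprime g q"
 shows "bij_betw (%n. (g * n) mod q) {n\<in>{..<q}. coprime n q} {n\<in>{..<q}. coprime n q}"
proof -
 have inj: "inj_on (%n. (g * n) mod q) {n\<in>{..<q}. coprime n q}"
 proof (rule inj_onI)
  fix x y assume *: "x \<in> {n\<in>{..<q}. coprime n q}" "y \<in> {n\<in>{..<q}. coprime n q}" "(g * x) mod q = (g * y) mod q"
  hence "[g * x = g * y] (mod q)" by (simp add: Cong.cong_def)
  hence "[x = y] (mod q)" using g by (simp add: cong_mult_lcancel_nat)
  thus "x = y" using * by (simp add: Cong.cong_def)
 qed
 moreover have "(%n. (g * n) mod q) ` {n\<in>{..<q}. coprime n q} <= {n\<in>{..<q}. coprime n q}"
  using q g by auto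
 ultimately show ?thesis by (simp add: bij_betw_def endo_inj_surj)
qed

text \<open>Multiplying the variable by a unit \<open>g\<close> with \<open>\<chi> g ~= 1\<close>
  permutes the reduced residues and multiplies the sum by \<open>\<chi> g\<close>, so the sum
  vanishes.\<close>

lemma dirichlet_char_sum_residues:
 assumes "dirichlet_char q \<chi>"
 shows "(\<Sum>n<q. \<chi> n) = (if \<chi> = trivial_char q then of_nat (totient q) else 0)"
proof -
 define U where "U = {n\<in>{..<q}. coprime n q}"
 have "(\<Sum>n<q. \<chi> n) = (\<Sum>n\<in>U. \<chi> n)"
  unfolding U_def using assms by (intro sum.mono_neutral_right) (auto simp: dirichlet_char_def)
 have cardU: "card U = totient q"
 proof -
  have "x \<in> U \<longleftrightarrow> x \<in> totatives q" for x
   using q by (cases "x = 0"; cases "x = q") (auto simp: U_def totatives_def coprime_commute)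
  hence "U = totatives q" by blast
  thus ?thesis by (simp add: totient_def)
 qed
 show ?thesis
 proof (cases "\<chi> = trivial_char q")
  case True
  hence "(\<Sum>n\<in>U. \<chi> n) = of_nat (card U)" by (simp add: U_def trivial_char_def)
  thus ?thesis using \<open>(\<Sum>n<q. \<chi> n) = _\<close> True cardU by simp
 next
  case False
  then obtain g where "\<chi> g ~= trivial_char q g" by blast
  hence g: "coprime g q" "\<chi> g ~= 1" using assms by (auto simp: trivial_char_def dirichlet_char_def split: if_splits)
  have "(\<Sum>n\<in>U. \<chi> n) = (\<Sum>n\<in>U. \<chi> ((g * n) mod q))"
   using sum.reindex_bij_betw[OF bij_mult_residues[OF g(1)], of \<chi>] by (simp add: U_def)
  also have "... = \<chi> g * (\<Sum>n\<in>U. \<chi> n)" using assms by (simp add: dirichlet_char_def sum_distrib_left)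
  finally have "(\<Sum>n\<in>U. \<chi> n) = 0" using g(2) by auto
  thus ?thesis using \<open>(\<Sum>n<q. \<chi> n) = _\<close> False by simp
 qed
qed

text \<open>The dual argument: multiplication by a character that separates \<open>g\<close> from 1
  permutes the characters. Their number stays a cardinality here and is identified with
  \<open>totient q\<close> afterwards.\<close>

lemma sum_dirichlet_chars:
 assumes g: "coprime g q"
 shows "(\<Sum>\<chi> | dirichlet_char q \<chi>. \<chi> g) = (if [g = 1] (mod q) then of_nat (card {\<chi>. dirichlet_char q \<chi>}) else 0)"
proof (cases "[g = 1] (mod q)")
 case True
 hence "g mod q = 1" using q by (simp add: Cong.cong_def)
 hence "\<chi> g = 1" if "dirichlet_char q \<chi>" for \<chi>
  using that unfolding dirichlet_char_def by metis
 hence "(\<Sum>\<chi> | dirichlet_char q \<chi>. \<chi> g) = (\<Sum>\<chi> | dirichlet_char q \<chi>. 1)" by (intro sum.cong) auto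
 thus ?thesis using True by simp
next
 case False
 then obtain \<psi> where \<psi>: "dirichlet_char q \<psi>" "\<psi> g ~= 1" using dirichlet_char_separates[OF q g] by blast
 have bij: "bij_betw (%\<chi> n. \<psi> n * \<chi> n) {\<chi>. dirichlet_char q \<chi>} {\<chi>. dirichlet_char q \<chi>}"
 proof -
  have "inj_on (%\<chi> n. \<psi> n * \<chi> n) {\<chi>. dirichlet_char q \<chi>}"
  proof (rule inj_onI, rule ext)
   fix \<chi> \<chi>' n assume *: "\<chi> \<in> {\<chi>. dirichlet_char q \<chi>}" "\<chi>' \<in> {\<chi>. dirichlet_char q \<chi>}"
    "(%n. \<psi> n * \<chi> n) = (%n. \<psi> n * \<chi>' n)"
   hence "\<psi> n * \<chi> n = \<psi> n * \<chi>' n" by metis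
   thus "\<chi> n = \<chi>' n" using * \<psi>(1) unfolding dirichlet_char_def by auto
  qed
  moreover have "(%\<chi> n. \<psi> n * \<chi> n) ` {\<chi>. dirichlet_char q \<chi>} <= {\<chi>. dirichlet_char q \<chi>}"
   using dirichlet_char_mult[OF \<psi>(1)] by auto
  ultimately show ?thesis using finite_dirichlet_chars by (simp add: bij_betw_def endo_inj_surj)
 qed
 have "(\<Sum>\<chi> | dirichlet_char q \<chi>. \<chi> g) = (\<Sum>\<chi> | dirichlet_char q \<chi>. \<psi> g * \<chi> g)"
  using sum.reindex_bij_betw[OF bij, of "%\<chi>. \<chi> g"] by simp
 also have "... = \<psi> g * (\<Sum>\<chi> | dirichlet_char q \<chi>. \<chi> g)" by (simp add: sum_distrib_left)
 finally have "(\<Sum>\<chi> | dirichlet_char q \<chi>. \<chi> g) = 0" using \<psi>(2) by auto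
 thus ?thesis using False by simp
qed

text \<open>The number of characters is read off by summing \<open>\<chi> n\<close> over both variables in either order.\<close>

lemma card_dirichlet_chars: "card {\<chi>. dirichlet_char q \<chi>} = totient q"
proof -
 have "(\<Sum>\<chi> | dirichlet_char q \<chi>. \<Sum>n<q. \<chi> n) = (\<Sum>\<chi> | dirichlet_char q \<chi>. if \<chi> = trivial_char q then of_nat (totient q) else 0)"
  by (intro sum.cong) (auto simp: dirichlet_char_sum_residues)
 also have "... = of_nat (totient q)"
  using finite_dirichlet_chars dirichlet_char_trivial by (subst sum.delta) auto
 finally have 1: "(\<Sum>\<chi> | dirichlet_char q \<chi>. \<Sum>n<q. \<chi> n) = of_nat (totient q)" .
 have "(\<Sum>\<chi> | dirichlet_char q \<chi>. \<Sum>n<q. \<chi> n) = (\<Sum>n<q. \<Sum>\<chi> | dirichlet_char q \<chi>. \<chi> n)" by (rule sum.swap)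
 also have "... = (\<Sum>n<q. if n = 1 then of_nat (card {\<chi>. dirichlet_char q \<chi>}) else 0)"
 proof (rule sum.cong)
  fix n assume n: "n \<in> {..<q}"
  show "(\<Sum>\<chi> | dirichlet_char q \<chi>. \<chi> n) = (if n = 1 then of_nat (card {\<chi>. dirichlet_char q \<chi>}) else 0)"
  proof (cases "coprime n q")
   case True
   thus ?thesis using sum_dirichlet_chars[OF True] n q by (simp add: Cong.cong_def)
  next
   case False
   hence "\<chi> n = 0" if "dirichlet_char q \<chi>" for \<chi> using that by (auto simp: dirichlet_char_def)
   thus ?thesis using False by (auto intro!: sum.neutral)
  qed
 qed simp
 also have "... = of_nat (card {\<chi>. dirichlet_char q \<chi>})" using q by (subst sum.delta) auto
 finally show ?thesis using 1 by (metis of_nat_eq_iff)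
qed

lemma dirichlet_char_orthogonality:
 assumes a: "coprime a q"
 shows "(\<Sum>\<chi> | dirichlet_char q \<chi>. cnj (\<chi> a) * \<chi> n) = (if [n = a] (mod q) then of_nat (totient q) else 0)"
proof (cases "coprime n q")
 case False
 hence "\<chi> n = 0" if "dirichlet_char q \<chi>" for \<chi> using that by (auto simp: dirichlet_char_def)
 moreover have "\<not> [n = a] (mod q)" using False a by (metis cong_imp_coprime cong_sym)
 ultimately show ?thesis by (auto intro!: sum.neutral)
next
 case True
 \<comment> \<open>The residue \<open>n / a\<close>, with Euler's theorem providing the inverse of
   \<open>a\<close>; this reduces the claim to orthogonality at the single argument
   \<open>g\<close>.\<close>
 define g where "g = n * a ^ (totient q - 1)"
 have ga: "[g * a = n] (mod q)"
 proof -
  have "totient q > 0" using q by simp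
  hence "g * a = n * a ^ totient q" by (cases "totient q") (auto simp: g_def mult_ac)
  moreover have "[n * a ^ totient q = n * 1] (mod q)" by (intro cong_mult cong_refl euler_theorem a)
  ultimately show ?thesis by simp
 qed
 have cop: "coprime g q" using True a by (simp add: g_def)
 have "cnj (\<chi> a) * \<chi> n = \<chi> g" if "dirichlet_char q \<chi>" for \<chi>
 proof -
  have "\<chi> n = \<chi> (n mod q)" "\<chi> (g * a) = \<chi> (g * a mod q)" using that by (auto simp: dirichlet_char_def)
  hence "\<chi> n = \<chi> (g * a)" using ga by (simp add: Cong.cong_def)
  hence "\<chi> n = \<chi> g * \<chi> a" "\<chi> a ~= 0" using that a by (auto simp: dirichlet_char_def)
  thus ?thesis using dirichlet_char_cnj[OF that] by simp
 qed
 hence "(\<Sum>\<chi> | dirichlet_char q \<chi>. cnj (\<chi> a) * \<chi> n) = (\<Sum>\<chi> | dirichlet_char q \<chi>. \<chi> g)"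
  by (intro sum.cong) auto
 also have "... = (if [g = 1] (mod q) then of_nat (totient q) else 0)"
  using sum_dirichlet_chars[OF cop] card_dirichlet_chars by simp
 also have "[g = 1] (mod q) \<longleftrightarrow> [g * a = 1 * a] (mod q)" using a using cong_mult_rcancel_nat[of a q g 1] by simp
 also have "... \<longleftrightarrow> [n = a] (mod q)" using ga by (metis cong_sym cong_trans mult_1)
 finally show ?thesis .
qed

end

section \<open>Dirichlet series\<close>

text \<open>As \<open>0 powr z = 0\<close>, the term of index 0 vanishes and Dirichlet series can be
  summed over all naturals.\<close>

definition npow :: "nat => complex => complex" where
 "npow n s = of_nat n powr (- s)"

definition dseries :: "(nat => complex) => complex => complex" where
 "dseries f s = (\<Sum>n. f n * npow n s)"

lemma npow_0 [simp]: "npow 0 s = 0" by (simp add: npow_def)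
lemma npow_1 [simp]: "npow (Suc 0) s = 1" by (simp add: npow_def)

lemma npow_mult: "npow (m * n) s = npow m s * npow n s"
 unfolding npow_def of_nat_mult by (rule powr_times_real) auto

lemma norm_npow [simp]: "norm (npow n s) = real n powr - Re s"
 unfolding npow_def by (subst norm_powr_real_powr) auto

lemma npow_has_derivative:
 "(npow n has_field_derivative - of_real (ln (real n)) * npow n s) (at s within A)"
proof (cases "n = 0")
 case True
 have "npow 0 = (%_. 0)" by (simp add: fun_eq_iff)
 thus ?thesis using True by simp
next
 case False
 have eq: "npow n s = exp (- s * of_real (ln (real n)))" for s
  using False by (simp add: npow_def powr_def Ln_of_nat)
 show ?thesis unfolding eq[abs_def]
  by (auto intro!: derivative_eq_intros)
qed

lemma npow_holomorphic [holomorphic_intros]: "npow n holomorphic_on A"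
 using npow_has_derivative holomorphic_on_def field_differentiable_def by metis

lemma summable_powr: "\<sigma> > 1 ==> summable (%n. real n powr - \<sigma>)"
 by (simp add: summable_real_powr_iff)

lemma ln_le_powr_real: "\<epsilon> > 0 ==> ln (real n) <= real n powr \<epsilon> / \<epsilon>"
 by (cases "n = 0") (auto intro: ln_powr_bound)

lemma summable_dseries:
 assumes f: "!!n. n > 0 ==> norm (f n) <= B * (1 + ln (real n))" and s: "Re s > 1"
 shows "summable (%n. norm (f n * npow n s))"
proof -
 \<comment> \<open>Half of the distance from \<open>Re s\<close> to 1 is spent on absorbing the
   logarithm into a power of \<open>n\<close>.\<close>
 define \<epsilon> where "\<epsilon> = (Re s - 1) / 2"
 have \<epsilon>: "\<epsilon> > 0" "Re s - \<epsilon> > 1" using s by (auto simp: \<epsilon>_def field_simps)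
 have B: "B >= 0" using order_trans[OF norm_ge_zero f[of 1]] by simp
 have "summable (%n. B * (real n powr - Re s + real n powr - (Re s - \<epsilon>) / \<epsilon>))"
  using s \<epsilon> by (intro summable_mult summable_add summable_divide summable_powr) auto
 thus ?thesis
 proof (rule summable_comparison_test[rotated], intro exI[of _ 0] allI impI)
  fix n :: nat
  show "norm (norm (f n * npow n s)) <= B * (real n powr - Re s + real n powr - (Re s - \<epsilon>) / \<epsilon>)"
  proof (cases "n = 0")
   case False
   have "norm (f n * npow n s) <= B * (1 + ln (real n)) * real n powr - Re s"
    using f[of n] False by (simp add: norm_mult mult_right_mono)
   also have "... <= B * (1 + real n powr \<epsilon> / \<epsilon>) * real n powr - Re s"
    using ln_le_powr_real[OF \<epsilon>(1), of n] B by (intro mult_right_mono mult_left_mono) auto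
   also have "... = B * (real n powr - Re s + real n powr - (Re s - \<epsilon>) / \<epsilon>)"
    by (simp add: algebra_simps flip: powr_add)
   finally show ?thesis by simp
  qed simp
 qed
qed

lemma dseries_bounded_coeff:
 assumes f: "!!n. norm (f n) <= B" and s: "Re s > 1"
 shows "summable (%n. norm (f n * npow n s))"
proof (rule summable_dseries[where B = B])
 fix n :: nat assume "n > 0"
 hence "ln (real n) >= 0" by simp
 moreover have "B >= 0" using f[of 0] norm_ge_zero[of "f 0"] by linarith
 ultimately have "B * 1 <= B * (1 + ln (real n))" by (intro mult_left_mono) auto
 thus "norm (f n) <= B * (1 + ln (real n))" using f[of n] by simp
qed (use s in auto)

lemma dseries_sums:
 assumes "summable (%n. norm (f n * npow n s))"
 shows "(%n. f n * npow n s) sums dseries f s"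
 unfolding dseries_def using summable_norm_cancel[OF assms] by (rule summable_sums)

lemma dseries_has_derivative:
 assumes f: "!!n. norm (f n) <= B" and s: "Re s > 1"
 shows "(dseries f has_field_derivative - dseries (%n. f n * of_real (ln (real n))) s) (at s)"
proof -
 have B: "B >= 0" using f[of 0] norm_ge_zero[of "f 0"] by linarith
 have "open {s. Re s > 1}" by (simp add: open_halfspace_Re_gt)
 hence "EX g g'. \<forall>x\<in>{s. Re s > 1}. ((%n. f n * npow n x) sums g x) &
   ((%n. f n * (- of_real (ln (real n)) * npow n x)) sums g' x) & (g has_field_derivative g' x) (at x)"
 proof (rule series_and_derivative_comparison_complex)
  fix x :: complex assume x: "x \<in> {s. Re s > 1}"
  \<comment> \<open>Midway between 1 and \<open>Re x\<close>: on the ball of radius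
    \<open>Re x - \<sigma>\<close> all real parts are at least \<open>\<sigma>\<close>, so
    \<open>B * real n powr - \<sigma>\<close> is a common majorant.\<close>
  define \<sigma> where "\<sigma> = (1 + Re x) / 2"
  have \<sigma>: "\<sigma> > 1" "Re x - \<sigma> > 0" using x by (auto simp: \<sigma>_def field_simps)
  show "EX d h. 0 < d & summable h & range h <= \<real>\<^sub>\<ge>\<^sub>0 &
    (\<forall>\<^sub>F n in sequentially. \<forall>y\<in>ball x d \<inter> {s. 1 < Re s}. cmod (f n * npow n y) <= cmod (h n))"
  proof (intro exI conjI)
   show "Re x - \<sigma> > 0" by (fact \<sigma>(2))
   show "summable (%n. complex_of_real (B * real n powr - \<sigma>))"
    unfolding summable_complex_of_real using \<sigma> by (intro summable_mult summable_powr)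
   show "range (%n. complex_of_real (B * real n powr - \<sigma>)) <= \<real>\<^sub>\<ge>\<^sub>0"
    using B by auto
   show "\<forall>\<^sub>F n in sequentially. \<forall>y\<in>ball x (Re x - \<sigma>) \<inter> {s. 1 < Re s}.
     cmod (f n * npow n y) <= cmod (complex_of_real (B * real n powr - \<sigma>))"
    using eventually_gt_at_top[of 0]
   proof eventually_elim
    case (elim n)
    show ?case
    proof
     fix y assume "y \<in> ball x (Re x - \<sigma>) \<inter> {s. 1 < Re s}"
     hence "norm (x - y) < Re x - \<sigma>" by (simp add: dist_norm)
     hence "Re y >= \<sigma>" using complex_Re_le_cmod[of "x - y"] by simp
     hence "real n powr - Re y <= real n powr - \<sigma>" using elim by (intro powr_mono) auto
     hence "norm (f n) * real n powr - Re y <= B * real n powr - \<sigma>"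
      using f[of n] B by (intro mult_mono) auto
     thus "cmod (f n * npow n y) <= cmod (complex_of_real (B * real n powr - \<sigma>))"
      using B by (simp add: norm_mult)
    qed
   qed
  qed
 qed (auto intro!: derivative_eq_intros npow_has_derivative)
 then obtain g g' where g: "!!x. Re x > 1 ==> (%n. f n * npow n x) sums g x"
  "!!x. Re x > 1 ==> (%n. f n * (- of_real (ln (real n)) * npow n x)) sums g' x"
  "!!x. Re x > 1 ==> (g has_field_derivative g' x) (at x)" by blast
 have 1: "dseries f x = g x" if "Re x > 1" for x
  unfolding dseries_def using sums_unique[OF g(1)[OF that]] by simp
 have "(%n. - (f n * of_real (ln (real n)) * npow n s)) sums g' s" using g(2)[OF s] by (simp add: mult_ac)
 hence "(%n. f n * of_real (ln (real n)) * npow n s) sums - g' s" using sums_minus by fastforce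
 hence 2: "- dseries (%n. f n * of_real (ln (real n))) s = g' s"
  unfolding dseries_def using sums_unique[of _ "- g' s"] by simp
 show ?thesis unfolding 2
  by (rule has_field_derivative_transform_within_open[OF g(3)[OF s], of "{s. Re s > 1}"])
   (use s 1 in \<open>auto simp: open_halfspace_Re_gt\<close>)
qed

lemma has_sum_positive_nat:
 fixes h :: "nat => complex"
 assumes "summable (%n. norm (h n))" "h 0 = 0"
 shows "(h has_sum suminf h) {0<..}" and "(%n. norm (h n)) summable_on {0<..}"
proof -
 have "(h has_sum suminf h) UNIV"
  by (rule norm_summable_imp_has_sum[OF assms(1) summable_sums[OF summable_norm_cancel[OF assms(1)]]])
 thus "(h has_sum suminf h) {0<..}"
  by (subst has_sum_cong_neutral[of UNIV "{0<..}" h h]) (use assms(2) in auto)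
 have "(%n. norm (h n)) summable_on UNIV" using assms(1) by (subst summable_on_UNIV_nonneg_real_iff) auto
 thus "(%n. norm (h n)) summable_on {0<..}" by (rule summable_on_subset_banach) auto
qed

text \<open>Absolute convergence allows the double sum over pairs \<open>(d, m)\<close> to be
  regrouped by the product \<open>n = d * m\<close>. Index 0 is removed first, because every number
  divides 0.\<close>

lemma dseries_mult:
 assumes f: "summable (%n. norm (f n * npow n s))" and g: "summable (%n. norm (g n * npow n s))"
  and h: "summable (%n. norm (h n * npow n s))"
  and conv: "!!n. n > 0 ==> h n = (\<Sum>d | d dvd n. f d * g (n div d))"
 shows "dseries f s * dseries g s = dseries h s"
proof -
 let ?P = "{0::nat<..}"
 define F where "F = (%(d, m). (f d * npow d s) * (g m * npow m s))"
 note f' = has_sum_positive_nat[OF f, simplified] and g' = has_sum_positive_nat[OF g, simplified]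
  and h' = has_sum_positive_nat[OF h, simplified]
 have "F summable_on ?P \<times> ?P"
 proof (rule Infinite_Sum.abs_summable_summable, subst Infinite_Sum.abs_summable_on_Sigma_iff, intro conjI ballI)
  fix d show "(%m. norm (F (d, m))) summable_on ?P"
   using g'(2) unfolding F_def by (auto simp: norm_mult intro!: summable_on_cmult_right)
 next
  have "(\<Sum>\<^sub>\<infinity>m\<in>?P. norm (F (d, m))) = norm (f d * npow d s) * (\<Sum>\<^sub>\<infinity>m\<in>?P. norm (g m * npow m s))" for d
   unfolding F_def by (simp only: prod.case norm_mult[of "f d * npow d s"] infsum_cmult_right')
  thus "(%d. norm (\<Sum>\<^sub>\<infinity>m\<in>?P. norm (F (d, m)))) summable_on ?P"
   using f'(2) by (auto simp: norm_mult infsum_nonneg intro!: summable_on_cmult_left)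
 qed
 hence "(F has_sum (dseries f s * dseries g s)) (?P \<times> ?P)"
 proof (rule has_sum_SigmaI[rotated 2])
  fix d assume "d \<in> ?P"
  show "((%m. F (d, m)) has_sum (f d * npow d s * dseries g s)) ?P"
   unfolding F_def prod.case dseries_def by (intro has_sum_cmult_right g')
 next
  show "((%d. f d * npow d s * dseries g s) has_sum (dseries f s * dseries g s)) ?P"
   unfolding dseries_def by (intro has_sum_cmult_left f')
 qed
 also have "?this \<longleftrightarrow> ((%(n, d). f d * g (n div d) * npow n s) has_sum (dseries f s * dseries g s)) (Sigma ?P (%n. {d. d dvd n}))"
 proof (rule has_sum_reindex_bij_witness[of _ "%(n, d). (d, n div d)" "%(d, m). (d * m, d)"])
  fix a assume "a \<in> ?P \<times> ?P"
  thus "(case (case a of (d, m) => (d * m, d)) of (n, d) => f d * g (n div d) * npow n s) = F a"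
   by (auto simp: F_def npow_mult)
 qed (auto elim!: dvdE)
 finally have "((%n. h n * npow n s) has_sum (dseries f s * dseries g s)) ?P"
 proof (rule has_sum_SigmaD)
  fix n assume n: "n \<in> ?P"
  show "((%d. case (n, d) of (n, d) => f d * g (n div d) * npow n s) has_sum h n * npow n s) {d. d dvd n}"
   using n by (intro has_sum_finiteI) (auto simp: conv sum_distrib_right)
 qed
 with h'(1) show ?thesis unfolding dseries_def using has_sum_unique by blast
qed

section \<open>Continuation of the zeta function and the \<open>L\<close>-functions to
  \<open>Re s > 0\<close>\<close>

text \<open>The vector-valued mean value inequality for \<open>u powr - s\<close>. The majorant
  \<open>\<phi>\<close> is left free: it is linear for neighbouring integers, and a multiple of
  \<open>u powr (- Re z)\<close> in \<open>npow_int_bound\<close>.\<close>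

lemma norm_powr_diff_bound:
 assumes a: "0 < a" "a <= b" and cont: "continuous_on {a..b} \<phi>"
  and \<phi>: "!!u. a < u ==> u < b ==> (\<phi> has_real_derivative \<phi>' u) (at u)"
  and bd: "!!u. a < u ==> u < b ==> norm (s::complex) * u powr (- Re s - 1) <= \<phi>' u"
 shows "norm (of_real a powr - s - of_real b powr - s) <= \<phi> b - \<phi> a"
proof (cases "a = b")
 case False
 hence "a < b" using a by simp
 hence "norm (of_real b powr - s - of_real a powr - s) <= \<phi> b - \<phi> a"
 proof (rule differentiable_bound_general[where f' = "%u. - s * of_real u powr (- s - 1)"])
  show "continuous_on {a..b} (%u. complex_of_real u powr - s)"
   using a by (intro continuous_intros) (auto simp: complex_nonpos_Reals_iff)
  fix u assume u: "a < u" "u < b"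
  show "((%u. complex_of_real u powr - s) has_vector_derivative - s * of_real u powr (- s - 1)) (at u)"
   using u a by (intro has_vector_derivative_real_field)
    (auto intro!: derivative_eq_intros simp: complex_nonpos_Reals_iff)
  show "(\<phi> has_vector_derivative \<phi>' u) (at u)" using \<phi>[OF u] by (simp add: has_real_derivative_iff_has_vector_derivative)
  show "norm (- s * of_real u powr (- s - 1)) <= \<phi>' u"
   using bd[OF u] u a by (simp add: norm_mult norm_powr_real_powr)
 qed (use cont in auto)
 thus ?thesis by (simp add: norm_minus_commute)
qed simp

lemma norm_npow_diff:
 assumes n: "n > 0" and s: "Re s > -1"
 shows "norm (npow n s - npow (Suc n) s) <= norm s * real n powr (- Re s - 1)"
proof -
 have "norm (of_real (real n) powr - s - of_real (real (Suc n)) powr - s)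
  <= norm s * real n powr (- Re s - 1) * real (Suc n) - norm s * real n powr (- Re s - 1) * real n"
  by (rule norm_powr_diff_bound[where \<phi>' = "%_. norm s * real n powr (- Re s - 1)"])
   (use n s in \<open>auto intro!: continuous_intros derivative_eq_intros mult_left_mono powr_mono2'\<close>)
 thus ?thesis by (simp add: npow_def algebra_simps)
qed

text \<open>The term of the series for \<open>(s - 1) \<zeta>(s)\<close>: the difference of \<open>n powr - s\<close> and its integral
 over \<open>[n, n + 1]\<close>, multiplied by \<open>s - 1\<close> so that the pole disappears.\<close>

definition zeta_term :: "nat => complex => complex" where
 "zeta_term n s = (s - 1) * npow n s - npow n (s - 1) + npow (Suc n) (s - 1)"

text \<open>The auxiliary \<open>f\<close> has increment \<open>zeta_term n s\<close> over
  \<open>[n, n + 1]\<close>, and its derivative at \<open>u\<close> is \<open>s - 1\<close> times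
  the difference of \<open>n powr - s\<close> and \<open>u powr - s\<close>. That difference is
  small by the mean value inequality, which gains one power of \<open>n\<close>.\<close>

lemma norm_zeta_term:
 assumes n: "n > 0" and s: "Re s > 0"
 shows "norm (zeta_term n s) <= norm (s - 1) * norm s * real n powr (- Re s - 1)"
proof -
 define C where "C = norm (s - 1) * norm s * real n powr (- Re s - 1)"
 define f where "f = (%u. (u - real n) *\<^sub>R ((s - 1) * npow n s) + complex_of_real u powr (1 - s))"
 have "norm (f (real n + 1) - f (real n)) <= C * (real n + 1) - C * real n"
 proof (rule differentiable_bound_general[where f = f and \<phi> = "%x. C * x" and \<phi>' = "%_. C" and
    f' = "%u. (s - 1) * (npow n s - of_real u powr - s)"])
  show "continuous_on {real n..real n + 1} f" unfolding f_def
   using n by (intro continuous_intros) (auto simp: complex_nonpos_Reals_iff)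
  fix u assume u: "real n < u" "u < real n + 1"
  have up: "u > 0" using n u by linarith
  have "((%u. complex_of_real u powr (1 - s)) has_vector_derivative (1 - s) * of_real u powr (1 - s - 1)) (at u)"
   using up by (intro has_vector_derivative_real_field)
    (auto intro!: derivative_eq_intros simp: complex_nonpos_Reals_iff)
  moreover have "((%u. (u - real n) *\<^sub>R ((s - 1) * npow n s)) has_vector_derivative (s - 1) * npow n s) (at u)"
   unfolding has_vector_derivative_def by (auto intro!: derivative_eq_intros)
  ultimately have "(f has_vector_derivative ((s - 1) * npow n s + (1 - s) * of_real u powr (1 - s - 1))) (at u)"
   unfolding f_def by (intro has_vector_derivative_add)
  thus "(f has_vector_derivative (s - 1) * (npow n s - of_real u powr - s)) (at u)"
   by (simp add: algebra_simps)
  have "norm (of_real (real n) powr - s - of_real u powr - s)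
   <= norm s * real n powr (- Re s - 1) * u - norm s * real n powr (- Re s - 1) * real n"
   by (rule norm_powr_diff_bound[where \<phi>' = "%_. norm s * real n powr (- Re s - 1)"])
    (use n s u in \<open>auto intro!: continuous_intros derivative_eq_intros mult_left_mono powr_mono2'\<close>)
  also have "... = norm s * real n powr (- Re s - 1) * (u - real n)" by (simp add: algebra_simps)
  also have "... <= norm s * real n powr (- Re s - 1) * 1" using u by (intro mult_left_mono) auto
  finally have "norm (npow n s - of_real u powr - s) <= norm s * real n powr (- Re s - 1)" by (simp add: npow_def)
  thus "norm ((s - 1) * (npow n s - of_real u powr - s)) <= C"
   unfolding C_def norm_mult by (simp add: mult.assoc mult_left_mono)
 qed (auto intro!: continuous_intros derivative_eq_intros simp flip: has_real_derivative_iff_has_vector_derivative)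
 moreover have "f (real n + 1) - f (real n) = zeta_term n s"
  by (simp add: f_def zeta_term_def npow_def add_ac)
 ultimately show ?thesis by (simp add: C_def algebra_simps)
qed

text \<open>Shared by \<open>zeta1\<close> and \<open>abel_series\<close>. The decay of the terms
  gives locally uniform convergence for \<open>Re s > 0\<close>; for \<open>Re s >= 1/2\<close> it
  is at least that of \<open>n powr (-3/2)\<close>, which leaves a bound quadratic in
  \<open>norm s\<close>.\<close>

lemma holomorphic_series:
 assumes hol: "!!n. t n holomorphic_on {s. Re s > 0}" and C: "C >= 0"
  and bd: "!!n s. n > 0 ==> Re s > 0 ==> norm (t n s) <= C * (1 + norm s)^2 * real n powr (- Re s - 1)"
  and t0: "!!s. t 0 s = 0"
 shows "(%s. \<Sum>n. t n s) holomorphic_on {s. Re s > 0}"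
  and "Re s > 0 ==> summable (%n. t n s)"
  and "Re s >= 1/2 ==> norm (\<Sum>n. t n s) <= C * (\<Sum>n. real n powr (-3/2)) * (1 + norm s)^2"
proof -
 have bd': "norm (t n s) <= C * (1 + norm s)^2 * real n powr (- Re s - 1)" if "Re s > 0" for n s
  using bd[OF _ that, of n] t0 by (cases "n = 0") auto
 have summ: "summable (%n. norm (t n s))" if "Re s > 0" for s
  by (rule summable_comparison_test[OF _ summable_mult[OF summable_powr[of "Re s + 1"], of "C * (1 + norm s)^2"]])
   (use bd'[OF that] that in auto)
 thus "Re s > 0 ==> summable (%n. t n s)" by (blast intro: summable_norm_cancel)
 show "norm (\<Sum>n. t n s) <= C * (\<Sum>n. real n powr (-3/2)) * (1 + norm s)^2" if s: "Re s >= 1/2"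
 proof -
  have s0: "Re s > 0" using s by linarith
  have S: "summable (%n. C * (1 + norm s)^2 * real n powr (-3/2))"
   using summable_powr[of "3/2"] by (intro summable_mult) simp
  have "norm (\<Sum>n. t n s) <= (\<Sum>n. norm (t n s))" by (rule summable_norm[OF summ[OF s0]])
  also have "... <= (\<Sum>n. C * (1 + norm s)^2 * real n powr (-3/2))"
  proof (rule suminf_le[OF _ summ[OF s0] S])
   fix n
   have "real n powr (- Re s - 1) <= real n powr (-3/2)" using s
    by (cases "n = 0") (auto intro!: powr_mono)
   hence "C * (1 + norm s)^2 * real n powr (- Re s - 1) <= C * (1 + norm s)^2 * real n powr (-3/2)"
    using C by (intro mult_left_mono) auto
   thus "norm (t n s) <= C * (1 + norm s)^2 * real n powr (-3/2)" using bd'[OF s0, of n] by linarith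
  qed
  also have "... = C * (\<Sum>n. real n powr (-3/2)) * (1 + norm s)^2"
   using summable_powr[of "3/2"] by (subst suminf_mult) (simp_all add: mult_ac)
  finally show ?thesis .
 qed
 have op: "open {s. Re s > 0}" by (simp add: open_halfspace_Re_gt)
 show "(%s. \<Sum>n. t n s) holomorphic_on {s. Re s > 0}"
 proof (rule holomorphic_uniform_sequence[OF op, of "%N s. \<Sum>n<N. t n s"])
  fix x :: complex assume x: "x \<in> {s. Re s > 0}"
  define d where "d = Re x / 2"
  have d: "d > 0" using x by (simp add: d_def)
  have near: "Re y >= d & norm y <= norm x + d" if "y \<in> cball x d" for y
  proof -
   have "norm (x - y) <= d" using that by (simp add: dist_norm)
   hence "Re x - Re y <= d" "norm y <= norm x + d"
    using complex_Re_le_cmod[of "x - y"] norm_triangle_ineq2[of y x] by (auto simp: norm_minus_commute)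
   thus ?thesis by (auto simp: d_def field_simps)
  qed
  have "uniform_limit (cball x d) (%N s. \<Sum>n<N. t n s) (%s. \<Sum>n. t n s) sequentially"
  proof (rule Weierstrass_m_test)
   fix n y assume y: "y \<in> cball x d"
   have "norm (t n y) <= C * (1 + norm y)^2 * real n powr (- Re y - 1)" using near[OF y] d by (intro bd') auto
   also have "... <= C * (1 + (norm x + d))^2 * real n powr (- d - 1)"
   proof (intro mult_mono power_mono)
    show "real n powr (- Re y - 1) <= real n powr (- d - 1)"
     using near[OF y] by (cases "n = 0") (auto intro!: powr_mono)
   qed (use near[OF y] C d in auto)
   finally show "norm (t n y) <= C * (1 + (norm x + d))^2 * real n powr (- d - 1)" .
  next
   have "summable (%n. real n powr - (d + 1))" using d by (intro summable_powr) simp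
   thus "summable (%n. C * (1 + (norm x + d))^2 * real n powr (- d - 1))"
    by (intro summable_mult) simp
  qed
  thus "\<exists>d>0. cball x d <= {s. Re s > 0} & uniform_limit (cball x d) (%N s. \<Sum>n<N. t n s) (%s. \<Sum>n. t n s) sequentially"
   using d near by (intro exI[of _ d]) force
 qed (intro holomorphic_intros hol)
qed

text \<open>This is \<open>s - 1\<close> times the Riemann zeta function: the integrals inside
  \<open>zeta_term\<close> telescope, and their lower end \<open>npow 1 (s - 1) = 1\<close> accounts
  for the leading 1.\<close>

definition zeta1 :: "complex => complex" where
 "zeta1 s = 1 + (\<Sum>n. if n = 0 then 0 else zeta_term n s)"

lemma npow_tendsto_0:
 assumes "Re s > 0" shows "(%n. npow n s) \<longlonglongrightarrow> 0"
proof (rule tendsto_norm_zero_cancel)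
 show "(%n. norm (npow n s)) \<longlonglongrightarrow> 0"
  using assms tendsto_neg_powr[of "- Re s" "%n. real n" sequentially] filterlim_real_sequentially by simp
qed

lemma zeta1_props:
 shows zeta1_holomorphic: "zeta1 holomorphic_on {s. Re s > 0}"
  and zeta1_bound: "\<exists>C>0. ALL s. Re s >= 1/2 --> norm (zeta1 s) <= C * (1 + norm s)^2"
  and zeta1_eq: "Re s > 1 ==> zeta1 s = (s - 1) * dseries (%_. 1) s"
  and zeta1_1: "zeta1 1 = 1"
proof -
 define t where "t = (%n s. if n = 0 then 0 else zeta_term n s)"
 have hol: "t n holomorphic_on {s. Re s > 0}" for n
  unfolding t_def zeta_term_def npow_def by (cases "n = 0") (auto intro!: holomorphic_intros)
 have bd: "norm (t n s) <= 1 * (1 + norm s)^2 * real n powr (- Re s - 1)" if "n > 0" "Re s > 0" for n s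
 proof -
  have "norm (t n s) <= norm (s - 1) * norm s * real n powr (- Re s - 1)"
   using norm_zeta_term[OF that] that by (simp add: t_def)
  also have "... <= (1 + norm s) * (1 + norm s) * real n powr (- Re s - 1)"
   using norm_triangle_ineq4[of s 1] by (intro mult_right_mono mult_mono) auto
  finally show ?thesis by (simp add: power2_eq_square)
 qed
 note ser = holomorphic_series[where t = t and C = 1, OF hol _ bd, unfolded t_def, simplified]
 show "zeta1 holomorphic_on {s. Re s > 0}"
  unfolding zeta1_def[abs_def] by (intro holomorphic_intros ser(1))
 show "\<exists>C>0. ALL s. Re s >= 1/2 --> norm (zeta1 s) <= C * (1 + norm s)^2"
 proof (intro exI conjI allI impI)
  define Z where "Z = (\<Sum>n. real n powr (-3/2))"
  have "Z >= 0" unfolding Z_def by (intro suminf_nonneg) (use summable_powr[of "3/2"] in auto)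
  thus "1 + Z > 0" by simp
  fix s :: complex assume "Re s >= 1/2"
  hence "norm (zeta1 s) <= 1 + Z * (1 + norm s)^2"
   unfolding zeta1_def Z_def using ser(3)[of s] norm_triangle_ineq[of 1 "\<Sum>n. if n = 0 then 0 else zeta_term n s"] by simp
  also have "... <= 1 * (1 + norm s)^2 + Z * (1 + norm s)^2"
   using one_le_power[of "1 + norm s" 2] by simp
  finally show "norm (zeta1 s) <= (1 + Z) * (1 + norm s)^2" by (simp add: algebra_simps)
 qed
 have t1: "t n 1 = (if n = 0 then 0 else 0)" for n
 proof -
  have "(1::complex) + of_nat n ~= 0" by (metis of_nat_Suc of_nat_neq_0)
  thus ?thesis by (auto simp: t_def zeta_term_def npow_def)
 qed
 show "zeta1 1 = 1" unfolding zeta1_def using t1 by (simp add: t_def fun_eq_iff cong: if_cong)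
 show "zeta1 s = (s - 1) * dseries (%_. 1) s" if s: "Re s > 1"
 proof -
  have part: "(\<Sum>n<Suc N. t n s) = (s - 1) * (\<Sum>n<Suc N. npow n s) + npow (Suc N) (s - 1) - 1" for N
   by (induction N) (auto simp: t_def zeta_term_def algebra_simps)
  have "(%n. npow n s) sums dseries (%_. 1) s"
   using dseries_sums[of "%_. 1" s] dseries_bounded_coeff[of "%_. 1" 1 s] s by simp
  hence "(%N. (s - 1) * (\<Sum>n<Suc N. npow n s) + npow (Suc N) (s - 1) - 1) \<longlonglongrightarrow> (s - 1) * dseries (%_. 1) s + 0 - 1"
   using s npow_tendsto_0[of "s - 1"]
   by (intro tendsto_intros LIMSEQ_Suc) (auto simp: sums_def)
  moreover have "(%N. \<Sum>n<Suc N. t n s) \<longlonglongrightarrow> (\<Sum>n. t n s)"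
   using ser(2)[of s] s by (intro LIMSEQ_Suc summable_LIMSEQ) (auto simp: t_def)
  ultimately have "(\<Sum>n. t n s) = (s - 1) * dseries (%_. 1) s - 1"
   unfolding part using LIMSEQ_unique by fastforce
  thus ?thesis by (simp add: zeta1_def t_def)
 qed
qed

text \<open>Summation by parts moves the Dirichlet series of \<open>g\<close> onto its partial sums;
  when these are bounded, the new series converges in the larger half-plane
  \<open>Re s > 0\<close>.\<close>

definition abel_series :: "(nat => complex) => complex => complex" where
 "abel_series g s = (\<Sum>n. (\<Sum>m=1..n. g m) * (npow n s - npow (Suc n) s))"

lemma abel_series_props:
 assumes B: "!!n. norm (\<Sum>m=1..n. g m) <= B" and B': "!!n. norm (g n) <= B'"
 shows abel_series_holomorphic: "abel_series g holomorphic_on {s. Re s > 0}"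
  and abel_series_bound: "\<exists>C>0. ALL s. Re s >= 1/2 --> norm (abel_series g s) <= C * (1 + norm s)^2"
  and abel_series_eq: "Re s > 1 ==> abel_series g s = dseries g s"
  and abel_series_summable: "Re s > 0 ==> summable (%n. (\<Sum>m=1..n. g m) * (npow n s - npow (Suc n) s))"
proof -
 define t where "t = (%n s. (\<Sum>m=1..n. g m) * (npow n s - npow (Suc n) s))"
 have B0: "B >= 0" using B[of 0] by simp
 have hol: "t n holomorphic_on {s. Re s > 0}" for n
  unfolding t_def by (auto intro!: holomorphic_intros)
 have bd: "norm (t n s) <= B * (1 + norm s)^2 * real n powr (- Re s - 1)" if "n > 0" "Re s > 0" for n s
 proof -
  have "norm (t n s) <= B * (norm s * real n powr (- Re s - 1))"
   unfolding t_def norm_mult using norm_npow_diff[of n s] that B[of n] B0 by (intro mult_mono) auto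
  also have "norm s <= (1 + norm s)^2" by (simp add: power2_eq_square algebra_simps)
  finally show ?thesis using B0 by (simp add: mult_left_mono mult_right_mono mult.assoc)
 qed
 note ser = holomorphic_series[where t = t and C = B, OF hol B0 bd, unfolded t_def, simplified]
 show "abel_series g holomorphic_on {s. Re s > 0}"
  unfolding abel_series_def[abs_def] using ser(1) by simp
 show summ: "summable (%n. (\<Sum>m=1..n. g m) * (npow n s - npow (Suc n) s))" if "Re s > 0" for s
  using ser(2)[of s] that by simp
 show "\<exists>C>0. ALL s. Re s >= 1/2 --> norm (abel_series g s) <= C * (1 + norm s)^2"
 proof (intro exI conjI allI impI)
  define Z where "Z = (\<Sum>n. real n powr (-3/2))"
  have "Z >= 0" unfolding Z_def by (intro suminf_nonneg) (use summable_powr[of "3/2"] in auto)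
  thus "1 + B * Z > 0" using B0 by (simp add: add_pos_nonneg)
  fix s :: complex assume "Re s >= 1/2"
  hence "norm (abel_series g s) <= B * Z * (1 + norm s)^2"
   unfolding abel_series_def Z_def using ser(3)[of s] by simp
  thus "norm (abel_series g s) <= (1 + B * Z) * (1 + norm s)^2"
   by (simp add: algebra_simps add_increasing)
 qed
 show "abel_series g s = dseries g s" if s: "Re s > 1"
 proof -
  have part: "(\<Sum>n<Suc N. t n s) = (\<Sum>n<Suc N. g n * npow n s) - (\<Sum>m=1..N. g m) * npow (Suc N) s" for N
   by (induction N) (auto simp: t_def algebra_simps)
  have 1: "(%n. g n * npow n s) sums dseries g s"
   using dseries_bounded_coeff[OF B' s] by (rule dseries_sums)
  have 2: "(%N. (\<Sum>m=1..N. g m) * npow (Suc N) s) \<longlonglongrightarrow> 0"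
  proof (rule Lim_null_comparison)
   show "\<forall>\<^sub>F N in sequentially. norm ((\<Sum>m=1..N. g m) * npow (Suc N) s) <= B * norm (npow (Suc N) s)"
    unfolding norm_mult using B by (intro always_eventually allI mult_right_mono) auto
   have "(%N. B * norm (npow (Suc N) s)) \<longlonglongrightarrow> B * norm (0::complex)"
    by (intro tendsto_intros LIMSEQ_Suc[OF npow_tendsto_0]) (use s in auto)
   thus "(%N. B * norm (npow (Suc N) s)) \<longlonglongrightarrow> 0" by (simp del: norm_npow)
  qed
  have "(%N. (\<Sum>n<Suc N. g n * npow n s) - (\<Sum>m=1..N. g m) * npow (Suc N) s) \<longlonglongrightarrow> dseries g s - 0"
   using 1 unfolding sums_def by (intro tendsto_diff 2) (rule LIMSEQ_Suc)
  moreover have "(%N. \<Sum>n<Suc N. t n s) \<longlonglongrightarrow> (\<Sum>n. t n s)"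
   using summ[of s] s by (intro LIMSEQ_Suc summable_LIMSEQ) (auto simp: t_def)
  ultimately show ?thesis
   unfolding part abel_series_def using LIMSEQ_unique[of _ "\<Sum>n. t n s" "dseries g s"] by (simp add: t_def)
 qed
qed

text \<open>Complete periods cancel, which leaves fewer than \<open>q\<close> terms.\<close>

lemma periodic_sum_bound:
 fixes f :: "nat => complex"
 assumes q: "q > 0" and per: "!!n. f (n mod q) = f n" and zero: "(\<Sum>n<q. f n) = 0" and B: "!!n. norm (f n) <= B"
 shows "norm (\<Sum>n<N. f n) <= B * real q"
proof -
 have shift: "f (n + q * k) = f n" for n k by (metis per mod_mult_self2)
 have append: "(\<Sum>n<a + b. f n) = (\<Sum>n<a. f n) + (\<Sum>n<b. f (n + a))" for a b
  by (induction b) (auto simp: add_ac)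
 have blocks: "(\<Sum>n<q * k + r. f n) = (\<Sum>n<r. f n)" for k r
 proof (induction k)
  case (Suc k)
  have "(\<Sum>n<q * Suc k + r. f n) = (\<Sum>n<q + (q * k + r). f n)" by (simp add: algebra_simps)
  also have "... = (\<Sum>n<q. f n) + (\<Sum>n<q * k + r. f (n + q))" by (rule append)
  also have "(\<Sum>n<q * k + r. f (n + q)) = (\<Sum>n<q * k + r. f n)" using shift[of _ 1] by simp
  finally show ?case using Suc zero by simp
 qed simp
 have "(\<Sum>n<N. f n) = (\<Sum>n<q * (N div q) + N mod q. f n)" by simp
 also have "... = (\<Sum>n<N mod q. f n)" by (rule blocks)
 also have "norm ... <= (\<Sum>n<N mod q. B)" by (intro sum_norm_le B)
 also have "... <= B * real q"
  using order_trans[OF norm_ge_zero B[of 0]] q by (simp add: mult.commute[of B] mult_right_mono)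
 finally show ?thesis .
qed

text \<open>The mean of \<open>\<chi>\<close> over a period. Subtracting it makes the partial sums
  bounded for the trivial character too, so all characters share one construction.\<close>

definition char_density :: "nat => (nat => complex) => complex" where
 "char_density q \<chi> = (if \<chi> = trivial_char q then of_nat (totient q) / of_nat q else 0)"

definition pole_factor :: "nat => (nat => complex) => complex => complex" where
 "pole_factor q \<chi> s = (if \<chi> = trivial_char q then s - 1 else 1)"

text \<open>The Dirichlet \<open>L\<close>-function, multiplied by \<open>s - 1\<close> for the trivial character.\<close>

definition Lreg :: "nat => (nat => complex) => complex => complex" where
 "Lreg q \<chi> s = char_density q \<chi> * zeta1 s + pole_factor q \<chi> s * abel_series (%n. \<chi> n - char_density q \<chi>) s"

context
 fixes q :: nat and \<chi> :: "nat => complex" assumes q: "q > 1" and \<chi>: "dirichlet_char q \<chi>"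
begin

lemma char_density_norm: "norm (char_density q \<chi>) <= 1"
 using q totient_le[of q] by (auto simp: char_density_def norm_divide)

lemma char_partial_sum_bound: "norm (\<Sum>m=1..n. \<chi> m - char_density q \<chi>) <= 2 * real q + 2"
proof -
 let ?f = "%n. \<chi> n - char_density q \<chi>"
 have B: "norm (?f n) <= 2" for n
  using norm_triangle_ineq4[of "\<chi> n" "char_density q \<chi>"] char_density_norm dirichlet_char_norm_le[OF q \<chi>, of n] by linarith
 have "(\<Sum>n<q. ?f n) = 0"
  using q dirichlet_char_sum_residues[OF q \<chi>] by (auto simp: sum_subtractf char_density_def)
 moreover have "?f (n mod q) = ?f n" for n using \<chi> by (simp add: dirichlet_char_def)
 ultimately have *: "norm (\<Sum>n<Suc n. ?f n) <= 2 * real q"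
  using periodic_sum_bound[of q ?f 2 "Suc n"] q B by simp
 have "(\<Sum>n<Suc n. f n) = f 0 + (\<Sum>m=1..n. f m)" for f :: "nat => complex"
  by (simp add: sum.lessThan_Suc_shift sum.atLeast1_atMost_eq del: sum.lessThan_Suc)
 from this[of ?f] have "(\<Sum>m=1..n. ?f m) = (\<Sum>n<Suc n. ?f n) - ?f 0" by (metis add_diff_cancel_left')
 thus ?thesis using * B[of 0] norm_triangle_ineq4[of "\<Sum>n<Suc n. ?f n" "?f 0"] by simp
qed

lemma char_diff_norm: "norm (\<chi> n - char_density q \<chi>) <= 2"
 using norm_triangle_ineq4[of "\<chi> n" "char_density q \<chi>"] char_density_norm dirichlet_char_norm_le[OF q \<chi>, of n] by linarith

lemmas char_abel = abel_series_props[OF char_partial_sum_bound char_diff_norm]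

lemma Lreg_holomorphic: "Lreg q \<chi> holomorphic_on {s. Re s > 0}"
proof -
 have "pole_factor q \<chi> holomorphic_on {s. Re s > 0}"
  unfolding pole_factor_def[abs_def] by (cases "\<chi> = trivial_char q") (auto intro!: holomorphic_intros)
 thus ?thesis unfolding Lreg_def[abs_def]
  by (intro holomorphic_intros zeta1_holomorphic char_abel(1))
qed

lemma Lreg_bound: "\<exists>C>0. ALL s. Re s >= 1/2 --> norm (Lreg q \<chi> s) <= C * (1 + norm s)^3"
proof -
 obtain C1 where C1: "C1 > 0" "!!s. Re s >= 1/2 ==> norm (zeta1 s) <= C1 * (1 + norm s)^2" using zeta1_bound by blast
 obtain C2 where C2: "C2 > 0" "!!s. Re s >= 1/2 ==> norm (abel_series (%n. \<chi> n - char_density q \<chi>) s) <= C2 * (1 + norm s)^2"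
  using char_abel(2) by blast
 have "norm (Lreg q \<chi> s) <= (C1 + C2) * (1 + norm s)^3" if s: "Re s >= 1/2" for s
 proof -
  have pf: "norm (pole_factor q \<chi> s) <= 1 + norm s"
   using norm_triangle_ineq4[of s 1] by (auto simp: pole_factor_def)
  have "norm (Lreg q \<chi> s) <= norm (char_density q \<chi>) * norm (zeta1 s) + norm (pole_factor q \<chi> s) * norm (abel_series (%n. \<chi> n - char_density q \<chi>) s)"
   unfolding Lreg_def by (metis norm_mult norm_triangle_ineq)
  also have "... <= (1 + norm s) * (C1 * (1 + norm s)^2) + (1 + norm s) * (C2 * (1 + norm s)^2)"
  proof (intro add_mono mult_mono)
   show "norm (char_density q \<chi>) <= 1 + norm s" using char_density_norm norm_ge_zero[of s] by linarith
  qed (use pf C1(2)[OF s] C2(2)[OF s] in auto)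
  also have "... = (C1 + C2) * (1 + norm s)^3" by (simp add: power2_eq_square power3_eq_cube algebra_simps)
  finally show ?thesis .
 qed
 thus ?thesis using C1(1) C2(1) by (intro exI[of _ "C1 + C2"]) auto
qed

lemma Lreg_eq:
 assumes s: "Re s > 1" shows "Lreg q \<chi> s = pole_factor q \<chi> s * dseries \<chi> s"
proof -
 let ?c = "char_density q \<chi>"
 have 1: "(%n. npow n s) sums dseries (%_. 1) s"
  using dseries_sums[of "%_. 1" s] dseries_bounded_coeff[of "%_. 1" 1 s] s by simp
 have 2: "(%n. (\<chi> n - ?c) * npow n s) sums dseries (%n. \<chi> n - ?c) s"
  by (intro dseries_sums dseries_bounded_coeff[OF char_diff_norm s])
 from sums_add[OF 2 sums_mult[OF 1, of ?c]]
 have "(%n. \<chi> n * npow n s) sums (dseries (%n. \<chi> n - ?c) s + ?c * dseries (%_. 1) s)"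
  by (simp add: algebra_simps)
 hence "dseries \<chi> s = dseries (%n. \<chi> n - ?c) s + ?c * dseries (%_. 1) s"
  unfolding dseries_def[of \<chi>] using sums_unique by metis
 thus ?thesis unfolding Lreg_def char_abel(3)[OF s] zeta1_eq[OF s]
  by (auto simp: algebra_simps pole_factor_def char_density_def diff_divide_distrib)
qed

end

text \<open>Sieving out the primes up to \<open>y\<close> leaves \<open>1\<close> and terms with index above \<open>y\<close>.\<close>

lemma euler_product_tendsto:
 fixes f :: "nat => complex"
 assumes summ: "summable (%n. norm (f n))" and f1: "f 1 = 1" and f0: "f 0 = 0"
  and mult: "!!m n. f (m * n) = f m * f n"
 shows "(%y. suminf f * (\<Prod>p | prime p & p <= y. 1 - f p)) \<longlonglongrightarrow> 1"
proof -
 note pos = has_sum_positive_nat[OF summ f0]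
 have ss: "f summable_on A" if "A <= {0<..}" for A
  by (rule summable_on_subset_banach[OF _ that]) (use pos(1) in \<open>auto simp: summable_on_def\<close>)
 define R where "R = (%Q::nat set. {n. n > 0 & (\<forall>p\<in>Q. \<not> p dvd n)})"
 \<comment> \<open>Splitting off the multiples of a new prime \<open>r\<close>: complete
   multiplicativity makes their sum \<open>f r\<close> times the old one, so each prime contributes
   a factor \<open>1 - f r\<close>.\<close>
 have RQ: "infsum f (R Q) = suminf f * (\<Prod>p\<in>Q. 1 - f p)" if "finite Q" "\<forall>p\<in>Q. prime p" for Q
  using that
 proof (induction Q)
  case empty
  thus ?case using infsumI[OF pos(1)] by (simp add: R_def greaterThan_def)
 next
  case (insert r Q)
  have r: "prime r" and Q: "\<forall>p\<in>Q. prime p" using insert.prems by auto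
  have split: "R Q = R (insert r Q) \<union> (*) r ` R Q"
  proof (intro equalityI subsetI)
   fix n assume n: "n \<in> R Q"
   show "n \<in> R (insert r Q) \<union> (*) r ` R Q"
   proof (cases "r dvd n")
    case True
    then obtain m where m: "n = r * m" by blast
    hence "m \<in> R Q" using n by (auto simp: R_def)
    thus ?thesis using m by blast
   qed (use n in \<open>auto simp: R_def\<close>)
  next
   fix n assume "n \<in> R (insert r Q) \<union> (*) r ` R Q"
   thus "n \<in> R Q"
   proof
    assume "n \<in> (*) r ` R Q"
    then obtain m where m: "n = r * m" "m \<in> R Q" by blast
    have "\<not> p dvd r * m" if p: "p \<in> Q" for p
    proof
     assume "p dvd r * m"
     hence "p dvd r" using m(2) p Q prime_dvd_mult_iff[of p r m] by (auto simp: R_def)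
     hence "p = r" using p Q r primes_dvd_imp_eq by blast
     thus False using p insert.hyps by simp
    qed
    thus ?thesis using m r prime_gt_0_nat[OF r] by (auto simp: R_def)
   qed (auto simp: R_def)
  qed
  have disj: "R (insert r Q) \<inter> (*) r ` R Q = {}" by (auto simp: R_def)
  have sub: "R Q' <= {0<..}" for Q' by (auto simp: R_def)
  have sub2: "(*) r ` R Q <= {0<..}" using prime_gt_0_nat[OF r] by (auto simp: R_def)
  have "infsum f (R Q) = infsum f (R (insert r Q)) + infsum f ((*) r ` R Q)"
   using infsum_Un_disjoint[OF ss[OF sub] ss[OF sub2] disj] split by simp
  also have "infsum f ((*) r ` R Q) = infsum (f \<circ> (*) r) (R Q)"
   using prime_gt_0_nat[OF r] by (intro infsum_reindex) (auto simp: inj_on_def)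
  also have "... = f r * infsum f (R Q)" by (simp add: o_def mult infsum_cmult_right')
  finally have "infsum f (R (insert r Q)) = infsum f (R Q) - f r * infsum f (R Q)"
   by (metis add_diff_cancel_right')
  hence "infsum f (R (insert r Q)) = (1 - f r) * infsum f (R Q)" by (simp only: left_diff_distrib mult_1)
  thus ?case using insert by simp
 qed
 define T where "T = (%y. \<Sum>n. norm (f (n + Suc y)))"
 have "(%y. suminf f * (\<Prod>p | prime p & p <= y. 1 - f p) - 1) \<longlonglongrightarrow> 0"
 proof (rule Lim_null_comparison)
  show "T \<longlonglongrightarrow> 0" unfolding T_def
   using suminf_exist_split2[OF summ] by (rule LIMSEQ_Suc)
  show "\<forall>\<^sub>F y in sequentially. norm (suminf f * (\<Prod>p | prime p & p <= y. 1 - f p) - 1) <= T y"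
  proof (intro always_eventually allI)
   fix y :: nat
   define Q where "Q = {p. prime p & p <= y}"
   have fin: "finite Q" unfolding Q_def by simp
   have R1: "R Q = insert 1 (R Q - {1})" by (auto simp: R_def Q_def)
   have big: "R Q - {1} <= {Suc y..}"
   proof
    fix n assume n: "n \<in> R Q - {1}"
    then obtain p where p: "prime p" "p dvd n" using prime_factor_nat by (auto simp: R_def)
    hence "p > y" "n > 0" using n by (auto simp: R_def Q_def)
    moreover have "p <= n" using p(2) \<open>n > 0\<close> by (rule dvd_imp_le)
    ultimately show "n \<in> {Suc y..}" by simp
   qed
   have "infsum f (R Q) = f 1 + infsum f (R Q - {1})"
   proof -
    have "f summable_on (R Q - {1})" by (rule ss) (auto simp: R_def)
    hence "infsum f (insert 1 (R Q - {1})) = f 1 + infsum f (R Q - {1})"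
     by (rule infsum_insert) auto
    thus ?thesis using R1 by metis
   qed
   moreover have "infsum f (R Q) = suminf f * (\<Prod>p | prime p & p <= y. 1 - f p)"
    using RQ[OF fin] by (simp add: Q_def)
   ultimately have "suminf f * (\<Prod>p | prime p & p <= y. 1 - f p) - 1 = infsum f (R Q - {1})"
    using f1 by (metis add_diff_cancel_left')
   also have "norm ... <= infsum (%n. norm (f n)) (R Q - {1})"
    by (rule norm_infsum_bound) (rule summable_on_subset_banach[OF pos(2)], auto simp: R_def)
   also have "... <= infsum (%n. norm (f n)) {Suc y..}"
    using big by (intro infsum_mono2 summable_on_subset_banach[OF pos(2)]) (auto simp: R_def)
   also have "... = infsum (%n. norm (f (n + Suc y))) UNIV"
    by (rule infsum_reindex_bij_witness[of _ "%n. n + Suc y" "%n. n - Suc y"]) auto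
   also have "... = T y" unfolding T_def
   proof (rule infsumI, rule norm_summable_imp_has_sum)
    show "summable (%n. norm (norm (f (n + Suc y))))" using summable_ignore_initial_segment[OF summ, of "Suc y"] by simp
    thus "(%n. norm (f (n + Suc y))) sums (\<Sum>n. norm (f (n + Suc y)))" by (simp add: summable_sums)
   qed
   finally show "norm (suminf f * (\<Prod>p | prime p & p <= y. 1 - f p) - 1) <= T y" .
  qed
 qed
 thus ?thesis by (rule LIM_zero_cancel)
qed

text \<open>In the power series of the logarithms, the coefficient of \<open>u ^ n / n\<close> is
  minus \<open>3 + 4 * Re w + Re (w^2)\<close> with \<open>w = z ^ n\<close>. On the unit circle
  this expression equals \<open>2 * (1 + Re w)^2\<close>, hence is nonnegative.\<close>

lemma mertens_341:
 fixes z :: complex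
 assumes u: "0 <= u" "u < 1" and z: "norm z = 1"
 shows "norm (1 - of_real u :: complex) ^ 3 * norm (1 - of_real u * z) ^ 4 * norm (1 - of_real u * z^2) <= 1"
proof -
 have lns: "(%n. - (Re (w ^ n) / real n)) sums ln (norm (1 - w))" if "norm w < 1" for w :: complex
 proof -
  have "(%n. (-1) ^ Suc n / of_nat n * (-w) ^ n) sums Ln (1 + - w)" by (rule Ln_series) (use that in simp)
  moreover have "(-1) ^ Suc n / of_nat n * (-w) ^ n = - (w ^ n / of_nat n)" for n
   by (cases "even n") auto
  ultimately have "(%n. - (w ^ n / of_nat n)) sums Ln (1 + - w)" by (simp only:)
  hence "(%n. - (w ^ n / of_nat n)) sums Ln (1 - w)" by simp
  hence "(%n. Re (- (w ^ n / of_nat n))) sums Re (Ln (1 - w))" by (rule sums_Re)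
  moreover have "1 - w ~= 0" using that by auto
  ultimately show ?thesis by (simp add: Re_divide_of_nat)
 qed
 have nu: "norm (of_real u :: complex) < 1" "norm (of_real u * z) < 1" "norm (of_real u * z^2) < 1"
  using u z by (auto simp: norm_mult norm_power)
 define f where "f = (%n. 3 * - (Re (of_real u ^ n) / real n) + 4 * - (Re ((of_real u * z) ^ n) / real n) + - (Re ((of_real u * z^2) ^ n) / real n))"
 have S: "f sums (3 * ln (norm (1 - of_real u :: complex)) + 4 * ln (norm (1 - of_real u * z)) + ln (norm (1 - of_real u * z^2)))"
  unfolding f_def by (intro sums_add sums_mult lns nu)
 have "f n <= 0" for n
 proof -
  define w where "w = z ^ n"
  have "norm w = 1" using z by (simp add: w_def norm_power)
  hence "(Re w)\<^sup>2 + (Im w)\<^sup>2 = 1" by (simp add: cmod_def)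
  hence "Re (w^2) = 2 * (Re w)\<^sup>2 - 1" by (simp add: power2_eq_square)
  hence "3 + 4 * Re w + Re (w^2) = 2 * (1 + Re w)\<^sup>2" by (simp add: power2_eq_square algebra_simps)
  hence nn: "3 + 4 * Re w + Re (w^2) >= 0" by simp
  have "f n = - (u ^ n / real n * (3 + 4 * Re w + Re (w^2)))"
   by (simp add: f_def power_mult_distrib w_def algebra_simps add_divide_distrib flip: power_mult of_real_power)
  moreover have "u ^ n / real n * (3 + 4 * Re w + Re (w^2)) >= 0" using nn u by (intro mult_nonneg_nonneg) auto
  ultimately show ?thesis by simp
 qed
 hence le: "3 * ln (norm (1 - of_real u :: complex)) + 4 * ln (norm (1 - of_real u * z)) + ln (norm (1 - of_real u * z^2)) <= 0"
  using sums_le[OF _ S sums_zero] by simp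
 have pos: "norm (1 - of_real u :: complex) > 0" "norm (1 - of_real u * z) > 0" "norm (1 - of_real u * z^2) > 0"
  using nu by auto
 hence "ln (norm (1 - of_real u :: complex) ^ 3 * norm (1 - of_real u * z) ^ 4 * norm (1 - of_real u * z^2)) <= 0"
  using le by (simp add: ln_mult ln_realpow)
 thus ?thesis using pos by (subst (asm) ln_le_zero_iff) auto
qed

section \<open>Nonvanishing at 1 for real characters\<close>

lemma sum_divisors_coprime_mult:
 fixes f :: "nat => real"
 assumes mult: "!!m n. f (m * n) = f m * f n" and co: "coprime a b" and pos: "a > 0" "b > 0"
 shows "(\<Sum>d | d dvd a * b. f d) = (\<Sum>d | d dvd a. f d) * (\<Sum>d | d dvd b. f d)"
proof -
 have gcds: "gcd (x * y) a = x" "gcd (x * y) b = y" if xy: "x dvd a" "y dvd b" for x y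
 proof -
  have "coprime y a" "coprime x b" using xy co by (meson coprime_divisors coprime_commute dvd_refl)+
  hence "coprime a y" "coprime b x" by (simp_all add: coprime_commute)
  thus "gcd (x * y) a = x" "gcd (x * y) b = y"
   using xy by (simp_all add: gcd_mult_left_left_cancel gcd_mult_left_right_cancel gcd_proj1_if_dvd)
 qed
 have "(\<Sum>d | d dvd a. f d) * (\<Sum>d | d dvd b. f d) = (\<Sum>(x, y)\<in>{d. d dvd a} \<times> {d. d dvd b}. f x * f y)"
  by (simp add: sum_product sum.cartesian_product)
 also have "... = (\<Sum>d | d dvd a * b. f d)"
 proof (rule sum.reindex_bij_witness[of _ "%d. (gcd d a, gcd d b)" "%(x, y). x * y"])
  fix z assume "z \<in> {d. d dvd a} \<times> {d. d dvd b}"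
  then obtain x y where z: "z = (x, y)" "x dvd a" "y dvd b" by auto
  show "(gcd (case z of (x, y) => x * y) a, gcd (case z of (x, y) => x * y) b) = z"
   using z gcds by simp
  show "(case z of (x, y) => x * y) \<in> {d. d dvd a * b}" using z by (auto intro: mult_dvd_mono)
  show "f (case z of (x, y) => x * y) = (case z of (x, y) => f x * f y)" using z mult by simp
 next
  fix d assume "d \<in> {d. d dvd a * b}"
  then obtain x y where "d = x * y" "x dvd a" "y dvd b" using division_decomp by blast
  thus "(case (gcd d a, gcd d b) of (x, y) => x * y) = d" using gcds by simp
  show "(gcd d a, gcd d b) \<in> {d. d dvd a} \<times> {d. d dvd b}" by simp
 qed
 finally show ?thesis by simp
qed

text \<open>By multiplicativity only prime powers matter: for \<open>f p\<close> equal to 1, 0 or -1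
  the sum over the divisors of \<open>p ^ k\<close> is \<open>k + 1\<close>, 1, or the parity
  indicator of \<open>k\<close>. Squares have even exponents only, hence the lower bound 1.\<close>

lemma sum_divisors_real_char:
 fixes f :: "nat => real"
 assumes mult: "!!m n. f (m * n) = f m * f n" and f1: "f 1 = 1" and val: "!!n. f n \<in> {-1, 0, 1}"
 shows "n > 0 ==> (\<Sum>d | d dvd n. f d) >= 0" and "n > 0 ==> (\<Sum>d | d dvd n ^ 2. f d) >= 1"
proof -
 have pp: "(\<Sum>d | d dvd p ^ k. f d) >= (if even k then 1 else 0)" if p: "prime p" for p k
 proof -
  have dv: "{d. d dvd p ^ k} = (%i. p ^ i) ` {..k}" using divides_primepow_nat[OF p] by auto
  have "(\<Sum>d | d dvd p ^ k. f d) = (\<Sum>i\<le>k. f (p ^ i))"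
   unfolding dv using prime_gt_1_nat[OF p] by (subst sum.reindex) (auto simp: inj_on_def power_inject_exp)
  moreover have "f (p ^ i) = f p ^ i" for i by (induction i) (use mult f1 in auto)
  ultimately have eq: "(\<Sum>d | d dvd p ^ k. f d) = (\<Sum>i\<le>k. f p ^ i)" by simp
  have "(\<Sum>i\<le>k. (-1::real) ^ i) = (if even k then 1 else 0)" by (induction k) auto
  moreover have "(\<Sum>i\<le>k. (0::real) ^ i) = 1" by (induction k) auto
  ultimately show ?thesis unfolding eq using val[of p] by auto
 qed
 have dec: "EX p k m. prime p & k > 0 & coprime (p ^ k) m & m > 0 & m < n & n = p ^ k * m" if "n > 1" for n :: nat
 proof -
  obtain p where p: "prime p" "p dvd n" using prime_factor_nat \<open>n > 1\<close> by (metis less_irrefl)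
  obtain m where m: "n = p ^ multiplicity p n * m" "\<not> p dvd m"
   using multiplicity_decompose'[of n p] p \<open>n > 1\<close> by (metis less_nat_zero_code not_prime_unit)
  have k: "multiplicity p n > 0" using p \<open>n > 1\<close> by (simp add: prime_multiplicity_gt_zero_iff)
  hence "p ^ multiplicity p n > 1" by (intro one_less_power prime_gt_1_nat p)
  moreover have "m > 0" using m \<open>n > 1\<close> by (metis gr0I mult_0_right not_one_less_zero)
  ultimately have "1 * m < p ^ multiplicity p n * m" by (intro mult_strict_right_mono)
  hence "m < n" using m(1) by linarith
  moreover have "coprime (p ^ multiplicity p n) m" using prime_imp_coprime[OF p(1) m(2)] by simp
  ultimately show ?thesis using \<open>m > 0\<close>
   by (intro exI[of _ p] exI[of _ "multiplicity p n"] exI[of _ m] conjI p(1) k m(1))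
 qed
 show "(\<Sum>d | d dvd n. f d) >= 0" if "n > 0"
  using that
 proof (induction n rule: less_induct)
  case (less n)
  show ?case
  proof (cases "n = 1")
   case False
   hence "n > 1" using less.prems by linarith
   from dec[OF this] obtain p k m where *: "prime p" "coprime (p ^ k) m" "m > 0" "m < n" "n = p ^ k * m" by blast
   have "(\<Sum>d | d dvd p ^ k. f d) >= 0" using pp[OF *(1), of k] by (auto split: if_splits)
   moreover have "(\<Sum>d | d dvd n. f d) = (\<Sum>d | d dvd p ^ k. f d) * (\<Sum>d | d dvd m. f d)"
    unfolding *(5) using prime_gt_0_nat[OF *(1)] by (intro sum_divisors_coprime_mult mult *) auto
   ultimately show ?thesis using less.IH[OF *(4,3)] by simp
  qed (use f1 in simp)
 qed
 show "(\<Sum>d | d dvd n ^ 2. f d) >= 1" if "n > 0"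
  using that
 proof (induction n rule: less_induct)
  case (less n)
  show ?case
  proof (cases "n = 1")
   case False
   hence "n > 1" using less.prems by linarith
   from dec[OF this] obtain p k m where *: "prime p" "coprime (p ^ k) m" "m > 0" "m < n" "n = p ^ k * m" by blast
   have n2: "n ^ 2 = p ^ (2 * k) * m ^ 2" unfolding *(5) by (simp add: power_mult_distrib power_mult mult.commute flip: power_mult)
   have "coprime (p ^ (2 * k)) (m ^ 2)"
    using *(2) by (cases "k = 0") auto
   hence "(\<Sum>d | d dvd n ^ 2. f d) = (\<Sum>d | d dvd p ^ (2 * k). f d) * (\<Sum>d | d dvd m ^ 2. f d)"
    unfolding n2 using prime_gt_0_nat[OF *(1)] *(3) by (intro sum_divisors_coprime_mult mult) auto
   moreover have "(\<Sum>d | d dvd p ^ (2 * k). f d) >= 1" using pp[OF *(1), of "2 * k"] by simp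
   ultimately show ?thesis using less.IH[OF *(4,3)] mult_mono[of 1 "\<Sum>d | d dvd p ^ (2 * k). f d" 1 "\<Sum>d | d dvd m ^ 2. f d"] by simp
  qed (use f1 in simp)
 qed
qed

text \<open>Pairing the terms \<open>i\<close> and \<open>n - 1 - i\<close>, the
  arithmetic-geometric mean bounds the geometric sum below by \<open>n\<close> times its middle
  term, a power of \<open>y = sqrt x\<close>. In the nonvanishing proof the first inequality makes
  the sequence \<open>b\<close> nonnegative and the second makes it decreasing.\<close>

lemma geometric_sum_am_gm:
 fixes x :: real
 assumes "0 < x" "x < 1"
 shows "real n * (1 - x) * x ^ n <= 1 - x ^ n"
  and "real n * real (Suc n) * x ^ n * (1 - x)\<^sup>2 <= (1 - x ^ n) * (1 - x ^ Suc n)"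
proof -
 define y where "y = sqrt x"
 have y: "0 < y" "y < 1" "x = y ^ 2" using assms by (auto simp: y_def)
 have am: "real n * y ^ (n - 1) <= (\<Sum>i<n. x ^ i)" for n
 proof -
  have "(\<Sum>i<n. x ^ i) = (\<Sum>i<n. x ^ (n - Suc i))" by (rule sum.nat_diff_reindex[symmetric])
  hence "2 * (\<Sum>i<n. x ^ i) = (\<Sum>i<n. x ^ i + x ^ (n - Suc i))" by (simp add: sum.distrib)
  also have "... >= (\<Sum>i<n. 2 * y ^ (n - 1))"
  proof (rule sum_mono)
   fix i assume "i \<in> {..<n}"
   hence "y ^ (n - 1) = y ^ i * y ^ (n - Suc i)" by (simp flip: power_add)
   thus "2 * y ^ (n - 1) <= x ^ i + x ^ (n - Suc i)"
    using sum_squares_bound[of "y ^ i" "y ^ (n - Suc i)"] y(3) by (simp add: mult_ac flip: power_mult)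
  qed
  finally show ?thesis by simp
 qed
 have geo: "1 - x ^ n = (1 - x) * (\<Sum>i<n. x ^ i)" for n by (simp add: one_diff_power_eq)
 have le: "y ^ a <= y ^ b" if "b <= a" for a b using that y by (intro power_decreasing) auto
 have "real n * (1 - x) * x ^ n <= (1 - x) * (real n * y ^ (n - 1))"
  using le[of "n - 1" "2 * n"] assms by (simp add: y(3) mult_left_mono mult_ac flip: power_mult)
 also have "... <= 1 - x ^ n" unfolding geo using am[of n] assms by (intro mult_left_mono) auto
 finally show "real n * (1 - x) * x ^ n <= 1 - x ^ n" .
 have "real n * real (Suc n) * x ^ n * (1 - x)\<^sup>2 <= real n * real (Suc n) * (y ^ (n - 1) * y ^ n) * (1 - x)\<^sup>2"
  using le[of "n - 1 + n" "2 * n"] by (intro mult_right_mono mult_left_mono) (auto simp: y(3) simp flip: power_mult power_add)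
 also have "... = ((1 - x) * (real n * y ^ (n - 1))) * ((1 - x) * (real (Suc n) * y ^ (Suc n - 1)))"
  by (simp add: power2_eq_square mult_ac)
 also have "... <= (1 - x ^ n) * (1 - x ^ Suc n)"
  unfolding geo using am[of n] am[of "Suc n"] assms y by (intro mult_mono mult_left_mono mult_nonneg_nonneg sum_nonneg) auto
 finally show "real n * real (Suc n) * x ^ n * (1 - x)\<^sup>2 <= (1 - x ^ n) * (1 - x ^ Suc n)" .
qed

context
 fixes q :: nat and \<chi> :: "nat => complex" assumes q: "q > 1" and \<chi>: "dirichlet_char q \<chi>"
begin

text \<open>Monsky's argument: the Lambert series of \<open>\<chi>\<close> has coefficients \<open>\<Sum>d dvd n. \<chi> d >= 0\<close> that are at
 least 1 at squares, so it is unbounded near 1; but it would stay bounded if \<open>L(1, \<chi>) = 0\<close>, because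
 \<open>1 / (n (1 - x)) - x ^ n / (1 - x ^ n)\<close> decreases in \<open>n\<close>.\<close>

lemma Lreg_real_nonzero:
 assumes nt: "\<chi> ~= trivial_char q" and real: "!!n. \<chi> n * \<chi> n = trivial_char q n"
 shows "Lreg q \<chi> 1 ~= 0"
proof
 assume L0: "Lreg q \<chi> 1 = 0"
 define X where "X = (%n. Re (\<chi> n))"
 define r where "r = (%n. \<Sum>m=1..n. X m)"
 define B where "B = 2 * real q + 2"
 have c0: "char_density q \<chi> = 0" using nt by (simp add: char_density_def)
 have \<chi>v: "\<chi> n \<in> {-1, 0, 1}" for n
 proof -
  have "\<chi> n * \<chi> n = 0 \<or> \<chi> n * \<chi> n = 1" using real[of n] by (auto simp: trivial_char_def split: if_splits)
  thus ?thesis by (auto simp: square_eq_1_iff)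
 qed
 have \<chi>X: "\<chi> n = of_real (X n)" for n using \<chi>v[of n] by (auto simp: X_def)
 have Xv: "X n \<in> {-1, 0, 1}" for n using \<chi>v[of n] by (auto simp: X_def)
 have Xmult: "X (m * n) = X m * X n" for m n
 proof -
  have "\<chi> (m * n) = \<chi> m * \<chi> n" using \<chi> by (simp add: dirichlet_char_def)
  hence "complex_of_real (X (m * n)) = of_real (X m * X n)" by (simp add: \<chi>X)
  thus ?thesis by (simp only: of_real_eq_iff)
 qed
 have X1: "X 1 = 1" using \<chi> by (simp add: X_def dirichlet_char_def)
 have Xabs: "\<bar>X n\<bar> <= 1" for n using Xv[of n] by auto
 have rB: "\<bar>r n\<bar> <= B" for n
 proof -
  have "(\<Sum>m=1..n. \<chi> m - char_density q \<chi>) = of_real (r n)" by (simp add: c0 \<chi>X r_def)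
  thus ?thesis using char_partial_sum_bound[OF q \<chi>, of n] by (simp add: B_def)
 qed
 \<comment> \<open>The assumption that \<open>L(1)\<close> vanishes, in Abel-summed form with the
   real partial sums \<open>r\<close>.\<close>
 have S1: "(%n. r n * (1 / real n - 1 / real (Suc n))) sums 0"
 proof -
  have "(%n. (\<Sum>m=1..n. \<chi> m - char_density q \<chi>) * (npow n 1 - npow (Suc n) 1)) sums abel_series (%n. \<chi> n - char_density q \<chi>) 1"
   unfolding abel_series_def by (intro summable_sums char_abel(4)[OF q \<chi>]) simp
  moreover have "abel_series (%n. \<chi> n - char_density q \<chi>) 1 = 0"
   using L0 nt c0 by (simp add: Lreg_def pole_factor_def)
  moreover have "(\<Sum>m=1..n. \<chi> m - char_density q \<chi>) * (npow n 1 - npow (Suc n) 1) = of_real (r n * (1 / real n - 1 / real (Suc n)))" for n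
  proof (cases "n = 0")
   case False
   hence "npow n 1 = of_real (1 / real n)" "npow (Suc n) 1 = of_real (1 / real (Suc n))"
    by (simp_all add: npow_def powr_minus divide_inverse)
   thus ?thesis by (simp add: c0 \<chi>X r_def)
  qed (simp add: r_def)
  ultimately have "(%n. complex_of_real (r n * (1 / real n - 1 / real (Suc n)))) sums of_real 0" by simp
  thus ?thesis by (simp only: sums_of_real_iff)
 qed
 \<comment> \<open>The bound depends on neither \<open>x\<close> nor \<open>K\<close>; letting
   \<open>x\<close> tend to 1 yields \<open>K <= B\<close>, which fails for large
   \<open>K\<close>.\<close>
 have key: "(\<Sum>m=1..K. x ^ (m\<^sup>2)) <= B" if x: "0 < x" "x < 1" for x :: real and K :: nat
 proof -
  \<comment> \<open>\<open>c n\<close> is the factor of \<open>X n\<close> in the Lambert series,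
    and \<open>b n\<close> is its defect from the pole part \<open>1 / (n (1 - x))\<close>. Summed
    against \<open>X\<close>, the pole part gives \<open>L(1) / (1 - x)\<close>, which is 0 by
    assumption; only \<open>b\<close> remains.\<close>
  define c where "c = (%n. x ^ n / (1 - x ^ n))"
  define b where "b = (%n. 1 / (real n * (1 - x)) - c n)"
  have xn: "x ^ n < 1" if "n > 0" for n using x that by (simp add: power_less_one_iff)
  have c_bound: "0 <= c n & c n <= x ^ n / (1 - x)" if "n > 0" for n
  proof -
   have "x ^ n <= x ^ 1" using that x by (intro power_decreasing) auto
   thus ?thesis using x xn[OF that] unfolding c_def by (auto intro!: divide_left_mono mult_pos_pos)
  qed
  have b0: "b n >= 0" if "n > 0" for n
  proof -
   have "0 < 1 - x ^ n" "0 < real n * (1 - x)" using that x xn[OF that] by auto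
   moreover have "x ^ n * (real n * (1 - x)) <= 1 * (1 - x ^ n)"
    using geometric_sum_am_gm(1)[OF x, of n] by (simp add: mult_ac)
   ultimately have "x ^ n / (1 - x ^ n) <= 1 / (real n * (1 - x))"
    by (simp only: pos_divide_le_eq pos_le_divide_eq times_divide_eq_left mult_1 if_True)
   thus ?thesis by (simp add: b_def c_def)
  qed
  have bdec: "b n - b (Suc n) >= 0" if n: "n > 0" for n
  proof -
   have "c n - c (Suc n) = x ^ n * (1 - x) / ((1 - x ^ n) * (1 - x ^ Suc n))"
    using xn[OF n] xn[of "Suc n"] by (simp add: c_def field_simps)
   moreover have "1 / (real n * (1 - x)) - 1 / (real (Suc n) * (1 - x)) = 1 / (real n * real (Suc n) * (1 - x))"
    using n x by (simp add: divide_simps)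
   moreover have "x ^ n * (1 - x) / ((1 - x ^ n) * (1 - x ^ Suc n)) <= 1 / (real n * real (Suc n) * (1 - x))"
   proof -
    have "0 < (1 - x ^ n) * (1 - x ^ Suc n)" using xn[OF n] xn[of "Suc n"] by simp
    moreover have "0 < real n * real (Suc n) * (1 - x)" using n x by simp
    moreover have "x ^ n * (1 - x) * (real n * real (Suc n) * (1 - x)) <= 1 * ((1 - x ^ n) * (1 - x ^ Suc n))"
     using geometric_sum_am_gm(2)[OF x, of n] by (simp add: power2_eq_square mult_ac)
    ultimately show ?thesis by (simp only: pos_divide_le_eq pos_le_divide_eq frac_le_eq divide_le_eq le_divide_eq times_divide_eq_left mult_1 if_True)
   qed
   ultimately show ?thesis by (simp add: b_def)
  qed
  have b1: "b 1 = 1" using x by (simp add: b_def c_def field_simps)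
  \<comment> \<open>Since \<open>b\<close> decreases from \<open>b 1 = 1\<close> and stays
    nonnegative, its total variation telescopes to at most 1.\<close>
  have absum: "(\<Sum>n<Suc N. \<bar>r n * (b n - b (Suc n))\<bar>) <= B * (1 - b (Suc N))" for N
  proof (induction N)
   case 0
   thus ?case using b1 by (simp add: r_def)
  next
   case (Suc N)
   have "\<bar>r (Suc N) * (b (Suc N) - b (Suc (Suc N)))\<bar> <= B * (b (Suc N) - b (Suc (Suc N)))"
    using rB[of "Suc N"] bdec[of "Suc N"] by (simp add: abs_mult mult_right_mono)
   thus ?case using Suc by (simp add: algebra_simps)
  qed
  have part: "(\<Sum>n<Suc N. X n * c n) = (\<Sum>n<Suc N. r n * (1 / real n - 1 / real (Suc n))) / (1 - x)
    - (\<Sum>n<Suc N. r n * (b n - b (Suc n))) + r N * c (Suc N)" for N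
  proof -
   have "(\<Sum>n<Suc N. X n * c n) = (\<Sum>n<Suc N. r n * (c n - c (Suc n))) + r N * c (Suc N)"
   proof (induction N)
    case 0
    show ?case by (simp add: r_def c_def)
   next
    case (Suc N)
    have "r (Suc N) = r N + X (Suc N)" by (simp add: r_def)
    thus ?case using Suc by (simp add: algebra_simps)
   qed
   moreover have "r n * (c n - c (Suc n)) = r n * (1 / real n - 1 / real (Suc n)) / (1 - x) - r n * (b n - b (Suc n))" for n
   proof -
    have "c n = (1 / real n) / (1 - x) - b n" for n by (simp add: b_def)
    hence "c n - c (Suc n) = (1 / real n - 1 / real (Suc n)) / (1 - x) - (b n - b (Suc n))"
     by (simp only: diff_divide_distrib)
    thus ?thesis by (simp only: right_diff_distrib times_divide_eq_right)
   qed
   ultimately show ?thesis by (simp only: sum_subtractf sum_divide_distrib)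
  qed
  have geo: "(%n. x ^ n) sums (1 / (1 - x))" using geometric_sums[of x] x by simp
  have c_summ: "summable (%n. \<bar>X n * c n\<bar>)"
  proof (rule summable_comparison_test)
   show "EX N. \<forall>n\<ge>N. norm \<bar>X n * c n\<bar> <= x ^ n / (1 - x)"
   proof (intro exI[of _ 1] allI impI)
    fix n :: nat assume "n >= 1"
    hence c: "0 <= c n" "c n <= x ^ n / (1 - x)" using c_bound[of n] by simp_all
    have "\<bar>X n\<bar> * c n <= 1 * c n" using c Xabs by (intro mult_right_mono)
    thus "norm \<bar>X n * c n\<bar> <= x ^ n / (1 - x)" using c by (simp add: abs_mult)
   qed
   show "summable (%n. x ^ n / (1 - x))" using sums_summable[OF geo] by (rule summable_divide)
  qed
  define F where "F = (\<Sum>n. X n * c n)"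
  have Fsums: "(%n. X n * c n) sums F"
   unfolding F_def by (rule summable_sums[OF summable_rabs_cancel[OF c_summ]])
  have c_lim: "(%N. r N * c (Suc N)) \<longlonglongrightarrow> 0"
  proof (rule Lim_null_comparison)
   show "\<forall>\<^sub>F N in sequentially. norm (r N * c (Suc N)) <= B * (x ^ Suc N / (1 - x))"
   proof (intro always_eventually allI)
    fix N
    have c: "0 <= c (Suc N)" "c (Suc N) <= x ^ Suc N / (1 - x)" using c_bound[of "Suc N"] by simp_all
    have "\<bar>r N\<bar> * c (Suc N) <= B * (x ^ Suc N / (1 - x))"
     using c rB[of N] by (intro mult_mono) (auto simp: B_def)
    thus "norm (r N * c (Suc N)) <= B * (x ^ Suc N / (1 - x))" using c by (simp add: abs_mult)
   qed
   have "(%N. x ^ N) \<longlonglongrightarrow> 0" using x by (intro LIMSEQ_power_zero) simp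
   hence "(%N. B * (x ^ Suc N / (1 - x))) \<longlonglongrightarrow> B * (0 / (1 - x))"
    using x by (intro tendsto_intros LIMSEQ_Suc) auto
   thus "(%N. B * (x ^ Suc N / (1 - x))) \<longlonglongrightarrow> 0" by simp
  qed
  have S1': "(%N. \<Sum>n<Suc N. r n * (1 / real n - 1 / real (Suc n))) \<longlonglongrightarrow> 0"
   using S1 unfolding sums_def by (rule LIMSEQ_Suc)
  have "F <= 0 / (1 - x) + B + 0"
  proof (rule LIMSEQ_le)
   show "(%N. \<Sum>n<Suc N. X n * c n) \<longlonglongrightarrow> F" using Fsums unfolding sums_def by (rule LIMSEQ_Suc)
   show "(%N. (\<Sum>n<Suc N. r n * (1 / real n - 1 / real (Suc n))) / (1 - x) + B + r N * c (Suc N)) \<longlonglongrightarrow> 0 / (1 - x) + B + 0"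
    by (intro tendsto_intros c_lim S1') (use x in auto)
   have "- (\<Sum>n<Suc N. r n * (b n - b (Suc n))) <= B" for N
   proof -
    have "\<bar>\<Sum>n<Suc N. r n * (b n - b (Suc n))\<bar> <= B * (1 - b (Suc N))"
     by (rule order_trans[OF sum_abs absum])
    moreover have "B * b (Suc N) >= 0" using b0[of "Suc N"] by (simp add: B_def)
    ultimately show ?thesis by (simp add: algebra_simps)
   qed
   thus "EX N. \<forall>n\<ge>N. (\<Sum>n<Suc n. X n * c n) <= (\<Sum>n<Suc n. r n * (1 / real n - 1 / real (Suc n))) / (1 - x) + B + r n * c (Suc n)"
    unfolding part by (intro exI[of _ 0] allI impI) (smt (verit) add_right_mono)
  qed
  hence FB: "F <= B" by simp
  let ?P = "{0::nat<..}"
  \<comment> \<open>Expanding each \<open>c n\<close> as a geometric series and collecting the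
    exponents \<open>N = n * k\<close> turns the divisor sums into the coefficients of
    \<open>x ^ N\<close>.\<close>
  define G where "G = (%(n, k). X n * x ^ (n * k))"
  have inner: "((%k. x ^ (n * k)) has_sum c n) ?P" if n: "n > 0" for n
  proof -
   have "(%k. (x ^ n) ^ k) sums (1 / (1 - x ^ n))" using xn[OF n] x by (intro geometric_sums) auto
   hence "(%k. (x ^ n) ^ Suc k) sums (1 / (1 - x ^ n) - (x ^ n) ^ 0)" unfolding sums_Suc_iff by simp
   moreover have "1 / (1 - x ^ n) - (x ^ n) ^ 0 = c n" using xn[OF n] by (simp add: c_def field_simps)
   ultimately have "(%k. (x ^ n) ^ Suc k) sums c n" by (simp only:)
   hence "((%k. (x ^ n) ^ Suc k) has_sum c n) UNIV"
    using x by (intro norm_summable_imp_has_sum) (auto simp: sums_iff)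
   also have "?this \<longleftrightarrow> ((%k. x ^ (n * k)) has_sum c n) ?P"
    by (rule has_sum_reindex_bij_witness[of _ "%k. k - 1" Suc]) (auto simp: power_mult power_add)
   finally show ?thesis .
  qed
  have c_has: "((%n. X n * c n) has_sum F) ?P"
  proof -
   have "((%n. X n * c n) has_sum F) UNIV" using c_summ Fsums by (intro norm_summable_imp_has_sum) auto
   thus ?thesis by (subst has_sum_cong_neutral[of UNIV ?P "%n. X n * c n" "%n. X n * c n"]) (auto simp: c_def)
  qed
  have "G summable_on ?P \<times> ?P"
  proof (rule Infinite_Sum.abs_summable_summable, subst Infinite_Sum.abs_summable_on_Sigma_iff, intro conjI ballI)
   fix n assume "n \<in> ?P"
   hence n: "n > 0" by simp
   have "(%k. \<bar>X n\<bar> * x ^ (n * k)) summable_on ?P"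
    by (intro summable_on_cmult_right has_sum_imp_summable[OF inner[OF n]])
   thus "(%k. norm (G (n, k))) summable_on ?P" using x by (simp add: G_def abs_mult)
  next
   have "(\<Sum>\<^sub>\<infinity>k\<in>?P. norm (G (n, k))) = \<bar>X n\<bar> * c n" if n: "n > 0" for n
    unfolding G_def using x infsumI[OF inner[OF n]] by (simp add: abs_mult infsum_cmult_right')
   moreover have "(%n. \<bar>X n * c n\<bar>) summable_on ?P"
   proof (rule summable_on_subset_banach)
    show "(%n. \<bar>X n * c n\<bar>) summable_on UNIV" using c_summ by (subst summable_on_UNIV_nonneg_real_iff) auto
   qed auto
   ultimately show "(%n. norm (\<Sum>\<^sub>\<infinity>k\<in>?P. norm (G (n, k)))) summable_on ?P"
    by (subst summable_on_cong[of _ _ "%n. \<bar>X n * c n\<bar>"]) (auto simp: abs_mult)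
  qed
  hence "(G has_sum F) (?P \<times> ?P)"
  proof (rule has_sum_SigmaI[rotated 2])
   fix n assume "n \<in> ?P"
   thus "((%k. G (n, k)) has_sum (X n * c n)) ?P"
    unfolding G_def prod.case by (intro has_sum_cmult_right inner) auto
  qed (rule c_has)
  also have "?this \<longleftrightarrow> ((%(N, d). X d * x ^ N) has_sum F) (Sigma ?P (%N. {d. d dvd N}))"
   by (rule has_sum_reindex_bij_witness[of _ "%(N, d). (d, N div d)" "%(d, k). (d * k, d)"])
    (auto simp: G_def elim!: dvdE)
  finally have "((%N. (\<Sum>d | d dvd N. X d) * x ^ N) has_sum F) ?P"
  proof (rule has_sum_SigmaD)
   fix N assume N: "N \<in> ?P"
   show "((%d. case (N, d) of (N, d) => X d * x ^ N) has_sum (\<Sum>d | d dvd N. X d) * x ^ N) {d. d dvd N}"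
    using N by (intro has_sum_finiteI) (auto simp: sum_distrib_right)
  qed
  hence "(\<Sum>N\<in>(%m. m\<^sup>2) ` {1..K}. (\<Sum>d | d dvd N. X d) * x ^ N) <= F"
  proof (rule finite_sum_le_has_sum)
   fix N assume "N \<in> ?P - (%m. m\<^sup>2) ` {1..K}"
   thus "0 <= (\<Sum>d | d dvd N. X d) * x ^ N"
    using x sum_divisors_real_char(1)[of X N, OF Xmult X1 Xv] by simp
  qed auto
  also have "(\<Sum>N\<in>(%m. m\<^sup>2) ` {1..K}. (\<Sum>d | d dvd N. X d) * x ^ N) = (\<Sum>m=1..K. (\<Sum>d | d dvd m\<^sup>2. X d) * x ^ (m\<^sup>2))"
   by (subst sum.reindex) (auto simp: inj_on_def)
  also have "(\<Sum>m=1..K. x ^ (m\<^sup>2)) <= ..."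
   using x sum_divisors_real_char(2)[of X, OF Xmult X1 Xv] by (intro sum_mono) (auto intro!: mult_right_mono[of 1, simplified])
  finally show ?thesis using FB by linarith
 qed
 define K where "K = nat \<lceil>B\<rceil> + 1"
 have lim: "((%x. \<Sum>m=1..K. x ^ (m\<^sup>2)) \<longlongrightarrow> (\<Sum>m=1..K. 1 ^ (m\<^sup>2))) (at_left (1::real))"
  by (intro tendsto_intros)
 have "\<forall>\<^sub>F x in at_left (1::real). x \<in> {0<..<1}"
  by (rule eventually_at_leftI[of 0]) auto
 hence "\<forall>\<^sub>F x in at_left (1::real). (\<Sum>m=1..K. x ^ (m\<^sup>2)) <= B"
  by eventually_elim (rule key, auto)
 hence "(\<Sum>m=1..K. 1 ^ (m\<^sup>2)) <= B"
  by (intro tendsto_upperbound[OF lim]) auto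
 thus False unfolding K_def by (simp add: B_def)
qed

end

section \<open>A zero-free region\<close>

lemma Re_gt_1_halfspace_open: "open {s::complex. Re s > a}"
 by (simp add: open_halfspace_Re_gt)

context
 fixes q :: nat and \<chi> :: "nat => complex" assumes q: "q > 1" and \<chi>: "dirichlet_char q \<chi>"
begin

text \<open>\<open>mertens_341\<close> holds prime by prime, with factor 1 at primes dividing
  \<open>q\<close>, hence for the finite products; multiplied by the respective series, these
  products tend to 1.\<close>

lemma dseries_341:
 assumes \<sigma>: "\<sigma> > 1"
 shows "1 <= norm (dseries (trivial_char q) (of_real \<sigma>)) ^ 3 * norm (dseries \<chi> (Complex \<sigma> t)) ^ 4 *
  norm (dseries (%n. \<chi> n * \<chi> n) (Complex \<sigma> (2 * t)))"
proof -
 define s0 s1 s2 where "s0 = complex_of_real \<sigma>" and "s1 = Complex \<sigma> t" and "s2 = Complex \<sigma> (2 * t)"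
 define \<psi> where "\<psi> = (%n. \<chi> n * \<chi> n)"
 define f0 f1 f2 where "f0 = (%n. trivial_char q n * npow n s0)" and "f1 = (%n. \<chi> n * npow n s1)" and "f2 = (%n. \<psi> n * npow n s2)"
 have ch: "dirichlet_char q (trivial_char q)" "dirichlet_char q \<psi>"
  using dirichlet_char_trivial[OF q] dirichlet_char_mult[OF q \<chi> \<chi>] by (auto simp: \<psi>_def)
 have lim: "(%y. dseries \<eta> s * (\<Prod>p | prime p & p <= y. 1 - \<eta> p * npow p s)) \<longlonglongrightarrow> 1"
  if "dirichlet_char q \<eta>" "Re s > 1" for \<eta> s
  unfolding dseries_def
  by (rule euler_product_tendsto)
   (use that dseries_bounded_coeff[OF dirichlet_char_norm_le[OF q that(1)] that(2)] in \<open>auto simp: dirichlet_char_def npow_mult\<close>)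
 define P0 P1 P2 where "P0 = (%y. \<Prod>p | prime p & p <= (y::nat). 1 - f0 p)" and "P1 = (%y. \<Prod>p | prime p & p <= (y::nat). 1 - f1 p)"
  and "P2 = (%y. \<Prod>p | prime p & p <= (y::nat). 1 - f2 p)"
 define D0 D1 D2 where "D0 = dseries (trivial_char q) s0" and "D1 = dseries \<chi> s1" and "D2 = dseries \<psi> s2"
 have l0: "(%y. D0 * P0 y) \<longlonglongrightarrow> 1" and l1: "(%y. D1 * P1 y) \<longlonglongrightarrow> 1" and l2: "(%y. D2 * P2 y) \<longlonglongrightarrow> 1"
  unfolding D0_def D1_def D2_def P0_def P1_def P2_def f0_def f1_def f2_def
  using lim ch \<chi> \<sigma> by (simp_all add: s0_def s1_def s2_def)
 have "(%y. norm (D0 * P0 y) ^ 3 * norm (D1 * P1 y) ^ 4 * norm (D2 * P2 y)) \<longlonglongrightarrow> norm (1::complex) ^ 3 * norm (1::complex) ^ 4 * norm (1::complex)"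
  by (intro tendsto_intros l0 l1 l2)
 hence L: "(%y. norm (D0 * P0 y) ^ 3 * norm (D1 * P1 y) ^ 4 * norm (D2 * P2 y)) \<longlonglongrightarrow> 1" by simp
 have "norm (P0 y) ^ 3 * norm (P1 y) ^ 4 * norm (P2 y) <= 1" for y
 proof -
  have "norm (P0 y) ^ 3 * norm (P1 y) ^ 4 * norm (P2 y) =
   (\<Prod>p | prime p & p <= y. norm (1 - f0 p) ^ 3 * norm (1 - f1 p) ^ 4 * norm (1 - f2 p))"
   by (simp add: P0_def P1_def P2_def prod_norm[symmetric] prod.distrib prod_power_distrib)
  also have "... <= 1"
  proof (rule prod_le_1, safe)
   fix p :: nat assume p: "prime p"
   show "norm (1 - f0 p) ^ 3 * norm (1 - f1 p) ^ 4 * norm (1 - f2 p) <= 1"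
   proof (cases "coprime p q")
    case False
    hence "\<chi> p = 0" "trivial_char q p = 0" using \<chi> by (auto simp: dirichlet_char_def trivial_char_def)
    thus ?thesis by (simp add: f0_def f1_def f2_def \<psi>_def)
   next
    case True
    define u where "u = real p powr - \<sigma>"
    define z where "z = \<chi> p * npow p (Complex 0 t)"
    have p0: "p > 1" using p by (rule prime_gt_1_nat)
    have "u < 1" unfolding u_def using p0 \<sigma> powr_less_mono[of "-\<sigma>" 0 "real p"] by simp
    have nz: "norm z = 1" using True p0 by (simp add: z_def norm_mult dirichlet_char_norm[OF q \<chi>])
    have n0: "npow p s0 = of_real u" unfolding npow_def s0_def u_def
     by (metis of_real_minus of_real_of_nat_eq of_nat_0_le_iff powr_of_real)
    have add: "npow p (a + b) = npow p a * npow p b" for a b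
     unfolding npow_def minus_add_distrib by (rule powr_add)
    have e1: "s1 = s0 + Complex 0 t" and e2: "s2 = s0 + (Complex 0 t + Complex 0 t)"
     by (simp_all add: s0_def s1_def s2_def complex_eq_iff)
    have "f0 p = of_real u" using True n0 by (simp add: f0_def trivial_char_def)
    moreover have "f1 p = of_real u * z" unfolding f1_def e1 add n0 z_def by simp
    moreover have "f2 p = of_real u * z^2" unfolding f2_def e2 add n0 z_def \<psi>_def by (simp add: power2_eq_square)
    ultimately show ?thesis using mertens_341[of u z] nz \<open>u < 1\<close> by (simp add: u_def)
   qed
  qed (auto intro!: mult_nonneg_nonneg)
  finally show ?thesis .
 qed
 hence "(norm D0 ^ 3 * norm D1 ^ 4 * norm D2) * (norm (P0 y) ^ 3 * norm (P1 y) ^ 4 * norm (P2 y)) <= (norm D0 ^ 3 * norm D1 ^ 4 * norm D2) * 1" for y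
  by (intro mult_left_mono) auto
 hence "norm (D0 * P0 y) ^ 3 * norm (D1 * P1 y) ^ 4 * norm (D2 * P2 y) <= norm D0 ^ 3 * norm D1 ^ 4 * norm D2" for y
  by (simp add: norm_mult power_mult_distrib mult_ac)
 hence "1 <= norm D0 ^ 3 * norm D1 ^ 4 * norm D2" by (intro LIMSEQ_le_const2[OF L]) auto
 thus ?thesis by (simp add: D0_def D1_def D2_def s0_def s1_def s2_def \<psi>_def)
qed

text \<open>A zero at \<open>s\<close> would make the right-hand side of the 3-4-1 inequality
  vanish.\<close>

lemma dseries_nonzero: "Re s > 1 ==> dseries \<chi> s ~= 0"
 using dseries_341[of "Re s" "Im s"] by auto

lemma Lreg_nonzero_right: "Re s > 1 ==> Lreg q \<chi> s ~= 0"
 using Lreg_eq[OF q \<chi>, of s] dseries_nonzero[of s] by (auto simp: pole_factor_def)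

end

context
 fixes q :: nat assumes q: "q > 1"
begin

lemma Lreg_bound_strip:
 assumes \<chi>: "dirichlet_char q \<chi>"
 shows "\<exists>C>0. ALL s. 1/2 <= Re s --> Re s <= 3 --> norm (Lreg q \<chi> s) <= C * (2 + \<bar>Im s\<bar>)^3"
proof -
 obtain C where C: "C > 0" "!!s. Re s >= 1/2 ==> norm (Lreg q \<chi> s) <= C * (1 + norm s)^3"
  using Lreg_bound[OF q \<chi>] by blast
 have "norm (Lreg q \<chi> s) <= C * 8 * (2 + \<bar>Im s\<bar>)^3" if s: "1/2 <= Re s" "Re s <= 3" for s
 proof -
  have "1 + norm s <= 2 * (2 + \<bar>Im s\<bar>)" using cmod_le[of s] s by simp
  hence "(1 + norm s)^3 <= (2 * (2 + \<bar>Im s\<bar>))^3" by (intro power_mono) auto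
  hence "C * (1 + norm s)^3 <= C * (2 * (2 + \<bar>Im s\<bar>))^3" using C(1) by simp
  thus ?thesis using C(2)[OF s(1)] unfolding power_mult_distrib by simp
 qed
 thus ?thesis using C(1) by (intro exI[of _ "C * 8"]) auto
qed

text \<open>Cauchy's inequality on discs of radius 1/4, which stay in the strip of
  \<open>Lreg_bound_strip\<close>.\<close>

lemma Lreg_deriv_bound:
 assumes \<chi>: "dirichlet_char q \<chi>"
 shows "\<exists>D>0. ALL s. 3/4 <= Re s --> Re s <= 2 --> norm (deriv (Lreg q \<chi>) s) <= D * (2 + \<bar>Im s\<bar>)^3"
proof -
 obtain C where C: "C > 0" "!!s. 1/2 <= Re s ==> Re s <= 3 ==> norm (Lreg q \<chi> s) <= C * (2 + \<bar>Im s\<bar>)^3"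
  using Lreg_bound_strip[OF \<chi>] by blast
 have "norm (deriv (Lreg q \<chi>) s) <= C * 32 * (2 + \<bar>Im s\<bar>)^3" if s: "3/4 <= Re s" "Re s <= 2" for s
 proof -
  have near: "\<bar>Re w - Re s\<bar> <= 1/4 & \<bar>Im w\<bar> <= \<bar>Im s\<bar> + 1/4" if "norm (s - w) <= 1/4" for w
   using that abs_Re_le_cmod[of "s - w"] abs_Im_le_cmod[of "s - w"] unfolding minus_complex.sel by linarith
  have sub: "cball s (1/4) <= {s. Re s > 0}"
  proof
   fix w assume "w \<in> cball s (1/4)"
   hence "\<bar>Re w - Re s\<bar> <= 1/4" using near[of w] by (simp add: dist_norm)
   hence "Re w > 0" using s(1) unfolding abs_le_iff by linarith
   thus "w \<in> {s. Re s > 0}" by simp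
  qed
  have "norm ((deriv ^^ 1) (Lreg q \<chi>) s) <= fact 1 * (C * 8 * (2 + \<bar>Im s\<bar>)^3) / (1/4) ^ 1"
  proof (rule Cauchy_inequality)
   show "Lreg q \<chi> holomorphic_on ball s (1/4)"
    using Lreg_holomorphic[OF q \<chi>] sub ball_subset_cball by (meson holomorphic_on_subset subset_trans)
   show "continuous_on (cball s (1/4)) (Lreg q \<chi>)"
    using Lreg_holomorphic[OF q \<chi>] sub by (meson holomorphic_on_subset holomorphic_on_imp_continuous_on)
   fix w assume w: "norm (s - w) = 1/4"
   have n: "\<bar>Re w - Re s\<bar> <= 1/4 & \<bar>Im w\<bar> <= \<bar>Im s\<bar> + 1/4" using near w by simp
   hence "1/2 <= Re w" "Re w <= 3" using s n unfolding abs_le_iff by linarith+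
   hence "norm (Lreg q \<chi> w) <= C * (2 + \<bar>Im w\<bar>)^3" by (rule C(2))
   also have "... <= C * (2 * (2 + \<bar>Im s\<bar>))^3" using C(1) n by (intro mult_left_mono power_mono) auto
   finally show "norm (Lreg q \<chi> w) <= C * 8 * (2 + \<bar>Im s\<bar>)^3" unfolding power_mult_distrib by simp
  qed simp
  thus ?thesis by simp
 qed
 thus ?thesis using C(1) by (intro exI[of _ "C * 32"]) auto
qed

lemma Lreg_trivial_1: "Lreg q (trivial_char q) 1 ~= 0"
 using q zeta1_1 by (simp add: Lreg_def pole_factor_def char_density_def)

text \<open>Three cases. For the trivial character the value is a nonzero multiple of
  \<open>zeta1 1\<close>; nontrivial real characters are \<open>Lreg_real_nonzero\<close>; otherwise
  the square of \<open>\<chi>\<close> is nontrivial too, and at \<open>t = 0\<close> the 3-4-1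
  inequality would set a triple pole against a fourfold zero, with the third factor bounded.\<close>

lemma Lreg_1_nonzero:
 assumes \<chi>: "dirichlet_char q \<chi>"
 shows "Lreg q \<chi> 1 ~= 0"
proof (cases "\<chi> = trivial_char q")
 case True
 thus ?thesis using Lreg_trivial_1 by simp
next
 case nt: False
 define \<psi> where "\<psi> = (%n. \<chi> n * \<chi> n)"
 have \<psi>: "dirichlet_char q \<psi>" unfolding \<psi>_def by (rule dirichlet_char_mult[OF q \<chi> \<chi>])
 have \<chi>0: "dirichlet_char q (trivial_char q)" by (rule dirichlet_char_trivial[OF q])
 show ?thesis
 proof (cases "\<psi> = trivial_char q")
  case True
  thus ?thesis using Lreg_real_nonzero[OF q \<chi> nt] by (simp add: \<psi>_def fun_eq_iff)
 next
  case False
  show ?thesis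
  proof
   assume L0: "Lreg q \<chi> 1 = 0"
   obtain C0 where C0: "C0 > 0" "!!s. 1/2 <= Re s ==> Re s <= 3 ==> norm (Lreg q (trivial_char q) s) <= C0 * (2 + \<bar>Im s\<bar>)^3"
    using Lreg_bound_strip[OF \<chi>0] by blast
   obtain C2 where C2: "C2 > 0" "!!s. 1/2 <= Re s ==> Re s <= 3 ==> norm (Lreg q \<psi> s) <= C2 * (2 + \<bar>Im s\<bar>)^3"
    using Lreg_bound_strip[OF \<psi>] by blast
   obtain D where D: "D > 0" "!!s. 3/4 <= Re s ==> Re s <= 2 ==> norm (deriv (Lreg q \<chi>) s) <= D * (2 + \<bar>Im s\<bar>)^3"
    using Lreg_deriv_bound[OF \<chi>] by blast
   define K where "K = (8 * C0)^3 * (8 * D)^4 * (8 * C2)"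
   have K0: "K > 0" using C0(1) C2(1) D(1) by (simp add: K_def)
   have key: "1 <= K * \<delta>" if \<delta>: "0 < \<delta>" "\<delta> <= 1" for \<delta>
   proof -
    define s where "s = complex_of_real (1 + \<delta>)"
    have s: "Re s = 1 + \<delta>" "Im s = 0" by (simp_all add: s_def)
    have "norm (Lreg q \<chi> s - Lreg q \<chi> 1) <= (8 * D) * norm (s - 1)"
    proof (rule field_differentiable_bound[of "closed_segment 1 s"])
     fix z assume z: "z \<in> closed_segment 1 s"
     then obtain v where v: "0 <= v" "v <= 1" "z = (1 - v) *\<^sub>R 1 + v *\<^sub>R s" by (auto simp: in_segment)
     have zz: "Re z = 1 + v * \<delta>" "Im z = 0" unfolding v(3) using s by (simp_all add: algebra_simps)
     have "v * \<delta> <= 1" using v \<delta> by (simp add: mult_le_one)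
     moreover have "v * \<delta> >= 0" using v \<delta> by simp
     ultimately have re: "3/4 <= Re z" "Re z <= 2" using zz by auto
     have "z \<in> {s. Re s > 0}" using re by simp
     thus "(Lreg q \<chi> has_field_derivative deriv (Lreg q \<chi>) z) (at z within closed_segment 1 s)"
      using holomorphic_derivI[OF Lreg_holomorphic[OF q \<chi>] Re_gt_1_halfspace_open] by blast
     show "norm (deriv (Lreg q \<chi>) z) <= 8 * D" using D(2)[OF re] zz by simp
    qed auto
    hence L1: "norm (Lreg q \<chi> s) <= 8 * D * \<delta>" using L0 \<delta> by (simp add: s_def)
    have Re1: "Re s > 1" using s \<delta> by simp
    have d1: "dseries \<chi> s = Lreg q \<chi> s" using Lreg_eq[OF q \<chi> Re1] nt by (simp add: pole_factor_def)
    have d2: "dseries \<psi> s = Lreg q \<psi> s" using Lreg_eq[OF q \<psi> Re1] False by (simp add: pole_factor_def)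
    have "Lreg q (trivial_char q) s = (s - 1) * dseries (trivial_char q) s" using Lreg_eq[OF q \<chi>0 Re1] by (simp add: pole_factor_def)
    hence "norm (Lreg q (trivial_char q) s) = \<delta> * norm (dseries (trivial_char q) s)" using \<delta> by (simp add: s_def norm_mult)
    moreover have "norm (Lreg q (trivial_char q) s) <= 8 * C0" using C0(2)[of s] s \<delta> by simp
    ultimately have d0: "norm (dseries (trivial_char q) s) <= 8 * C0 / \<delta>" using \<delta> by (simp add: field_simps)
    have n2: "norm (dseries \<psi> s) <= 8 * C2" unfolding d2 using C2(2)[of s] s \<delta> by simp
    have "Complex (1 + \<delta>) 0 = s" by (simp add: s_def complex_eq_iff)
    hence "1 <= norm (dseries (trivial_char q) s) ^ 3 * norm (dseries \<chi> s) ^ 4 * norm (dseries \<psi> s)"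
     using dseries_341[OF q \<chi>, of "1 + \<delta>" 0] \<delta> by (simp add: \<psi>_def s_def)
    also have "... <= (8 * C0 / \<delta>) ^ 3 * (8 * D * \<delta>) ^ 4 * (8 * C2)"
     using d0 L1 n2 \<delta> C0(1) D(1) unfolding d1 by (intro mult_mono power_mono) auto
    also have "... = K * \<delta>" using \<delta> by (simp add: K_def power_mult_distrib power_divide field_simps eval_nat_numeral)
    finally show ?thesis .
   qed
   define \<delta> where "\<delta> = min 1 (1 / (2 * K))"
   have "0 < \<delta>" "\<delta> <= 1" "K * \<delta> <= 1/2" using K0 by (auto simp: \<delta>_def min_def field_simps)
   with key[of \<delta>] show False by simp
  qed
 qed
qed

text \<open>Let \<open>\<tau> = 2 + \<bar>Im s\<bar>\<close>. At distance \<open>\<delta>\<close> to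
  the right of 1 the 3-4-1 inequality makes the fourth power of the norm at least of order
  \<open>\<delta>^3 / \<tau>^3\<close>, and the derivative bound \<open>D * \<tau>^3\<close> carries
  this across the line. With \<open>\<delta> = \<kappa> / \<tau>^15\<close> the lower bound has
  order \<open>\<tau>\<close> to the power -48/4 and the loss has order \<open>\<tau>\<close> to the
  power 3 - 15. Both exponents are -12, which is the origin of 15.\<close>

lemma Lreg_lower_bound:
 assumes \<chi>: "dirichlet_char q \<chi>"
 shows "\<exists>\<kappa>>0. \<exists>c>0. \<kappa> <= 1/4 & (ALL s. \<bar>Re s - 1\<bar> <= \<kappa> / (2 + \<bar>Im s\<bar>)^15 --> norm (Lreg q \<chi> s) >= c / (2 + \<bar>Im s\<bar>)^12)"
proof -
 define \<psi> where "\<psi> = (%n. \<chi> n * \<chi> n)"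
 have \<psi>: "dirichlet_char q \<psi>" unfolding \<psi>_def by (rule dirichlet_char_mult[OF q \<chi> \<chi>])
 have \<chi>0: "dirichlet_char q (trivial_char q)" by (rule dirichlet_char_trivial[OF q])
 obtain C0 where C0: "C0 > 0" "!!s. 1/2 <= Re s ==> Re s <= 3 ==> norm (Lreg q (trivial_char q) s) <= C0 * (2 + \<bar>Im s\<bar>)^3"
  using Lreg_bound_strip[OF \<chi>0] by blast
 obtain C2 where C2: "C2 > 0" "!!s. 1/2 <= Re s ==> Re s <= 3 ==> norm (Lreg q \<psi> s) <= C2 * (2 + \<bar>Im s\<bar>)^3"
  using Lreg_bound_strip[OF \<psi>] by blast
 obtain D where D: "D > 0" "!!s. 3/4 <= Re s ==> Re s <= 2 ==> norm (deriv (Lreg q \<chi>) s) <= D * (2 + \<bar>Im s\<bar>)^3"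
  using Lreg_deriv_bound[OF \<chi>] by blast
 define c1 where "c1 = norm (Lreg q \<chi> 1) / 2"
 have c1: "c1 > 0" using Lreg_1_nonzero[OF \<chi>] by (simp add: c1_def)
 have "isCont (Lreg q \<chi>) 1"
  using holomorphic_on_imp_continuous_on[OF Lreg_holomorphic[OF q \<chi>]] Re_gt_1_halfspace_open[of 0]
  by (auto simp: continuous_on_eq_continuous_at)
 then obtain d where d: "d > 0" "!!s. dist s 1 < d ==> dist (Lreg q \<chi> s) (Lreg q \<chi> 1) < c1"
  unfolding continuous_at_eps_delta using c1 by (metis)
 \<comment> \<open>Near the point 1 continuity is used instead: for small \<open>t\<close> the
   factor \<open>pole_factor\<close> of a trivial \<open>\<psi>\<close> has no useful lower
   bound.\<close>
 define t0 where "t0 = min (1/4) (d / 4)"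
 have t0: "0 < t0" "t0 <= 1/4" "t0 <= d/4" using d(1) by (auto simp: t0_def)
 have near1: "norm (Lreg q \<chi> s) >= c1" if "\<bar>Re s - 1\<bar> <= t0" "\<bar>Im s\<bar> <= t0" for s
 proof -
  have "norm (s - 1) <= \<bar>Re s - 1\<bar> + \<bar>Im s\<bar>" using cmod_le[of "s - 1"] by simp
  hence "dist s 1 < d" using that t0 by (simp add: dist_norm)
  hence "norm (Lreg q \<chi> s - Lreg q \<chi> 1) < c1" using d(2) by (simp add: dist_norm)
  thus ?thesis using norm_triangle_ineq2[of "Lreg q \<chi> 1" "Lreg q \<chi> s"] by (simp add: c1_def norm_minus_commute)
 qed
 define c0 where "c0 = 2 * t0 ^ 5 / ((8 * C0)^3 * (8 * C2))"
 have c0: "c0 > 0" using t0 C0(1) C2(1) by (simp add: c0_def)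
 have right: "norm (Lreg q \<chi> (Complex \<sigma> t)) ^ 4 >= c0 * (\<sigma> - 1)^3 / (2 + \<bar>t\<bar>)^3"
  if \<sigma>: "1 < \<sigma>" "\<sigma> <= 2" and t: "\<bar>t\<bar> >= t0" for \<sigma> t
 proof -
  define \<tau> where "\<tau> = 2 + \<bar>t\<bar>"
  have \<tau>: "\<tau> > 0" by (simp add: \<tau>_def)
  let ?d0 = "norm (dseries (trivial_char q) (of_real \<sigma>))" and ?d1 = "norm (dseries \<chi> (Complex \<sigma> t))"
   and ?d2 = "norm (dseries \<psi> (Complex \<sigma> (2 * t)))"
  have one: "1 <= ?d0 ^ 3 * ?d1 ^ 4 * ?d2" using dseries_341[OF q \<chi> \<sigma>(1), of t] by (simp add: \<psi>_def)
  have "Lreg q (trivial_char q) (of_real \<sigma>) = (of_real \<sigma> - 1) * dseries (trivial_char q) (of_real \<sigma>)"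
   using Lreg_eq[OF q \<chi>0, of "of_real \<sigma>"] \<sigma> by (simp add: pole_factor_def)
  hence "norm (Lreg q (trivial_char q) (of_real \<sigma>)) = (\<sigma> - 1) * ?d0"
   using \<sigma> by (metis norm_mult norm_of_real of_real_1 of_real_diff abs_of_pos diff_gt_0_iff_gt)
  moreover have "norm (Lreg q (trivial_char q) (of_real \<sigma>)) <= 8 * C0" using C0(2)[of "of_real \<sigma>"] \<sigma> by simp
  ultimately have d0: "?d0 <= 8 * C0 / (\<sigma> - 1)" using \<sigma> by (simp add: field_simps)
  have pf: "norm (pole_factor q \<eta> (Complex \<sigma> u)) >= min 1 \<bar>u\<bar>" for \<eta> u
   using abs_Im_le_cmod[of "Complex \<sigma> u - 1"] by (auto simp: pole_factor_def)
  have "2 * t0 <= min 1 \<bar>2 * t\<bar>" using t t0 by simp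
  hence "2 * t0 * ?d2 <= norm (pole_factor q \<psi> (Complex \<sigma> (2 * t))) * ?d2"
   using pf[of "2 * t" \<psi>] by (intro mult_right_mono) auto
  also have "... = norm (Lreg q \<psi> (Complex \<sigma> (2 * t)))"
   using Lreg_eq[OF q \<psi>, of "Complex \<sigma> (2 * t)"] \<sigma> by (simp add: norm_mult)
  also have "... <= C2 * (2 + \<bar>2 * t\<bar>)^3" using C2(2)[of "Complex \<sigma> (2 * t)"] \<sigma> by simp
  also have "... <= C2 * (2 * \<tau>)^3" using C2(1) by (intro mult_left_mono power_mono) (auto simp: \<tau>_def)
  finally have d2: "?d2 <= 8 * C2 * \<tau>^3 / (2 * t0)" using t0 by (simp add: field_simps power_mult_distrib)
  have "t0 <= min 1 \<bar>t\<bar>" using t t0 by simp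
  hence "t0 * ?d1 <= norm (pole_factor q \<chi> (Complex \<sigma> t)) * ?d1"
   using pf[of t \<chi>] by (intro mult_right_mono) auto
  also have "... = norm (Lreg q \<chi> (Complex \<sigma> t))"
   using Lreg_eq[OF q \<chi>, of "Complex \<sigma> t"] \<sigma> by (simp add: norm_mult)
  finally have L1: "t0 * ?d1 <= norm (Lreg q \<chi> (Complex \<sigma> t))" .
  have "1 <= (8 * C0 / (\<sigma> - 1)) ^ 3 * ?d1 ^ 4 * (8 * C2 * \<tau>^3 / (2 * t0))"
  proof (rule order_trans[OF one], intro mult_mono power_mono)
   show "?d0 <= 8 * C0 / (\<sigma> - 1)" by (fact d0)
   show "?d2 <= 8 * C2 * \<tau>^3 / (2 * t0)" by (fact d2)
  qed (use C0(1) C2(1) \<sigma> in auto)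
  define Q where "Q = (8 * C0)^3 * (8 * C2) / (2 * t0)"
  have Q: "Q > 0" using C0(1) C2(1) t0 by (simp add: Q_def)
  have "(8 * C0 / (\<sigma> - 1)) ^ 3 * ?d1 ^ 4 * (8 * C2 * \<tau>^3 / (2 * t0)) = Q * ?d1 ^ 4 * \<tau>^3 / (\<sigma> - 1)^3"
   by (simp add: Q_def power_divide mult_ac)
  with \<open>1 <= (8 * C0 / (\<sigma> - 1)) ^ 3 * ?d1 ^ 4 * (8 * C2 * \<tau>^3 / (2 * t0))\<close>
  have "1 <= Q * ?d1 ^ 4 * \<tau>^3 / (\<sigma> - 1)^3" by simp
  hence "(\<sigma> - 1)^3 / \<tau>^3 <= Q * ?d1 ^ 4" using \<sigma> \<tau> by (simp add: field_simps)
  hence "c0 * ((\<sigma> - 1)^3 / \<tau>^3) <= c0 * (Q * ?d1 ^ 4)" using c0 by (intro mult_left_mono) auto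
  also have "c0 * (Q * ?d1 ^ 4) = t0 ^ 4 * ?d1 ^ 4"
   using C0(1) C2(1) t0 by (simp add: c0_def Q_def eval_nat_numeral)
  finally have "c0 * (\<sigma> - 1)^3 / \<tau>^3 <= t0 ^ 4 * ?d1 ^ 4" by simp
  also have "... = (t0 * ?d1) ^ 4" by (simp add: power_mult_distrib)
  also have "... <= norm (Lreg q \<chi> (Complex \<sigma> t)) ^ 4" using L1 t0 by (intro power_mono) auto
  finally show ?thesis by (simp add: \<tau>_def)
 qed
 \<comment> \<open>The second term guarantees \<open>4 * D * \<kappa> / \<tau>^12\<close> as a lower
   bound to the right of 1, twice the loss \<open>2 * D * \<kappa> / \<tau>^12\<close> of the shift
   to \<open>s\<close>.\<close>
 define \<kappa> where "\<kappa> = min t0 (c0 / (4 * D)^4)"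
 have \<kappa>: "\<kappa> > 0" "\<kappa> <= t0" "\<kappa> <= c0 / (4 * D)^4" using t0 c0 D(1) by (auto simp: \<kappa>_def)
 define c where "c = min c1 (2 * D * \<kappa>)"
 have c: "c > 0" "c <= c1" "c <= 2 * D * \<kappa>" using c1 D(1) \<kappa> by (auto simp: c_def)
 have "norm (Lreg q \<chi> s) >= c / (2 + \<bar>Im s\<bar>)^12" if s: "\<bar>Re s - 1\<bar> <= \<kappa> / (2 + \<bar>Im s\<bar>)^15" for s
 proof -
  define \<tau> where "\<tau> = 2 + \<bar>Im s\<bar>"
  have \<tau>: "\<tau> >= 2" by (simp add: \<tau>_def)
  define \<delta> where "\<delta> = \<kappa> / \<tau>^15"
  have p1: "1 <= \<tau>^k" for k using \<tau> by (intro one_le_power) simp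
  have \<delta>: "0 < \<delta>" "\<delta> <= \<kappa>" using \<kappa> \<tau> divide_left_mono[of 1 "\<tau>^15" \<kappa>] p1[of 15] by (auto simp: \<delta>_def)
  have s': "\<bar>Re s - 1\<bar> <= \<delta>" using s by (simp add: \<delta>_def \<tau>_def)
  show ?thesis
  proof (cases "\<bar>Im s\<bar> <= t0")
   case True
   have "c1 <= norm (Lreg q \<chi> s)" using s' \<delta> \<kappa> True by (intro near1) auto
   moreover have "c / \<tau>^12 <= c / 1" using c \<tau> p1[of 12] by (intro divide_left_mono) auto
   hence "c / \<tau>^12 <= c1" using c by simp
   ultimately show ?thesis by (simp add: \<tau>_def)
  next
   case False
   define w where "w = Complex (1 + \<delta>) (Im s)"
   have "norm (Lreg q \<chi> w) ^ 4 >= c0 * (1 + \<delta> - 1)^3 / \<tau>^3"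
    unfolding w_def \<tau>_def using \<delta> \<kappa> t0 False by (intro right) auto
   moreover have "(4 * D * \<kappa> / \<tau>^12) ^ 4 <= c0 * (1 + \<delta> - 1)^3 / \<tau>^3"
   proof -
    have "(4 * D)^4 * \<kappa> <= c0" using \<kappa>(3) D(1) by (simp add: field_simps)
    hence "((4 * D)^4 * \<kappa>) * (\<kappa>^3 / \<tau>^48) <= c0 * (\<kappa>^3 / \<tau>^48)" using \<kappa> \<tau> by (intro mult_right_mono) auto
    moreover have "(4 * D * \<kappa> / \<tau>^12) ^ 4 = ((4 * D)^4 * \<kappa>) * (\<kappa>^3 / \<tau>^48)"
    proof -
     have "\<kappa>^4 = \<kappa> * \<kappa>^3" by (simp add: eval_nat_numeral)
     thus ?thesis by (simp add: power_divide power_mult_distrib flip: power_mult)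
    qed
    moreover have "c0 * (1 + \<delta> - 1)^3 / \<tau>^3 = c0 * (\<kappa>^3 / \<tau>^48)"
     by (simp add: \<delta>_def power_divide flip: power_mult power_add)
    ultimately show ?thesis by simp
   qed
   ultimately have "(4 * D * \<kappa> / \<tau>^12) ^ 4 <= norm (Lreg q \<chi> w) ^ 4" by linarith
   hence Lw: "4 * D * \<kappa> / \<tau>^12 <= norm (Lreg q \<chi> w)" by (rule power_le_imp_le_base[where n = 3, simplified]) auto
   have "norm (Lreg q \<chi> w - Lreg q \<chi> s) <= (D * \<tau>^3) * norm (w - s)"
   proof (rule field_differentiable_bound[of "closed_segment w s"])
    fix z assume z: "z \<in> closed_segment w s"
    then obtain v where v: "0 <= v" "v <= 1" "z = (1 - v) *\<^sub>R w + v *\<^sub>R s" by (auto simp: in_segment)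
    have im: "Im z = Im s" unfolding v(3) by (simp add: w_def algebra_simps)
    have "Re z - 1 = (1 - v) * \<delta> + v * (Re s - 1)" unfolding v(3) by (simp add: w_def algebra_simps)
    hence "\<bar>Re z - 1\<bar> <= (1 - v) * \<delta> + v * \<delta>"
    proof -
     have "v * \<bar>Re s - 1\<bar> <= v * \<delta>" using v s' by (intro mult_left_mono)
     moreover have "\<bar>(1 - v) * \<delta> + v * (Re s - 1)\<bar> <= \<bar>(1 - v) * \<delta>\<bar> + \<bar>v * (Re s - 1)\<bar>" by (rule abs_triangle_ineq)
     ultimately show ?thesis using v \<delta> \<open>Re z - 1 = _\<close> by (simp add: abs_mult)
    qed
    hence "\<bar>Re z - 1\<bar> <= 1/4" using \<delta> \<kappa> t0 by (simp add: algebra_simps)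
    hence re: "3/4 <= Re z" "Re z <= 2" unfolding abs_le_iff by linarith+
    have "z \<in> {s. Re s > 0}" using re by simp
    thus "(Lreg q \<chi> has_field_derivative deriv (Lreg q \<chi>) z) (at z within closed_segment w s)"
     using holomorphic_derivI[OF Lreg_holomorphic[OF q \<chi>] Re_gt_1_halfspace_open] by blast
    show "norm (deriv (Lreg q \<chi>) z) <= D * \<tau>^3" using D(2)[OF re] im by (simp add: \<tau>_def)
   qed auto
   also have "norm (w - s) <= 2 * \<delta>"
   proof -
    have "w - s = of_real (1 + \<delta> - Re s)" by (simp add: w_def complex_eq_iff)
    thus ?thesis using s' by (simp only: norm_of_real)
   qed
   also have "(D * \<tau>^3) * (2 * \<delta>) = 2 * D * \<kappa> / \<tau>^12"
    using \<tau> by (simp add: \<delta>_def field_simps flip: power_add)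
   finally have "norm (Lreg q \<chi> w - Lreg q \<chi> s) <= 2 * D * \<kappa> / \<tau>^12" using D(1) \<tau> by (simp add: mult_left_mono)
   hence "norm (Lreg q \<chi> s) >= 2 * D * \<kappa> / \<tau>^12"
   proof -
    have "4 * D * \<kappa> / \<tau>^12 = 2 * (2 * D * \<kappa> / \<tau>^12)" by simp
    thus ?thesis
     using \<open>norm (Lreg q \<chi> w - Lreg q \<chi> s) <= 2 * D * \<kappa> / \<tau>^12\<close> Lw
      norm_triangle_ineq2[of "Lreg q \<chi> w" "Lreg q \<chi> s"] by linarith
   qed
   moreover have "c / \<tau>^12 <= 2 * D * \<kappa> / \<tau>^12" using c \<tau> by (intro divide_right_mono) auto
   ultimately show ?thesis by (simp add: \<tau>_def)
  qed
 qed
 thus ?thesis using \<kappa> c t0 by (intro exI[of _ \<kappa>] conjI exI[of _ c]) auto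
qed

end

section \<open>Newman's contour argument\<close>

text \<open>On the circle \<open>R^2 = z * cnj z\<close>, so the kernel divided by \<open>z\<close>
  becomes \<open>(z + cnj z) / R^2\<close>.\<close>

lemma newman_kernel_on_circle:
 assumes z: "norm z = R" and R: "R > 0"
 shows "norm ((1 + z^2 / of_real (R^2)) / z) = 2 * \<bar>Re z\<bar> / R^2"
proof -
 have "z ~= 0" using z R by auto
 have "of_real (R^2) = z * cnj z" using z by (simp add: complex_norm_square[symmetric])
 hence "(1 + z^2 / of_real (R^2)) / z = (z + cnj z) / of_real (R^2)"
  using \<open>z ~= 0\<close> by (simp add: field_simps power2_eq_square)
 also have "z + cnj z = of_real (2 * Re z)" by (simp add: complex_eq_iff)
 finally show ?thesis using R by (simp add: norm_divide norm_mult norm_power)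
qed

text \<open>Cauchy's formula with the circle cut at the imaginary axis, because the halves are
  estimated by different means. \<open>F z / z\<close> is split into a function that is holomorphic
  at 0, whose integral over the whole circle vanishes, and \<open>F 0 / z\<close>, which contributes
  \<open>pi * \<i> * F 0\<close> on each half.\<close>

lemma circle_arcs_integral:
 fixes F :: "complex => complex"
 assumes hol: "F holomorphic_on UNIV" and R: "R > 0"
 shows "EX I1 I2. ((%z. F z / z) has_contour_integral I1) (part_circlepath 0 R (-pi/2) (pi/2)) &
  ((%z. F z / z) has_contour_integral I2) (part_circlepath 0 R (pi/2) (3/2*pi)) & I1 + I2 = 2 * of_real pi * \<i> * F 0"
proof -
 define F1 where "F1 = (%z. if z = 0 then deriv F 0 else (F z - F 0) / (z - 0))"
 have F1: "F1 holomorphic_on UNIV" unfolding F1_def by (rule pole_lemma_open) (use hol in auto)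
 let ?A = "part_circlepath 0 R (-pi/2) (pi/2)" and ?B = "part_circlepath 0 R (pi/2) (3/2*pi)"
 have const: "((%z. F 0 / z) has_contour_integral F 0 * \<i> * of_real (b - a)) (part_circlepath 0 R a b)" if "a < b" for a b
 proof -
  have "((%t. F 0 * \<i>) has_integral (b - a) *\<^sub>R (F 0 * \<i>)) {a..b}"
   using has_integral_const_real[of "F 0 * \<i>" a b] that by simp
  hence "((%t. F 0 * \<i>) has_integral F 0 * \<i> * of_real (b - a)) {a..b}"
   by (simp add: scaleR_conv_of_real mult_ac)
  thus ?thesis
   unfolding has_contour_integral_part_circlepath_iff[OF that] using R by (simp add: field_simps)
 qed
 obtain J1 where J1: "(F1 has_contour_integral J1) ?A"
  using contour_integrable_holomorphic_simple[OF F1 open_UNIV, of ?A] by (auto simp: contour_integrable_on_def)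
 obtain J2 where J2: "(F1 has_contour_integral J2) ?B"
  using contour_integrable_holomorphic_simple[OF F1 open_UNIV, of ?B] by (auto simp: contour_integrable_on_def)
 have ends: "pathfinish ?A = pathstart ?B" "pathfinish ?B = pathstart ?A"
  using cos_3over2_pi sin_3over2_pi by (auto simp: exp_eq_polar cis.ctr complex_eq_iff)
 have "(F1 has_contour_integral 0) (?A +++ ?B)"
  using F1 ends by (intro Cauchy_theorem_convex_simple[of _ UNIV] valid_path_join) auto
 moreover have "(F1 has_contour_integral (J1 + J2)) (?A +++ ?B)"
  using J1 J2 by (intro has_contour_integral_join) auto
 ultimately have J: "J1 + J2 = 0" using has_contour_integral_unique by blast
 have eq: "F1 z + F 0 / z = F z / z" if "z \<in> path_image (part_circlepath 0 R a b)" for z a b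
 proof -
  have "norm z = R" using that R by (auto simp: path_image_def part_circlepath_def norm_mult)
  hence "z ~= 0" using R by auto
  thus ?thesis by (simp add: F1_def diff_divide_distrib)
 qed
 have "((%z. F z / z) has_contour_integral (J1 + F 0 * \<i> * of_real (pi/2 - (-pi/2)))) ?A"
  by (rule has_contour_integral_eq[OF has_contour_integral_add[OF J1 const]]) (use eq in auto)
 moreover have "((%z. F z / z) has_contour_integral (J2 + F 0 * \<i> * of_real (3/2*pi - pi/2))) ?B"
  by (rule has_contour_integral_eq[OF has_contour_integral_add[OF J2 const]]) (use eq in auto)
 moreover have "(J1 + F 0 * \<i> * of_real (pi/2 - (-pi/2))) + (J2 + F 0 * \<i> * of_real (3/2*pi - pi/2)) = 2 * of_real pi * \<i> * F 0"
 proof -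
  have "pi/2 - (-pi/2) = pi" "3/2*pi - pi/2 = pi" by simp_all
  thus ?thesis using J by (simp add: algebra_simps)
 qed
 ultimately show ?thesis by blast
qed

lemma mult_exp_neg_le:
 fixes y :: real assumes "y >= 0" shows "y * exp (- y) <= 1"
proof -
 have "y <= exp y" using exp_ge_add_one_self[of y] by linarith
 thus ?thesis by (simp add: exp_minus field_simps)
qed

text \<open>Newman's contour argument with explicit constants. The kernel \<open>1 + z\<^sup>2 / R\<^sup>2\<close> makes the
 integrand on the circle as small as \<open>Re z\<close>, which compensates the \<open>1 / Re z\<close> in the bounds of the
 partial sum and of the tail. On the left the limit function is only integrated along a box of
 depth \<open>\<delta>\<close>.\<close>

lemma newman_bound:
 fixes S g :: "complex => complex" and Y R \<delta> B K :: real
 assumes R: "R > 0" and \<delta>: "0 < \<delta>" "\<delta> <= R" and Y: "Y >= 3" and K: "K >= 0"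
  and hS: "S holomorphic_on UNIV"
  and hg: "g holomorphic_on {z. Re z > -2 * \<delta> & \<bar>Im z\<bar> < 2 * R}"
  and Sleft: "!!z. Re z < 0 ==> norm (S z) <= K * Y powr (- Re z) / \<bar>Re z\<bar>"
  and right: "!!z. Re z > 0 ==> norm (S z - g z) <= K * Y powr (- Re z) / Re z"
  and gB: "!!z. -\<delta> <= Re z ==> Re z <= 0 ==> \<bar>Im z\<bar> <= R ==> norm (g z) <= B"
 shows "norm (S 0 - g 0) <= (2 * K + norm (g 0)) / R + 2 * B * \<delta>^2 / R^2 + 2 * B * R * Y powr (-\<delta>) / \<delta>"
proof -
 define U where "U = {z. Re z > -2 * \<delta> & \<bar>Im z\<bar> < 2 * R}"
 have Ueq: "U = {z. Re z > -2 * \<delta>} \<inter> {z. Im z < 2 * R} \<inter> {z. Im z > - 2 * R}"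
  by (auto simp: U_def abs_less_iff)
 have Uo: "open U" and Uc: "convex U" unfolding Ueq
  by (auto intro!: open_Int convex_Int open_halfspace_Re_gt open_halfspace_Im_gt open_halfspace_Im_lt
    convex_halfspace_Re_gt convex_halfspace_Im_gt convex_halfspace_Im_lt)
 define E where "E = (%z::complex. exp (z * of_real (ln Y)) * (1 + z^2 / of_real (R^2)))"
 have nE: "norm (exp (z * of_real (ln Y))) = Y powr Re z" for z
  using Y by (simp add: powr_def mult.commute)
 have hE: "E holomorphic_on A" for A unfolding E_def by (intro holomorphic_intros) (use R in auto)
 have E0: "E 0 = 1" by (simp add: E_def)
 have Ecirc: "norm (E z / z) = Y powr Re z * (2 * \<bar>Re z\<bar> / R^2)" if "norm z = R" for z
 proof -
  have "E z / z = exp (z * of_real (ln Y)) * ((1 + z^2 / of_real (R^2)) / z)" by (simp add: E_def)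
  thus ?thesis by (simp only: norm_mult nE newman_kernel_on_circle[OF that R])
 qed
 let ?A = "part_circlepath 0 R (-pi/2) (pi/2)" and ?B = "part_circlepath 0 R (pi/2) (3/2*pi)"
 \<comment> \<open>Subtracting \<open>g 0\<close> removes the pole of \<open>g z / z\<close> at 0;
   the whole residue \<open>S 0 - g 0\<close> then sits in the entire function
   \<open>F\<close>.\<close>
 define F where "F = (%z. (S z - g 0) * E z)"
 have "F holomorphic_on UNIV" unfolding F_def by (intro holomorphic_intros hS hE)
 from circle_arcs_integral[OF this R] obtain I1 I2 where
  I: "((%z. F z / z) has_contour_integral I1) ?A" "((%z. F z / z) has_contour_integral I2) ?B"
   "I1 + I2 = 2 * of_real pi * \<i> * F 0" by blast
 define g1 where "g1 = (%z. if z = 0 then deriv g 0 else (g z - g 0) / (z - 0))"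
 have hg1: "g1 holomorphic_on U" unfolding g1_def
  by (rule pole_lemma_open[OF hg[folded U_def] Uo])
 define h where "h = (%z. g1 z * E z)"
 have hh: "h holomorphic_on U" unfolding h_def by (intro holomorphic_intros hg1 hE)
 define p where "p = Complex 0 R"
 define c1 where "c1 = Complex (-\<delta>) R"
 define c2 where "c2 = Complex (-\<delta>) (-R)"
 define m where "m = Complex 0 (-R)"
 have circ: "norm z = R" if "z \<in> path_image (part_circlepath 0 R a b)" for z a b
  using that R by (auto simp: path_image_def part_circlepath_def norm_mult)
 have Are: "Re z >= 0" if z: "z \<in> path_image ?A" for z
 proof -
  have le: "-pi/2 <= pi/2" by simp
  obtain t where t: "-pi/2 <= t" "t <= pi/2" "z = of_real R * exp (\<i> * of_real t)"
   using z[unfolded path_image_part_circlepath[OF le]] by auto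
  hence "Re z = R * cos t" by (simp add: exp_eq_polar)
  thus ?thesis using cos_ge_zero[of t] t R by simp
 qed
 have Bre: "Re z <= 0" if z: "z \<in> path_image ?B" for z
 proof -
  have le: "pi/2 <= 3/2*pi" by simp
  obtain t where t: "pi/2 <= t" "t <= 3/2*pi" "z = of_real R * exp (\<i> * of_real t)"
   using z[unfolded path_image_part_circlepath[OF le]] by auto
  hence "Re z = R * cos t" by (simp add: exp_eq_polar)
  moreover have "cos (t - pi) >= 0" using t by (intro cos_ge_zero) auto
  hence "cos t <= 0" by (simp add: cos_diff)
  ultimately show ?thesis using R by (simp add: mult_nonneg_nonpos)
 qed
 have AU: "path_image ?A <= U"
 proof
  fix z assume z: "z \<in> path_image ?A"
  thus "z \<in> U" using Are[OF z] circ[OF z] abs_Im_le_cmod[of z] R \<delta> by (simp add: U_def)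
 qed
 have pU: "p \<in> U" "c1 \<in> U" "c2 \<in> U" "m \<in> U" using R \<delta> by (auto simp: U_def p_def c1_def c2_def m_def)
 have seg: "closed_segment a b <= U" if "a \<in> U" "b \<in> U" for a b
  using that Uc by (simp add: closed_segment_subset)
 have ends: "pathstart ?A = m" "pathfinish ?A = p"
  by (auto simp: exp_eq_polar m_def p_def complex_eq_iff cos_minus sin_minus)
 obtain G0 where G0: "(h has_contour_integral G0) ?A"
  using contour_integrable_holomorphic_simple[OF hh Uo _ AU] by (auto simp: contour_integrable_on_def)
 have segint: "EX G. (h has_contour_integral G) (linepath a b)" if "a \<in> U" "b \<in> U" for a b
  using contour_integrable_holomorphic_simple[OF hh Uo, of "linepath a b"] seg[OF that]
  by (auto simp: contour_integrable_on_def)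
 obtain G1 where G1: "(h has_contour_integral G1) (linepath p c1)" using segint pU by blast
 obtain G2 where G2: "(h has_contour_integral G2) (linepath c1 c2)" using segint pU by blast
 obtain G3 where G3: "(h has_contour_integral G3) (linepath c2 m)" using segint pU by blast
 \<comment> \<open>For the part with \<open>g\<close> the left half circle, where \<open>g\<close>
   may have no continuation, is replaced by three sides of the box.\<close>
 let ?\<gamma> = "?A +++ linepath p c1 +++ linepath c1 c2 +++ linepath c2 m"
 have "(h has_contour_integral 0) ?\<gamma>"
 proof (rule Cauchy_theorem_convex_simple[OF hh Uc])
  show "valid_path ?\<gamma>" using ends by (intro valid_path_join) auto
  show "path_image ?\<gamma> <= U" using AU seg pU ends by (simp add: path_image_join)
  show "pathfinish ?\<gamma> = pathstart ?\<gamma>" using ends by simp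
 qed
 moreover have "(h has_contour_integral (G0 + (G1 + (G2 + G3)))) ?\<gamma>"
  using ends by (intro has_contour_integral_join G0 G1 G2 G3 valid_path_join) auto
 ultimately have G: "G0 + (G1 + (G2 + G3)) = 0" using has_contour_integral_unique by blast
 have hz: "h z = (g z - g 0) * E z / z" if "z ~= 0" for z using that by (simp add: h_def g1_def)
 have nz: "z ~= 0" if "norm z = R" for z using that R by auto
 have bA: "norm (I1 - G0) <= 2 * K / R^2 * R * (pi/2 - (-pi/2))"
 proof (rule has_contour_integral_bound_part_circlepath_strong[OF has_contour_integral_diff[OF I(1) G0], of "{z. Re z = 0 & norm z = R}"])
  have "{z. Re z = 0 & norm z = R} <= {p, m}"
  proof
   fix z assume z: "z \<in> {z. Re z = 0 & norm z = R}"
   hence "\<bar>Im z\<bar> = R" by (auto simp: cmod_def)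
   thus "z \<in> {p, m}" using z R by (auto simp: p_def m_def complex_eq_iff abs_if split: if_splits)
  qed
  thus "finite {z. Re z = 0 & norm z = R}" by (rule finite_subset) auto
  fix z assume z: "z \<in> path_image ?A - {z. Re z = 0 & norm z = R}"
  hence zR: "norm z = R" using circ by blast
  have re: "Re z > 0" using z Are[of z] zR by auto
  have "F z / z - h z = (S z - g z) * (E z / z)"
   using nz[OF zR] by (simp add: F_def hz diff_divide_distrib algebra_simps)
  hence "norm (F z / z - h z) = norm (S z - g z) * (Y powr Re z * (2 * \<bar>Re z\<bar> / R^2))"
   using Ecirc[OF zR] by (simp only: norm_mult)
  also have "... <= (K * Y powr (- Re z) / Re z) * (Y powr Re z * (2 * \<bar>Re z\<bar> / R^2))"
   by (intro mult_right_mono right re) auto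
  also have "... = 2 * K / R^2" using re Y by (simp add: powr_minus field_simps)
  finally show "norm (F z / z - h z) <= 2 * K / R^2" .
 qed (use K R in auto)
 have Y1: "ln Y >= 1" using Y exp_le by (subst ln_ge_iff) auto
 have bB: "norm I2 <= (2 * K + 2 * norm (g 0)) / R^2 * R * (3/2*pi - pi/2)"
 proof (rule has_contour_integral_bound_part_circlepath_strong[OF I(2), of "{z. Re z = 0 & norm z = R}"])
  have "{z. Re z = 0 & norm z = R} <= {p, m}"
  proof
   fix z assume z: "z \<in> {z. Re z = 0 & norm z = R}"
   hence "\<bar>Im z\<bar> = R" by (auto simp: cmod_def)
   thus "z \<in> {p, m}" using z R by (auto simp: p_def m_def complex_eq_iff abs_if split: if_splits)
  qed
  thus "finite {z. Re z = 0 & norm z = R}" by (rule finite_subset) auto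
  fix z assume z: "z \<in> path_image ?B - {z. Re z = 0 & norm z = R}"
  hence zR: "norm z = R" using circ by blast
  have re: "Re z < 0" using z Bre[of z] zR by auto
  define x where "x = - Re z"
  have x: "x > 0" "\<bar>Re z\<bar> = x" "Re z = - x" using re by (auto simp: x_def)
  \<comment> \<open>The term with \<open>g 0\<close> lacks the factor \<open>1 / x\<close> that
    would cancel the \<open>x\<close> of the kernel; the decay of \<open>Y powr (- x)\<close> takes
    its place.\<close>
  have YY: "Y powr (- x) * x <= 1"
  proof -
   have "x * 1 <= x * ln Y" using x Y1 by (intro mult_left_mono) auto
   hence "x * exp (- (x * ln Y)) <= (x * ln Y) * exp (- (x * ln Y))" by (intro mult_right_mono) auto
   also have "... <= 1" using x Y1 by (intro mult_exp_neg_le) auto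
   finally show ?thesis using Y by (simp add: powr_def mult.commute)
  qed
  have "norm (F z / z) = norm (S z - g 0) * (Y powr Re z * (2 * \<bar>Re z\<bar> / R^2))"
  proof -
   have "F z / z = (S z - g 0) * (E z / z)" by (simp add: F_def)
   thus ?thesis by (simp only: norm_mult Ecirc[OF zR])
  qed
  also have "... <= (K * Y powr (- Re z) / \<bar>Re z\<bar> + norm (g 0)) * (Y powr Re z * (2 * \<bar>Re z\<bar> / R^2))"
   using Sleft[OF re] norm_triangle_ineq4[of "S z" "g 0"] by (intro mult_right_mono) auto
  also have "... = 2 * K / R^2 + 2 * norm (g 0) / R^2 * (Y powr (- x) * x)"
  proof -
   have PQ: "Y powr x * Y powr (- x) = 1" using Y by (simp add: powr_minus)
   have "(K * Q / x + G) * (P * (2 * x / R^2)) = 2 * K / R^2 * (Q * P) + 2 * G / R^2 * (P * x)" for Q P G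
    using x(1) R by (simp add: field_simps)
   from this[of "Y powr x" "norm (g 0)" "Y powr (- x)"] show ?thesis unfolding x(2,3) PQ using x(1) by simp
  qed
  also have "... <= 2 * K / R^2 + 2 * norm (g 0) / R^2 * 1"
   using YY by (intro add_left_mono mult_left_mono) auto
  finally show "norm (F z / z) <= (2 * K + 2 * norm (g 0)) / R^2" by (simp add: add_divide_distrib)
 qed (use K R in auto)
 have B0: "B >= 0" using gB[of 0] R \<delta> norm_ge_zero[of "g 0"] by (smt (verit) zero_complex.simps)
 have gg: "norm (g z - g 0) <= 2 * B" if "-\<delta> <= Re z" "Re z <= 0" "\<bar>Im z\<bar> <= R" for z
  using gB[OF that] gB[of 0] R \<delta> norm_triangle_ineq4[of "g z" "g 0"] by simp
 have Y_le1: "Y powr Re z <= 1" if "Re z <= 0" for z using that Y powr_mono[of "Re z" 0 Y] by simp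
 \<comment> \<open>With \<open>\<bar>Im z\<bar> = R\<close> the real part of
   \<open>R^2 + z^2\<close> is only \<open>(Re z)^2\<close>, and the sum has \<open>Re z\<close> as
   a factor; so the kernel has size \<open>\<delta> / R^2\<close> on these two sides.\<close>
 have horiz: "norm (h z) <= 2 * B * (3 * \<delta> / R^2)"
  if "-\<delta> <= Re z" "Re z <= 0" "\<bar>Im z\<bar> = R" for z
 proof -
  have z0: "z ~= 0" using that R by auto
  have nzR: "norm z >= R" using abs_Im_le_cmod[of z] that by simp
  have Im2: "Im z * Im z = R * R" using that(3) by (metis abs_mult_self_eq)
  have "of_real (R^2) + z^2 = of_real (Re z) * (of_real (Re z) + 2 * \<i> * of_real (Im z))"
   by (simp add: complex_eq_iff power2_eq_square Im2 algebra_simps)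
  hence "norm (of_real (R^2) + z^2) = \<bar>Re z\<bar> * norm (of_real (Re z) + 2 * \<i> * of_real (Im z))"
   by (simp add: norm_mult del: of_real_power)
  also have "norm (of_real (Re z) + 2 * \<i> * of_real (Im z)) <= \<bar>Re z\<bar> + 2 * R"
   using norm_triangle_ineq[of "of_real (Re z)" "2 * \<i> * of_real (Im z)"] that(3) by (simp add: norm_mult)
  also have "\<bar>Re z\<bar> * (\<bar>Re z\<bar> + 2 * R) <= \<delta> * (3 * R)" using that \<delta> by (intro mult_mono) auto
  finally have n1: "norm (of_real (R^2) + z^2) <= \<delta> * (3 * R)" by (simp add: mult_left_mono)
  have "norm ((1 + z^2 / of_real (R^2)) / z) = norm (of_real (R^2) + z^2) / (R^2 * norm z)"
  proof -
   have "(1 + z^2 / of_real (R^2)) / z = (of_real (R^2) + z^2) / (of_real (R^2) * z)"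
    using z0 R by (simp add: field_simps del: of_real_power)
   thus ?thesis by (simp add: norm_divide norm_mult norm_power del: of_real_power)
  qed
  also have "... <= (\<delta> * (3 * R)) / (R^2 * R)"
   using n1 nzR R \<delta> by (intro frac_le mult_left_mono) auto
  also have "... = 3 * \<delta> / R^2" using R by (simp add: field_simps)
  finally have ker: "norm ((1 + z^2 / of_real (R^2)) / z) <= 3 * \<delta> / R^2" .
  have "norm (h z) = norm (g z - g 0) * (Y powr Re z * norm ((1 + z^2 / of_real (R^2)) / z))"
  proof -
   have "h z = (g z - g 0) * (exp (z * of_real (ln Y)) * ((1 + z^2 / of_real (R^2)) / z))"
    by (simp add: hz[OF z0] E_def)
   thus ?thesis by (simp only: norm_mult nE)
  qed
  also have "... <= 2 * B * (1 * (3 * \<delta> / R^2))"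
   using gg[of z] Y_le1[of z] ker that B0 \<delta> by (intro mult_mono) auto
  finally show ?thesis by simp
 qed
 have vert: "norm (h z) <= 2 * B * (Y powr (-\<delta>) * (3 / \<delta>))" if "Re z = -\<delta>" "\<bar>Im z\<bar> <= R" for z
 proof -
  have z0: "z ~= 0" using that \<delta> by auto
  have n1: "norm z >= \<delta>" using abs_Re_le_cmod[of z] that \<delta> by simp
  have n2: "norm z <= 2 * R" using cmod_le[of z] that \<delta> by simp
  have "norm ((1 + z^2 / of_real (R^2)) / z) <= norm (1 / z) + norm (z / of_real (R^2))"
  proof -
   have "(1 + z^2 / of_real (R^2)) / z = 1 / z + z / of_real (R^2)"
    using z0 R by (simp add: field_simps power2_eq_square)
   thus ?thesis using norm_triangle_ineq by metis
  qed
  also have "norm (1 / z) <= 1 / \<delta>" using n1 \<delta> by (simp add: norm_divide frac_le)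
  also have "norm (z / of_real (R^2)) <= 2 / \<delta>"
  proof -
   have "norm (z / of_real (R^2)) <= 2 * R / R^2" using n2 R by (simp add: norm_divide norm_power divide_right_mono)
   also have "... = 2 / R" using R by (simp add: power2_eq_square)
   also have "... <= 2 / \<delta>" using \<delta> by (simp add: frac_le)
   finally show ?thesis .
  qed
  finally have ker: "norm ((1 + z^2 / of_real (R^2)) / z) <= 3 / \<delta>" by simp
  have "norm (h z) = norm (g z - g 0) * (Y powr Re z * norm ((1 + z^2 / of_real (R^2)) / z))"
  proof -
   have "h z = (g z - g 0) * (exp (z * of_real (ln Y)) * ((1 + z^2 / of_real (R^2)) / z))"
    by (simp add: hz[OF z0] E_def)
   thus ?thesis by (simp only: norm_mult nE)
  qed
  also have "... <= 2 * B * (Y powr (-\<delta>) * (3 / \<delta>))"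
   using gg[of z] ker that B0 \<delta> by (intro mult_mono) auto
  finally show ?thesis .
 qed
 have line: "EX u. 0 <= u & u <= 1 & Re z = (1 - u) * Re a + u * Re b & Im z = (1 - u) * Im a + u * Im b"
  if "z \<in> closed_segment a b" for z a b :: complex
  using that by (auto simp: in_segment)
 have b1: "norm G1 <= 2 * B * (3 * \<delta> / R^2) * norm (c1 - p)"
 proof (rule has_contour_integral_bound_linepath[OF G1])
  fix z assume "z \<in> closed_segment p c1"
  then obtain u where "0 <= u" "u <= 1" "Re z = - (u * \<delta>)" "Im z = R"
   using line[of z p c1] by (auto simp: p_def c1_def algebra_simps)
  thus "norm (h z) <= 2 * B * (3 * \<delta> / R^2)" using \<delta> R mult_right_mono[of u 1 \<delta>] by (intro horiz) auto
 qed (use B0 \<delta> in auto)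
 have b3: "norm G3 <= 2 * B * (3 * \<delta> / R^2) * norm (m - c2)"
 proof (rule has_contour_integral_bound_linepath[OF G3])
  fix z assume "z \<in> closed_segment c2 m"
  then obtain u where "0 <= u" "u <= 1" "Re z = - ((1 - u) * \<delta>)" "Im z = - R"
   using line[of z c2 m] by (auto simp: m_def c2_def algebra_simps)
  thus "norm (h z) <= 2 * B * (3 * \<delta> / R^2)" using \<delta> R mult_right_mono[of "1 - u" 1 \<delta>] by (intro horiz) auto
 qed (use B0 \<delta> in auto)
 have b2: "norm G2 <= 2 * B * (Y powr (-\<delta>) * (3 / \<delta>)) * norm (c2 - c1)"
 proof (rule has_contour_integral_bound_linepath[OF G2])
  fix z assume "z \<in> closed_segment c1 c2"
  then obtain u where u: "0 <= u" "u <= 1" "Re z = - \<delta>" "Im z = (1 - 2 * u) * R"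
   using line[of z c1 c2] by (auto simp: c1_def c2_def algebra_simps)
  have "\<bar>1 - 2 * u\<bar> <= 1" using u by (auto simp: abs_le_iff)
  hence "\<bar>Im z\<bar> <= R" unfolding u(4) abs_mult using R mult_right_mono[of "\<bar>1 - 2 * u\<bar>" 1 R] by simp
  thus "norm (h z) <= 2 * B * (Y powr (-\<delta>) * (3 / \<delta>))" using u by (intro vert) auto
 qed (use B0 \<delta> in auto)
 have lens: "norm (c1 - p) = \<delta>" "norm (m - c2) = \<delta>" "norm (c2 - c1) = 2 * R"
  using \<delta> R by (simp_all add: c1_def c2_def p_def m_def cmod_def real_sqrt_mult)
 have F0: "F 0 = S 0 - g 0" by (simp add: F_def E0)
 have "2 * of_real pi * \<i> * (S 0 - g 0) = (I1 - G0) + I2 - (G1 + (G2 + G3))"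
  using I(3) G F0 by (simp add: algebra_simps add_eq_0_iff)
 hence "2 * pi * norm (S 0 - g 0) = norm ((I1 - G0) + I2 - (G1 + (G2 + G3)))"
  by (metis (no_types, opaque_lifting) abs_of_nonneg mult.commute mult_1 norm_ii norm_mult norm_numeral norm_of_real pi_ge_zero)
 also have "... <= norm (I1 - G0) + norm I2 + (norm G1 + (norm G2 + norm G3))"
  by (smt (verit) norm_triangle_ineq norm_triangle_ineq4)
 also have "... <= 2 * K / R^2 * R * (pi/2 - (-pi/2)) + (2 * K + 2 * norm (g 0)) / R^2 * R * (3/2*pi - pi/2)
   + (2 * B * (3 * \<delta> / R^2) * \<delta> + (2 * B * (Y powr (-\<delta>) * (3 / \<delta>)) * (2 * R) + 2 * B * (3 * \<delta> / R^2) * \<delta>))"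
  using bA bB b1 b2 b3 unfolding lens by (intro add_mono) auto
 also have "... = 2 * pi * ((2 * K + norm (g 0)) / R) + 6 * (2 * B * \<delta>^2 / R^2) + 6 * (2 * B * R * Y powr (-\<delta>) / \<delta>)"
  using R \<delta> by (simp add: power2_eq_square field_simps)
 also have "... <= 2 * pi * ((2 * K + norm (g 0)) / R) + 2 * pi * (2 * B * \<delta>^2 / R^2) + 2 * pi * (2 * B * R * Y powr (-\<delta>) / \<delta>)"
  using pi_gt3 B0 R \<delta> K by (intro add_mono mult_right_mono) auto
 also have "... = 2 * pi * ((2 * K + norm (g 0)) / R + 2 * B * \<delta>^2 / R^2 + 2 * B * R * Y powr (-\<delta>) / \<delta>)"
  by (simp add: algebra_simps)
 finally show ?thesis using pi_gt_zero by (simp only: mult_le_cancel_left_pos mult_pos_pos zero_less_numeral)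
qed

section \<open>Primes in arithmetic progressions\<close>

text \<open>Legendre's formula: the increment at \<open>Suc m\<close> is the sum of
  \<open>mangoldt\<close> over the divisors of \<open>Suc m\<close>.\<close>

lemma ln_fact_eq_mangoldt:
 "ln (fact m) = (\<Sum>d=1..m. mangoldt d * real (m div d))"
proof (induction m)
 case (Suc m)
 have "(\<Sum>d=1..Suc m. mangoldt d * real (Suc m div d)) =
  (\<Sum>d=1..Suc m. mangoldt d * real (m div d) + (if d dvd Suc m then mangoldt d else 0))"
  by (intro sum.cong) (auto simp: div_Suc dvd_eq_mod_eq_0 algebra_simps)
 also have "... = (\<Sum>d=1..Suc m. mangoldt d * real (m div d)) + (\<Sum>d=1..Suc m. if d dvd Suc m then mangoldt d else 0)"
  by (rule sum.distrib)
 also have "(\<Sum>d=1..Suc m. if d dvd Suc m then mangoldt d else (0::real)) = (\<Sum>d | d dvd Suc m. mangoldt d)"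
 proof -
  have "1 <= x & x <= Suc m" if "x dvd Suc m" for x
   using dvd_imp_le[OF that] dvd_pos_nat[OF _ that] by (simp add: Suc_le_eq)
  thus ?thesis by (intro sum.mono_neutral_cong_right) auto
 qed
 also have "... = ln (real (Suc m))" using mangoldt_sum[of "Suc m", where ?'a = real] by simp
 also have "(\<Sum>d=1..Suc m. mangoldt d * real (m div d)) = ln (fact m)" using Suc by simp
 finally show ?case by (simp add: ln_mult)
qed simp

text \<open>Chebyshev's argument: \<open>2 * m div d\<close> exceeds \<open>2 * (m div d)\<close> by
  1 for \<open>m < d <= 2 * m\<close> and is never smaller, so the logarithm of the central binomial
  coefficient dominates the block from \<open>m + 1\<close> to \<open>2 * m\<close>. The induction
  halves \<open>N\<close>, rounding up; the constant 5 leaves room for the rounding.\<close>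

lemma chebyshev_psi: "(\<Sum>n=1..N. mangoldt n :: real) <= 5 * real N"
proof (induction N rule: less_induct)
 case (less N)
 have step: "(\<Sum>d=Suc m..2*m. mangoldt d :: real) <= 2 * real m * ln 2" for m
 proof -
  have "ln (fact (2*m)) - 2 * ln (fact m) = (\<Sum>d=1..2*m. mangoldt d * real (2*m div d)) - 2 * (\<Sum>d=1..2*m. mangoldt d * real (m div d))"
  proof -
   have "(\<Sum>d=1..m. mangoldt d * real (m div d)) = (\<Sum>d=1..2*m. mangoldt d * real (m div d))"
    by (intro sum.mono_neutral_left) auto
   thus ?thesis by (simp add: ln_fact_eq_mangoldt)
  qed
  also have "... = (\<Sum>d=1..2*m. mangoldt d * (real (2*m div d) - 2 * real (m div d)))"
   by (simp add: sum_subtractf sum_distrib_left algebra_simps)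
  also have "... >= (\<Sum>d=1..2*m. if d > m then mangoldt d else 0)"
  proof (rule sum_mono)
   fix d assume d: "d \<in> {1..2*m}"
   have "2 * (m div d) * d <= 2 * m" using div_times_less_eq_dividend[of m d] by simp
   hence "2 * (m div d) <= 2 * m div d" using d by (simp add: less_eq_div_iff_mult_less_eq)
   hence "0 <= real (2*m div d) - 2 * real (m div d)" by linarith
   moreover have "real (2*m div d) - 2 * real (m div d) >= 1" if "d > m"
   proof -
    have "1 <= 2 * m div d" using d by (simp add: less_eq_div_iff_mult_less_eq)
    thus ?thesis using that by simp
   qed
   ultimately show "(if d > m then mangoldt d else 0) <= mangoldt d * (real (2*m div d) - 2 * real (m div d))"
    using mangoldt_nonneg[of d] mult_left_mono[of 1 "real (2*m div d) - 2 * real (m div d)" "mangoldt d"] by auto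
  qed
  also have "(\<Sum>d=1..2*m. if d > m then mangoldt d else 0) = (\<Sum>d=Suc m..2*m. mangoldt d :: real)"
   by (intro sum.mono_neutral_cong_right) auto
  finally have 1: "(\<Sum>d=Suc m..2*m. mangoldt d :: real) <= ln (fact (2*m)) - 2 * ln (fact m)" by simp
  have "fact m * fact m * (2*m choose m) = (fact (2*m) :: nat)" using binomial_fact_lemma[of m "2*m"] by simp
  hence "fact m * fact m * real (2*m choose m) = fact (2*m)" by (metis of_nat_fact of_nat_mult)
  moreover have "real (2*m choose m) > 0" by simp
  ultimately have "ln (fact (2*m)) = 2 * ln (fact m) + ln (real (2*m choose m))"
   by (metis (no_types, opaque_lifting) fact_gt_zero ln_mult_pos mult_2 mult_pos_pos)
  moreover have "ln (real (2*m choose m)) <= 2 * real m * ln 2"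
  proof -
   have "real (2*m choose m) <= 2 ^ (2*m)" using binomial_le_pow2[of "2*m" m] by (metis of_nat_le_iff of_nat_numeral of_nat_power)
   hence "ln (real (2*m choose m)) <= ln (2 ^ (2*m))" by (subst ln_le_cancel_iff) auto
   thus ?thesis by (simp add: ln_realpow)
  qed
  ultimately show ?thesis using 1 by linarith
 qed
 show ?case
 proof (cases "N <= 1")
  case True
  hence "N = 0 \<or> N = 1" by auto
  thus ?thesis by auto
 next
  case False
  define m where "m = (N + 1) div 2"
  have m: "m < N" "N <= 2 * m" "2 * m <= N + 1" using False by (auto simp: m_def)
  have "(\<Sum>n=1..N. mangoldt n :: real) <= (\<Sum>n=1..2*m. mangoldt n)"
   using m by (intro sum_mono2) (auto intro: mangoldt_nonneg)
  also have "... = (\<Sum>n=1..m. mangoldt n) + (\<Sum>n=Suc m..2*m. mangoldt n)"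
   by (subst sum.union_disjoint[symmetric]) (auto intro!: sum.cong)
  also have "... <= 5 * real m + 2 * real m * ln 2" using less.IH[OF m(1)] step[of m] by linarith
  also have "... <= 5 * real m + 2 * real m * (7/10)"
   using ln2_le_25_over_36 by (intro add_left_mono mult_left_mono) auto
  also have "... <= 5 * real N" using m False by linarith
  finally show ?thesis .
 qed
qed

text \<open>Integrals \<open>\<integral>\<^sub>n\<^sup>n\<^sup>+\<^sup>1 u powr (- s - 1) du\<close>, as entire functions of \<open>s\<close>.\<close>

definition npow_int :: "nat => complex => complex" where
 "npow_int n s = (if s = 0 then deriv (%s. npow n s - npow (Suc n) s) 0
  else ((npow n s - npow (Suc n) s) - (npow n 0 - npow (Suc n) 0)) / (s - 0))"

lemma npow_int_holomorphic: "npow_int n holomorphic_on UNIV"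
 unfolding npow_int_def[abs_def]
 by (rule pole_lemma_open[where f = "%s. npow n s - npow (Suc n) s" and a = 0]) (auto intro!: holomorphic_intros)

lemma npow_int_eq:
 assumes "n > 0" "s ~= 0" shows "npow_int n s = (npow n s - npow (Suc n) s) / s"
proof -
 have "npow n 0 = 1" "npow (Suc n) 0 = 1" using assms by (simp_all add: npow_def del: of_nat_Suc)
 thus ?thesis using assms by (simp add: npow_int_def)
qed

text \<open>The majorant is chosen to telescope in \<open>n\<close>, for either sign of
  \<open>Re z\<close>. At \<open>z = -1\<close>, where \<open>npow_int\<close> takes its filled-in
  value, that value is a difference of logarithms.\<close>

lemma npow_int_bound:
 assumes n: "n > 0" and x: "Re z ~= 0"
 shows "real n * norm (npow_int n (1 + z)) <= (real n powr (- Re z) - real (Suc n) powr (- Re z)) / Re z"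
proof (cases "1 + z = 0")
 case True
 hence z: "z = -1" by (simp add: add_eq_0_iff)
 have "((%s. npow n s - npow (Suc n) s) has_field_derivative (- of_real (ln (real n)) * npow n 0 - - of_real (ln (real (Suc n))) * npow (Suc n) 0)) (at 0)"
  by (intro derivative_intros npow_has_derivative)
 hence "deriv (%s. npow n s - npow (Suc n) s) 0 = of_real (ln (real (Suc n)) - ln (real n))"
  using n by (simp add: DERIV_imp_deriv npow_def del: of_nat_Suc)
 hence "npow_int n (1 + z) = of_real (ln (real (Suc n)) - ln (real n))" using True by (simp add: npow_int_def)
 moreover have "ln (real (Suc n)) - ln (real n) >= 0" using n by simp
 ultimately have "norm (npow_int n (1 + z)) = ln (real (Suc n)) - ln (real n)"
  by (simp only: norm_of_real abs_of_nonneg)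
 also have "... = ln (1 + 1 / real n)"
 proof -
  have "1 + 1 / real n = real (Suc n) / real n" using n by (simp add: field_simps)
  thus ?thesis using n by (simp only: ln_div) (simp add: ln_div)
 qed
 also have "... <= 1 / real n" by (intro ln_add_one_self_le_self) simp
 finally show ?thesis using n z by (simp add: field_simps)
next
 case False
 define \<phi> where "\<phi> = (%u. - (norm (1 + z) / (real n * Re z)) * u powr (- Re z))"
 have "norm (of_real (real n) powr - (1 + z) - of_real (real (Suc n)) powr - (1 + z)) <= \<phi> (real (Suc n)) - \<phi> (real n)"
 proof (rule norm_powr_diff_bound)
  show "continuous_on {real n..real (Suc n)} \<phi>" unfolding \<phi>_def using n by (intro continuous_intros) auto
  fix u assume u: "real n < u" "u < real (Suc n)"
  hence u0: "u > 0" using n by linarith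
  show "(\<phi> has_real_derivative norm (1 + z) / real n * u powr (- Re z - 1)) (at u)"
   unfolding \<phi>_def using u0 x n by (auto intro!: derivative_eq_intros simp: field_simps)
  have "u powr (- Re (1 + z) - 1) = u powr (- Re z - 1) / u" using u0 by (simp add: powr_diff powr_minus field_simps power2_eq_square)
  also have "... <= u powr (- Re z - 1) / real n" using u n by (intro divide_left_mono) auto
  finally show "norm (1 + z) * u powr (- Re (1 + z) - 1) <= norm (1 + z) / real n * u powr (- Re z - 1)"
   using mult_left_mono[of "u powr (- Re (1 + z) - 1)" "u powr (- Re z - 1) / real n" "norm (1 + z)"] by simp
 qed (use n in auto)
 also have "\<phi> (real (Suc n)) - \<phi> (real n) = norm (1 + z) / real n * ((real n powr (- Re z) - real (Suc n) powr (- Re z)) / Re z)"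
  using n x by (simp add: \<phi>_def field_simps)
 finally have "norm (npow n (1 + z) - npow (Suc n) (1 + z)) <= norm (1 + z) / real n * ((real n powr (- Re z) - real (Suc n) powr (- Re z)) / Re z)"
  by (simp add: npow_def)
 hence "real n * (norm (npow n (1 + z) - npow (Suc n) (1 + z)) / norm (1 + z)) <=
   real n * (norm (1 + z) / real n * ((real n powr (- Re z) - real (Suc n) powr (- Re z)) / Re z) / norm (1 + z))"
  by (intro mult_left_mono divide_right_mono) auto
 also have "... = (real n powr (- Re z) - real (Suc n) powr (- Re z)) / Re z" using n False by simp
 finally show ?thesis unfolding npow_int_eq[OF n False] norm_divide .
qed

text \<open>If the summatory function \<open>A\<close> of \<open>u\<close> is \<open>O(n)\<close>, its partial sums against \<open>npow_int\<close> satisfy the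
 hypotheses of Newman's argument.\<close>

lemma npow_int_sums:
 fixes A :: "nat => real"
 assumes A: "!!n. \<bar>A n\<bar> <= K * real n"
 shows "Re z < 0 ==> norm (\<Sum>n=1..N. of_real (A n) * npow_int n (1 + z)) <= K * real (Suc N) powr (- Re z) / \<bar>Re z\<bar>"
  and "Re z > 0 ==> (%n. of_real (A n) * npow_int n (1 + z)) sums g ==>
   norm ((\<Sum>n=1..N. of_real (A n) * npow_int n (1 + z)) - g) <= K * real (Suc N) powr (- Re z) / Re z"
proof -
 have K: "K >= 0" using A[of 1] by simp
 have A0: "A 0 = 0" using A[of 0] by simp
 define f where "f = (%n z. complex_of_real (A n) * npow_int n (1 + z))"
 define e where "e = (%n z. real n powr (- Re z))"
 have b: "norm (f n z) <= K * ((e n z - e (Suc n) z) / Re z)" if "n > 0" "Re z ~= 0" for n z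
 proof -
  have "norm (f n z) <= K * real n * norm (npow_int n (1 + z))"
   unfolding f_def norm_mult using A[of n] by (intro mult_right_mono) auto
  also have "... = K * (real n * norm (npow_int n (1 + z)))" by simp
  also have "... <= K * ((e n z - e (Suc n) z) / Re z)"
   unfolding e_def by (intro mult_left_mono npow_int_bound that K)
  finally show ?thesis .
 qed
 have tele: "(\<Sum>n=M..<M + m. (e n z - e (Suc n) z) / Re z) = (e M z - e (M + m) z) / Re z" for m M z
  by (induction m) (auto simp: diff_divide_distrib)
 show "norm (\<Sum>n=1..N. of_real (A n) * npow_int n (1 + z)) <= K * real (Suc N) powr (- Re z) / \<bar>Re z\<bar>" if z: "Re z < 0"
 proof -
  have "norm (\<Sum>n=1..N. f n z) <= (\<Sum>n=1..N. K * ((e n z - e (Suc n) z) / Re z))"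
   by (intro sum_norm_le b) (use z in auto)
  also have "... = K * (\<Sum>n=1..<1 + N. (e n z - e (Suc n) z) / Re z)"
   by (simp add: sum_distrib_left atLeastLessThanSuc_atLeastAtMost)
  also have "... = K * ((1 - e (Suc N) z) / Re z)" unfolding tele by (simp add: e_def)
  also have "(1 - e (Suc N) z) / Re z <= e (Suc N) z / \<bar>Re z\<bar>" using z by (simp add: field_simps)
  finally show ?thesis using K by (simp add: f_def e_def mult_left_mono)
 qed
 show "norm ((\<Sum>n=1..N. of_real (A n) * npow_int n (1 + z)) - g) <= K * real (Suc N) powr (- Re z) / Re z"
  if z: "Re z > 0" and g: "(%n. of_real (A n) * npow_int n (1 + z)) sums g"
 proof -
  have "(%m. (\<Sum>n<m + Suc N. f n z)) \<longlonglongrightarrow> g"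
   using g unfolding sums_def f_def by (rule LIMSEQ_ignore_initial_segment)
  moreover have "(\<Sum>n<m + Suc N. f n z) = (\<Sum>n=1..N. f n z) + (\<Sum>n=Suc N..<Suc N + m. f n z)" for m
  proof (induction m)
   case 0
   have "{..<Suc N} = insert 0 {1..N}" by auto
   thus ?case by (simp add: f_def A0)
  qed (simp add: add_ac)
  ultimately have "(%m. (\<Sum>n=1..N. f n z) + (\<Sum>n=Suc N..<Suc N + m. f n z)) \<longlonglongrightarrow> g" by simp
  hence "(%m. norm ((\<Sum>n=1..N. f n z) - ((\<Sum>n=1..N. f n z) + (\<Sum>n=Suc N..<Suc N + m. f n z)))) \<longlonglongrightarrow> norm ((\<Sum>n=1..N. f n z) - g)"
   by (intro tendsto_intros)
  hence L: "(%m. norm (\<Sum>n=Suc N..<Suc N + m. f n z)) \<longlonglongrightarrow> norm ((\<Sum>n=1..N. f n z) - g)" by simp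
  have "norm (\<Sum>n=Suc N..<Suc N + m. f n z) <= K * e (Suc N) z / Re z" for m
  proof -
   have "norm (\<Sum>n=Suc N..<Suc N + m. f n z) <= (\<Sum>n=Suc N..<Suc N + m. K * ((e n z - e (Suc n) z) / Re z))"
    by (intro sum_norm_le b) (use z in auto)
   also have "... = K * ((e (Suc N) z - e (Suc N + m) z) / Re z)" unfolding tele[symmetric] by (rule sum_distrib_left[symmetric])
   also have "... <= K * (e (Suc N) z / Re z)" using z K by (intro mult_left_mono divide_right_mono) (auto simp: e_def)
   finally show ?thesis by simp
  qed
  hence "norm ((\<Sum>n=1..N. f n z) - g) <= K * e (Suc N) z / Re z" by (intro LIMSEQ_le_const2[OF L]) auto
  thus ?thesis by (simp add: f_def e_def)
 qed
qed

text \<open>Partial summation, with a boundary term of order \<open>n powr (1 - Re s)\<close>;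
  dividing by \<open>s\<close> turns the differences of powers into \<open>npow_int\<close>.\<close>

lemma dseries_partial_summation:
 fixes u :: "nat => real"
 assumes A: "!!n. \<bar>\<Sum>m=1..n. u m\<bar> <= K * real n" and s: "Re s > 1"
  and summ: "summable (%n. norm (of_real (u n) * npow n s))"
 shows "(%n. of_real (\<Sum>m=1..n. u m) * npow_int n s) sums (dseries (%n. of_real (u n)) s / s)"
proof -
 have K: "K >= 0" using A[of 1] by simp
 define A' where "A' = (%n. complex_of_real (\<Sum>m=1..n. u m))"
 have s0: "s ~= 0" using s by auto
 have eq: "A' n * npow_int n s = A' n * (npow n s - npow (Suc n) s) / s" for n
  using npow_int_eq[of n s] s0 by (cases "n = 0") (auto simp: A'_def)
 have part: "(\<Sum>n<Suc N. A' n * (npow n s - npow (Suc n) s)) = (\<Sum>n<Suc N. of_real (u n) * npow n s) - A' N * npow (Suc N) s" for N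
  by (induction N) (auto simp: A'_def algebra_simps)
 have 2: "(%N. A' N * npow (Suc N) s) \<longlonglongrightarrow> 0"
 proof (rule Lim_null_comparison)
  show "\<forall>\<^sub>F N in sequentially. norm (A' N * npow (Suc N) s) <= K * norm (npow (Suc N) (s - 1))"
  proof (intro always_eventually allI)
   fix N
   have "norm (A' N * npow (Suc N) s) <= K * real N * real (Suc N) powr (- Re s)"
    unfolding norm_mult norm_npow using A[of N] by (intro mult_right_mono) (auto simp: A'_def simp del: of_real_sum)
   also have "... <= K * real (Suc N) * real (Suc N) powr (- Re s)" using K by (intro mult_right_mono mult_left_mono) auto
   also have "... = K * norm (npow (Suc N) (s - 1))" by (simp add: powr_diff powr_minus field_simps)
   finally show "norm (A' N * npow (Suc N) s) <= K * norm (npow (Suc N) (s - 1))" .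
  qed
  have "(%N. K * norm (npow (Suc N) (s - 1))) \<longlonglongrightarrow> K * norm (0::complex)"
   by (intro tendsto_intros LIMSEQ_Suc[OF npow_tendsto_0]) (use s in auto)
  thus "(%N. K * norm (npow (Suc N) (s - 1))) \<longlonglongrightarrow> 0" by (simp del: norm_npow)
 qed
 have "(%N. \<Sum>n<N. of_real (u n) * npow n s) \<longlonglongrightarrow> dseries (%n. of_real (u n)) s"
  using dseries_sums[OF summ] by (simp add: sums_def)
 hence "(%N. (\<Sum>n<Suc N. of_real (u n) * npow n s) - A' N * npow (Suc N) s) \<longlonglongrightarrow> dseries (%n. of_real (u n)) s - 0"
  by (intro tendsto_diff 2) (rule LIMSEQ_Suc)
 hence "(%N. \<Sum>n<Suc N. A' n * (npow n s - npow (Suc n) s)) \<longlonglongrightarrow> dseries (%n. of_real (u n)) s"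
  unfolding part by simp
 hence "(%n. A' n * (npow n s - npow (Suc n) s)) sums dseries (%n. of_real (u n)) s"
  unfolding sums_def by (subst (asm) filterlim_sequentially_Suc)
 hence "(%n. A' n * (npow n s - npow (Suc n) s) / s) sums (dseries (%n. of_real (u n)) s / s)"
  by (rule sums_divide)
 hence "(%n. A' n * npow_int n s) sums (dseries (%n. of_real (u n)) s / s)" by (simp only: eq)
 thus ?thesis by (simp only: A'_def)
qed

text \<open>The regular part of the zeta function, that is \<zeta>(s) - 1 / (s - 1), with the
  singularity at 1 filled in.\<close>

definition zeta_quot :: "complex => complex" where
 "zeta_quot s = (if s = 1 then deriv zeta1 1 else (zeta1 s - zeta1 1) / (s - 1))"

text \<open>Continuation of the Dirichlet series with coefficients
  \<open>ap_weight q a n - 1\<close>: the trivial character and the zeta function both contribute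
  \<open>1 / (s - 1)\<close>, these poles cancel, and only regular parts are left.\<close>

definition log_deriv_sum :: "nat => nat => complex => complex" where
 "log_deriv_sum q a s = - zeta_quot s - (\<Sum>\<chi> | dirichlet_char q \<chi>. cnj (\<chi> a) * (deriv (Lreg q \<chi>) s / Lreg q \<chi> s))"

definition ap_weight :: "nat => nat => nat => real" where
 "ap_weight q a n = (if [n = a] (mod q) then real (totient q) * mangoldt n else 0)"

context
 fixes q :: nat assumes q: "q > 1"
begin

text \<open>The convolution of \<open>mangoldt\<close> with 1 is the logarithm, and the completely
  multiplicative \<open>\<chi>\<close> distributes over the convolution.\<close>

lemma mangoldt_char_dseries:
 assumes \<chi>: "dirichlet_char q \<chi>" and s: "Re s > 1"
 shows "dseries (%n. \<chi> n * mangoldt n) s * dseries \<chi> s = - deriv (dseries \<chi>) s"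
proof -
 have lnle: "mangoldt n <= 1 + ln (real n)" if "n > 0" for n
 proof -
  have "(mangoldt n :: real) <= (\<Sum>d | d dvd n. mangoldt d)"
   using that by (intro member_le_sum) (auto intro: mangoldt_nonneg)
  thus ?thesis using mangoldt_sum[of n, where ?'a = real] that by simp
 qed
 have "dseries (%n. \<chi> n * mangoldt n) s * dseries \<chi> s = dseries (%n. \<chi> n * of_real (ln (real n))) s"
 proof (rule dseries_mult)
  show "summable (%n. norm (\<chi> n * mangoldt n * npow n s))"
  proof (rule summable_dseries[where B = 1])
   fix n :: nat assume "n > 0"
   thus "norm (\<chi> n * mangoldt n) <= 1 * (1 + ln (real n))"
    using lnle[of n] dirichlet_char_norm_le[OF q \<chi>, of n] mult_mono[of "norm (\<chi> n)" 1 "mangoldt n" "1 + ln (real n)"] mangoldt_nonneg[of n]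
    by (simp add: norm_mult)
  qed (rule s)
  show "summable (%n. norm (\<chi> n * npow n s))" by (rule dseries_bounded_coeff[OF dirichlet_char_norm_le[OF q \<chi>] s])
  show "summable (%n. norm (\<chi> n * of_real (ln (real n)) * npow n s))"
  proof (rule summable_dseries[where B = 1])
   fix n :: nat assume "n > 0"
   thus "norm (\<chi> n * of_real (ln (real n))) <= 1 * (1 + ln (real n))"
    using dirichlet_char_norm_le[OF q \<chi>, of n] mult_mono[of "norm (\<chi> n)" 1 "ln (real n)" "1 + ln (real n)"]
    by (simp add: norm_mult)
  qed (rule s)
  fix n :: nat assume n: "n > 0"
  have "(\<Sum>d | d dvd n. \<chi> d * mangoldt d * \<chi> (n div d)) = (\<Sum>d | d dvd n. \<chi> n * mangoldt d)"
  proof (rule sum.cong)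
   fix d assume "d \<in> {d. d dvd n}"
   hence "\<chi> n = \<chi> d * \<chi> (n div d)" using \<chi> unfolding dirichlet_char_def by (metis dvd_mult_div_cancel mem_Collect_eq)
   thus "\<chi> d * mangoldt d * \<chi> (n div d) = \<chi> n * mangoldt d" by simp
  qed simp
  also have "... = \<chi> n * of_real (ln (real n))" using mangoldt_sum[of n, where ?'a = complex] n by (simp flip: sum_distrib_left)
  finally show "\<chi> n * of_real (ln (real n)) = (\<Sum>d | d dvd n. \<chi> d * mangoldt d * \<chi> (n div d))" by simp
 qed
 also have "... = - deriv (dseries \<chi>) s"
  using DERIV_imp_deriv[OF dseries_has_derivative[OF dirichlet_char_norm_le[OF q \<chi>] s]] by simp
 finally show ?thesis .
qed

lemma Lreg_log_deriv:
 assumes \<chi>: "dirichlet_char q \<chi>" and s: "Re s > 1"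
 shows "deriv (Lreg q \<chi>) s / Lreg q \<chi> s = (if \<chi> = trivial_char q then 1 / (s - 1) else 0) - dseries (%n. \<chi> n * mangoldt n) s"
proof -
 have D0: "dseries \<chi> s ~= 0" by (rule dseries_nonzero[OF q \<chi> s])
 have s1: "s ~= 1" using s by auto
 define d where "d = deriv (dseries \<chi>) s"
 have h: "(dseries \<chi> has_field_derivative - dseries (%n. \<chi> n * of_real (ln (real n))) s) (at s)"
  by (rule dseries_has_derivative[where B = 1]) (use dirichlet_char_norm_le[OF q \<chi>] s in auto)
 have dd: "(dseries \<chi> has_field_derivative d) (at s)"
  using h unfolding d_def DERIV_imp_deriv[OF h] .
 define pf' where "pf' = (if \<chi> = trivial_char q then 1 else 0 :: complex)"
 have pf: "(pole_factor q \<chi> has_field_derivative pf') (at s)"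
  unfolding pole_factor_def[abs_def] pf'_def by (auto intro!: derivative_eq_intros)
 have "((%s. pole_factor q \<chi> s * dseries \<chi> s) has_field_derivative (pf' * dseries \<chi> s + d * pole_factor q \<chi> s)) (at s)"
  by (rule DERIV_mult[OF pf dd])
 hence "(Lreg q \<chi> has_field_derivative (pf' * dseries \<chi> s + d * pole_factor q \<chi> s)) (at s)"
  by (rule has_field_derivative_transform_within_open[of _ _ _ "{s. Re s > 1}"])
   (use s Lreg_eq[OF q \<chi>] in \<open>auto simp: open_halfspace_Re_gt\<close>)
 hence "deriv (Lreg q \<chi>) s = pf' * dseries \<chi> s + d * pole_factor q \<chi> s" by (rule DERIV_imp_deriv)
 moreover have "d = - (dseries (%n. \<chi> n * mangoldt n) s * dseries \<chi> s)"
  using mangoldt_char_dseries[OF \<chi> s] by (simp add: d_def)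
 ultimately show ?thesis unfolding Lreg_eq[OF q \<chi> s] using D0 s1
  by (auto simp: pole_factor_def pf'_def field_simps)
qed

lemma ap_weight_dseries:
 assumes a: "coprime a q" and s: "Re s > 1"
 shows "summable (%n. norm (complex_of_real (ap_weight q a n - 1) * npow n s))"
  and "dseries (%n. of_real (ap_weight q a n - 1)) s = log_deriv_sum q a s"
proof -
 let ?X = "{\<chi>. dirichlet_char q \<chi>}"
 have fin: "finite ?X" by (rule finite_dirichlet_chars[OF q])
 have lnle: "mangoldt n <= 1 + ln (real n)" if "n > 0" for n
 proof -
  have "(mangoldt n :: real) <= (\<Sum>d | d dvd n. mangoldt d)"
   using that by (intro member_le_sum) (auto intro: mangoldt_nonneg)
  thus ?thesis using mangoldt_sum[of n, where ?'a = real] that by simp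
 qed
 have chs: "summable (%n. norm (\<chi> n * mangoldt n * npow n s))" if "dirichlet_char q \<chi>" for \<chi>
 proof (rule summable_dseries[where B = 1])
  fix n :: nat assume "n > 0"
  thus "norm (\<chi> n * mangoldt n) <= 1 * (1 + ln (real n))"
   using lnle[of n] dirichlet_char_norm_le[OF q that, of n] mult_mono[of "norm (\<chi> n)" 1 "mangoldt n" "1 + ln (real n)"] mangoldt_nonneg[of n]
   by (simp add: norm_mult)
 qed (rule s)
 show summ: "summable (%n. norm (complex_of_real (ap_weight q a n - 1) * npow n s))"
 proof (rule summable_dseries[where B = "real (totient q) + 1"])
  fix n :: nat assume n: "n > 0"
  have "\<bar>ap_weight q a n - 1\<bar> <= real (totient q) * mangoldt n + 1" using mangoldt_nonneg[of n] by (auto simp: ap_weight_def abs_le_iff)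
  also have "... <= real (totient q) * (1 + ln (real n)) + 1 * (1 + ln (real n))"
   using lnle[OF n] n by (intro add_mono mult_left_mono) auto
  finally show "norm (complex_of_real (ap_weight q a n - 1)) <= (real (totient q) + 1) * (1 + ln (real n))"
   by (simp only: norm_of_real distrib_right)
 qed (rule s)
 have "(%n. \<Sum>\<chi>\<in>?X. cnj (\<chi> a) * (\<chi> n * mangoldt n * npow n s)) sums (\<Sum>\<chi>\<in>?X. cnj (\<chi> a) * dseries (%n. \<chi> n * mangoldt n) s)"
  by (intro sums_sum sums_mult dseries_sums chs) auto
 moreover have "(\<Sum>\<chi>\<in>?X. cnj (\<chi> a) * (\<chi> n * mangoldt n * npow n s)) = of_real (ap_weight q a n) * npow n s" for n
 proof -
  have "(\<Sum>\<chi>\<in>?X. cnj (\<chi> a) * (\<chi> n * mangoldt n * npow n s)) = (\<Sum>\<chi>\<in>?X. cnj (\<chi> a) * \<chi> n) * (mangoldt n * npow n s)"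
   by (subst sum_distrib_right) (auto intro!: sum.cong simp: mult_ac)
  thus ?thesis using dirichlet_char_orthogonality[OF q a, of n] by (simp add: ap_weight_def)
 qed
 ultimately have 1: "(%n. of_real (ap_weight q a n) * npow n s) sums (\<Sum>\<chi>\<in>?X. cnj (\<chi> a) * dseries (%n. \<chi> n * mangoldt n) s)" by simp
 have "(%n. 1 * npow n s) sums dseries (%_. 1) s"
  by (intro dseries_sums dseries_bounded_coeff[where B = 1]) (use s in auto)
 from sums_diff[OF 1 this]
 have "(%n. complex_of_real (ap_weight q a n - 1) * npow n s) sums ((\<Sum>\<chi>\<in>?X. cnj (\<chi> a) * dseries (%n. \<chi> n * mangoldt n) s) - dseries (%_. 1) s)"
  by (simp add: algebra_simps)
 hence "dseries (%n. of_real (ap_weight q a n - 1)) s = (\<Sum>\<chi>\<in>?X. cnj (\<chi> a) * dseries (%n. \<chi> n * mangoldt n) s) - dseries (%_. 1) s"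
  unfolding dseries_def[of "%n. complex_of_real (ap_weight q a n - 1)" s] by (rule sums_unique[symmetric])
 also have "(\<Sum>\<chi> | dirichlet_char q \<chi>. cnj (\<chi> a) * dseries (%n. \<chi> n * mangoldt n) s) =
   (\<Sum>\<chi>\<in>?X. (if \<chi> = trivial_char q then cnj (\<chi> a) * (1 / (s - 1)) else 0) - cnj (\<chi> a) * (deriv (Lreg q \<chi>) s / Lreg q \<chi> s))"
 proof (rule sum.cong)
  fix \<chi> assume "\<chi> \<in> ?X"
  hence "dseries (%n. \<chi> n * mangoldt n) s = (if \<chi> = trivial_char q then 1 / (s - 1) else 0) - deriv (Lreg q \<chi>) s / Lreg q \<chi> s"
   using Lreg_log_deriv[of \<chi> s] s by simp
  thus "cnj (\<chi> a) * dseries (%n. \<chi> n * mangoldt n) s = (if \<chi> = trivial_char q then cnj (\<chi> a) * (1 / (s - 1)) else 0) - cnj (\<chi> a) * (deriv (Lreg q \<chi>) s / Lreg q \<chi> s)"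
   by (simp only: right_diff_distrib) simp
 qed simp
 also have "... = 1 / (s - 1) - (\<Sum>\<chi>\<in>?X. cnj (\<chi> a) * (deriv (Lreg q \<chi>) s / Lreg q \<chi> s))"
  using fin a dirichlet_char_trivial[OF q] by (simp add: sum_subtractf trivial_char_def)
 also have "dseries (%_. 1) s = zeta1 s / (s - 1)" using zeta1_eq[OF s] s by auto
 finally show "dseries (%n. of_real (ap_weight q a n - 1)) s = log_deriv_sum q a s"
  using s by (auto simp: log_deriv_sum_def zeta_quot_def zeta1_1 diff_divide_distrib)
qed

lemma ap_weight_partial_bound: "\<bar>\<Sum>m=1..n. ap_weight q a m - 1\<bar> <= (5 * real (totient q) + 1) * real n"
proof -
 have nn: "ap_weight q a m >= 0" for m by (simp add: ap_weight_def mangoldt_nonneg)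
 have "(\<Sum>m=1..n. ap_weight q a m) <= (\<Sum>m=1..n. real (totient q) * mangoldt m)"
  by (intro sum_mono) (auto simp: ap_weight_def mangoldt_nonneg)
 also have "... = real (totient q) * (\<Sum>m=1..n. mangoldt m)" by (simp add: sum_distrib_left)
 also have "... <= real (totient q) * (5 * real n)" by (intro mult_left_mono chebyshev_psi) auto
 finally have "(\<Sum>m=1..n. ap_weight q a m) <= 5 * real (totient q) * real n" by simp
 moreover have "(\<Sum>m=1..n. ap_weight q a m) >= 0" by (intro sum_nonneg nn)
 moreover have "0 <= 5 * real (totient q) * real n" by simp
 ultimately show ?thesis by (simp add: sum_subtractf abs_le_iff algebra_simps)
qed

end

section \<open>The prime number theorem for progressions with a logarithmic power saving\<close>

text \<open>If \<open>\<bar>A n\<bar> = \<theta> * n\<close>, monotonicity of \<open>\<psi>\<close>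
  keeps \<open>A\<close> at half this size for about \<open>\<theta> * n / 2\<close> indices, to the
  right of \<open>n\<close> when \<open>A n\<close> is positive and to the left when it is negative.
  These terms move \<open>T\<close> by a multiple of \<open>\<theta>^2\<close>, whereas the
  hypothesis allows at most \<open>2 * E\<close>; hence the square root.\<close>

lemma unsmooth_monotone:
 fixes \<psi> A T :: "nat => real"
 assumes mono: "!!m n. m <= n ==> \<psi> m <= \<psi> n" and nonneg: "!!n. \<psi> n >= 0"
  and A: "!!n. A n = \<psi> n - real n" and K: "!!n. A n <= K * real n" "K >= 0"
  and T: "!!n. T n = (\<Sum>m=1..n. A m / (real m * real (Suc m)))"
  and E: "!!m. real m + 1 >= real n / 2 ==> \<bar>T m - g\<bar> <= E" and n: "n >= 2"
 shows "\<bar>A n\<bar> <= (6 + 3 * K) * sqrt E * real n"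
proof -
 have E0: "E >= 0" using E[of n] by (auto intro: order_trans[OF abs_ge_zero])
 have split: "T (m + d) - T (m - 1) = (\<Sum>i=m..m + d. A i / (real i * real (Suc i)))" if "m >= 1" for m d
 proof -
  have "{1..m + d} = {1..m - 1} \<union> {m..m + d}" using that by auto
  thus ?thesis unfolding T by (simp add: sum.union_disjoint)
 qed
 define \<theta> where "\<theta> = \<bar>A n\<bar> / real n"
 \<comment> \<open>Rounded down so that all shifts stay within \<open>\<theta> * n / 2\<close>,
   while the \<open>d + 1\<close> terms of the block still number at least that many.\<close>
 define d where "d = nat \<lfloor>real n * \<theta> / 2\<rfloor>"
 have \<theta>0: "\<theta> >= 0" by (simp add: \<theta>_def)
 have d: "real d <= real n * \<theta> / 2" "real n * \<theta> / 2 <= real d + 1"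
  using \<theta>0 by (auto simp: d_def of_nat_nat floor_le_iff) linarith
 have nA: "\<bar>A n\<bar> = \<theta> * real n" using n by (simp add: \<theta>_def)
 have "\<theta>\<^sup>2 <= (6 + 3 * K)\<^sup>2 * E"
 proof (cases "A n >= 0")
  case True
  hence An: "A n = \<theta> * real n" using nA by simp
  have \<theta>K: "\<theta> <= K" using K(1)[of n] An n by simp
  have tm: "A i / (real i * real (Suc i)) >= (\<theta> * real n / 2) / ((2 + K) * real n * ((2 + K) * real n))"
   if i: "i \<in> {n..n + d}" for i
  proof -
   have "A i >= \<psi> n - real i" using mono[of n i] i A by simp
   moreover have "\<psi> n = real n + \<theta> * real n" using A[of n] An by simp
   moreover have "real i <= real n + real n * \<theta> / 2" using i d(1) by auto
   ultimately have Ai: "A i >= \<theta> * real n / 2" by (simp add: algebra_simps)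
   have "real n * \<theta> / 2 <= real n * K / 2" using \<theta>K by (intro divide_right_mono mult_left_mono) auto
   hence iu: "real i <= (2 + K) * real n" "real (Suc i) <= (2 + K) * real n"
   proof -
    have "real n * K >= 0" using K(2) by simp
    moreover have "(2 + K) * real n = 2 * real n + real n * K" by (simp add: algebra_simps)
    moreover have "real (Suc i) = real i + 1" by simp
    ultimately show "real i <= (2 + K) * real n" "real (Suc i) <= (2 + K) * real n"
     using \<open>real i <= real n + real n * \<theta> / 2\<close> \<open>real n * \<theta> / 2 <= real n * K / 2\<close> n by linarith+
   qed
   have "0 <= \<theta> * real n" using \<theta>0 by simp
   hence "A i >= 0" using Ai by linarith
   thus ?thesis
    using Ai iu i n \<theta>0 by (intro frac_le mult_mono) auto
  qed
  have "\<theta> * real n / 2 * ((\<theta> * real n / 2) / ((2 + K) * real n * ((2 + K) * real n)))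
    <= real (d + 1) * ((\<theta> * real n / 2) / ((2 + K) * real n * ((2 + K) * real n)))"
   using d(2) \<theta>0 K(2) by (intro mult_right_mono) (auto simp: mult.commute)
  also have "... = (\<Sum>i=n..n + d. (\<theta> * real n / 2) / ((2 + K) * real n * ((2 + K) * real n)))" by simp
  also have "... <= (\<Sum>i=n..n + d. A i / (real i * real (Suc i)))" by (intro sum_mono tm)
  also have "... = T (n + d) - T (n - 1)" using split[of n d] n by simp
  also have "... <= 2 * E" using E[of "n + d"] E[of "n - 1"] n by (auto simp: abs_le_iff of_nat_diff)
  finally have "\<theta>\<^sup>2 / (4 * (2 + K)\<^sup>2) <= 2 * E" using n by (simp add: power2_eq_square)
  hence "\<theta>\<^sup>2 <= 2 * E * (4 * (2 + K)\<^sup>2)" using K(2) by (subst (asm) pos_divide_le_eq) auto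
  also have "... = 8 * (2 + K)\<^sup>2 * E" by simp
  also have "... <= 9 * (2 + K)\<^sup>2 * E" using E0 by (intro mult_right_mono) auto
  also have "9 * (2 + K)\<^sup>2 = (6 + 3 * K)\<^sup>2" by (simp add: power2_eq_square algebra_simps)
  finally show ?thesis .
 next
  case False
  hence An: "A n = - \<theta> * real n" using nA by simp
  have \<psi>n: "\<psi> n = real n - \<theta> * real n" using A[of n] An by simp
  hence "\<theta> * real n <= 1 * real n" using nonneg[of n] by simp
  hence \<theta>1: "\<theta> <= 1" using n by simp
  have "real n * \<theta> / 2 <= real n * 1 / 2" using \<theta>1 by (intro divide_right_mono mult_left_mono) auto
  hence dn: "2 * real d <= real n" using d(1) by linarith
  hence dn': "d < n" using n by linarith
  have tm: "A i / (real i * real (Suc i)) <= - ((\<theta> * real n / 2) / (real n * (2 * real n)))"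
   if i: "i \<in> {n - d..n}" for i
  proof -
   have i0: "real i > 0" using i dn' by auto
   have "A i <= \<psi> n - real i" using mono[of i n] i A by simp
   moreover have "real i >= real n - real d" using i dn' by (auto simp: of_nat_diff)
   ultimately have Ai: "- A i >= \<theta> * real n / 2" using \<psi>n d(1) by (simp add: algebra_simps)
   have "0 <= \<theta> * real n" using \<theta>0 by simp
   hence "A i <= 0" using Ai by linarith
   hence "(\<theta> * real n / 2) / (real n * (2 * real n)) <= (- A i) / (real i * real (Suc i))"
    using Ai i i0 n \<theta>0 by (intro frac_le mult_mono) auto
   thus ?thesis by simp
  qed
  have "(\<Sum>i=n - d..n - d + d. A i / (real i * real (Suc i))) <= (\<Sum>i=n - d..n - d + d. - ((\<theta> * real n / 2) / (real n * (2 * real n))))"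
   using dn' by (intro sum_mono tm) auto
  also have "... = - (real (d + 1) * ((\<theta> * real n / 2) / (real n * (2 * real n))))" by simp
  also have "... <= - (\<theta> * real n / 2 * ((\<theta> * real n / 2) / (real n * (2 * real n))))"
   using d(2) \<theta>0 by (intro le_imp_neg_le mult_right_mono) (auto simp: mult.commute)
  also have "... = - (\<theta>\<^sup>2 / 8)" using n by (simp add: power2_eq_square)
  finally have "T (n - d + d) - T (n - d - 1) <= - (\<theta>\<^sup>2 / 8)" using split[of "n - d" d] dn' by simp
  moreover have "\<bar>T (n - d + d) - g\<bar> <= E" using dn' by (intro E) auto
  moreover have "\<bar>T (n - d - 1) - g\<bar> <= E" using dn' dn by (intro E) (auto simp: of_nat_diff)
  ultimately have "\<theta>\<^sup>2 / 8 <= 2 * E" by linarith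
  hence "\<theta>\<^sup>2 <= 36 * E" using E0 by simp
  also have "... <= (6 + 3 * K)\<^sup>2 * E"
   using power_mono[of 6 "6 + 3 * K" 2] K(2) E0 by (intro mult_right_mono) auto
  finally show ?thesis .
 qed
 hence "\<theta> <= sqrt ((6 + 3 * K)\<^sup>2 * E)" by (rule real_le_rsqrt)
 also have "... = (6 + 3 * K) * sqrt E" using K(2) by (simp add: real_sqrt_mult)
 finally show ?thesis using nA by (simp add: mult_right_mono)
qed

definition ap_error :: "nat => nat => nat => real" where
 "ap_error q a n = (\<Sum>m=1..n. ap_weight q a m - 1)"

context
 fixes q :: nat assumes q: "q > 1"
begin

lemma zeta_quot_bound: "\<exists>C>0. ALL s. 3/4 <= Re s --> Re s <= 2 --> norm (zeta_quot s) <= C * (2 + \<bar>Im s\<bar>)^15"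
proof -
 have hol: "zeta_quot holomorphic_on {s. Re s > 0}"
  unfolding zeta_quot_def[abs_def] by (rule pole_lemma_open[OF zeta1_holomorphic Re_gt_1_halfspace_open])
 have sub: "cball 1 (1/4) <= {s. Re s > 0}"
 proof
  fix s :: complex assume "s \<in> cball 1 (1/4)"
  hence "\<bar>Re s - 1\<bar> <= 1/4" using abs_Re_le_cmod[of "1 - s"] by (simp add: dist_norm abs_minus_commute)
  hence "Re s > 0" unfolding abs_le_iff by linarith
  thus "s \<in> {s. Re s > 0}" by simp
 qed
 have "compact (zeta_quot ` cball 1 (1/4))"
  using hol sub by (intro compact_continuous_image holomorphic_on_imp_continuous_on) (auto intro: holomorphic_on_subset)
 then obtain B1 where B1: "B1 > 0" "!!s. s \<in> cball 1 (1/4) ==> norm (zeta_quot s) <= B1"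
  using compact_imp_bounded bounded_pos by (metis (no_types, lifting) imageI)
 obtain Cz where Cz: "Cz > 0" "!!s. Re s >= 1/2 ==> norm (zeta1 s) <= Cz * (1 + norm s)^2" using zeta1_bound by blast
 have "norm (zeta_quot s) <= (B1 + 16 * Cz + 4) * (2 + \<bar>Im s\<bar>)^15" if s: "3/4 <= Re s" "Re s <= 2" for s
 proof -
  define \<tau> where "\<tau> = 2 + \<bar>Im s\<bar>"
  have \<tau>: "1 <= \<tau>^15" "\<tau>^2 <= \<tau>^15" "\<tau> >= 2" by (auto simp: \<tau>_def intro!: one_le_power power_increasing)
  show ?thesis
  proof (cases "s \<in> cball 1 (1/4)")
   case True
   hence "norm (zeta_quot s) <= (B1 + 16 * Cz + 4) * 1" using B1(2)[of s] Cz(1) by simp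
   also have "... <= (B1 + 16 * Cz + 4) * \<tau>^15" using \<tau> B1(1) Cz(1) by (intro mult_left_mono) auto
   finally show ?thesis by (simp add: \<tau>_def)
  next
   case False
   hence far: "norm (s - 1) > 1/4" by (simp add: dist_norm norm_minus_commute)
   hence "norm (zeta_quot s) = norm (zeta1 s - 1) / norm (s - 1)" by (auto simp: zeta_quot_def zeta1_1 norm_divide)
   also have "... <= norm (zeta1 s - 1) / (1/4)" using far by (intro divide_left_mono) auto
   also have "... <= 4 * (norm (zeta1 s) + 1)" using norm_triangle_ineq4[of "zeta1 s" 1] by simp
   also have "... <= 4 * (Cz * (2 * \<tau>)^2 + 1)"
   proof -
    have "1 + norm s <= 2 * \<tau>" using cmod_le[of s] s by (simp add: \<tau>_def)
    hence "Cz * (1 + norm s)^2 <= Cz * (2 * \<tau>)^2" using Cz(1) by (intro mult_left_mono power_mono) auto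
    moreover have "norm (zeta1 s) <= Cz * (1 + norm s)^2" using s by (intro Cz(2)) simp
    ultimately have "norm (zeta1 s) <= Cz * (2 * \<tau>)^2" by (rule order_trans[rotated])
    thus ?thesis by simp
   qed
   also have "... = 16 * Cz * \<tau>^2 + 4 * 1" by (simp add: power_mult_distrib)
   also have "... <= 16 * Cz * \<tau>^15 + 4 * \<tau>^15" using \<tau> Cz(1) by (intro add_mono mult_left_mono) auto
   also have "... <= B1 * \<tau>^15 + 16 * Cz * \<tau>^15 + 4 * \<tau>^15" using B1(1) \<tau> by simp
   finally show ?thesis by (simp add: \<tau>_def algebra_simps)
  qed
 qed
 thus ?thesis using B1(1) Cz(1) by (intro exI[of _ "B1 + 16 * Cz + 4"]) auto
qed

text \<open>Uniform over the finitely many characters. The exponent 15 of the size bound is 3 from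
  the derivative plus 12 from the reciprocal of the lower bound.\<close>

lemma strip_bounds:
 assumes a: "coprime a q"
 shows "\<exists>\<kappa>>0. \<exists>C>0. \<kappa> <= 1/4 & (ALL s. \<bar>Re s - 1\<bar> <= \<kappa> / (2 + \<bar>Im s\<bar>)^15 -->
  (\<forall>\<chi>. dirichlet_char q \<chi> --> Lreg q \<chi> s ~= 0) & norm (log_deriv_sum q a s) <= C * (2 + \<bar>Im s\<bar>)^15)"
proof -
 let ?X = "{\<chi>. dirichlet_char q \<chi>}"
 have fin: "finite ?X" by (rule finite_dirichlet_chars[OF q])
 have ne: "?X ~= {}" using dirichlet_char_trivial[OF q] by auto
 have "\<exists>\<kappa> C. \<kappa> > 0 & C > 0 & \<kappa> <= 1/4 & (ALL s. \<bar>Re s - 1\<bar> <= \<kappa> / (2 + \<bar>Im s\<bar>)^15 -->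
  Lreg q \<chi> s ~= 0 & norm (deriv (Lreg q \<chi>) s / Lreg q \<chi> s) <= C * (2 + \<bar>Im s\<bar>)^15)" if \<chi>: "dirichlet_char q \<chi>" for \<chi>
 proof -
  obtain \<kappa> c where \<kappa>: "\<kappa> > 0" "\<kappa> <= 1/4" and c: "c > 0"
   and low: "!!s. \<bar>Re s - 1\<bar> <= \<kappa> / (2 + \<bar>Im s\<bar>)^15 ==> norm (Lreg q \<chi> s) >= c / (2 + \<bar>Im s\<bar>)^12"
   using Lreg_lower_bound[OF q \<chi>] by blast
  obtain D where D: "D > 0" "!!s. 3/4 <= Re s ==> Re s <= 2 ==> norm (deriv (Lreg q \<chi>) s) <= D * (2 + \<bar>Im s\<bar>)^3"
   using Lreg_deriv_bound[OF q \<chi>] by blast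
  have "Lreg q \<chi> s ~= 0 & norm (deriv (Lreg q \<chi>) s / Lreg q \<chi> s) <= (D / c) * (2 + \<bar>Im s\<bar>)^15"
   if s: "\<bar>Re s - 1\<bar> <= \<kappa> / (2 + \<bar>Im s\<bar>)^15" for s
  proof -
   define \<tau> where "\<tau> = 2 + \<bar>Im s\<bar>"
   have \<tau>: "\<tau> > 0" "1 <= \<tau>^15" by (auto simp: \<tau>_def intro!: one_le_power)
   have "\<kappa> / \<tau>^15 <= \<kappa> / 1" using \<tau> \<kappa> by (intro divide_left_mono) auto
   hence "\<bar>Re s - 1\<bar> <= 1/4" using s \<kappa> by (simp add: \<tau>_def)
   hence re: "3/4 <= Re s" "Re s <= 2" unfolding abs_le_iff by linarith+
   have lo: "norm (Lreg q \<chi> s) >= c / \<tau>^12" using low[OF s] by (simp add: \<tau>_def)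
   have pos: "c / \<tau>^12 > 0" using c \<tau> by simp
   have "norm (deriv (Lreg q \<chi>) s / Lreg q \<chi> s) <= (D * \<tau>^3) / (c / \<tau>^12)"
    unfolding norm_divide using D(2)[OF re] lo pos D(1) \<tau> by (intro frac_le) (auto simp: \<tau>_def)
   also have "... = (D / c) * \<tau>^15" by (simp flip: power_add)
   finally show ?thesis using lo pos by (auto simp: \<tau>_def)
  qed
  thus ?thesis using \<kappa> c D(1) by (intro exI[of _ \<kappa>] exI[of _ "D / c"]) auto
 qed
 hence "\<forall>\<chi>\<in>?X. \<exists>\<kappa>. EX C. \<kappa> > 0 & C > 0 & \<kappa> <= 1/4 & (ALL s. \<bar>Re s - 1\<bar> <= \<kappa> / (2 + \<bar>Im s\<bar>)^15 -->
  Lreg q \<chi> s ~= 0 & norm (deriv (Lreg q \<chi>) s / Lreg q \<chi> s) <= C * (2 + \<bar>Im s\<bar>)^15)" by simp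
 from bchoice[OF this] obtain kf where "\<forall>\<chi>\<in>?X. EX C. kf \<chi> > 0 & C > 0 & kf \<chi> <= 1/4 & (ALL s. \<bar>Re s - 1\<bar> <= kf \<chi> / (2 + \<bar>Im s\<bar>)^15 -->
  Lreg q \<chi> s ~= 0 & norm (deriv (Lreg q \<chi>) s / Lreg q \<chi> s) <= C * (2 + \<bar>Im s\<bar>)^15)" by blast
 from bchoice[OF this] obtain Cf where kC: "\<forall>\<chi>\<in>?X. kf \<chi> > 0 & Cf \<chi> > 0 & kf \<chi> <= 1/4 & (ALL s. \<bar>Re s - 1\<bar> <= kf \<chi> / (2 + \<bar>Im s\<bar>)^15 -->
  Lreg q \<chi> s ~= 0 & norm (deriv (Lreg q \<chi>) s / Lreg q \<chi> s) <= Cf \<chi> * (2 + \<bar>Im s\<bar>)^15)" by blast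
 define \<kappa> where "\<kappa> = Min (kf ` ?X)"
 have \<kappa>le: "\<kappa> <= kf \<chi>" if "\<chi> \<in> ?X" for \<chi> unfolding \<kappa>_def using fin that by (intro Min_le) auto
 have \<kappa>0: "\<kappa> > 0" unfolding \<kappa>_def using fin ne kC by (subst Min_gr_iff) auto
 have \<kappa>4: "\<kappa> <= 1/4" using \<kappa>le[of "trivial_char q"] kC dirichlet_char_trivial[OF q] by force
 obtain Cz where Cz: "Cz > 0" "!!s. 3/4 <= Re s ==> Re s <= 2 ==> norm (zeta_quot s) <= Cz * (2 + \<bar>Im s\<bar>)^15"
  using zeta_quot_bound by blast
 define C where "C = Cz + (\<Sum>\<chi>\<in>?X. Cf \<chi>)"
 have "C > 0" unfolding C_def using Cz(1) kC by (intro add_pos_nonneg sum_nonneg) (auto intro: less_imp_le)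
 moreover have "(\<forall>\<chi>. dirichlet_char q \<chi> --> Lreg q \<chi> s ~= 0) & norm (log_deriv_sum q a s) <= C * (2 + \<bar>Im s\<bar>)^15"
  if s: "\<bar>Re s - 1\<bar> <= \<kappa> / (2 + \<bar>Im s\<bar>)^15" for s
 proof -
  define \<tau> where "\<tau> = 2 + \<bar>Im s\<bar>"
  have \<tau>: "\<tau> > 0" "1 <= \<tau>^15" by (auto simp: \<tau>_def intro!: one_le_power)
  have "\<kappa> / \<tau>^15 <= \<kappa> / 1" using \<tau> \<kappa>0 by (intro divide_left_mono) auto
  hence "\<bar>Re s - 1\<bar> <= 1/4" using s \<kappa>4 by (simp add: \<tau>_def)
  hence re: "3/4 <= Re s" "Re s <= 2" unfolding abs_le_iff by linarith+
  have each: "Lreg q \<chi> s ~= 0 & norm (deriv (Lreg q \<chi>) s / Lreg q \<chi> s) <= Cf \<chi> * \<tau>^15" if "\<chi> \<in> ?X" for \<chi>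
  proof -
   have "\<kappa> / \<tau>^15 <= kf \<chi> / \<tau>^15" using \<kappa>le[OF that] \<tau> by (intro divide_right_mono) auto
   hence "\<bar>Re s - 1\<bar> <= kf \<chi> / (2 + \<bar>Im s\<bar>)^15" using s by (simp add: \<tau>_def)
   thus ?thesis using kC that by (simp add: \<tau>_def)
  qed
  have "norm (\<Sum>\<chi>\<in>?X. cnj (\<chi> a) * (deriv (Lreg q \<chi>) s / Lreg q \<chi> s)) <= (\<Sum>\<chi>\<in>?X. Cf \<chi> * \<tau>^15)"
  proof (rule sum_norm_le)
   fix \<chi> assume \<chi>: "\<chi> \<in> ?X"
   have "norm (cnj (\<chi> a) * (deriv (Lreg q \<chi>) s / Lreg q \<chi> s)) <= 1 * (Cf \<chi> * \<tau>^15)"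
    unfolding norm_mult using each[OF \<chi>] dirichlet_char_norm_le[OF q, of \<chi> a] \<chi> by (intro mult_mono) auto
   thus "norm (cnj (\<chi> a) * (deriv (Lreg q \<chi>) s / Lreg q \<chi> s)) <= Cf \<chi> * \<tau>^15" by simp
  qed
  moreover have "norm (zeta_quot s) <= Cz * \<tau>^15" using Cz(2)[OF re] by (simp add: \<tau>_def)
  moreover have "norm (log_deriv_sum q a s) <= norm (zeta_quot s) + norm (\<Sum>\<chi>\<in>?X. cnj (\<chi> a) * (deriv (Lreg q \<chi>) s / Lreg q \<chi> s))"
   unfolding log_deriv_sum_def using norm_triangle_ineq4[of "- zeta_quot s"] by simp
  ultimately have "norm (log_deriv_sum q a s) <= C * \<tau>^15" by (simp add: C_def distrib_right sum_distrib_right)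
  thus ?thesis using each by (simp add: \<tau>_def)
 qed
 ultimately show ?thesis using \<kappa>0 \<kappa>4 by (intro exI[of _ \<kappa>] conjI exI[of _ C]) auto
qed

text \<open>Newman's bound with \<open>R\<close> the 32nd root of \<open>ln Y\<close> and
  \<open>\<delta>\<close> of order \<open>1 / R^15\<close>, the width of the zero-free strip at
  height \<open>R\<close>. Since \<open>32 = 15 + 17\<close>, the product
  \<open>\<delta> * ln Y\<close> has order \<open>R^17\<close>, so \<open>Y powr (-\<delta>)\<close>
  outweighs the powers of \<open>R\<close> coming from \<open>B\<close> and
  \<open>1 / \<delta>\<close>, and all three error terms are \<open>O(1 / R)\<close>.\<close>

lemma ap_error_smoothed:
 assumes a: "coprime a q"
 shows "\<exists>C>0. \<exists>g0::real. \<forall>N\<ge>2. \<bar>(\<Sum>n=1..N. ap_error q a n / (real n * real (Suc n))) - g0\<bar> <= C / root 32 (ln (real N + 1))"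
proof -
 obtain \<kappa> C where \<kappa>: "\<kappa> > 0" "\<kappa> <= 1/4" and C: "C > 0"
  and strip: "!!s. \<bar>Re s - 1\<bar> <= \<kappa> / (2 + \<bar>Im s\<bar>)^15 ==>
   (\<forall>\<chi>. dirichlet_char q \<chi> --> Lreg q \<chi> s ~= 0) & norm (log_deriv_sum q a s) <= C * (2 + \<bar>Im s\<bar>)^15"
  using strip_bounds[OF a] by blast
 define K where "K = 5 * real (totient q) + 1"
 have A: "\<bar>ap_error q a n\<bar> <= K * real n" for n
  unfolding ap_error_def K_def by (rule ap_weight_partial_bound[OF q])
 define g where "g = (%z. log_deriv_sum q a (1 + z) / (1 + z))"
 \<comment> \<open>The domain of \<open>g\<close> reaches real part \<open>-2 * \<delta>\<close> and
   height \<open>2 * R\<close>; \<open>2 + 2 * R <= 4 * R\<close> explains the factor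
   \<open>4^15\<close>, and the 2 covers the doubled depth.\<close>
 define \<kappa>1 where "\<kappa>1 = \<kappa> / (2 * 4^15)"
 have \<kappa>1: "\<kappa>1 > 0" "\<kappa>1 <= 1/4" "2 * \<kappa>1 = \<kappa> / 4^15" using \<kappa> by (auto simp: \<kappa>1_def)
 define C1 where "C1 = 2 * K + norm (g 0) + 4 * C * 3^15 + 8 * C * 3^15 / \<kappa>1^3"
 have "norm ((\<Sum>n=1..N. of_real (ap_error q a n) * npow_int n 1) - g 0) <= C1 / root 32 (ln (real N + 1))" if N: "N >= 2" for N
 proof -
  define Y where "Y = real (Suc N)"
  define R where "R = root 32 (ln Y)"
  have Y: "Y >= 3" using N by (simp add: Y_def)
  have lnY: "ln Y >= 1" using Y exp_le by (subst ln_ge_iff) auto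
  have R1: "R >= 1" using lnY by (simp add: R_def)
  have R32: "R ^ 32 = ln Y" using lnY by (simp add: R_def)
  have Rp: "R^k >= 1" for k using R1 by (rule one_le_power)
  define \<delta> where "\<delta> = \<kappa>1 / R^15"
  have \<delta>: "\<delta> > 0" using \<kappa>1 R1 by (simp add: \<delta>_def)
  have "\<delta> <= \<kappa>1 / 1" unfolding \<delta>_def using \<kappa>1 R1 Rp[of 15] by (intro divide_left_mono) auto
  with \<kappa>1(2) \<delta> have \<delta>: "\<delta> > 0" "\<delta> <= 1/4" by auto
  have in_strip: "\<bar>Re (1 + z) - 1\<bar> <= \<kappa> / (2 + \<bar>Im (1 + z)\<bar>)^15" if "\<bar>Re z\<bar> <= 2 * \<delta>" "\<bar>Im z\<bar> <= 2 * R" for z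
  proof -
   have "(2 + \<bar>Im z\<bar>)^15 <= (4 * R)^15" using that R1 by (intro power_mono) auto
   hence "\<kappa> / (4 * R)^15 <= \<kappa> / (2 + \<bar>Im z\<bar>)^15" using \<kappa> R1 by (intro divide_left_mono) (auto intro!: mult_pos_pos zero_less_power)
   moreover have "2 * \<delta> = \<kappa> / (4 * R)^15" by (simp only: \<delta>_def power_mult_distrib times_divide_eq_right \<kappa>1(3) divide_divide_eq_left)
   ultimately show ?thesis using that(1) by simp
  qed
  define B where "B = 2 * C * (3 * R)^15"
  define S where "S = (%z. \<Sum>n=1..N. of_real (ap_error q a n) * npow_int n (1 + z))"
  define U where "U = {z. Re z > -2 * \<delta> & \<bar>Im z\<bar> < 2 * R}"
  have "norm (S 0 - g 0) <= (2 * K + norm (g 0)) / R + 2 * B * \<delta>^2 / R^2 + 2 * B * R * Y powr (-\<delta>) / \<delta>"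
  proof (rule newman_bound)
   show "R > 0" "\<delta> > 0" "\<delta> <= R" "Y >= 3" "K >= 0" using R1 \<delta> Y by (auto simp: K_def)
   have "(%z. npow_int n (1 + z)) holomorphic_on UNIV" for n
    by (rule holomorphic_on_compose_gen[of "%z. 1 + z" UNIV "npow_int n" UNIV, unfolded o_def])
     (auto intro!: holomorphic_intros npow_int_holomorphic)
   thus "S holomorphic_on UNIV" unfolding S_def by (intro holomorphic_intros) auto
   have nz: "Lreg q \<chi> (1 + z) ~= 0" if "z \<in> U" "dirichlet_char q \<chi>" for z \<chi>
   proof (cases "Re z > 0")
    case True
    thus ?thesis using Lreg_nonzero_right[OF q that(2)] by simp
   next
    case False
    hence "\<bar>Re (1 + z) - 1\<bar> <= \<kappa> / (2 + \<bar>Im (1 + z)\<bar>)^15" using that(1) \<delta> by (intro in_strip) (auto simp: U_def)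
    thus ?thesis using strip that(2) by blast
   qed
   have ReU: "Re (1 + z) > 0" if "z \<in> U" for z using that \<delta> by (simp add: U_def)
   have img: "(%z. 1 + z) ` U <= {s. Re s > 0}" using ReU by auto
   have Uo: "open U"
   proof -
    have "U = {z. Re z > -2 * \<delta>} \<inter> {z. Im z < 2 * R} \<inter> {z. Im z > - 2 * R}" by (auto simp: U_def abs_less_iff)
    thus ?thesis by (auto intro!: open_Int open_halfspace_Re_gt open_halfspace_Im_gt open_halfspace_Im_lt)
   qed
   have comp: "(%z. f (1 + z)) holomorphic_on U" if "f holomorphic_on {s. Re s > 0}" for f
    by (rule holomorphic_on_compose_gen[of "%z. 1 + z" U f "{s. Re s > 0}", unfolded o_def])
     (use that img in \<open>auto intro!: holomorphic_intros\<close>)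
   have "zeta_quot holomorphic_on {s. Re s > 0}"
    unfolding zeta_quot_def[abs_def] by (rule pole_lemma_open[OF zeta1_holomorphic Re_gt_1_halfspace_open])
   hence "(%z. log_deriv_sum q a (1 + z)) holomorphic_on U"
    unfolding log_deriv_sum_def
    by (intro holomorphic_intros comp holomorphic_deriv[OF Lreg_holomorphic[OF q] Re_gt_1_halfspace_open] Lreg_holomorphic[OF q])
     (use nz in auto)
   thus "g holomorphic_on {z. Re z > -2 * \<delta> & \<bar>Im z\<bar> < 2 * R}"
    unfolding g_def U_def[symmetric]
   proof (intro holomorphic_intros)
    show "1 + z ~= 0" if "z \<in> U" for z
     using ReU[OF that] by (metis less_irrefl zero_complex.sel(1))
   qed
   show "norm (S z) <= K * Y powr (- Re z) / \<bar>Re z\<bar>" if "Re z < 0" for z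
    unfolding S_def Y_def by (rule npow_int_sums(1)[OF A that])
   show "norm (S z - g z) <= K * Y powr (- Re z) / Re z" if z: "Re z > 0" for z
    unfolding S_def Y_def
   proof (rule npow_int_sums(2)[OF A z])
    have s: "Re (1 + z) > 1" using z by simp
    have "(%n. of_real (\<Sum>m=1..n. ap_weight q a m - 1) * npow_int n (1 + z)) sums (dseries (%n. of_real (ap_weight q a n - 1)) (1 + z) / (1 + z))"
     by (rule dseries_partial_summation[OF _ s]) (use ap_weight_partial_bound[OF q] ap_weight_dseries(1)[OF q a s] in auto)
    thus "(%n. of_real (ap_error q a n) * npow_int n (1 + z)) sums g z"
     unfolding ap_weight_dseries(2)[OF q a s] g_def ap_error_def .
   qed
   show "norm (g z) <= B" if z: "-\<delta> <= Re z" "Re z <= 0" "\<bar>Im z\<bar> <= R" for z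
   proof -
    have "norm (log_deriv_sum q a (1 + z)) <= C * (2 + \<bar>Im (1 + z)\<bar>)^15"
     using strip[OF in_strip[of z]] z \<delta> R1 by auto
    also have "... <= C * (3 * R)^15" using z R1 C by (intro mult_left_mono power_mono) auto
    finally have 1: "norm (log_deriv_sum q a (1 + z)) <= C * (3 * R)^15" .
    have 2: "norm (1 + z) >= 1/2" using abs_Re_le_cmod[of "1 + z"] z \<delta> by simp
    have "norm (g z) <= C * (3 * R)^15 / (1/2)"
     unfolding g_def norm_divide using 1 2 C R1 by (intro frac_le) auto
    thus ?thesis by (simp add: B_def)
   qed
  qed
  also have "2 * B * \<delta>^2 / R^2 <= (4 * C * 3^15) / R"
  proof -
   have "2 * B * \<delta>^2 / R^2 = (4 * C * 3^15) * (\<kappa>1^2 / R^17)"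
    using R1 by (simp add: B_def \<delta>_def power_mult_distrib power_divide field_simps flip: power_add power_mult)
   also have "\<kappa>1^2 / R^17 <= 1 / R"
    using \<kappa>1 R1 power_increasing[of 1 17 R] by (intro frac_le) (auto simp: power_le_one)
   finally show ?thesis using C by (simp add: mult_left_mono)
  qed
  also have "2 * B * R * Y powr (-\<delta>) / \<delta> <= (8 * C * 3^15 / \<kappa>1^3) / R"
  proof -
   define u where "u = \<kappa>1 * R^17"
   have u0: "u > 0" using \<kappa>1 R1 by (simp add: u_def)
   have "\<delta> * ln Y = u" unfolding R32[symmetric] \<delta>_def u_def using R1 by (simp add: field_simps flip: power_add)
   hence Yu: "Y powr (-\<delta>) = exp (- u)" using Y by (simp add: powr_def)
   have "u\<^sup>2 / 2 <= exp u" using exp_lower_Taylor_quadratic[of u] u0 by simp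
   hence "exp (- u) <= 2 / u\<^sup>2" using u0 by (simp add: exp_minus field_simps)
   hence "2 * B * R * Y powr (-\<delta>) / \<delta> <= 2 * B * R * (2 / u\<^sup>2) / \<delta>"
    unfolding Yu using R1 C \<delta> by (intro divide_right_mono mult_left_mono) (auto simp: B_def)
   also have "... = (8 * C * 3^15 / \<kappa>1^3) * (R^31 / R^34)"
    using R1 \<kappa>1 by (simp add: B_def \<delta>_def u_def power_mult_distrib field_simps power2_eq_square power3_eq_cube flip: power_add power_Suc)
   also have "... <= (8 * C * 3^15 / \<kappa>1^3) * (1 / R)"
   proof (intro mult_left_mono)
    have "R^31 * R <= R^34" using power_increasing[of 32 34 R] R1 by (simp flip: power_Suc2)
    thus "R^31 / R^34 <= 1 / R" using R1 by (simp add: divide_simps)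
   qed (use C \<kappa>1 in auto)
   finally show ?thesis by simp
  qed
  finally have "norm (S 0 - g 0) <= C1 / R" by (simp add: C1_def add_divide_distrib)
  thus ?thesis by (simp add: S_def R_def Y_def add_ac)
 qed
 note bound = this
 have ni: "npow_int n 1 = of_real (1 / (real n * real (Suc n)))" if "n > 0" for n
 proof -
  have "npow n 1 = of_real (1 / real n)" "npow (Suc n) 1 = of_real (1 / real (Suc n))"
   using that by (simp_all add: npow_def powr_minus divide_inverse)
  hence "npow_int n 1 = of_real (1 / real n - 1 / real (Suc n))" using npow_int_eq[of n 1] that by simp
  also have "1 / real n - 1 / real (Suc n) = 1 / (real n * real (Suc n))" using that by (simp add: field_simps)
  finally show ?thesis .
 qed
 have "\<bar>(\<Sum>n=1..N. ap_error q a n / (real n * real (Suc n))) - Re (g 0)\<bar> <= C1 / root 32 (ln (real N + 1))" if N: "N >= 2" for N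
 proof -
  have "(\<Sum>n=1..N. of_real (ap_error q a n) * npow_int n 1) = complex_of_real (\<Sum>n=1..N. ap_error q a n / (real n * real (Suc n)))"
   unfolding of_real_sum by (intro sum.cong) (auto simp: ni simp del: of_nat_Suc)
  hence "\<bar>(\<Sum>n=1..N. ap_error q a n / (real n * real (Suc n))) - Re (g 0)\<bar> <= norm ((\<Sum>n=1..N. of_real (ap_error q a n) * npow_int n 1) - g 0)"
   using abs_Re_le_cmod[of "(\<Sum>n=1..N. of_real (ap_error q a n) * npow_int n 1) - g 0"] by simp
  also have "... <= C1 / root 32 (ln (real N + 1))" by (rule bound[OF N])
  finally show ?thesis .
 qed
 moreover have "C1 > 0" using C \<kappa>1 by (simp add: C1_def K_def add_nonneg_pos)
 ultimately show ?thesis by (intro exI[of _ C1] conjI exI[of _ "Re (g 0)"]) auto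
qed

text \<open>\<open>unsmooth_monotone\<close> takes the square root of an error with exponent 1/32,
  hence 1/64. For \<open>n < 6\<close> the logarithmic factor is at least 1/2 and the linear bound
  is enough.\<close>

lemma ap_error_bound:
 assumes a: "coprime a q"
 shows "\<exists>C>0. \<forall>n\<ge>2. \<bar>ap_error q a n\<bar> <= C * real n * (ln (real n)) powr (-1/64)"
proof -
 obtain C g0 where C: "C > 0" and sm: "!!N. N >= 2 ==> \<bar>(\<Sum>n=1..N. ap_error q a n / (real n * real (Suc n))) - g0\<bar> <= C / root 32 (ln (real N + 1))"
  using ap_error_smoothed[OF a] by blast
 define K where "K = 5 * real (totient q) + 1"
 have A: "\<bar>ap_error q a n\<bar> <= K * real n" for n
  unfolding ap_error_def K_def by (rule ap_weight_partial_bound[OF q])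
 define C' where "C' = (6 + 3 * K) * sqrt (2 * C) + 2 * K"
 have K0: "K > 0" by (simp add: K_def add_nonneg_pos)
 have wn: "ap_weight q a m >= 0" for m by (simp add: ap_weight_def mangoldt_nonneg)
 have "\<bar>ap_error q a n\<bar> <= C' * real n * (ln (real n)) powr (-1/64)" if n: "n >= 2" for n
 proof (cases "n >= 6")
  case True
  have ln1: "ln (real n) >= 1" using True exp_le by (subst ln_ge_iff) auto
  define E where "E = 2 * C / root 32 (ln (real n))"
  have "\<bar>ap_error q a n\<bar> <= (6 + 3 * K) * sqrt E * real n"
  proof (rule unsmooth_monotone[where \<psi> = "%n. \<Sum>m=1..n. ap_weight q a m" and T = "%N. \<Sum>n=1..N. ap_error q a n / (real n * real (Suc n))" and g = g0])
   show "(\<Sum>i=1..m. ap_weight q a i) <= (\<Sum>i=1..n. ap_weight q a i)" if "m <= n" for m n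
    using that by (intro sum_mono2 wn) auto
   show "0 <= (\<Sum>m=1..n. ap_weight q a m)" for n by (intro sum_nonneg wn)
   show "ap_error q a n = (\<Sum>m=1..n. ap_weight q a m) - real n" for n by (simp add: ap_error_def sum_subtractf)
   show "ap_error q a n <= K * real n" for n using A[of n] by simp
   fix m :: nat assume m: "real m + 1 >= real n / 2"
   hence m2: "m >= 2" using True by linarith
   have "ln (real n) / 2 <= ln (real m + 1)"
   proof -
    have "ln (real n / 2) <= ln (real m + 1)" using m True by (subst ln_le_cancel_iff) auto
    moreover have "ln (real n / 2) = ln (real n) - ln 2" using True by (simp add: ln_div)
    moreover have "2 * ln 2 <= ln (real n)"
    proof -
     have "ln ((2::real)^2) <= ln (real n)" using True by (subst ln_le_cancel_iff) auto
     thus ?thesis by (simp only: ln_realpow)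
    qed
    ultimately show ?thesis by linarith
   qed
   hence "root 32 (ln (real n) / 2) <= root 32 (ln (real m + 1))" by simp
   moreover have "root 32 (ln (real n)) / 2 <= root 32 (ln (real n) / 2)"
   proof -
    have "root 32 (2::real) <= 2"
    proof -
     have "root 32 (2::real) <= root 32 (2^32)" by (subst real_root_le_iff) auto
     also have "... = 2" by (rule real_root_power_cancel) auto
     finally show ?thesis .
    qed
    moreover have "root 32 (2::real) > 0" by simp
    moreover have "root 32 (ln (real n)) >= 0" using ln1 by simp
    ultimately show ?thesis unfolding real_root_divide by (intro divide_left_mono) auto
   qed
   moreover have "root 32 (ln (real n)) > 0" using ln1 by simp
   ultimately have "root 32 (ln (real n)) / 2 <= root 32 (ln (real m + 1))" "0 < root 32 (ln (real n)) / 2" by linarith+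
   hence "C / root 32 (ln (real m + 1)) <= C / (root 32 (ln (real n)) / 2)"
    using C by (intro divide_left_mono mult_pos_pos) linarith+
   also have "... = E" by (simp add: E_def)
   finally show "\<bar>(\<Sum>n=1..m. ap_error q a n / (real n * real (Suc n))) - g0\<bar> <= E" using sm[OF m2] by linarith
  qed (use n K0 in auto)
  also have "sqrt E = sqrt (2 * C) * (ln (real n)) powr (-1/64)"
  proof -
   define X where "X = (ln (real n)) powr (-1/64)"
   have "root 32 (ln (real n)) = (ln (real n)) powr (1/32)" using ln1 by (subst root_powr_inverse) auto
   hence "1 / root 32 (ln (real n)) = (ln (real n)) powr (-(1/32))" by (simp only: powr_minus_divide)
   also have "... = (ln (real n)) powr (-1/64 + -1/64)" by (rule arg_cong[where f = "%t. _ powr t"]) simp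
   also have "... = X * X" unfolding X_def by (rule powr_add)
   also have "... = X\<^sup>2" by (rule power2_eq_square[symmetric])
   finally have "1 / root 32 (ln (real n)) = X\<^sup>2" .
   have "E = (2 * C) * (1 / root 32 (ln (real n)))" by (simp add: E_def)
   also have "1 / root 32 (ln (real n)) = X\<^sup>2" by fact
   finally have E2: "E = (2 * C) * X\<^sup>2" .
   have "sqrt E = sqrt (2 * C) * sqrt (X\<^sup>2)" unfolding E2 by (rule real_sqrt_mult)
   also have "sqrt (X\<^sup>2) = X" by (simp add: X_def)
   finally show ?thesis by (simp only: X_def)
  qed
  finally have "\<bar>ap_error q a n\<bar> <= ((6 + 3 * K) * sqrt (2 * C)) * (real n * (ln (real n)) powr (-1/64))"
   by (simp only: mult_ac)
  also have "... <= C' * (real n * (ln (real n)) powr (-1/64))" using K0 by (intro mult_right_mono) (auto simp: C'_def)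
  finally show ?thesis by simp
 next
  case False
  have l0: "ln (real n) > 0" using n by simp
  have l2: "ln (real n) <= 2"
  proof -
   have "real n <= exp 2" using False exp_lower_Taylor_quadratic[of 2] by simp
   hence "ln (real n) <= ln (exp 2)" using n by (subst ln_le_cancel_iff) auto
   thus ?thesis by simp
  qed
  have "(ln (real n)) powr (-1/64) >= 2 powr (-1/64)" using l0 l2 by (intro powr_mono2') auto
  moreover have "(2::real) powr (-1/64) >= 2 powr (-1)" by (intro powr_mono) auto
  ultimately have "1 <= 2 * (ln (real n)) powr (-1/64)" by (simp add: powr_minus)
  hence "K * real n * 1 <= K * real n * (2 * (ln (real n)) powr (-1/64))" using K0 by (intro mult_left_mono) auto
  also have "... = 2 * K * (real n * (ln (real n)) powr (-1/64))" by simp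
  also have "... <= C' * (real n * (ln (real n)) powr (-1/64))" using K0 C by (intro mult_right_mono) (auto simp: C'_def)
  finally show ?thesis using A[of n] by simp
 qed
 moreover have "C' > 0" using K0 C by (simp add: C'_def add_nonneg_pos)
 ultimately show ?thesis by blast
qed

end

section \<open>From prime sums to reciprocal sums\<close>

definition prime_sum :: "(nat => real) => real => real" where
 "prime_sum f x = (\<Sum>p | prime p & real p <= x. f p)"

abbreviation theta_sum :: "(nat => real) => real => real" where
 "theta_sum w \<equiv> prime_sum (%p. w p * ln (real p))"

abbreviation recip_sum :: "(nat => real) => real => real" where
 "recip_sum w \<equiv> prime_sum (%p. w p / real p)"

lemma finite_primes_le: "finite {p::nat. prime p & real p <= x}"
 by (rule finite_subset[of _ "{..nat \<lfloor>x\<rfloor>}"]) (auto simp: le_nat_floor)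

text \<open>Two forms of Mertens' theorem: a bounded error valid down to \<open>u = 1\<close>, where
  \<open>1 + ln u\<close> keeps the iterated logarithm meaningful, and a precise form with constant
  \<open>b\<close>. Its slow rate matches the other errors of the recursion. The threshold 27
  exceeds \<open>exp 3\<close>, so that \<open>ln (ln u) >= 1\<close>.\<close>

definition mertens_weight :: "(nat => real) => real => real => bool" where
 "mertens_weight w b K \<longleftrightarrow> K >= 1 & (ALL p. 0 <= w p & w p <= K) &
  (\<forall>u\<ge>1. \<bar>recip_sum w u - ln (1 + ln u)\<bar> <= K) &
  (\<forall>u\<ge>27. \<bar>recip_sum w u - (ln (ln u) + b)\<bar> <= K / ln (ln u))"

definition pnt_weight :: "(nat => real) => real => bool" where
 "pnt_weight w K \<longleftrightarrow> (\<forall>u\<ge>1. \<bar>theta_sum w u - u\<bar> <= K * u * (1 + ln u) powr (-1/64))"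

lemma prime_sum_nat: "x >= 0 ==> prime_sum f x = prime_sum f (real (nat \<lfloor>x\<rfloor>))"
proof -
 assume x: "x >= 0"
 have "real p <= x \<longleftrightarrow> real p <= real (nat \<lfloor>x\<rfloor>)" for p :: nat
  using le_floor_iff[of "int p" x] x by auto
 thus ?thesis unfolding prime_sum_def by simp
qed

lemma prime_sum_Suc: "prime_sum f (real (Suc n)) = prime_sum f (real n) + (if prime (Suc n) then f (Suc n) else 0)"
proof -
 have "{p. prime p & real p <= real (Suc n)} = (if prime (Suc n) then insert (Suc n) {p. prime p & real p <= real n} else {p. prime p & real p <= real n})"
  by (auto simp: le_Suc_eq simp del: of_nat_Suc)
 thus ?thesis unfolding prime_sum_def using finite_primes_le[of "real n"] by (auto simp: add.commute)
qed

lemma prime_sum_mono: "(!!p. 0 <= f p) ==> x <= y ==> prime_sum f x <= prime_sum f y"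
 unfolding prime_sum_def by (intro sum_mono2 finite_primes_le) auto

lemma prime_sum_nonneg: "(!!p. 0 <= f p) ==> 0 <= prime_sum f x"
 unfolding prime_sum_def by (intro sum_nonneg) auto

lemma ln_ln_step:
 fixes u v :: real
 assumes "1 < u" "u <= v"
 shows "(v - u) / (v * ln v) <= ln (ln v) - ln (ln u)" and "ln (ln v) - ln (ln u) <= (v - u) / (u * ln u)"
proof -
 have *: "(v - u) / (v * ln v) <= ln (ln v) - ln (ln u) & ln (ln v) - ln (ln u) <= (v - u) / (u * ln u)"
 proof (cases "u = v")
  case False
  hence "u < v" using assms by simp
  hence "EX z. u < z & z < v & ln (ln v) - ln (ln u) = (v - u) * (1 / (z * ln z))"
  proof (rule MVT2)
   fix x assume "u <= x" "x <= v"
   hence "x > 1" using assms by linarith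
   thus "((%x. ln (ln x)) has_real_derivative 1 / (x * ln x)) (at x)"
    by (auto intro!: derivative_eq_intros simp: field_simps)
  qed
  then obtain z where z: "u < z" "z < v" "ln (ln v) - ln (ln u) = (v - u) * (1 / (z * ln z))" by blast
  have "u * ln u <= z * ln z" "z * ln z <= v * ln v" using z assms by (auto intro!: mult_mono)
  moreover have "u * ln u > 0" using assms by simp
  ultimately have "(v - u) / (v * ln v) <= (v - u) / (z * ln z)" "(v - u) / (z * ln z) <= (v - u) / (u * ln u)"
   using \<open>u < v\<close> z(1,2) assms by (auto intro!: divide_left_mono mult_pos_pos)
  thus ?thesis unfolding z(3) by simp
 qed simp
 thus "(v - u) / (v * ln v) <= ln (ln v) - ln (ln u)" "ln (ln v) - ln (ln u) <= (v - u) / (u * ln u)" by auto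
qed

text \<open>The mean value theorem for \<open>- (ln x powr (-c)) / c\<close>; it makes the remainder
  in the partial summation below telescope.\<close>

lemma ln_powr_step:
 fixes c :: real and n :: nat
 assumes c: "c > 0" and n: "n >= 3"
 shows "1 / (real n * ln (real n) powr (1 + c)) <= (ln (real (n - 1)) powr (-c) - ln (real n) powr (-c)) / c"
proof -
 have r: "real (n - 1) = real n - 1" "real n - 1 > 1" using n by auto
 obtain z where z: "real n - 1 < z" "z < real n"
  "(- (ln (real n) powr (-c)) / c) - (- (ln (real n - 1) powr (-c)) / c) = (real n - (real n - 1)) * (1 / (z * ln z powr (1 + c)))"
 proof -
  have "EX z. real n - 1 < z & z < real n & (- (ln (real n) powr (-c)) / c) - (- (ln (real n - 1) powr (-c)) / c) = (real n - (real n - 1)) * (1 / (z * ln z powr (1 + c)))"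
  proof (rule MVT2)
   fix x assume x: "real n - 1 <= x" "x <= real n"
   hence "x > 1" using r by linarith
   hence "ln x > 0" by simp
   thus "((%x. - (ln x powr (-c)) / c) has_real_derivative 1 / (x * ln x powr (1 + c))) (at x)"
    using c \<open>x > 1\<close> by (auto intro!: derivative_eq_intros simp: powr_minus powr_add powr_diff field_simps)
  qed simp
  thus ?thesis using that by blast
 qed
 have z1: "z > 1" using z(1) r by linarith
 have "z * ln z powr (1 + c) <= real n * ln (real n) powr (1 + c)"
  using z z1 c by (intro mult_mono powr_mono2) auto
 hence "1 / (real n * ln (real n) powr (1 + c)) <= 1 / (z * ln z powr (1 + c))"
  using z1 n by (intro divide_left_mono mult_pos_pos) auto
 also have "... = (ln (real (n - 1)) powr (-c) - ln (real n) powr (-c)) / c" using z(3) unfolding r by (simp add: diff_divide_distrib)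
 finally show ?thesis .
qed

lemma recip_ln_step:
 fixes n :: nat assumes "n >= 3"
 shows "0 <= 1 / (real n * ln (real n)) - 1 / (real (Suc n) * ln (real (Suc n)))"
  and "1 / (real n * ln (real n)) - 1 / (real (Suc n) * ln (real (Suc n))) <= 2 / ((real n)\<^sup>2 * ln (real n))"
proof -
 define l l' where "l = ln (real n)" and "l' = ln (real (Suc n))"
 have l: "l >= 1" unfolding l_def using assms exp_le by (subst ln_ge_iff) auto
 have ll: "l <= l'" unfolding l_def l'_def using assms by simp
 have "l' - l = ln (real (Suc n) / real n)" unfolding l_def l'_def using assms by (simp add: ln_div)
 also have "... <= real (Suc n) / real n - 1" using assms by (intro ln_le_minus_one) auto
 also have "... = 1 / real n" using assms by (simp add: field_simps)
 finally have step: "real n * (l' - l) <= 1" using assms by (simp add: field_simps)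
 have n0: "real n > 0" using assms by simp
 have eq: "1 / (real n * l) - 1 / (real (Suc n) * l') = (real (Suc n) * l' - real n * l) / (real n * l * (real (Suc n) * l'))"
 proof -
  have "1 / x - 1 / y = (y - x) / (x * y)" if "x ~= 0" "y ~= 0" for x y :: real
   using that by (simp add: field_simps)
  thus ?thesis using n0 l ll by simp
 qed
 have num: "real (Suc n) * l' - real n * l = l' + real n * (l' - l)" by (simp add: algebra_simps)
 show "0 <= 1 / (real n * ln (real n)) - 1 / (real (Suc n) * ln (real (Suc n)))"
  unfolding l_def[symmetric] l'_def[symmetric] eq num using l ll n0 by (intro divide_nonneg_nonneg add_nonneg_nonneg mult_nonneg_nonneg) auto
 have "(real (Suc n) * l' - real n * l) / (real n * l * (real (Suc n) * l')) <= (2 * l') / (real n * l * (real n * l'))"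
  unfolding num using step l ll n0 by (intro frac_le mult_mono mult_nonneg_nonneg mult_pos_pos) auto
 also have "... = 2 / ((real n)\<^sup>2 * l)" using l ll n0 by (simp add: power2_eq_square field_simps)
 finally show "1 / (real n * ln (real n)) - 1 / (real (Suc n) * ln (real (Suc n))) <= 2 / ((real n)\<^sup>2 * ln (real n))"
  unfolding l_def[symmetric] l'_def[symmetric] eq .
qed

lemma exp_27: "exp (3::real) <= 27"
proof -
 have "exp (3::real) = exp 1 ^ 3" by (simp flip: exp_of_nat_mult)
 also have "... <= 3 ^ 3" using exp_le by (intro power_mono) auto
 finally show ?thesis by simp
qed

lemma cauchy_rate_limit:
 fixes B e :: "nat => real"
 assumes e: "e \<longlonglongrightarrow> 0" and B: "!!M N. M0 <= M ==> M <= N ==> \<bar>B N - B M\<bar> <= e M"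
 shows "EX b. \<forall>M\<ge>M0. \<bar>B M - b\<bar> <= e M"
proof -
 have "Cauchy B"
 proof (rule metric_CauchyI)
  fix \<epsilon> :: real assume "\<epsilon> > 0"
  then obtain M1 where M1: "!!n. n >= M1 ==> \<bar>e n\<bar> < \<epsilon> / 2" using LIMSEQ_D[OF e, of "\<epsilon>/2"] by auto
  define M where "M = max M0 M1"
  have "\<bar>B m - B M\<bar> < \<epsilon> / 2" if "m >= M" for m
   using B[of M m] M1[of M] that by (auto simp: M_def)
  hence "dist (B m) (B n) < \<epsilon>" if "m >= M" "n >= M" for m n
   using \<open>!!m. m >= M ==> \<bar>B m - B M\<bar> < \<epsilon> / 2\<close>[OF that(1)] \<open>!!m. m >= M ==> \<bar>B m - B M\<bar> < \<epsilon> / 2\<close>[OF that(2)]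
   unfolding dist_real_def by linarith
  thus "EX M. \<forall>m\<ge>M. \<forall>n\<ge>M. dist (B m) (B n) < \<epsilon>" by blast
 qed
 then obtain b where b: "B \<longlonglongrightarrow> b" using Cauchy_convergent_iff convergent_def by blast
 have "\<bar>B M - b\<bar> <= e M" if "M >= M0" for M
 proof -
  have "(%N. \<bar>B N - B M\<bar>) \<longlonglongrightarrow> \<bar>b - B M\<bar>" by (intro tendsto_intros b)
  hence "\<bar>b - B M\<bar> <= e M" by (rule LIMSEQ_le_const2) (use B[OF that] in blast)
  thus ?thesis by (simp add: abs_minus_commute)
 qed
 thus ?thesis by blast
qed

text \<open>Partial summation with the factor \<open>f n = 1 / (n * ln n)\<close>: the boundary
  terms are of order \<open>L n\<close>, the remainders \<open>R n\<close> against differences of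
  \<open>f\<close> are majorised by differences of \<open>L\<close>, and the sum of \<open>f\<close>
  is compared with \<open>ln (ln n)\<close>. The constant \<open>b\<close> arises as a Cauchy
  limit.\<close>

lemma pnt_imp_mertens:
 assumes w: "!!p. 0 <= w p" "!!p. w p <= W" and P: "pnt_weight w K"
 shows "EX b K'. mertens_weight w b K'"
proof -
 define c :: real where "c = 1/64"
 define R where "R = (%n. theta_sum w (real n) - real n)"
 define f where "f = (%n. 1 / (real n * ln (real n)))"
 define L where "L = (%n. ln (real n) powr (-c))"
 have W0: "W >= 0" using w[of 0] by linarith
 have "\<bar>theta_sum w 1 - 1\<bar> <= K * 1 * (1 + ln 1) powr (-1/64)" using P unfolding pnt_weight_def by blast
 hence K0: "K >= 0" by (smt (verit) ln_one mult_cancel_left1 powr_one_eq_one add_0_right mult.right_neutral)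
 have ln1: "ln (real n) >= 1" if "n >= 3" for n :: nat using that exp_le by (subst ln_ge_iff) auto
 have Lle: "(1 + ln (real n)) powr (-1/64) <= L n" if "n >= 3" for n
  unfolding L_def c_def using ln1[OF that] by (simp, intro powr_mono2') auto
 have Rb: "\<bar>R n\<bar> <= K * real n * L n" if "n >= 3" for n
 proof -
  have "\<bar>R n\<bar> <= K * real n * (1 + ln (real n)) powr (-1/64)" using P that unfolding pnt_weight_def R_def by auto
  also have "... <= K * real n * L n" using Lle[OF that] K0 by (intro mult_left_mono) auto
  finally show ?thesis .
 qed
 have fb: "0 <= f n & real n * f n <= 1 & f n <= L n" if "n >= 3" for n
 proof -
  have "real n * f n = 1 / ln (real n)" using that by (simp add: f_def)
  moreover have "1 / ln (real n) <= 1" using ln1[OF that] by simp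
  moreover have "f n <= 1 / ln (real n)" unfolding f_def using that ln1[OF that] by (intro divide_left_mono) (auto intro!: mult_pos_pos)
  moreover have "1 / ln (real n) = ln (real n) powr (-1)" using ln1[OF that] by (simp add: powr_minus divide_inverse)
  moreover have "ln (real n) powr (-1) <= L n" unfolding L_def c_def using ln1[OF that] by (intro powr_mono) auto
  ultimately have "real n * f n <= 1" "f n <= L n" by linarith+
  moreover have "f n >= 0" using ln1[OF that] by (simp add: f_def)
  ultimately show ?thesis by blast
 qed
 have Ldec: "L n <= L m" if "3 <= m" "m <= n" for m n
  unfolding L_def using that ln1[OF that(1)] by (intro powr_mono2') (auto simp: c_def)
 define B where "B = (%n. recip_sum w (real n) - ln (ln (real n)))"
 have Bstep: "B (Suc n) - B n = (R (Suc n) - R n) * f (Suc n) + (f (Suc n) - (ln (ln (real (Suc n))) - ln (ln (real n))))"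
  if "n >= 3" for n
 proof -
  have "recip_sum w (real (Suc n)) - recip_sum w (real n) = (theta_sum w (real (Suc n)) - theta_sum w (real n)) * f (Suc n)"
  proof -
   have "w N / real N = w N * ln (real N) * f N" if "N >= 3" for N
    unfolding f_def using that ln1[OF that] by simp
   hence "w (Suc n) / real (Suc n) = w (Suc n) * ln (real (Suc n)) * f (Suc n)" using that by (simp del: of_nat_Suc)
   thus ?thesis unfolding prime_sum_Suc by (simp del: of_nat_Suc)
  qed
  also have "theta_sum w (real (Suc n)) - theta_sum w (real n) = R (Suc n) - R n + 1" by (simp add: R_def)
  finally show ?thesis by (simp add: B_def algebra_simps)
 qed
 have main: "\<bar>B (M + m) - B M\<bar> <= \<bar>R (M + m)\<bar> * f (Suc (M + m)) + \<bar>R M\<bar> * f (Suc M) + (f M - f (M + m)) + 2 * K / c * (L M - L (M + m))"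
  if M: "M >= 3" for M m
 proof -
  \<comment> \<open>\<open>V\<close> collects the boundary terms of the summation by parts; what
    remains is bounded by telescoping quantities, so the induction on \<open>m\<close>
    closes.\<close>
  define V where "V = (%m. (R (M + m) * f (Suc (M + m)) - R M * f (Suc M)))"
  have "\<bar>B (M + m) - B M - V m\<bar> <= (f M - f (M + m)) + 2 * K / c * (L M - L (M + m))"
  proof (induction m)
   case (Suc m)
   define n where "n = M + m"
   have n: "n >= 3" using M by (simp add: n_def)
   have "B (Suc n) - B n - (R (Suc n) * f (Suc (Suc n)) - R n * f (Suc n)) =
     R (Suc n) * (f (Suc n) - f (Suc (Suc n))) + (f (Suc n) - (ln (ln (real (Suc n))) - ln (ln (real n))))"
    unfolding Bstep[OF n] by (simp add: algebra_simps)
   moreover have "\<bar>f (Suc n) - (ln (ln (real (Suc n))) - ln (ln (real n)))\<bar> <= f n - f (Suc n)"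
    using ln_ln_step[of "real n" "real (Suc n)"] n by (simp add: f_def)
   moreover have "\<bar>R (Suc n) * (f (Suc n) - f (Suc (Suc n)))\<bar> <= 2 * K / c * (L n - L (Suc n))"
   proof -
    have s3: "Suc n >= 3" using n by simp
    have "\<bar>R (Suc n) * (f (Suc n) - f (Suc (Suc n)))\<bar> <= (K * real (Suc n) * L (Suc n)) * (2 / ((real (Suc n))\<^sup>2 * ln (real (Suc n))))"
     unfolding abs_mult using Rb[OF s3] recip_ln_step[OF s3] K0
     by (intro mult_mono) (auto simp: f_def L_def)
    also have "... = 2 * K * (1 / (real (Suc n) * ln (real (Suc n)) powr (1 + c)))"
    proof -
     have gen: "(K * N * (l powr - c)) * (2 / (N\<^sup>2 * l)) = 2 * K * (1 / (N * l powr (1 + c)))"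
      if "N > 0" "l > 0" for N l :: real
      using that by (simp add: powr_add powr_minus power2_eq_square field_simps)
     have "real (Suc n) > 0" "ln (real (Suc n)) > 0" using ln1[OF s3] n by auto
     from gen[OF this] show ?thesis by (simp only: L_def)
    qed
    also have "... <= 2 * K * ((L n - L (Suc n)) / c)"
     using ln_powr_step[of c "Suc n"] n K0 by (intro mult_left_mono) (auto simp: L_def c_def)
    finally show ?thesis by simp
   qed
   ultimately have "\<bar>B (Suc n) - B n - (R (Suc n) * f (Suc (Suc n)) - R n * f (Suc n))\<bar> <= (f n - f (Suc n)) + 2 * K / c * (L n - L (Suc n))"
    by linarith
   moreover have "k * (x - y) + k * (z - x) = k * (z - y)" for k x y z :: real by (simp add: algebra_simps)
   from this[of "2 * K / c" "L n" "L (Suc n)" "L M"]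
   have "2 * K / c * (L n - L (Suc n)) + 2 * K / c * (L M - L n) = 2 * K / c * (L M - L (Suc n))" .
   moreover have "\<bar>B n - B M - V m\<bar> <= (f M - f n) + 2 * K / c * (L M - L n)" using Suc by (simp only: n_def)
   moreover have "B (Suc n) - B M - V (Suc m) = (B (Suc n) - B n - (R (Suc n) * f (Suc (Suc n)) - R n * f (Suc n))) + (B n - B M - V m)"
    by (simp add: V_def n_def)
   ultimately have "\<bar>B (Suc n) - B M - V (Suc m)\<bar> <= (f M - f (Suc n)) + 2 * K / c * (L M - L (Suc n))"
    by linarith
   thus ?case by (simp add: n_def)
  qed (simp add: V_def)
  moreover have "\<bar>V m\<bar> <= \<bar>R (M + m)\<bar> * f (Suc (M + m)) + \<bar>R M\<bar> * f (Suc M)"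
   unfolding V_def using fb[of "Suc (M + m)"] fb[of "Suc M"] M
    abs_triangle_ineq4[of "R (M + m) * f (Suc (M + m))" "R M * f (Suc M)"] by (simp add: abs_mult)
  ultimately show ?thesis by linarith
 qed
 define C where "C = 2 * K + 1 + 2 * K / c"
 have C0: "C >= 0" using K0 by (simp add: C_def c_def)
 have Rf: "\<bar>R n\<bar> * f (Suc n) <= K * L n" if "n >= 3" for n
 proof -
  have "f (Suc n) <= f n" using recip_ln_step(1)[OF that] by (simp add: f_def)
  hence "\<bar>R n\<bar> * f (Suc n) <= (K * real n * L n) * f n" using Rb[OF that] fb[of "Suc n"] that K0 by (intro mult_mono) (auto simp: L_def)
  also have "... = K * L n * (real n * f n)" by simp
  also have "... <= K * L n * 1" using fb[OF that] K0 by (intro mult_left_mono) (auto simp: L_def)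
  finally show ?thesis by simp
 qed
 have cau: "\<bar>B N - B M\<bar> <= C * L M" if MN: "3 <= M" "M <= N" for M N
 proof -
  have "\<bar>B N - B M\<bar> <= \<bar>R N\<bar> * f (Suc N) + \<bar>R M\<bar> * f (Suc M) + (f M - f N) + 2 * K / c * (L M - L N)"
   using main[OF MN(1), of "N - M"] MN by simp
  also have "... <= K * L M + K * L M + L M + 2 * K / c * L M"
  proof (intro add_mono)
   have "K * L N <= K * L M" using Ldec[OF MN] K0 by (intro mult_left_mono)
   thus "\<bar>R N\<bar> * f (Suc N) <= K * L M" using Rf[of N] MN by simp
   show "\<bar>R M\<bar> * f (Suc M) <= K * L M" using Rf MN by simp
   show "f M - f N <= L M" using fb[of M] fb[of N] MN by simp
   show "2 * K / c * (L M - L N) <= 2 * K / c * L M" using K0 by (intro mult_left_mono) (auto simp: L_def c_def)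
  qed
  finally show ?thesis by (simp add: C_def algebra_simps)
 qed
 have "(%n. C * L n) \<longlonglongrightarrow> C * 0" unfolding L_def c_def by (intro tendsto_intros) real_asymp
 hence "EX b. \<forall>M\<ge>3. \<bar>B M - b\<bar> <= C * L M" by (intro cauchy_rate_limit) (use cau in auto)
 then obtain b where b: "!!M. M >= 3 ==> \<bar>B M - b\<bar> <= C * L M" by blast
 have x_bound: "\<bar>recip_sum w u - (ln (ln u) + b)\<bar> <= (C + 1) * 64 / ln (ln u)" if u: "u >= 27" for u
 proof -
  define n where "n = nat \<lfloor>u\<rfloor>"
  have n: "n >= 27" "real n <= u" "u < real n + 1"
  proof -
   show "n >= 27" unfolding n_def using u by (simp add: le_nat_iff le_floor_iff)
   have "0 <= \<lfloor>u\<rfloor>" using u by simp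
   thus "real n <= u" "u < real n + 1" unfolding n_def by simp_all
  qed
  have D: "recip_sum w u = recip_sum w (real n)" unfolding n_def using u by (intro prime_sum_nat) simp
  have "0 <= ln (ln u) - ln (ln (real n))"
  proof -
   have "ln (real n) <= ln u" using n by simp
   thus ?thesis using n ln1[of n] by simp
  qed
  moreover have "ln (ln u) - ln (ln (real n)) <= (u - real n) / (real n * ln (real n))" using n by (intro ln_ln_step) auto
  moreover have "(u - real n) / (real n * ln (real n)) <= 1 / (real n * ln (real n))" using n ln1[of n] by (intro divide_right_mono) auto
  moreover have "1 / (real n * ln (real n)) <= L n" using fb[of n] n by (simp add: f_def)
  ultimately have "\<bar>recip_sum w u - (ln (ln u) + b)\<bar> <= (C + 1) * L n"
  proof -
   have "(C + 1) * L n = C * L n + L n" by (simp add: algebra_simps)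
   moreover have "\<bar>recip_sum w (real n) - ln (ln (real n)) - b\<bar> <= C * L n" using b[of n] n by (simp add: B_def)
   ultimately show ?thesis
    using \<open>0 <= ln (ln u) - ln (ln (real n))\<close> \<open>ln (ln u) - ln (ln (real n)) <= (u - real n) / (real n * ln (real n))\<close>
     \<open>(u - real n) / (real n * ln (real n)) <= 1 / (real n * ln (real n))\<close> \<open>1 / (real n * ln (real n)) <= L n\<close> D
    by linarith
  qed
  \<comment> \<open>The power saving is exchanged for the weaker iterated logarithm, by
    \<open>t powr (1/64) >= 1 + ln t / 64\<close> and \<open>ln u <= 2 * t\<close>.\<close>
  also have "L n <= 64 / ln (ln u)"
  proof -
   define t where "t = ln (real n)"
   have t: "t >= 1" using n ln1[of n] by (simp add: t_def)
   have "u <= (real n)\<^sup>2"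
   proof -
    have "27 * real n <= real n * real n" using n by (intro mult_right_mono) auto
    thus ?thesis using n unfolding power2_eq_square by linarith
   qed
   hence "ln u <= ln ((real n)\<^sup>2)" using u n by (subst ln_le_cancel_iff) auto
   hence lu: "ln u <= 2 * t" using n by (simp add: ln_realpow t_def)
   have l1: "ln u >= 3" using u exp_27 by (subst ln_ge_iff) auto
   have "ln (ln u) <= ln (2 * t)" using lu l1 t by (subst ln_le_cancel_iff) auto
   also have "... = ln 2 + ln t" using t by (simp add: ln_mult)
   also have "... <= 64 * (1 + ln t / 64)" using ln_2_less_1 by simp
   also have "... <= 64 * exp (ln t / 64)" by (intro mult_left_mono exp_ge_add_one_self) auto
   also have "exp (ln t / 64) = t powr (1/64)" using t by (simp add: powr_def)
   finally have "ln (ln u) <= 64 * t powr (1/64)" .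
   moreover have "ln (ln u) > 0" using l1 by simp
   moreover have "L n = 1 / t powr (1/64)" unfolding L_def c_def t_def by (simp only: powr_minus_divide)
   moreover have "t powr (1/64) > 0" using t by simp
   ultimately have "1 / t powr (1/64) <= 64 / ln (ln u)" by (simp add: field_simps)
   thus ?thesis by (simp only: \<open>L n = 1 / t powr (1/64)\<close>)
  qed
  finally show ?thesis using C0 by (simp add: mult_left_mono)
 qed
 have wp: "0 <= w p / real p" for p using w by simp
 have D0: "recip_sum w u >= 0" for u by (intro prime_sum_nonneg wp)
 define E where "E = recip_sum w 27 + ln (1 + ln 27)"
 have E: "E >= 0" "recip_sum w 27 <= E" "ln (1 + ln 27) <= E" using D0[of 27] by (simp_all add: E_def)
 define K' where "K' = 1 + W + (C + 1) * 64 + \<bar>b\<bar> + 2 + E"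
 have "mertens_weight w b K'"
  unfolding mertens_weight_def
 proof (intro conjI allI impI)
  show "K' >= 1" using W0 C0 E by (simp add: K'_def)
  show "0 <= w p" for p by (rule w)
  show "w p <= K'" for p
  proof -
   have "w p + 0 <= W + (1 + (C + 1) * 64 + \<bar>b\<bar> + 2 + E)"
    using w(2)[of p] C0 E by (intro add_mono add_nonneg_nonneg) auto
   thus ?thesis by (simp add: K'_def algebra_simps)
  qed
  fix u :: real
  have big: "ln (ln u) >= 1 & ln u >= 3" if "u >= 27"
  proof -
   have l1: "ln u >= 3" using that exp_27 by (subst ln_ge_iff) auto
   hence "ln (ln u) >= 1" using exp_le by (subst ln_ge_iff) auto
   thus ?thesis using l1 by simp
  qed
  show "\<bar>recip_sum w u - (ln (ln u) + b)\<bar> <= K' / ln (ln u)" if "u >= 27"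
  proof -
   have "(C + 1) * 64 <= K'" using W0 E by (simp add: K'_def)
   hence "(C + 1) * 64 / ln (ln u) <= K' / ln (ln u)" using big[OF that] by (intro divide_right_mono) auto
   thus ?thesis using x_bound[OF that] by linarith
  qed
  show "\<bar>recip_sum w u - ln (1 + ln u)\<bar> <= K'" if u: "u >= 1"
  proof (cases "u >= 27")
   case True
   have "(C + 1) * 64 / ln (ln u) <= (C + 1) * 64" using big[OF True] C0 by (simp add: divide_le_eq mult_left_mono)
   moreover have "\<bar>ln (1 + ln u) - ln (ln u)\<bar> <= 1"
   proof -
    have "ln (ln u) <= ln (1 + ln u)" using big[OF True] by simp
    moreover have "ln (1 + ln u) <= ln (2 * ln u)" using big[OF True] by (subst ln_le_cancel_iff) auto
    moreover have "ln (2 * ln u) = ln 2 + ln (ln u)" using big[OF True] by (simp add: ln_mult)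
    ultimately show ?thesis using ln_2_less_1 by linarith
   qed
   ultimately have "\<bar>recip_sum w u - ln (1 + ln u)\<bar> <= \<bar>b\<bar> + 1 + (C + 1) * 64" using x_bound[OF True] by linarith
   thus ?thesis using W0 E(1) unfolding K'_def by linarith
  next
   case False
   have "recip_sum w u <= recip_sum w 27" using False by (intro prime_sum_mono wp) auto
   moreover have "ln (1 + ln u) <= ln (1 + ln 27)"
   proof -
    have "ln u <= ln 27" "ln u >= 0" using False u by auto
    thus ?thesis by simp
   qed
   moreover have "ln (1 + ln u) >= 0" using u by simp
   ultimately have "\<bar>recip_sum w u - ln (1 + ln u)\<bar> <= E" using D0[of u] E by linarith
   moreover have "E <= K'" using W0 C0 by (simp add: K'_def)
   ultimately show ?thesis by linarith
  qed
 qed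
 thus ?thesis by blast
qed

section \<open>Products of distinct primes\<close>

declare of_nat_prod [simp del]

text \<open>Sets stand for squarefree integers: distinctness is built in, and a prime is easily
  inserted or removed. By \<open>prime_sets_prod_inj\<close> a set is recovered from its
  product.\<close>

definition prime_sets :: "nat => real => nat set set" where
 "prime_sets k x = {P. finite P & (\<forall>p\<in>P. prime p) & card P = k & real (\<Prod>P) <= x}"

definition wsum :: "(nat => real) => nat => real => real" where
 "wsum v k x = (\<Sum>P\<in>prime_sets k x. \<Prod>p\<in>P. v p)"

abbreviation lsum :: "(nat => real) => nat => real => real" where
 "lsum w \<equiv> wsum (%p. w p / real p)"

lemma prime_set_prod_pos: "finite P ==> \<forall>p\<in>P. prime p ==> \<Prod>P > (0::nat)"
 by (intro prod_pos) (auto simp: prime_gt_0_nat)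

lemma prime_setsD:
 assumes "P \<in> prime_sets k x"
 shows "finite P" "p \<in> P ==> prime p" "card P = k" "real (\<Prod>P) <= x" "real (\<Prod>P) > 0" "real (\<Prod>P) >= 1" "\<Prod>P > 0"
proof -
 have "\<Prod>P > 0" using assms prime_set_prod_pos[of P] by (auto simp: prime_sets_def)
 hence "1 <= \<Prod>P" by linarith
 hence "real 1 <= real (\<Prod>P)" by (rule of_nat_mono)
 hence "real (\<Prod>P) >= 1" "real (\<Prod>P) > 0" by linarith+
 with assms \<open>\<Prod>P > 0\<close> show "finite P" "p \<in> P ==> prime p" "card P = k" "real (\<Prod>P) <= x" "real (\<Prod>P) > 0" "real (\<Prod>P) >= 1" "\<Prod>P > 0"
  unfolding prime_sets_def by blast+
qed

lemma finite_prime_sets: "finite (prime_sets k x)"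
proof (rule finite_subset)
 show "prime_sets k x <= Pow {..nat \<lfloor>x\<rfloor>}"
 proof (intro subsetI PowI)
  fix P p assume P: "P \<in> prime_sets k x" and p: "p \<in> P"
  have "p dvd \<Prod>P" using p prime_setsD(1)[OF P] by (intro dvd_prodI)
  hence "p <= \<Prod>P" using prime_setsD(7)[OF P] by (rule dvd_imp_le)
  hence "real p <= x" using prime_setsD(4)[OF P] by linarith
  thus "p \<in> {..nat \<lfloor>x\<rfloor>}" by (simp add: le_nat_floor)
 qed
qed simp

lemma prime_sets_0: "prime_sets 0 x = (if x >= 1 then {{}} else {})"
 by (auto simp: prime_sets_def)

lemma wsum_0: "wsum v 0 x = (if x >= 1 then 1 else 0)"
 by (simp add: wsum_def prime_sets_0)

lemma prime_sets_mono: "x <= y ==> prime_sets k x <= prime_sets k y"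
 by (auto simp: prime_sets_def)

lemma wsum_nonneg: "(!!p. 0 <= v p) ==> 0 <= wsum v k x"
 unfolding wsum_def by (intro sum_nonneg prod_nonneg) auto

lemma wsum_mono: "(!!p. 0 <= v p) ==> x <= y ==> wsum v k x <= wsum v k y"
 unfolding wsum_def by (intro sum_mono2 finite_prime_sets prime_sets_mono prod_nonneg) auto

text \<open>Pointing at one prime of a set: the pairs \<open>(P, p)\<close> with \<open>p \<in> P\<close> correspond to the
 pairs \<open>(Q, p)\<close> with \<open>p \<notin> Q\<close> through \<open>P = Q \<union> {p}\<close>.\<close>

lemma sum_pointed_prime_sets:
 "(\<Sum>P\<in>prime_sets (Suc k) x. \<Sum>p\<in>P. f p (P - {p})) =
 (\<Sum>Q\<in>prime_sets k x. \<Sum>p | prime p & real p <= x / real (\<Prod>Q) & p \<notin> Q. (f p Q :: real))"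
proof -
 have finP: "finite P" if "P \<in> prime_sets j x" for P j using prime_setsD[OF that] by simp
 have "(\<Sum>P\<in>prime_sets (Suc k) x. \<Sum>p\<in>P. f p (P - {p})) = (\<Sum>(P, p)\<in>Sigma (prime_sets (Suc k) x) (%P. P). f p (P - {p}))"
  using finP by (intro sum.Sigma finite_prime_sets) auto
 also have "... = (\<Sum>(Q, p)\<in>Sigma (prime_sets k x) (%Q. {p. prime p & real p <= x / real (\<Prod>Q) & p \<notin> Q}). f p Q)"
 proof (rule sum.reindex_bij_witness[of _ "%(Q, p). (insert p Q, p)" "%(P, p). (P - {p}, p)"])
  fix z assume "z \<in> Sigma (prime_sets (Suc k) x) (%P. P)"
  then obtain P p where z: "z = (P, p)" "P \<in> prime_sets (Suc k) x" "p \<in> P" by auto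
  note P = prime_setsD[OF z(2)]
  show "(case (case z of (P, p) => (P - {p}, p)) of (Q, p) => (insert p Q, p)) = z" using z by auto
  have pr: "\<Prod>P = p * \<Prod>(P - {p})" using P(1) z(3) by (rule prod.remove)
  have p: "prime p" using P(2) z(3) by blast
  have pos: "\<Prod>(P - {p}) > 0" using pr P(7) by (cases "\<Prod>(P - {p}) = 0") auto
  have "\<Prod>(P - {p}) <= \<Prod>P" unfolding pr using prime_gt_0_nat[OF p] by simp
  hence "real (\<Prod>(P - {p})) <= x" using P(4) by linarith
  hence 1: "P - {p} \<in> prime_sets k x" using P z(3) by (auto simp: prime_sets_def)
  have "real p * real (\<Prod>(P - {p})) <= x" using P(4) unfolding pr by simp
  hence "real p <= x / real (\<Prod>(P - {p}))" using pos by (simp add: pos_le_divide_eq)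
  thus "(case z of (P, p) => (P - {p}, p)) \<in> Sigma (prime_sets k x) (%Q. {p. prime p & real p <= x / real (\<Prod>Q) & p \<notin> Q})"
   using 1 p z by simp
  show "(case case z of (P, p) => (P - {p}, p) of (Q, p) => f p Q) = (case z of (P, p) => f p (P - {p}))" using z by simp
 next
  fix z assume "z \<in> Sigma (prime_sets k x) (%Q. {p. prime p & real p <= x / real (\<Prod>Q) & p \<notin> Q})"
  then obtain Q p where z: "z = (Q, p)" "Q \<in> prime_sets k x" "prime p" "real p <= x / real (\<Prod>Q)" "p \<notin> Q" by auto
  note Q = prime_setsD[OF z(2)]
  show "(case (case z of (Q, p) => (insert p Q, p)) of (P, p) => (P - {p}, p)) = z" using z by auto
  have "real p * real (\<Prod>Q) <= x" using z(4) Q(5) by (simp add: pos_le_divide_eq)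
  hence "insert p Q \<in> prime_sets (Suc k) x" using Q z by (auto simp: prime_sets_def)
  thus "(case z of (Q, p) => (insert p Q, p)) \<in> Sigma (prime_sets (Suc k) x) (%P. P)" using z by simp
 qed
 also have "... = (\<Sum>Q\<in>prime_sets k x. \<Sum>p | prime p & real p <= x / real (\<Prod>Q) & p \<notin> Q. f p Q)"
 proof (rule sum.Sigma[symmetric])
  show "\<forall>Q\<in>prime_sets k x. finite {p. prime p & real p <= x / real (\<Prod>Q) & p \<notin> Q}"
   by (auto intro: finite_subset[OF _ finite_primes_le])
 qed (rule finite_prime_sets)
 finally show ?thesis .
qed

lemma prime_sum_split_mem:
 assumes "finite Q"
 shows "prime_sum f u = (\<Sum>p | prime p & real p <= u & p \<notin> Q. f p) + (\<Sum>p\<in>{p\<in>Q. prime p & real p <= u}. f p)"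
proof -
 have "{p. prime p & real p <= u} = {p. prime p & real p <= u & p \<notin> Q} \<union> {p\<in>Q. prime p & real p <= u}" by auto
 thus ?thesis unfolding prime_sum_def
  using assms by (simp add: sum.union_disjoint[symmetric] finite_subset[OF _ finite_primes_le[of u]] disjoint_iff)
qed

text \<open>For nonnegative terms an upper bound may forget that the pointed prime lies outside
  \<open>Q\<close>.\<close>

lemma sum_pointed_le:
 assumes "!!p Q. 0 <= f p Q"
 shows "(\<Sum>P\<in>prime_sets (Suc k) x. \<Sum>p\<in>P. f p (P - {p})) <= (\<Sum>Q\<in>prime_sets k x. prime_sum (%p. f p Q) (x / real (\<Prod>Q)))"
 unfolding sum_pointed_prime_sets
proof (rule sum_mono)
 fix Q assume "Q \<in> prime_sets k x"
 show "(\<Sum>p | prime p & real p <= x / real (\<Prod>Q) & p \<notin> Q. f p Q) <= prime_sum (%p. f p Q) (x / real (\<Prod>Q))"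
  unfolding prime_sum_def using assms by (intro sum_mono2 finite_primes_le) auto
qed

lemma prod_pointed: "finite P ==> p \<in> P ==> (\<Prod>r\<in>P. v r) = v p * (\<Prod>r\<in>P - {p}. (v r :: real))"
 by (rule prod.remove)

text \<open>\<open>(k + 1) L\<^sub>k\<^sub>+\<^sub>1\<close> counts pointed sets.\<close>

lemma wsum_Suc:
 "real (Suc k) * wsum v (Suc k) x = (\<Sum>Q\<in>prime_sets k x. (\<Prod>r\<in>Q. v r) * (\<Sum>p | prime p & real p <= x / real (\<Prod>Q) & p \<notin> Q. v p))"
proof -
 have "real (Suc k) * wsum v (Suc k) x = (\<Sum>P\<in>prime_sets (Suc k) x. \<Sum>p\<in>P. (\<Prod>r\<in>P. v r))"
  unfolding wsum_def sum_distrib_left by (intro sum.cong) (auto dest: prime_setsD(3))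
 also have "... = (\<Sum>P\<in>prime_sets (Suc k) x. \<Sum>p\<in>P. v p * (\<Prod>r\<in>P - {p}. v r))"
  by (intro sum.cong refl prod_pointed) (auto dest: prime_setsD(1))
 also have "... = (\<Sum>Q\<in>prime_sets k x. \<Sum>p | prime p & real p <= x / real (\<Prod>Q) & p \<notin> Q. v p * (\<Prod>r\<in>Q. v r))"
  by (rule sum_pointed_prime_sets)
 also have "... = (\<Sum>Q\<in>prime_sets k x. (\<Prod>r\<in>Q. v r) * (\<Sum>p | prime p & real p <= x / real (\<Prod>Q) & p \<notin> Q. v p))"
  by (simp add: sum_distrib_left mult.commute)
 finally show ?thesis .
qed

lemma wsum_Suc_le:
 assumes v: "!!p. 0 <= v p" and X: "prime_sum v x <= X"
 shows "real (Suc k) * wsum v (Suc k) x <= X * wsum v k x"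
proof -
 have "real (Suc k) * wsum v (Suc k) x <= (\<Sum>Q\<in>prime_sets k x. (\<Prod>r\<in>Q. v r) * X)"
  unfolding wsum_Suc
 proof (intro sum_mono mult_left_mono prod_nonneg v ballI)
  fix Q assume Q: "Q \<in> prime_sets k x"
  have "x / real (\<Prod>Q) <= x" using prime_setsD(4,6)[OF Q] by (simp add: divide_le_eq mult_le_cancel_left1)
  hence "(\<Sum>p | prime p & real p <= x / real (\<Prod>Q) & p \<notin> Q. v p) <= prime_sum v x"
   unfolding prime_sum_def by (intro sum_mono2 finite_primes_le) (auto simp: v)
  thus "(\<Sum>p | prime p & real p <= x / real (\<Prod>Q) & p \<notin> Q. v p) <= X" using X by linarith
 qed
 thus ?thesis by (simp add: wsum_def sum_distrib_left mult.commute)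
qed

text \<open>Iterating \<open>wsum_Suc_le\<close>; the factorial counts the orders in which the same
  set can be built up.\<close>

lemma wsum_le_power:
 assumes v: "!!p. 0 <= v p" and X: "prime_sum v x <= X"
 shows "wsum v k x <= X ^ k / fact k"
proof (induction k)
 case (Suc k)
 have X0: "X >= 0" using order.trans[OF prime_sum_nonneg[of v x] X] v by simp
 have "real (Suc k) * wsum v (Suc k) x <= X * (X ^ k / fact k)"
  using wsum_Suc_le[OF v X, of k] mult_left_mono[OF Suc X0] by linarith
 hence "wsum v (Suc k) x <= X * (X ^ k / fact k) / real (Suc k)" by (simp only: pos_le_divide_eq of_nat_0_less_iff zero_less_Suc mult.commute)
 thus ?case by (simp add: mult.commute)
qed (simp add: wsum_0)

text \<open>Bounds of Mertens type in short ranges only use Chebyshev's estimate for \<open>\<theta>\<close>; they hold for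
 every bounded weight.\<close>

definition chebyshev_weight :: "(nat => real) => real => bool" where
 "chebyshev_weight w K \<longleftrightarrow> (\<forall>x\<ge>0. theta_sum w x <= K * x) & (ALL p. 0 <= w p)"

text \<open>Dyadic blocks: on \<open>z / 2 < p <= z\<close> the bound for \<open>theta_sum\<close>
  gives at most \<open>2 * K\<close>, and \<open>log 2 T\<close> blocks, rounded up, cover the
  range.\<close>

lemma mertens_short_range:
 assumes w: "chebyshev_weight w K" and y: "y >= 1" and T: "T >= 1"
 shows "(\<Sum>p | prime p & real p <= y & real p > y / T. w p / real p * ln (real p)) <= 4 * K * (ln T + 1)"
proof -
 define g where "g = (%p. w p / real p * ln (real p))"
 have w0: "0 <= w p" for p using w by (simp add: chebyshev_weight_def)
 have g0: "g p >= 0" if "prime p" for p using w0[of p] prime_gt_1_nat[OF that] by (simp add: g_def)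
 have K0: "K >= 0"
 proof -
  have "0 <= theta_sum w 1" unfolding prime_sum_def
   using w0 by (intro sum_nonneg mult_nonneg_nonneg ln_ge_zero) (auto dest: prime_gt_0_nat)
  also have "... <= K * 1" using w unfolding chebyshev_weight_def by (metis zero_le_one)
  finally show ?thesis by simp
 qed
 have half: "(\<Sum>p | prime p & real p <= z & real p > z / 2. g p) <= 2 * K" if z: "z > 0" for z
 proof -
  have "(\<Sum>p | prime p & real p <= z & real p > z / 2. g p) <= (\<Sum>p | prime p & real p <= z & real p > z / 2. (2 / z) * (w p * ln (real p)))"
  proof (rule sum_mono)
   fix p assume p: "p \<in> {p. prime p & real p <= z & real p > z / 2}"
   hence "1 / real p <= 2 / z" using z by (simp add: field_simps)
   moreover have "0 <= w p * ln (real p)" using w0[of p] p prime_gt_1_nat[of p] by simp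
   ultimately have "1 / real p * (w p * ln (real p)) <= 2 / z * (w p * ln (real p))" by (rule mult_right_mono)
   thus "g p <= (2 / z) * (w p * ln (real p))" by (simp add: g_def)
  qed
  also have "... = (2 / z) * (\<Sum>p | prime p & real p <= z & real p > z / 2. w p * ln (real p))" by (rule sum_distrib_left[symmetric])
  also have "... <= (2 / z) * theta_sum w z"
  proof (rule mult_left_mono)
   show "(\<Sum>p | prime p & real p <= z & real p > z / 2. w p * ln (real p)) <= theta_sum w z"
    unfolding prime_sum_def by (intro sum_mono2 finite_primes_le) (auto simp: w0 dest: prime_gt_1_nat intro!: mult_nonneg_nonneg)
  qed (use z in auto)
  also have "... <= (2 / z) * (K * z)" using w z by (intro mult_left_mono) (auto simp: chebyshev_weight_def)
  also have "... = 2 * K" using z by simp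
  finally show ?thesis .
 qed
 have dyadic: "(\<Sum>p | prime p & real p <= y & real p > y / 2 ^ m. g p) <= 2 * K * real m" for m
 proof (induction m)
  case (Suc m)
  have "{p. prime p & real p <= y & real p > y / 2 ^ Suc m} \<subseteq>
   {p. prime p & real p <= y & real p > y / 2 ^ m} \<union> {p. prime p & real p <= y / 2 ^ m & real p > y / 2 ^ m / 2}"
   by auto
  moreover have fin: "finite {p. prime p & real p <= a & real p > b}" for a b
   by (rule finite_subset[OF _ finite_primes_le[of a]]) auto
  ultimately have "(\<Sum>p | prime p & real p <= y & real p > y / 2 ^ Suc m. g p) <=
   (\<Sum>p\<in>{p. prime p & real p <= y & real p > y / 2 ^ m} \<union> {p. prime p & real p <= y / 2 ^ m & real p > y / 2 ^ m / 2}. g p)"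
   by (intro sum_mono2) (auto intro: g0)
  also have "... = (\<Sum>p | prime p & real p <= y & real p > y / 2 ^ m. g p) + (\<Sum>p | prime p & real p <= y / 2 ^ m & real p > y / 2 ^ m / 2. g p)"
   by (intro sum.union_disjoint fin) auto
  also have "... <= 2 * K * real m + 2 * K" using Suc half[of "y / 2 ^ m"] y by simp
  finally show ?case by (simp add: algebra_simps)
 qed (auto intro!: sum_nonpos)
 define m where "m = nat \<lceil>log 2 T\<rceil>"
 have logT: "log 2 T >= 0" using T by simp
 have m: "log 2 T <= real m" "real m <= log 2 T + 1" using logT unfolding m_def by linarith+
 have "T = 2 powr (log 2 T)" using T by simp
 also have "... <= 2 powr real m" using m by (intro powr_mono) auto
 finally have T2: "T <= 2 ^ m" by (simp add: powr_realpow)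
 have "(\<Sum>p | prime p & real p <= y & real p > y / T. g p) <= (\<Sum>p | prime p & real p <= y & real p > y / 2 ^ m. g p)"
 proof (rule sum_mono2)
  show "finite {p. prime p & real p <= y & real p > y / 2 ^ m}" by (rule finite_subset[OF _ finite_primes_le[of y]]) auto
  have "y / 2 ^ m <= y / T" using T2 T y by (intro divide_left_mono) auto
  thus "{p. prime p & real p <= y & real p > y / T} <= {p. prime p & real p <= y & real p > y / 2 ^ m}" by auto
 qed (auto intro: g0)
 also have "... <= 2 * K * real m" by (rule dyadic)
 also have "... <= 2 * K * (2 * (ln T + 1))"
 proof (intro mult_left_mono)
  have "1/2 <= ln (2::real)" using ln_le_minus_one[of "1/2::real"] by (simp add: ln_div)
  hence "ln T / ln 2 <= ln T / (1/2)" using T by (intro divide_left_mono) auto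
  hence "log 2 T <= 2 * ln T" by (simp add: log_def)
  show "real m <= 2 * (ln T + 1)"
   using order.trans[OF m(2) add_right_mono[OF \<open>log 2 T <= 2 * ln T\<close>, of 1]] by simp
 qed (use K0 in auto)
 finally show ?thesis by (simp add: g_def algebra_simps)
qed

context
 fixes w :: "nat => real" and K :: real
 assumes cw: "chebyshev_weight w K"
begin

lemma cw_nonneg: "0 <= w p" and cw_v: "0 <= w p / real p"
 using cw by (auto simp: chebyshev_weight_def)

lemma cw_K: "K >= 0"
proof -
 have "0 <= theta_sum w 1" unfolding prime_sum_def
  using cw_nonneg by (intro sum_nonneg mult_nonneg_nonneg ln_ge_zero) (auto dest: prime_gt_0_nat)
 also have "... <= K * 1" using cw unfolding chebyshev_weight_def by (metis zero_le_one)
 finally show ?thesis by simp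
qed

abbreviation wprod :: "nat set => real" where
 "wprod P \<equiv> \<Prod>p\<in>P. w p / real p"

lemma wprod_nonneg: "wprod P >= 0"
 by (intro prod_nonneg) (auto simp: cw_nonneg)

lemma ln_prod_primes: "P \<in> prime_sets k x ==> ln (real (\<Prod>P)) = (\<Sum>p\<in>P. ln (real p))"
 using prime_setsD[of P k x] by (subst of_nat_prod, subst ln_prod) (auto dest: prime_gt_0_nat)

text \<open>Weighting by \<open>ln (\<Prod>P) = (\<Sum>p\<in>P. ln p)\<close> and pointing at \<open>p\<close> shows that sets with product in
 \<open>(x / T, x]\<close> carry only a proportion \<open>ln T / ln x\<close>.\<close>

lemma lsum_ln_weight_range:
 assumes T: "T >= 1"
 shows "(\<Sum>P\<in>{P\<in>prime_sets (Suc k) x. real (\<Prod>P) > x / T}. wprod P * ln (real (\<Prod>P))) <= 4 * K * (ln T + 1) * lsum w k x"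
proof -
 define f where "f = (%p Q. if real p * real (\<Prod>Q) > x / T then (w p / real p * ln (real p)) * wprod Q else 0)"
 have "(\<Sum>P\<in>{P\<in>prime_sets (Suc k) x. real (\<Prod>P) > x / T}. wprod P * ln (real (\<Prod>P)))
   = (\<Sum>P\<in>prime_sets (Suc k) x. if real (\<Prod>P) > x / T then wprod P * ln (real (\<Prod>P)) else 0)"
  by (simp add: sum.inter_filter finite_prime_sets)
 also have "... = (\<Sum>P\<in>prime_sets (Suc k) x. \<Sum>p\<in>P. f p (P - {p}))"
 proof (rule sum.cong)
  fix P assume P: "P \<in> prime_sets (Suc k) x"
  have pr: "\<Prod>P = p * \<Prod>(P - {p})" "wprod P = w p / real p * wprod (P - {p})" if "p \<in> P" for p
   using prime_setsD(1)[OF P] that by (rule prod.remove)+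
  have "f p (P - {p}) = (if real (\<Prod>P) > x / T then wprod P * ln (real p) else 0)" if "p \<in> P" for p
  proof -
   have "real (\<Prod>P) = real p * real (\<Prod>(P - {p}))" using pr(1)[OF that] by (metis of_nat_mult)
   thus ?thesis unfolding f_def pr(2)[OF that] by simp
  qed
  hence "(\<Sum>p\<in>P. f p (P - {p})) = (\<Sum>p\<in>P. if real (\<Prod>P) > x / T then wprod P * ln (real p) else 0)" by (intro sum.cong) auto
  also have "... = (if real (\<Prod>P) > x / T then wprod P * ln (real (\<Prod>P)) else 0)"
   unfolding ln_prod_primes[OF P] by (simp add: sum_distrib_left)
  finally show "(if real (\<Prod>P) > x / T then wprod P * ln (real (\<Prod>P)) else 0) = (\<Sum>p\<in>P. f p (P - {p}))" by simp
 qed simp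
 also have "... = (\<Sum>Q\<in>prime_sets k x. \<Sum>p | prime p & real p <= x / real (\<Prod>Q) & p \<notin> Q. f p Q)"
  by (rule sum_pointed_prime_sets)
 also have "... <= (\<Sum>Q\<in>prime_sets k x. wprod Q * (4 * K * (ln T + 1)))"
 proof (rule sum_mono)
  fix Q assume Q: "Q \<in> prime_sets k x"
  define y where "y = x / real (\<Prod>Q)"
  have pos: "real (\<Prod>Q) > 0" using prime_setsD(5)[OF Q] .
  have y1: "y >= 1" using prime_setsD(4)[OF Q] pos by (simp add: y_def)
  have "(\<Sum>p | prime p & real p <= y & p \<notin> Q. f p Q) <= (\<Sum>p | prime p & real p <= y & real p > y / T. w p / real p * ln (real p) * wprod Q)"
  proof -
   have fp: "f p Q = (if real p > y / T then w p / real p * ln (real p) * wprod Q else 0)" for p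
   proof -
    have "real p * real (\<Prod>Q) > x / T \<longleftrightarrow> real p > y / T" using pos T by (simp add: y_def field_simps)
    thus ?thesis by (simp add: f_def)
   qed
   have "(\<Sum>p | prime p & real p <= y & p \<notin> Q. f p Q) <= (\<Sum>p | prime p & real p <= y. f p Q)"
    using wprod_nonneg[of Q] unfolding fp by (intro sum_mono2 finite_primes_le) (auto simp: cw_nonneg intro!: mult_nonneg_nonneg dest: prime_gt_0_nat)
   also have "... = (\<Sum>p | prime p & real p <= y & real p > y / T. w p / real p * ln (real p) * wprod Q)"
    unfolding fp by (subst sum.inter_filter[symmetric, OF finite_primes_le]) (auto intro!: sum.cong)
   finally show ?thesis .
  qed
  also have "... = wprod Q * (\<Sum>p | prime p & real p <= y & real p > y / T. w p / real p * ln (real p))"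
   by (simp add: sum_distrib_left mult.commute)
  also have "... <= wprod Q * (4 * K * (ln T + 1))"
   by (intro mult_left_mono mertens_short_range[OF cw y1 T] wprod_nonneg)
  finally show "(\<Sum>p | prime p & real p <= x / real (\<Prod>Q) & p \<notin> Q. f p Q) <= wprod Q * (4 * K * (ln T + 1))"
   by (simp add: y_def)
 qed
 also have "... = 4 * K * (ln T + 1) * lsum w k x" unfolding wsum_def sum_distrib_left by (intro sum.cong) (simp_all only: mult.commute)
 finally show ?thesis .
qed

text \<open>With \<open>T = x * exp 1\<close> the range condition holds for every set, because every
  product is at least 1.\<close>

lemma lsum_ln_weight:
 assumes "x >= 1"
 shows "(\<Sum>P\<in>prime_sets (Suc k) x. wprod P * ln (real (\<Prod>P))) <= 4 * K * (ln x + 2) * lsum w k x"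
proof -
 have "{P\<in>prime_sets (Suc k) x. real (\<Prod>P) > x / (x * exp 1)} = prime_sets (Suc k) x"
 proof -
  have "real (\<Prod>P) > x / (x * exp 1)" if "P \<in> prime_sets (Suc k) x" for P
  proof -
   have "x / (x * exp 1) = 1 / exp 1" using assms by simp
   also have "... < 1" by simp
   finally show ?thesis using prime_setsD(6)[OF that] by linarith
  qed
  thus ?thesis by blast
 qed
 moreover have "x * exp 1 >= 1" using assms mult_mono[of 1 x 1 "exp (1::real)"] by simp
 moreover have "ln (x * exp 1) + 1 = ln x + 2" using assms by (simp add: ln_mult)
 ultimately show ?thesis using lsum_ln_weight_range[of "x * exp 1" k x] by (simp add: add.commute)
qed

text \<open>As \<open>T <= sqrt x\<close>, the logarithmic weight is at least
  \<open>ln x / 2\<close> on this range and can be divided out. The inflated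
  \<open>T * exp 1\<close> turns the strict range of \<open>lsum_ln_weight_range\<close> into a
  closed one.\<close>

lemma lsum_short_range:
 assumes x: "x > 1" and T: "T >= 1" "T <= sqrt x"
 shows "(\<Sum>P\<in>{P\<in>prime_sets (Suc k) x. real (\<Prod>P) >= x / T}. wprod P) <= 16 * K * (ln T + 1) / ln x * lsum w k x"
proof -
 have lx: "ln x > 0" using x by simp
 have T0: "T > 0" using T by simp
 define T' where "T' = T * exp 1"
 have T': "T' >= 1" "ln T' + 1 = ln T + 2" using T mult_mono[of 1 T 1 "exp (1::real)"] by (auto simp: T'_def ln_mult)
 have lT: "ln T >= 0" using T by simp
 have xT: "ln (x / T) >= ln x / 2"
 proof -
  have "ln T <= ln (sqrt x)" using T T0 x by (subst ln_le_cancel_iff) auto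
  thus ?thesis using x T0 by (simp add: ln_div ln_sqrt)
 qed
 have sub: "x / T' < x / T" using x T0 by (simp add: T'_def divide_strict_left_mono)
 have "ln x / 2 * (\<Sum>P\<in>{P\<in>prime_sets (Suc k) x. real (\<Prod>P) >= x / T}. wprod P) <=
   (\<Sum>P\<in>{P\<in>prime_sets (Suc k) x. real (\<Prod>P) >= x / T}. wprod P * ln (real (\<Prod>P)))"
  unfolding sum_distrib_left
 proof (rule sum_mono)
  fix P assume P: "P \<in> {P\<in>prime_sets (Suc k) x. real (\<Prod>P) >= x / T}"
  hence "ln (x / T) <= ln (real (\<Prod>P))" using x T0 prime_setsD(5)[of P "Suc k" x] by (subst ln_le_cancel_iff) auto
  hence "ln x / 2 * wprod P <= ln (real (\<Prod>P)) * wprod P" using xT by (intro mult_right_mono wprod_nonneg) linarith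
  thus "ln x / 2 * wprod P <= wprod P * ln (real (\<Prod>P))" by (simp only: mult.commute)
 qed
 also have "... <= (\<Sum>P\<in>{P\<in>prime_sets (Suc k) x. real (\<Prod>P) > x / T'}. wprod P * ln (real (\<Prod>P)))"
 proof (rule sum_mono2)
  show "finite {P\<in>prime_sets (Suc k) x. real (\<Prod>P) > x / T'}" using finite_prime_sets by simp
  show "{P\<in>prime_sets (Suc k) x. real (\<Prod>P) >= x / T} <= {P\<in>prime_sets (Suc k) x. real (\<Prod>P) > x / T'}" using sub by auto
  fix P assume "P \<in> {P\<in>prime_sets (Suc k) x. real (\<Prod>P) > x / T'} - {P\<in>prime_sets (Suc k) x. real (\<Prod>P) >= x / T}"
  thus "0 <= wprod P * ln (real (\<Prod>P))" using prime_setsD(6)[of P "Suc k" x] by (intro mult_nonneg_nonneg wprod_nonneg) auto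
 qed
 also have "... <= 4 * K * (ln T' + 1) * lsum w k x" by (rule lsum_ln_weight_range[OF T'(1)])
 also have "... <= 4 * K * (2 * (ln T + 1)) * lsum w k x"
  unfolding T'(2) using cw_K lT wsum_nonneg[of "%p. w p / real p" k x] cw_v by (intro mult_right_mono mult_left_mono) auto
 finally show ?thesis using lx by (simp add: field_simps)
qed

end

section \<open>The recursion in the number of prime factors\<close>

text \<open>Comparison with the telescoping sum of \<open>1 / (N * (N + 1))\<close> started at
  \<open>y\<close>.\<close>

lemma prime_sum_recip_squares:
 assumes y: "y >= (1::nat)"
 shows "prime_sum (%p. if p > y then 1 / (real p)\<^sup>2 else 0) x <= 1 / real y"
proof -
 have nat: "prime_sum (%p. if p > y then 1 / (real p)\<^sup>2 else 0) (real N) <= (if N > y then 1 / real y - 1 / real N else 0)" for N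
 proof (induction N)
  case 0
  have "{p::nat. prime p & real p <= real 0} = {}" by (auto dest: prime_gt_0_nat)
  thus ?case by (simp add: prime_sum_def)
 next
  case (Suc N)
  show ?case
  proof (cases "Suc N > y")
   case True
   have "1 / (real (Suc N))\<^sup>2 <= 1 / (real N * real (Suc N))"
    using True y by (intro divide_left_mono) (auto simp: power2_eq_square)
   also have "... = 1 / real N - 1 / real (Suc N)" using True y by (simp add: field_simps)
   finally have "1 / (real (Suc N))\<^sup>2 <= 1 / real N - 1 / real (Suc N)" .
   moreover have "prime_sum (%p. if p > y then 1 / (real p)\<^sup>2 else 0) (real N) <= 1 / real y - 1 / real N"
    using Suc True by (cases "N > y") (auto simp: less_Suc_eq)
   moreover have "0 <= 1 / (real (Suc N))\<^sup>2" by simp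
   ultimately have "prime_sum (%p. if p > y then 1 / (real p)\<^sup>2 else 0) (real N) + (if prime (Suc N) then 1 / (real (Suc N))\<^sup>2 else 0) <= 1 / real y - 1 / real (Suc N)"
    by (cases "prime (Suc N)"; simp only: if_True if_False; linarith)
   thus ?thesis unfolding prime_sum_Suc by (cases "prime (Suc N)") (simp_all only: True if_True if_False)
  next
   case False
   thus ?thesis unfolding prime_sum_Suc using Suc by simp
  qed
 qed
 show ?thesis
 proof (cases "x >= 0")
  case True
  have "prime_sum (%p. if p > y then 1 / (real p)\<^sup>2 else 0) x <= (if nat \<lfloor>x\<rfloor> > y then 1 / real y - 1 / real (nat \<lfloor>x\<rfloor>) else 0)"
   unfolding prime_sum_nat[OF True] by (rule nat)
  also have "... <= 1 / real y" by simp
  finally show ?thesis .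
 next
  case False
  hence empty: "{p::nat. prime p & real p <= x} = {}" by auto
  show ?thesis unfolding prime_sum_def empty by simp
 qed
qed

text \<open>The value 0 at \<open>k = 0\<close> lets the error terms of the recursion be stated for
  all \<open>k\<close> at once.\<close>

definition lprev :: "(nat => real) => nat => real => real" where
 "lprev w k x = (if k = 0 then 0 else lsum w (k - 1) x)"

context
 fixes w :: "nat => real" and b K :: real
 assumes mw: "mertens_weight w b K" and cw: "chebyshev_weight w K"
begin

lemma mw_K: "K >= 1" and mw_bound: "0 <= w p & w p <= K"
 and mw_D1: "u >= 1 ==> \<bar>recip_sum w u - ln (1 + ln u)\<bar> <= K"
 and mw_D: "u >= 27 ==> \<bar>recip_sum w u - (ln (ln u) + b)\<bar> <= K / ln (ln u)"
 using mw by (auto simp: mertens_weight_def)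

lemma lsum_nonneg: "0 <= lsum w k x"
 by (intro wsum_nonneg cw_v[OF cw])

lemma recip_square_sum: "prime_sum (%p. (w p / real p)\<^sup>2) x <= K\<^sup>2"
proof -
 have "prime_sum (%p. (w p / real p)\<^sup>2) x <= prime_sum (%p. K\<^sup>2 * (if p > 1 then 1 / (real p)\<^sup>2 else 0)) x"
  unfolding prime_sum_def
 proof (rule sum_mono)
  fix p assume "p \<in> {p::nat. prime p & real p <= x}"
  hence "p > 1" by (auto dest: prime_gt_1_nat)
  moreover have "(w p)\<^sup>2 <= K\<^sup>2" using mw_bound[of p] by (intro power_mono) auto
  ultimately show "(w p / real p)\<^sup>2 <= K\<^sup>2 * (if p > 1 then 1 / (real p)\<^sup>2 else 0)"
   by (simp add: power_divide divide_right_mono)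
 qed
 also have "... = K\<^sup>2 * prime_sum (%p. if p > 1 then 1 / (real p)\<^sup>2 else 0) x"
  unfolding prime_sum_def by (rule sum_distrib_left[symmetric])
 also have "... <= K\<^sup>2 * (1 / real 1)" by (intro mult_left_mono prime_sum_recip_squares) auto
 finally show ?thesis by simp
qed

text \<open>The correction for primes already in the set: a repeated \<open>p\<close> brings a
  second factor \<open>w p / p\<close>, and the sum of the squares is bounded, so the total is at
  most a multiple of the sum over sets with one prime fewer.\<close>

lemma lsum_repeated:
 "(\<Sum>Q\<in>prime_sets (Suc k) x. (\<Prod>p\<in>Q. w p / real p) * (\<Sum>p\<in>{p\<in>Q. prime p & real p <= x / real (\<Prod>Q)}. w p / real p)) <= K\<^sup>2 * lsum w k x"
proof -
 have "(\<Sum>Q\<in>prime_sets (Suc k) x. (\<Prod>p\<in>Q. w p / real p) * (\<Sum>p\<in>{p\<in>Q. prime p & real p <= x / real (\<Prod>Q)}. w p / real p))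
   <= (\<Sum>Q\<in>prime_sets (Suc k) x. \<Sum>p\<in>Q. (w p / real p)\<^sup>2 * (\<Prod>p\<in>Q - {p}. w p / real p))"
 proof (rule sum_mono)
  fix Q assume Q: "Q \<in> prime_sets (Suc k) x"
  have "(\<Prod>p\<in>Q. w p / real p) * (\<Sum>p\<in>{p\<in>Q. prime p & real p <= x / real (\<Prod>Q)}. w p / real p) <= (\<Prod>p\<in>Q. w p / real p) * (\<Sum>p\<in>Q. w p / real p)"
   using prime_setsD(1)[OF Q] by (intro mult_left_mono sum_mono2 wprod_nonneg[OF cw] cw_v[OF cw]) auto
  also have "... = (\<Sum>p\<in>Q. (w p / real p)\<^sup>2 * (\<Prod>p\<in>Q - {p}. w p / real p))"
   unfolding sum_distrib_left
  proof (rule sum.cong)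
   fix p assume "p \<in> Q"
   hence "(\<Prod>p\<in>Q. w p / real p) = w p / real p * (\<Prod>p\<in>Q - {p}. w p / real p)" using prime_setsD(1)[OF Q] by (intro prod.remove)
   thus "(\<Prod>p\<in>Q. w p / real p) * (w p / real p) = (w p / real p)\<^sup>2 * (\<Prod>p\<in>Q - {p}. w p / real p)"
    by (simp only: power2_eq_square mult_ac)
  qed simp
  finally show "(\<Prod>p\<in>Q. w p / real p) * (\<Sum>p\<in>{p\<in>Q. prime p & real p <= x / real (\<Prod>Q)}. w p / real p) <= (\<Sum>p\<in>Q. (w p / real p)\<^sup>2 * (\<Prod>p\<in>Q - {p}. w p / real p))" .
 qed
 also have "... <= (\<Sum>Q\<in>prime_sets k x. prime_sum (%p. (w p / real p)\<^sup>2 * (\<Prod>p\<in>Q. w p / real p)) (x / real (\<Prod>Q)))"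
  by (intro sum_pointed_le mult_nonneg_nonneg wprod_nonneg[OF cw]) auto
 also have "... <= (\<Sum>Q\<in>prime_sets k x. K\<^sup>2 * (\<Prod>p\<in>Q. w p / real p))"
 proof (rule sum_mono)
  fix Q
  have "prime_sum (%p. (w p / real p)\<^sup>2 * (\<Prod>p\<in>Q. w p / real p)) (x / real (\<Prod>Q)) = prime_sum (%p. (w p / real p)\<^sup>2) (x / real (\<Prod>Q)) * (\<Prod>p\<in>Q. w p / real p)"
   unfolding prime_sum_def by (rule sum_distrib_right[symmetric])
  also have "... <= K\<^sup>2 * (\<Prod>p\<in>Q. w p / real p)" by (intro mult_right_mono recip_square_sum wprod_nonneg[OF cw])
  finally show "prime_sum (%p. (w p / real p)\<^sup>2 * (\<Prod>p\<in>Q. w p / real p)) (x / real (\<Prod>Q)) <= K\<^sup>2 * (\<Prod>p\<in>Q. w p / real p)" .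
 qed
 also have "... = K\<^sup>2 * lsum w k x" by (simp add: wsum_def sum_distrib_left)
 finally show ?thesis .
qed

text \<open>Layers \<open>ln u + 1 <= (ln x + 1) exp (- i)\<close> turn the logarithmic weight into a geometric series.\<close>

lemma lsum_layers:
 assumes x: "ln x >= 2" and x1: "x > 1"
 shows "(\<Sum>Q\<in>{Q\<in>prime_sets (Suc k) x. x / real (\<Prod>Q) <= sqrt x}. (\<Prod>p\<in>Q. w p / real p) * ln ((1 + ln x) / (1 + ln (x / real (\<Prod>Q))))) <= 56 * K * lsum w k x"
  and "(\<Sum>Q\<in>{Q\<in>prime_sets (Suc k) x. x / real (\<Prod>Q) <= sqrt x}. (\<Prod>p\<in>Q. w p / real p)) <= 16 * K * lsum w k x"
proof -
 define wp where "wp = (%Q. \<Prod>p\<in>Q. w p / real p)"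
 define u where "u = (%Q. x / real (\<Prod>Q))"
 define S where "S = {Q\<in>prime_sets (Suc k) x. u Q <= sqrt x}"
 define y where "y = (%Q. ln ((1 + ln x) / (1 + ln (u Q))))"
 have finS: "finite S" unfolding S_def using finite_prime_sets by simp
 have u1: "u Q >= 1" if "Q \<in> prime_sets (Suc k) x" for Q
  using prime_setsD(4,5)[OF that] by (simp add: u_def)
 have range: "sum wp {Q\<in>prime_sets (Suc k) x. u Q <= T} <= 16 * K * (ln T + 1) / ln x * lsum w k x"
  if T: "T >= 1" "T <= sqrt x" for T
 proof -
  have "{Q\<in>prime_sets (Suc k) x. u Q <= T} = {Q\<in>prime_sets (Suc k) x. real (\<Prod>Q) >= x / T}"
   using T x1 by (auto simp: u_def field_simps dest: prime_setsD(5))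
  thus ?thesis unfolding wp_def using lsum_short_range[OF cw x1 T, of k] by simp
 qed
 have sq: "sqrt x >= 1" "ln (sqrt x) = ln x / 2" using x1 by (auto simp: ln_sqrt)
 have L0: "lsum w k x >= 0" by (rule lsum_nonneg)
 have KL: "0 <= K * lsum w k x" using mw_K L0 by simp
 have base: "sum wp S <= 16 * K * lsum w k x"
 proof -
  have "sum wp S <= 16 * K * (ln x / 2 + 1) / ln x * lsum w k x" unfolding S_def using range[OF sq(1)] sq(2) by simp
  also have "... = 16 * (K * lsum w k x) * ((ln x / 2 + 1) / ln x)" by simp
  also have "... <= 16 * (K * lsum w k x) * 1" using x KL by (intro mult_left_mono) (auto simp: field_simps)
  finally show ?thesis by simp
 qed
 thus "(\<Sum>Q\<in>{Q\<in>prime_sets (Suc k) x. x / real (\<Prod>Q) <= sqrt x}. (\<Prod>p\<in>Q. w p / real p)) <= 16 * K * lsum w k x"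
  by (simp add: S_def wp_def u_def)
 define I where "I = nat \<lceil>ln (1 + ln x)\<rceil>"
 \<comment> \<open>Layer-cake formula: a number is at most 1 plus the number of positive integers up
   to it. Each condition \<open>real i <= y Q\<close> describes a set to which \<open>range\<close>
   applies.\<close>
 have y_le: "y Q <= 1 + (\<Sum>i=1..I. if real i <= y Q then 1 else 0)" if Q: "Q \<in> S" for Q
 proof -
  have uq: "u Q >= 1" using Q u1 by (simp add: S_def)
  hence lu: "ln (u Q) >= 0" by simp
  have "(1 + ln x) / (1 + ln (u Q)) <= (1 + ln x) / 1" using lu x by (intro divide_left_mono) auto
  hence "y Q <= ln (1 + ln x)" unfolding y_def using lu x by (subst ln_le_cancel_iff) auto
  hence yI: "y Q <= real I" unfolding I_def by linarith
  show ?thesis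
  proof (cases "y Q >= 0")
   case True
   define j where "j = nat \<lfloor>y Q\<rfloor>"
   have j: "real j <= y Q" "y Q < real j + 1" "j <= I" using True yI unfolding j_def by linarith+
   have "real j = (\<Sum>i=1..j. (1::real))" by simp
   also have "... = (\<Sum>i=1..j. if real i <= y Q then 1 else 0)"
   proof (rule sum.cong)
    fix i assume "i \<in> {1..j}"
    hence "real i <= y Q" using order.trans[OF _ j(1), of "real i"] by simp
    thus "1 = (if real i <= y Q then 1 else (0::real))" by simp
   qed simp
   also have "... <= (\<Sum>i=1..I. if real i <= y Q then 1 else 0)"
    using j(3) by (intro sum_mono2) auto
   finally show ?thesis using j by linarith
  next
   case False
   thus ?thesis by (smt (verit) sum_nonneg)
  qed
 qed
 have layer: "(\<Sum>Q\<in>S. if real i <= y Q then wp Q else 0) <= 32 * K * lsum w k x * (1/2) ^ i" if i: "i >= 1" for i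
 proof -
  define T where "T = exp ((1 + ln x) * exp (- real i) - 1)"
  have e12: "exp (- real i) <= (1/2) ^ i"
  proof -
   have "exp (1::real) >= 2" using exp_ge_add_one_self[of 1] by simp
   hence "exp (- 1 :: real) <= 1/2" by (simp add: exp_minus field_simps)
   hence "exp (- 1 :: real) ^ i <= (1/2) ^ i" by (intro power_mono) auto
   thus ?thesis by (simp flip: exp_of_nat_mult)
  qed
  have sub: "{Q\<in>S. real i <= y Q} <= {Q\<in>prime_sets (Suc k) x. u Q <= T}"
  proof
   fix Q assume Q: "Q \<in> {Q\<in>S. real i <= y Q}"
   hence uq: "u Q >= 1" using u1 by (simp add: S_def)
   hence lu: "ln (u Q) >= 0" by simp
   have "exp (real i) <= exp (y Q)" using Q by simp
   also have "... = (1 + ln x) / (1 + ln (u Q))" unfolding y_def using lu x by (intro exp_ln divide_pos_pos) auto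
   finally have "(1 + ln (u Q)) * exp (real i) <= 1 + ln x" using lu by (simp add: field_simps)
   hence "1 + ln (u Q) <= (1 + ln x) * exp (- real i)" by (simp add: exp_minus field_simps)
   hence "exp (ln (u Q)) <= T" unfolding T_def by (subst exp_le_cancel_iff) linarith
   thus "Q \<in> {Q\<in>prime_sets (Suc k) x. u Q <= T}" using Q uq by (simp add: S_def)
  qed
  have "(\<Sum>Q\<in>S. if real i <= y Q then wp Q else 0) = sum wp {Q\<in>S. real i <= y Q}"
   by (simp add: sum.inter_filter finS)
  also have "... <= sum wp {Q\<in>prime_sets (Suc k) x. u Q <= T}"
   using sub finite_prime_sets by (intro sum_mono2) (auto simp: wp_def wprod_nonneg[OF cw])
  also have "... <= 32 * K * lsum w k x * (1/2) ^ i"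
  proof (cases "T >= 1")
   case True
   have "exp (- real i) <= 1/2" using e12 power_decreasing[of 1 i "1/2::real"] i by simp
   hence "(1 + ln x) * exp (- real i) <= (1 + ln x) * (1/2)" using x by (intro mult_left_mono) auto
   hence "T <= exp (ln (sqrt x))" unfolding T_def sq(2) by (subst exp_le_cancel_iff) (simp add: field_simps)
   hence "T <= sqrt x" using x1 by simp
   from range[OF True this] have "sum wp {Q\<in>prime_sets (Suc k) x. u Q <= T} <= 16 * K * ((1 + ln x) * exp (- real i)) / ln x * lsum w k x"
    by (simp add: T_def)
   also have "... = 16 * (K * lsum w k x) * (((1 + ln x) / ln x) * exp (- real i))" by simp
   also have "... <= 16 * (K * lsum w k x) * (2 * (1/2) ^ i)"
    using x KL e12 by (intro mult_left_mono mult_mono) (auto simp: field_simps)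
   finally show ?thesis by simp
  next
   case False
   hence "{Q\<in>prime_sets (Suc k) x. u Q <= T} = {}" using u1 by force
   hence "sum wp {Q\<in>prime_sets (Suc k) x. u Q <= T} = 0" by (simp only: sum.empty)
   thus ?thesis using mult_nonneg_nonneg[OF KL, of "32 * (1/2)^i"] by (simp add: mult_ac)
  qed
  finally show ?thesis .
 qed
 have "(\<Sum>Q\<in>S. wp Q * y Q) <= (\<Sum>Q\<in>S. wp Q + (\<Sum>i=1..I. if real i <= y Q then wp Q else 0))"
 proof (rule sum_mono)
  fix Q assume Q: "Q \<in> S"
  have "wp Q * y Q <= wp Q * (1 + (\<Sum>i=1..I. if real i <= y Q then 1 else 0))"
   by (intro mult_left_mono y_le[OF Q]) (simp add: wp_def wprod_nonneg[OF cw])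
  also have "... = wp Q + (\<Sum>i=1..I. if real i <= y Q then wp Q else 0)"
   by (simp add: distrib_left sum_distrib_left if_distrib cong: if_cong)
  finally show "wp Q * y Q <= wp Q + (\<Sum>i=1..I. if real i <= y Q then wp Q else 0)" .
 qed
 also have "... = sum wp S + (\<Sum>i=1..I. \<Sum>Q\<in>S. if real i <= y Q then wp Q else 0)"
  by (simp add: sum.distrib) (rule sum.swap)
 also have "... <= 16 * K * lsum w k x + (\<Sum>i=1..I. 32 * K * lsum w k x * (1/2) ^ i)"
  by (intro add_mono base sum_mono layer) auto
 also have "(\<Sum>i=1..I. 32 * K * lsum w k x * (1/2) ^ i) = 32 * (K * lsum w k x) * (\<Sum>i=1..I. (1/2) ^ i)"
  by (simp add: sum_distrib_left mult.assoc)
 also have "... <= 32 * (K * lsum w k x) * 1"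
 proof (intro mult_left_mono)
  have "(\<Sum>i=1..I. (1/2::real) ^ i) = 1 - (1/2) ^ I" by (induction I) auto
  thus "(\<Sum>i=1..I. (1/2::real) ^ i) <= 1" by simp
 qed (use KL in auto)
 finally have "(\<Sum>Q\<in>S. wp Q * y Q) <= 48 * (K * lsum w k x)" by simp
 also have "... <= 56 * (K * lsum w k x)" using KL by (intro mult_right_mono) auto
 finally show "(\<Sum>Q\<in>{Q\<in>prime_sets (Suc k) x. x / real (\<Prod>Q) <= sqrt x}. (\<Prod>p\<in>Q. w p / real p) * ln ((1 + ln x) / (1 + ln (x / real (\<Prod>Q))))) <= 56 * K * lsum w k x"
  by (simp add: S_def wp_def u_def y_def mult_ac)
qed

text \<open>Where \<open>x / \<Prod>Q\<close> exceeds \<open>sqrt x\<close>, the precise Mertens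
  estimate applies, and replacing its main term by \<open>ln (ln x)\<close> costs
  \<open>2 * ln (\<Prod>Q) / ln x\<close>, which \<open>lsum_ln_weight\<close> sums. The other sets
  only admit the bounded-error form, whose loss is the logarithm controlled by
  \<open>lsum_layers\<close>. The threshold 729 is \<open>27^2\<close>.\<close>

lemma lsum_recip_deviation:
 assumes x: "x >= 729" and LL: "ln (ln x) >= 2"
 shows "(\<Sum>Q\<in>prime_sets k x. (\<Prod>p\<in>Q. w p / real p) * \<bar>recip_sum w (x / real (\<Prod>Q)) - (ln (ln x) + b)\<bar>)
  <= (88 * K + 16 * K * (K + \<bar>b\<bar> + 1)) * lprev w k x + 2 * K / ln (ln x) * lsum w k x"
proof (cases k)
 case 0
 have "K / ln (ln x) <= 2 * K / ln (ln x)" using LL mw_K by (intro divide_right_mono) auto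
 thus ?thesis using mw_D[of x] x 0 by (simp add: prime_sets_0 wsum_0 lprev_def)
next
 case (Suc j)
 have lx2: "ln x >= 2"
 proof -
  have "ln x > 0" using x by simp
  hence "exp (ln (ln x)) = ln x" by simp
  moreover have "exp (ln (ln x)) >= 1 + ln (ln x)" by (rule exp_ge_add_one_self)
  ultimately show ?thesis using LL by linarith
 qed
 define wp where "wp = (%Q. \<Prod>p\<in>Q. w p / real p)"
 define u where "u = (%Q. x / real (\<Prod>Q))"
 define dev where "dev = (%Q. \<bar>recip_sum w (u Q) - (ln (ln x) + b)\<bar>)"
 have wp0: "wp Q >= 0" for Q unfolding wp_def by (rule wprod_nonneg[OF cw])
 define S where "S = {Q\<in>prime_sets (Suc j) x. u Q <= sqrt x}"
 have SS: "S <= prime_sets (Suc j) x" by (auto simp: S_def)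
 have sq27: "sqrt x >= 27" using x by (intro real_le_rsqrt) auto
 have lsq: "ln (sqrt x) = ln x / 2" using x by (simp add: ln_sqrt)
 have far: "wp Q * dev Q <= 2 / ln x * (wp Q * ln (real (\<Prod>Q))) + 2 * K / ln (ln x) * wp Q"
  if Q: "Q \<in> prime_sets (Suc j) x - S" for Q
 proof -
  have uQ: "u Q > sqrt x" using Q by (auto simp: S_def)
  hence u27: "u Q >= 27" using sq27 by linarith
  have pos: "real (\<Prod>Q) > 0" "real (\<Prod>Q) >= 1" using Q prime_setsD(5,6) by blast+
  have lu: "ln (u Q) = ln x - ln (real (\<Prod>Q))" unfolding u_def using pos x by (simp add: ln_div)
  have lu2: "ln (u Q) >= ln x / 2" using uQ sq27 lsq by (metis less_eq_real_def ln_le_cancel_iff order_less_le_trans zero_less_numeral order.strict_trans)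
  have lup: "ln (u Q) > 0" using lu2 lx2 by linarith
  have lle: "ln (u Q) <= ln x" using lu pos by simp
  have d1: "\<bar>recip_sum w (u Q) - (ln (ln (u Q)) + b)\<bar> <= K / ln (ln (u Q))" by (rule mw_D[OF u27])
  have "ln (ln x / 2) <= ln (ln (u Q))" using lu2 lx2 by (subst ln_le_cancel_iff) auto
  moreover have "ln (ln x / 2) = ln (ln x) - ln 2" using lx2 by (simp add: ln_div)
  ultimately have "ln (ln (u Q)) >= ln (ln x) / 2" using LL ln_2_less_1 by linarith
  hence d2: "K / ln (ln (u Q)) <= K / (ln (ln x) / 2)" using LL mw_K by (intro divide_left_mono mult_pos_pos) auto
  have "ln (ln x) - ln (ln (u Q)) = ln (ln x / ln (u Q))" using lup lle by (simp add: ln_div)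
  also have "... <= ln x / ln (u Q) - 1" using lup lle by (intro ln_le_minus_one divide_pos_pos) auto
  also have "... = ln (real (\<Prod>Q)) / ln (u Q)" using lup lu by (simp add: field_simps)
  also have "... <= ln (real (\<Prod>Q)) / (ln x / 2)" using lu2 lx2 pos lup by (intro divide_left_mono mult_pos_pos) auto
  finally have d3: "ln (ln x) - ln (ln (u Q)) <= 2 / ln x * ln (real (\<Prod>Q))" by (simp add: mult.commute)
  have d4: "ln (ln (u Q)) <= ln (ln x)" using lup lle by simp
  have "dev Q <= 2 / ln x * ln (real (\<Prod>Q)) + 2 * K / ln (ln x)"
   unfolding dev_def abs_le_iff using abs_le_D1[OF d1] abs_le_D2[OF d1] d2 d3 d4 by (auto simp: mult.commute)
  hence "wp Q * dev Q <= wp Q * (2 / ln x * ln (real (\<Prod>Q)) + 2 * K / ln (ln x))" using wp0 by (intro mult_left_mono)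
  thus ?thesis by (simp add: algebra_simps)
 qed
 have near: "wp Q * dev Q <= (K + \<bar>b\<bar> + 1) * wp Q + wp Q * ln ((1 + ln x) / (1 + ln (u Q)))" if Q: "Q \<in> S" for Q
 proof -
  have u1: "u Q >= 1" using Q prime_setsD(4,5)[of Q "Suc j" x] by (simp add: S_def u_def)
  hence lu: "ln (u Q) >= 0" by simp
  have "u Q <= sqrt x" using Q by (simp add: S_def)
  hence lux: "ln (u Q) <= ln x / 2" using u1 lsq sq27 by (metis ln_le_cancel_iff order_less_le_trans zero_less_numeral zero_less_one)
  have d1: "\<bar>recip_sum w (u Q) - ln (1 + ln (u Q))\<bar> <= K" by (rule mw_D1[OF u1])
  have d2: "ln ((1 + ln x) / (1 + ln (u Q))) = ln (1 + ln x) - ln (1 + ln (u Q))" using lu lx2 by (simp add: ln_div)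
  have d3: "ln (1 + ln (u Q)) <= ln (1 + ln x)" using lu lux lx2 by simp
  have d4: "ln (ln x) <= ln (1 + ln x)" using lx2 by simp
  have "ln (1 + ln x) <= ln (2 * ln x)" using lx2 by (subst ln_le_cancel_iff) auto
  also have "... = ln 2 + ln (ln x)" using lx2 by (simp add: ln_mult)
  finally have d5: "ln (1 + ln x) <= 1 + ln (ln x)" using ln_2_less_1 by linarith
  have "dev Q <= (K + \<bar>b\<bar> + 1) + ln ((1 + ln x) / (1 + ln (u Q)))"
   unfolding dev_def d2 using d1 d3 d4 d5 by linarith
  hence "wp Q * dev Q <= wp Q * ((K + \<bar>b\<bar> + 1) + ln ((1 + ln x) / (1 + ln (u Q))))" using wp0 by (intro mult_left_mono)
  thus ?thesis by (simp add: algebra_simps)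
 qed
 have L0: "0 <= K * lsum w j x" using lsum_nonneg[of j x] mw_K by simp
 have "(\<Sum>Q\<in>prime_sets (Suc j) x. wp Q * dev Q) = (\<Sum>Q\<in>prime_sets (Suc j) x - S. wp Q * dev Q) + (\<Sum>Q\<in>S. wp Q * dev Q)"
  by (rule sum.subset_diff[OF SS finite_prime_sets])
 also have "(\<Sum>Q\<in>S. wp Q * dev Q) <= (\<Sum>Q\<in>S. (K + \<bar>b\<bar> + 1) * wp Q + wp Q * ln ((1 + ln x) / (1 + ln (u Q))))"
  by (intro sum_mono near)
 also have "... = (K + \<bar>b\<bar> + 1) * sum wp S + (\<Sum>Q\<in>S. wp Q * ln ((1 + ln x) / (1 + ln (u Q))))"
  by (simp add: sum.distrib sum_distrib_left)
 also have "... <= (K + \<bar>b\<bar> + 1) * (16 * K * lsum w j x) + 56 * K * lsum w j x"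
  using lsum_layers[OF lx2 _, of j] x mw_K by (intro add_mono mult_left_mono) (auto simp: S_def wp_def u_def)
 also have "(\<Sum>Q\<in>prime_sets (Suc j) x - S. wp Q * dev Q) <= (\<Sum>Q\<in>prime_sets (Suc j) x - S. 2 / ln x * (wp Q * ln (real (\<Prod>Q))) + 2 * K / ln (ln x) * wp Q)"
  by (intro sum_mono far)
 also have "... <= (\<Sum>Q\<in>prime_sets (Suc j) x. 2 / ln x * (wp Q * ln (real (\<Prod>Q))) + 2 * K / ln (ln x) * wp Q)"
 proof (intro sum_mono2 finite_prime_sets)
  fix Q assume "Q \<in> prime_sets (Suc j) x - (prime_sets (Suc j) x - S)"
  hence "Q \<in> prime_sets (Suc j) x" by blast
  hence "ln (real (\<Prod>Q)) >= 0" using prime_setsD(6) by (metis ln_ge_zero)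
  thus "0 <= 2 / ln x * (wp Q * ln (real (\<Prod>Q))) + 2 * K / ln (ln x) * wp Q"
   using wp0 lx2 LL mw_K by (intro add_nonneg_nonneg mult_nonneg_nonneg) auto
 qed auto
 also have "... = 2 / ln x * (\<Sum>Q\<in>prime_sets (Suc j) x. wp Q * ln (real (\<Prod>Q))) + 2 * K / ln (ln x) * lsum w (Suc j) x"
  by (simp add: sum.distrib sum_distrib_left wsum_def wp_def)
 also have "2 / ln x * (\<Sum>Q\<in>prime_sets (Suc j) x. wp Q * ln (real (\<Prod>Q))) <= 2 / ln x * (4 * K * (ln x + 2) * lsum w j x)"
  unfolding wp_def using lx2 x by (intro mult_left_mono lsum_ln_weight[OF cw]) auto
 also have "2 / ln x * (4 * K * (ln x + 2) * lsum w j x) = 8 * (K * lsum w j x) * ((ln x + 2) / ln x)" by simp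
 also have "... <= 8 * (K * lsum w j x) * 2" using lx2 L0 by (intro mult_left_mono) (auto simp: field_simps)
 finally have "(\<Sum>Q\<in>prime_sets (Suc j) x. wp Q * dev Q) <=
  8 * (K * lsum w j x) * 2 + 2 * K / ln (ln x) * lsum w (Suc j) x + ((K + \<bar>b\<bar> + 1) * (16 * K * lsum w j x) + 56 * K * lsum w j x)" by simp
 also have "... <= (88 * K + 16 * K * (K + \<bar>b\<bar> + 1)) * lsum w j x + 2 * K / ln (ln x) * lsum w (Suc j) x"
 proof -
  have "(88 * K + 16 * K * (K + \<bar>b\<bar> + 1)) * lsum w j x = 88 * (K * lsum w j x) + (K + \<bar>b\<bar> + 1) * (16 * K * lsum w j x)"
   by (simp add: algebra_simps)
  thus ?thesis using L0 by linarith
 qed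
 finally show ?thesis by (simp add: Suc lprev_def wp_def dev_def u_def)
qed

text \<open>By \<open>wsum_Suc\<close> the left term is an average of \<open>recip_sum\<close> at
  \<open>x / \<Prod>Q\<close>, minus the primes of \<open>Q\<close> itself; the first part is
  \<open>lsum_recip_deviation\<close>, the second \<open>lsum_repeated\<close>.\<close>

theorem lsum_recursion:
 assumes x: "x >= 729" and LL: "ln (ln x) >= 2"
 shows "\<bar>real (Suc k) * lsum w (Suc k) x - (ln (ln x) + b) * lsum w k x\<bar>
  <= (88 * K + 16 * K * (K + \<bar>b\<bar> + 1) + K\<^sup>2) * (lprev w k x + lsum w k x / ln (ln x))"
proof -
 define wp where "wp = (%Q. \<Prod>p\<in>Q. w p / real p)"
 define u where "u = (%Q. x / real (\<Prod>Q))"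
 define corr where "corr = (%Q. \<Sum>p\<in>{p\<in>Q. prime p & real p <= u Q}. w p / real p)"
 have wp0: "wp Q >= 0" for Q unfolding wp_def by (rule wprod_nonneg[OF cw])
 have L0: "lsum w j x >= 0" for j by (rule lsum_nonneg)
 have prev0: "lprev w k x >= 0" using L0 by (simp add: lprev_def)
 have 1: "real (Suc k) * lsum w (Suc k) x = (\<Sum>Q\<in>prime_sets k x. wp Q * (recip_sum w (u Q) - corr Q))"
  unfolding wsum_Suc wp_def u_def corr_def
 proof (rule sum.cong)
  fix Q assume "Q \<in> prime_sets k x"
  from prime_sum_split_mem[OF prime_setsD(1)[OF this], of "%p. w p / real p" "x / real (\<Prod>Q)"]
  show "(\<Prod>r\<in>Q. w r / real r) * (\<Sum>p | prime p & real p <= x / real (\<Prod>Q) & p \<notin> Q. w p / real p) =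
   (\<Prod>p\<in>Q. w p / real p) * (recip_sum w (x / real (\<Prod>Q)) - (\<Sum>p\<in>{p\<in>Q. prime p & real p <= x / real (\<Prod>Q)}. w p / real p))" by simp
 qed simp
 have 2: "(ln (ln x) + b) * lsum w k x = (\<Sum>Q\<in>prime_sets k x. wp Q * (ln (ln x) + b))"
  by (simp add: wsum_def wp_def sum_distrib_left mult.commute)
 have "real (Suc k) * lsum w (Suc k) x - (ln (ln x) + b) * lsum w k x =
  (\<Sum>Q\<in>prime_sets k x. wp Q * (recip_sum w (u Q) - (ln (ln x) + b))) - (\<Sum>Q\<in>prime_sets k x. wp Q * corr Q)"
  unfolding 1 2 by (simp add: sum_subtractf[symmetric] algebra_simps)
 moreover have "\<bar>\<Sum>Q\<in>prime_sets k x. wp Q * (recip_sum w (u Q) - (ln (ln x) + b))\<bar> <= (\<Sum>Q\<in>prime_sets k x. wp Q * \<bar>recip_sum w (u Q) - (ln (ln x) + b)\<bar>)"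
  using sum_abs[of "%Q. wp Q * (recip_sum w (u Q) - (ln (ln x) + b))" "prime_sets k x"] wp0 by (simp add: abs_mult)
 moreover have "... <= (88 * K + 16 * K * (K + \<bar>b\<bar> + 1)) * lprev w k x + 2 * K / ln (ln x) * lsum w k x"
  unfolding wp_def u_def by (rule lsum_recip_deviation[OF x LL])
 moreover have "0 <= (\<Sum>Q\<in>prime_sets k x. wp Q * corr Q)"
  by (intro sum_nonneg mult_nonneg_nonneg wp0) (auto simp: corr_def intro!: sum_nonneg cw_v[OF cw])
 moreover have "(\<Sum>Q\<in>prime_sets k x. wp Q * corr Q) <= K\<^sup>2 * lprev w k x"
 proof (cases k)
  case 0
  thus ?thesis by (simp add: prime_sets_0 corr_def lprev_def)
 next
  case (Suc j)
  thus ?thesis using lsum_repeated[where k = j and x = x] by (simp add: wp_def corr_def u_def lprev_def)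
 qed
 ultimately have "\<bar>real (Suc k) * lsum w (Suc k) x - (ln (ln x) + b) * lsum w k x\<bar> <=
  (88 * K + 16 * K * (K + \<bar>b\<bar> + 1)) * lprev w k x + 2 * K / ln (ln x) * lsum w k x + K\<^sup>2 * lprev w k x" by linarith
 also have "... <= (88 * K + 16 * K * (K + \<bar>b\<bar> + 1) + K\<^sup>2) * lprev w k x + (88 * K + 16 * K * (K + \<bar>b\<bar> + 1) + K\<^sup>2) * (lsum w k x / ln (ln x))"
 proof -
  have "2 * K <= 88 * K + 16 * K * (K + \<bar>b\<bar> + 1) + K\<^sup>2" using mw_K by simp
  moreover have "lsum w k x / ln (ln x) >= 0" using L0 LL by simp
  ultimately have "2 * K * (lsum w k x / ln (ln x)) <= (88 * K + 16 * K * (K + \<bar>b\<bar> + 1) + K\<^sup>2) * (lsum w k x / ln (ln x))"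
   by (rule mult_right_mono)
  thus ?thesis by (simp add: distrib_right)
 qed
 finally show ?thesis by (simp add: distrib_left)
qed

end

section \<open>Quotients of consecutive sums, and their comparison for two weights\<close>

definition rec_const :: "real => real => real" where
 "rec_const b K = 88 * K + 16 * K * (K + \<bar>b\<bar> + 1) + K\<^sup>2"

lemma rec_const_nonneg: "K >= 1 ==> rec_const b K >= 0"
 by (simp add: rec_const_def)

lemma prod_div_primes: "(\<Prod>p\<in>P. w p / real p) = (\<Prod>p\<in>P. w p) / real (\<Prod>P)"
 by (simp add: prod_dividef of_nat_prod)

context
 fixes w :: "nat => real" and b K :: real
 assumes mw: "mertens_weight w b K" and cw: "chebyshev_weight w K"
begin

text \<open>This makes the error of the recursion relative: positivity permits division, and
  \<open>lprev\<close> is shown to be \<open>O(j / l)\<close> times \<open>lsum\<close>. Both go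
  into one induction, since the growth at \<open>j\<close> rests on the bound for
  \<open>lprev\<close> at \<open>j\<close>. The parameter \<open>A\<close> bounds
  \<open>j / l\<close>, and is 1 in \<open>lsum_ratio\<close>.\<close>

lemma lsum_growth:
 fixes x A :: real
 defines "l \<equiv> ln (ln x)" and "C \<equiv> rec_const b K"
 assumes x: "x >= 729" and l2: "l >= 2" and l: "l >= 2 * (\<bar>b\<bar> + (2 * A + 1) * C)" and A: "A >= 0"
  and j: "real j <= A * l"
 shows "lsum w j x > 0" and "(l - (\<bar>b\<bar> + (2 * A + 1) * C)) * lsum w j x <= real (Suc j) * lsum w (Suc j) x"
  and "lprev w j x <= 2 * real j / l * lsum w j x"
proof -
 have C0: "C >= 0" unfolding C_def using mw_K[OF mw cw] by (rule rec_const_nonneg)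
 have step: "(l - (\<bar>b\<bar> + (2 * A + 1) * C)) * lsum w j x <= real (Suc j) * lsum w (Suc j) x"
  if pos: "lsum w j x > 0" and prev: "lprev w j x <= 2 * real j / l * lsum w j x" and j: "real j <= A * l" for j
 proof -
  have "2 * real j / l <= 2 * A" using j l2 by (simp add: divide_le_eq)
  hence 1: "lprev w j x <= 2 * A * lsum w j x" using prev mult_right_mono[of "2 * real j / l" "2 * A" "lsum w j x"] pos by linarith
  have 2: "lsum w j x / l <= lsum w j x" using l2 pos by (simp add: divide_le_eq)
  have "C * (lprev w j x + lsum w j x / l) <= C * ((2 * A + 1) * lsum w j x)"
   using 1 2 C0 by (intro mult_left_mono) (auto simp: algebra_simps)
  moreover have "\<bar>real (Suc j) * lsum w (Suc j) x - (l + b) * lsum w j x\<bar> <= C * (lprev w j x + lsum w j x / l)"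
   unfolding l_def C_def rec_const_def using lsum_recursion[OF mw cw x, of j] l2 by (simp only: l_def)
  ultimately have "(l + b) * lsum w j x - C * ((2 * A + 1) * lsum w j x) <= real (Suc j) * lsum w (Suc j) x" by linarith
  moreover have "(l - (\<bar>b\<bar> + (2 * A + 1) * C)) * lsum w j x <= (l + b - C * (2 * A + 1)) * lsum w j x"
   using pos by (intro mult_right_mono) (auto simp: algebra_simps)
  ultimately show ?thesis by (simp add: algebra_simps)
 qed
 have *: "lsum w j x > 0 & lprev w j x <= 2 * real j / l * lsum w j x" using j
 proof (induction j)
  case 0
  thus ?case using x by (simp add: wsum_0 lprev_def)
 next
  case (Suc j)
  have j: "real j <= A * l" using Suc.prems by simp
  have pos: "lsum w j x > 0" using Suc.IH[OF j] by simp
  have "(l - (\<bar>b\<bar> + (2 * A + 1) * C)) * lsum w j x <= real (Suc j) * lsum w (Suc j) x"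
   using step Suc.IH[OF j] j by blast
  moreover have "l / 2 * lsum w j x <= (l - (\<bar>b\<bar> + (2 * A + 1) * C)) * lsum w j x" using l pos by (intro mult_right_mono) auto
  ultimately have a: "l / 2 * lsum w j x <= real (Suc j) * lsum w (Suc j) x" by (rule order.trans[rotated])
  have "0 < l / 2 * lsum w j x" using l2 pos by simp
  hence "0 < real (Suc j) * lsum w (Suc j) x" using a by (rule order.strict_trans2)
  hence "lsum w (Suc j) x > 0" by (simp add: zero_less_mult_iff)
  moreover have "lsum w j x <= 2 * real (Suc j) / l * lsum w (Suc j) x"
  proof -
   have "lsum w j x = (l / 2 * lsum w j x) * (2 / l)" using l2 by simp
   also have "... <= (real (Suc j) * lsum w (Suc j) x) * (2 / l)" using a l2 by (intro mult_right_mono) auto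
   finally show ?thesis by (simp add: mult_ac del: of_nat_Suc)
  qed
  ultimately show ?case by (simp add: lprev_def)
 qed
 thus "lsum w j x > 0" "lprev w j x <= 2 * real j / l * lsum w j x" by auto
 thus "(l - (\<bar>b\<bar> + (2 * A + 1) * C)) * lsum w j x <= real (Suc j) * lsum w (Suc j) x"
  using step j by blast
qed

lemma lsum_quotient:
 fixes x A :: real
 defines "l \<equiv> ln (ln x)" and "C \<equiv> rec_const b K"
 assumes x: "x >= 729" and l2: "l >= 2" and l: "l >= 2 * (\<bar>b\<bar> + (2 * A + 1) * C)" and A: "A >= 0"
  and j: "real j <= A * l"
 shows "\<bar>real (Suc j) * lsum w (Suc j) x / lsum w j x - (l + b)\<bar> <= 2 * C * real (Suc j) / l"
proof -
 have C0: "C >= 0" unfolding C_def using mw_K[OF mw cw] by (rule rec_const_nonneg)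
 note g = lsum_growth[of x A j, folded l_def C_def, OF x l2 l A j]
 have "lprev w j x + lsum w j x / l <= 2 * real (Suc j) / l * lsum w j x"
 proof -
  have "2 * real (Suc j) / l * lsum w j x = 2 * real j / l * lsum w j x + 2 * (lsum w j x / l)"
   by (simp add: algebra_simps add_divide_distrib)
  moreover have "lsum w j x / l >= 0" using g(1) l2 by simp
  ultimately show ?thesis using g(3) by linarith
 qed
 hence "C * (lprev w j x + lsum w j x / l) <= C * (2 * real (Suc j) / l * lsum w j x)" using C0 by (rule mult_left_mono)
 moreover have "\<bar>real (Suc j) * lsum w (Suc j) x - (l + b) * lsum w j x\<bar> <= C * (lprev w j x + lsum w j x / l)"
  unfolding l_def C_def rec_const_def using lsum_recursion[OF mw cw x, of j] l2 by (simp only: l_def)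
 ultimately have "\<bar>real (Suc j) * lsum w (Suc j) x - (l + b) * lsum w j x\<bar> <= (2 * C * real (Suc j) / l) * lsum w j x"
  by (simp add: mult_ac)
 moreover have "real (Suc j) * lsum w (Suc j) x / lsum w j x - (l + b) = (real (Suc j) * lsum w (Suc j) x - (l + b) * lsum w j x) / lsum w j x"
  using g(1) by (simp add: diff_divide_distrib)
 ultimately show ?thesis using g(1) by (simp add: pos_divide_le_eq)
qed

end

text \<open>With \<open>D = l + b0 + e0 >= l / 2\<close>, the error is exactly
  \<open>(e1 - e0) / D\<close> minus \<open>(b1 - b0) * (b0 + e0) / (l * D)\<close>.\<close>

lemma quotient_expansion:
 fixes l b1 b0 e1 e0 E :: real
 assumes "\<bar>e1\<bar> <= E" "\<bar>e0\<bar> <= E" "l > 0" "2 * (\<bar>b0\<bar> + E) <= l"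
 shows "\<bar>(l + b1 + e1) / (l + b0 + e0) - 1 - (b1 - b0) / l\<bar> <= 4 * E / l + 2 * \<bar>b1 - b0\<bar> * (\<bar>b0\<bar> + E) / l\<^sup>2"
proof -
 define D where "D = l + b0 + e0"
 have D: "D >= l / 2" using abs_ge_minus_self[of b0] abs_le_D2[OF assms(2)] assms(4) unfolding D_def by argo
 hence D0: "D > 0" using assms by linarith
 have inv: "1 / D <= 2 / l" using D D0 assms by (simp add: field_simps)
 have "(l + b1 + e1) / D - 1 - (b1 - b0) / l = (e1 - e0) * (1 / D) - (b1 - b0) * (b0 + e0) / l * (1 / D)"
  using D0 assms(3) by (simp add: field_simps) (simp add: D_def algebra_simps)
 also have "\<bar>...\<bar> <= \<bar>(e1 - e0) * (1 / D)\<bar> + \<bar>(b1 - b0) * (b0 + e0) / l * (1 / D)\<bar>" by (rule abs_triangle_ineq4)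
 also have "... = \<bar>e1 - e0\<bar> * (1 / D) + \<bar>b1 - b0\<bar> * \<bar>b0 + e0\<bar> / l * (1 / D)" using D0 assms(3) by (simp add: abs_mult)
 also have "... <= (2 * E) * (2 / l) + \<bar>b1 - b0\<bar> * (\<bar>b0\<bar> + E) / l * (2 / l)"
  using assms D0 by (intro add_mono mult_mono inv divide_right_mono) auto
 also have "... = 4 * E / l + 2 * \<bar>b1 - b0\<bar> * (\<bar>b0\<bar> + E) / l\<^sup>2" by (simp add: power2_eq_square)
 finally show ?thesis by (simp add: D_def)
qed

text \<open>To be read with \<open>h = 1 / ln (ln x)\<close>: a product of factors
  \<open>1 + c * h + O(j * h^2)\<close> stays within \<open>O(j^2 * h^2)\<close> of its linear part
  while \<open>j * h <= 1\<close>. The induction carries a growing factor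
  \<open>(1 + M * h) ^ j\<close>, which is at most \<open>exp M\<close> in this range.\<close>

lemma ratio_recursion_bound:
 fixes \<rho> \<eta> :: "nat => real" and c C h :: real
 defines "M \<equiv> \<bar>c\<bar> + C + (1 + \<bar>c\<bar>) * C + c\<^sup>2"
 assumes 0: "\<rho> 0 = 1" and h: "h > 0" and C: "C >= 0"
  and rec: "!!j. real (Suc j) * h <= 1 ==> \<rho> (Suc j) = \<rho> j * (1 + c * h + \<eta> j)"
  and eta: "!!j. real (Suc j) * h <= 1 ==> \<bar>\<eta> j\<bar> <= C * real (Suc j) * h\<^sup>2"
  and j: "real j * h <= 1"
 shows "\<bar>\<rho> j - (1 + real j * c * h)\<bar> <= exp M * M * (real j)\<^sup>2 * h\<^sup>2"
proof -
 have M: "M >= 0" using C by (simp add: M_def)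
 have 1: "\<bar>\<rho> j - (1 + real j * c * h)\<bar> <= (1 + M * h) ^ j * (M * (real j)\<^sup>2 * h\<^sup>2)" using j
 proof (induction j)
  case 0
  thus ?case using \<open>\<rho> 0 = 1\<close> by simp
 next
  case (Suc j)
  define \<delta> where "\<delta> = \<rho> j - (1 + real j * c * h)"
  define s where "s = real (Suc j)"
  define r where "r = (1 + M * h) ^ j * M * h\<^sup>2"
  have sj: "s = real j + 1" by (simp add: s_def)
  have jh: "real j * h <= 1" using Suc.prems h by (simp add: distrib_right)
  have IH: "\<bar>\<delta>\<bar> <= r * (real j)\<^sup>2" using Suc.IH[OF jh] by (simp add: \<delta>_def r_def mult_ac)
  have e: "\<bar>\<eta> j\<bar> <= C * s * h\<^sup>2" using eta[OF Suc.prems] by (simp add: s_def)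
  have e2: "\<bar>\<eta> j\<bar> <= C * h"
  proof -
   have "C * s * h\<^sup>2 = (C * h) * (s * h)" by (simp add: power2_eq_square)
   also have "... <= (C * h) * 1" using Suc.prems C h by (intro mult_left_mono) (auto simp: s_def)
   finally show ?thesis using e by simp
  qed
  have "\<rho> (Suc j) - (1 + s * c * h) = \<delta> * (1 + c * h + \<eta> j) + (1 + real j * h * c) * \<eta> j + real j * c\<^sup>2 * h\<^sup>2"
   unfolding rec[OF Suc.prems] \<delta>_def sj by (simp add: algebra_simps power2_eq_square)
  also have "\<bar>...\<bar> <= \<bar>\<delta> * (1 + c * h + \<eta> j)\<bar> + \<bar>(1 + real j * h * c) * \<eta> j\<bar> + \<bar>real j * c\<^sup>2 * h\<^sup>2\<bar>" by linarith
  also have "... <= (r * (real j)\<^sup>2) * (1 + M * h) + (1 + \<bar>c\<bar>) * (C * s * h\<^sup>2) + s * c\<^sup>2 * h\<^sup>2"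
  proof (intro add_mono)
   have "\<bar>c * h\<bar> = \<bar>c\<bar> * h" using h by (simp add: abs_mult)
   hence "\<bar>1 + c * h + \<eta> j\<bar> <= 1 + (\<bar>c\<bar> * h + C * h)" using e2 abs_triangle_ineq[of "1 + c * h" "\<eta> j"] abs_triangle_ineq[of 1 "c * h"] by linarith
   also have "\<bar>c\<bar> * h + C * h = (\<bar>c\<bar> + C) * h" by (simp add: distrib_right)
   also have "1 + (\<bar>c\<bar> + C) * h <= 1 + M * h" using h C by (intro add_left_mono mult_right_mono) (auto simp: M_def)
   finally show "\<bar>\<delta> * (1 + c * h + \<eta> j)\<bar> <= (r * (real j)\<^sup>2) * (1 + M * h)"
    unfolding abs_mult using IH by (intro mult_mono) auto
   have "\<bar>1 + real j * h * c\<bar> <= 1 + \<bar>real j * h * c\<bar>" using abs_triangle_ineq[of 1 "real j * h * c"] by simp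
   also have "\<bar>real j * h * c\<bar> = (real j * h) * \<bar>c\<bar>" using h by (simp add: abs_mult)
   also have "... <= 1 * \<bar>c\<bar>" by (intro mult_right_mono jh) simp
   finally have "\<bar>1 + real j * h * c\<bar> <= 1 + \<bar>c\<bar>" by simp
   thus "\<bar>(1 + real j * h * c) * \<eta> j\<bar> <= (1 + \<bar>c\<bar>) * (C * s * h\<^sup>2)"
    unfolding abs_mult using e by (intro mult_mono) auto
   show "\<bar>real j * c\<^sup>2 * h\<^sup>2\<bar> <= s * c\<^sup>2 * h\<^sup>2" unfolding sj by (simp add: mult_right_mono)
  qed
  also have "(r * (real j)\<^sup>2) * (1 + M * h) + (1 + \<bar>c\<bar>) * (C * s * h\<^sup>2) + s * c\<^sup>2 * h\<^sup>2
    = (r * (real j)\<^sup>2) * (1 + M * h) + ((1 + \<bar>c\<bar>) * C + c\<^sup>2) * (s * h\<^sup>2)" by (simp add: algebra_simps)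
  also have "... <= (r * (real j)\<^sup>2) * (1 + M * h) + ((1 + M * h) ^ Suc j * M) * (s * h\<^sup>2)"
  proof (intro add_left_mono mult_right_mono)
   have "(1 + \<bar>c\<bar>) * C + c\<^sup>2 <= 1 * M" using C by (simp add: M_def)
   also have "... <= (1 + M * h) ^ Suc j * M" using M h by (intro mult_right_mono one_le_power) auto
   finally show "(1 + \<bar>c\<bar>) * C + c\<^sup>2 <= (1 + M * h) ^ Suc j * M" .
  qed (simp add: s_def)
  also have "... = ((1 + M * h) ^ Suc j * M * h\<^sup>2) * ((real j)\<^sup>2 + s)" by (simp add: r_def algebra_simps)
  also have "... <= ((1 + M * h) ^ Suc j * M * h\<^sup>2) * s\<^sup>2"
   using M h by (intro mult_left_mono) (auto simp: sj power2_eq_square algebra_simps)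
  finally show ?case by (simp add: s_def mult_ac)
 qed
 have "(1 + M * h) ^ j <= exp (M * h) ^ j" using M h by (intro power_mono exp_ge_add_one_self) auto
 also have "... = exp (M * (real j * h))" by (simp add: exp_of_nat_mult[symmetric] mult_ac)
 also have "... <= exp (M * 1)" using j M by (simp only: exp_le_cancel_iff mult_left_mono)
 finally have "(1 + M * h) ^ j * (M * (real j)\<^sup>2 * h\<^sup>2) <= exp M * (M * (real j)\<^sup>2 * h\<^sup>2)" using M by (intro mult_right_mono) auto
 thus ?thesis using 1 by (simp add: mult.assoc)
qed

text \<open>Dividing the quotients of \<open>lsum_quotient\<close> for the two weights cancels the
  factor \<open>j + 1\<close> and leaves \<open>(l + b1 + e1) / (l + b0 + e0)\<close>; to first
  order in \<open>1 / l\<close> only \<open>b1 - b0\<close> survives.\<close>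

lemma lsum_ratio:
 assumes w1: "mertens_weight w1 b1 K" "chebyshev_weight w1 K" and w0: "mertens_weight w0 b0 K" "chebyshev_weight w0 K"
 shows "\<exists>C\<ge>0. \<forall>\<^sub>F x in at_top. ALL j. real j <= ln (ln x) -->
  \<bar>lsum w1 j x / lsum w0 j x - (1 + real j * (b1 - b0) / ln (ln x))\<bar> <= C * (real j)\<^sup>2 / (ln (ln x))\<^sup>2"
proof -
 define R where "R = rec_const b1 K + rec_const b0 K"
 have K: "K >= 1" using w1 by (simp add: mertens_weight_def)
 have R: "rec_const b1 K <= R" "rec_const b0 K <= R" "R >= 0" using rec_const_nonneg[OF K, of b1] rec_const_nonneg[OF K, of b0] by (auto simp: R_def)
 define B where "B = 2 * (\<bar>b1\<bar> + \<bar>b0\<bar> + 3 * R)"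
 define C where "C = 8 * R + 2 * \<bar>b1 - b0\<bar> * (\<bar>b0\<bar> + 2 * R)"
 have C: "C >= 0" using R by (simp add: C_def)
 define M where "M = \<bar>b1 - b0\<bar> + C + (1 + \<bar>b1 - b0\<bar>) * C + (b1 - b0)\<^sup>2"
 have "\<forall>\<^sub>F x::real in at_top. x >= 729 & ln (ln x) >= max 2 B"
  by (intro eventually_conj eventually_ge_at_top filterlim_at_top[THEN iffD1, rule_format]) real_asymp
 hence "\<forall>\<^sub>F x in at_top. ALL j. real j <= ln (ln x) -->
  \<bar>lsum w1 j x / lsum w0 j x - (1 + real j * (b1 - b0) / ln (ln x))\<bar> <= (exp M * M) * (real j)\<^sup>2 / (ln (ln x))\<^sup>2"
 proof eventually_elim
  case (elim x)
  define l where "l = ln (ln x)"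
  have x: "x >= 729" and l2: "l >= 2" and lB: "l >= B" using elim by (auto simp: l_def)
  have lb: "2 * (\<bar>b1\<bar> + (2 * 1 + 1) * rec_const b1 K) <= l" "2 * (\<bar>b0\<bar> + (2 * 1 + 1) * rec_const b0 K) <= l"
   using lB R unfolding B_def by (simp_all add: algebra_simps)
  have x1: "x >= 1" using x by simp
  define e1 where "e1 = (%j. real (Suc j) * lsum w1 (Suc j) x / lsum w1 j x - (l + b1))"
  define e0 where "e0 = (%j. real (Suc j) * lsum w0 (Suc j) x / lsum w0 j x - (l + b0))"
  define \<eta> where "\<eta> = (%j. (l + b1 + e1 j) / (l + b0 + e0 j) - 1 - (b1 - b0) / l)"
  have pos: "lsum w1 j x > 0" "lsum w0 j x > 0" if "real j <= l" for j
   using lsum_growth(1)[OF w1 x, of 1 j] lsum_growth(1)[OF w0 x, of 1 j] l2 lb that by (simp_all add: l_def)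
  show ?case
  proof (intro allI impI)
   fix j assume j: "real j <= ln (ln x)"
   have "\<bar>lsum w1 j x / lsum w0 j x - (1 + real j * (b1 - b0) * (1 / l))\<bar> <= exp M * M * (real j)\<^sup>2 * (1 / l)\<^sup>2"
    unfolding M_def
   proof (rule ratio_recursion_bound)
    show "lsum w1 0 x / lsum w0 0 x = 1" using x1 by (simp add: wsum_0)
    show "1 / l > 0" using l2 by simp
    show "real j * (1 / l) <= 1" using j l2 by (simp add: l_def)
    show "C >= 0" by (rule C)
    fix i assume "real (Suc i) * (1 / l) <= 1"
    hence i: "real (Suc i) <= l" "real i <= l" using l2 by (auto simp: field_simps)
    have e: "\<bar>e1 i\<bar> <= 2 * R * real (Suc i) / l" "\<bar>e0 i\<bar> <= 2 * R * real (Suc i) / l"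
    proof -
     have "\<bar>e1 i\<bar> <= 2 * rec_const b1 K * real (Suc i) / l"
      using lsum_quotient[OF w1 x, of 1 i] l2 lb i by (simp add: l_def e1_def del: of_nat_Suc)
     also have "... <= 2 * R * real (Suc i) / l" using R l2 by (intro divide_right_mono mult_right_mono mult_left_mono) auto
     finally show "\<bar>e1 i\<bar> <= 2 * R * real (Suc i) / l" .
     have "\<bar>e0 i\<bar> <= 2 * rec_const b0 K * real (Suc i) / l"
      using lsum_quotient[OF w0 x, of 1 i] l2 lb i by (simp add: l_def e0_def del: of_nat_Suc)
     also have "... <= 2 * R * real (Suc i) / l" using R l2 by (intro divide_right_mono mult_right_mono mult_left_mono) auto
     finally show "\<bar>e0 i\<bar> <= 2 * R * real (Suc i) / l" .
    qed
    have q: "l + b1 + e1 i = real (Suc i) * lsum w1 (Suc i) x / lsum w1 i x" "l + b0 + e0 i = real (Suc i) * lsum w0 (Suc i) x / lsum w0 i x"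
     by (simp_all add: e1_def e0_def)
    have "1 + (b1 - b0) * (1 / l) + \<eta> i = (l + b1 + e1 i) / (l + b0 + e0 i)" by (simp add: \<eta>_def)
    also have "... = (lsum w1 (Suc i) x / lsum w1 i x) / (lsum w0 (Suc i) x / lsum w0 i x)"
     unfolding q by (simp del: of_nat_Suc)
    finally show "lsum w1 (Suc i) x / lsum w0 (Suc i) x = lsum w1 i x / lsum w0 i x * (1 + (b1 - b0) * (1 / l) + \<eta> i)"
     using pos[OF i(1)] pos[OF i(2)] by (simp add: field_simps)
    define E where "E = 2 * R * real (Suc i) / l"
    have E: "E <= 2 * R" "E >= 0"
     using mult_left_mono[OF i(1), of "2 * R"] R l2 by (simp_all add: E_def pos_divide_le_eq)
    have "\<bar>\<eta> i\<bar> <= 4 * E / l + 2 * \<bar>b1 - b0\<bar> * (\<bar>b0\<bar> + E) / l\<^sup>2"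
     unfolding \<eta>_def using e l2 lB E R by (intro quotient_expansion) (auto simp: E_def B_def)
    also have "... <= 4 * E / l + 2 * \<bar>b1 - b0\<bar> * (\<bar>b0\<bar> + 2 * R) * real (Suc i) / l\<^sup>2"
    proof -
     have "2 * \<bar>b1 - b0\<bar> * (\<bar>b0\<bar> + E) <= 2 * \<bar>b1 - b0\<bar> * (\<bar>b0\<bar> + 2 * R) * 1" using E by (simp add: mult_left_mono)
     also have "... <= 2 * \<bar>b1 - b0\<bar> * (\<bar>b0\<bar> + 2 * R) * real (Suc i)" using R by (intro mult_left_mono) auto
     finally show ?thesis by (simp only: add_left_mono divide_right_mono zero_le_power2)
    qed
    also have "... = C * real (Suc i) * (1 / l)\<^sup>2" unfolding C_def E_def by (simp add: power_divide power2_eq_square algebra_simps add_divide_distrib del: of_nat_Suc)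
    finally show "\<bar>\<eta> i\<bar> <= C * real (Suc i) * (1 / l)\<^sup>2" .
   qed
   thus "\<bar>lsum w1 j x / lsum w0 j x - (1 + real j * (b1 - b0) / ln (ln x))\<bar> <= (exp M * M) * (real j)\<^sup>2 / (ln (ln x))\<^sup>2"
    by (simp add: l_def power_divide)
  qed
 qed
 moreover have "exp M * M >= 0" using C by (simp add: M_def)
 ultimately show ?thesis by blast
qed

section \<open>From the sums with weights \<open>w p / p\<close> back to the counting sums\<close>

lemma sum_wprod_le:
 "(\<Sum>P\<in>prime_sets k x. (\<Prod>p\<in>P. w p) * (x / real (\<Prod>P))) = x * lsum w k x"
 by (simp add: wsum_def prod_div_primes sum_distrib_left mult_ac)

context
 fixes w :: "nat => real" and b K :: real
 assumes mw: "mertens_weight w b K" and cw: "chebyshev_weight w K" and pw: "pnt_weight w K"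
begin

text \<open>Two estimates for two uses: the precise one loses at most \<open>K * ln u\<close> for
  each of the \<open>k\<close> excluded primes, the crude one is free of \<open>k\<close> and serves
  for small \<open>u\<close>.\<close>

lemma theta_sum_avoiding:
 assumes Q: "Q \<in> prime_sets k x" and u: "u >= 1"
 defines "g \<equiv> \<Sum>p | prime p & real p <= u & p \<notin> Q. w p * ln (real p)"
 shows "\<bar>g - u\<bar> <= K * u * (1 + ln u) powr (-1/64) + real k * K * ln u" and "\<bar>g - u\<bar> <= (K + 1) * u"
proof -
 define corr where "corr = (\<Sum>p\<in>{p\<in>Q. prime p & real p <= u}. w p * ln (real p))"
 have K: "K >= 1" by (rule mw_K[OF mw cw])
 have w0: "0 <= w p" "w p <= K" for p using mw_bound[OF mw cw, of p] by auto
 have eq: "theta_sum w u = g + corr"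
  unfolding g_def corr_def by (rule prime_sum_split_mem) (rule prime_setsD(1)[OF Q])
 have term0: "0 <= w p * ln (real p)" if "prime p" for p using w0[of p] prime_gt_1_nat[OF that] by simp
 have corr0: "corr >= 0" unfolding corr_def by (intro sum_nonneg term0) auto
 have g0: "g >= 0" unfolding g_def by (intro sum_nonneg term0) auto
 have "corr <= real (card {p\<in>Q. prime p & real p <= u}) * (K * ln u)"
  unfolding corr_def
 proof (rule sum_bounded_above)
  fix p assume "p \<in> {p\<in>Q. prime p & real p <= u}"
  hence p: "prime p" "real p <= u" by auto
  thus "w p * ln (real p) <= K * ln u" using w0[of p] prime_gt_1_nat[OF p(1)] K by (intro mult_mono) auto
 qed
 also have "... <= real k * (K * ln u)"
  using card_mono[OF prime_setsD(1)[OF Q], of "{p\<in>Q. prime p & real p <= u}"] prime_setsD(3)[OF Q] K u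
  by (intro mult_right_mono) auto
 finally have corr: "corr <= real k * K * ln u" by (simp add: mult.assoc)
 have "\<bar>theta_sum w u - u\<bar> <= K * u * (1 + ln u) powr (-1/64)" using pw u by (simp add: pnt_weight_def)
 thus "\<bar>g - u\<bar> <= K * u * (1 + ln u) powr (-1/64) + real k * K * ln u"
  using eq corr corr0 by linarith
 have "theta_sum w u <= K * u" using cw u by (simp add: chebyshev_weight_def)
 moreover have "K * u >= 0" using K u by simp
 ultimately show "\<bar>g - u\<bar> <= (K + 1) * u" using eq corr0 g0 u by (simp add: distrib_right abs_le_iff)
qed

text \<open>Expanding \<open>ln (\<Prod>P)\<close> over the primes of \<open>P\<close> and pointing
  turns the inner sum into \<open>theta_sum\<close> at \<open>u = x / \<Prod>Q\<close>, which is
  nearly \<open>u\<close>. Sets with \<open>u <= T\<close> receive the crude bound and are rare by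
  \<open>lsum_short_range\<close>.\<close>

lemma wsum_ln_weight:
 assumes x: "x > 1" and T: "T >= 1" "T <= sqrt x"
 shows "\<bar>(\<Sum>P\<in>prime_sets (Suc j) x. (\<Prod>p\<in>P. w p) * ln (real (\<Prod>P))) - x * lsum w j x\<bar> <=
  x * ((K * (1 + ln T) powr (-1/64) + real j * K * ln x / T) * lsum w j x + (K + 1) * (16 * K * (ln T + 1) / ln x) * lprev w j x)"
proof -
 have K: "K >= 1" by (rule mw_K[OF mw cw])
 define W where "W = (%P. \<Prod>p\<in>P. w p)"
 have W0: "W P >= 0" for P unfolding W_def using mw_bound[OF mw cw] by (intro prod_nonneg) auto
 define u where "u = (%Q. x / real (\<Prod>Q))"
 define g where "g = (%Q. \<Sum>p | prime p & real p <= u Q & p \<notin> Q. w p * ln (real p))"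
 define \<delta> where "\<delta> = K * (1 + ln T) powr (-1/64) + real j * K * ln x / T"
 have d0: "\<delta> >= 0" using K x T unfolding \<delta>_def by (intro add_nonneg_nonneg mult_nonneg_nonneg divide_nonneg_nonneg) auto
 have "(\<Sum>P\<in>prime_sets (Suc j) x. W P * ln (real (\<Prod>P))) = (\<Sum>P\<in>prime_sets (Suc j) x. \<Sum>p\<in>P. w p * ln (real p) * W (P - {p}))"
 proof (rule sum.cong)
  fix P assume P: "P \<in> prime_sets (Suc j) x"
  have "W P = w p * W (P - {p})" if "p \<in> P" for p unfolding W_def using prime_setsD(1)[OF P] that by (rule prod.remove)
  hence "(\<Sum>p\<in>P. w p * ln (real p) * W (P - {p})) = (\<Sum>p\<in>P. W P * ln (real p))" by (intro sum.cong) simp_all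
  thus "W P * ln (real (\<Prod>P)) = (\<Sum>p\<in>P. w p * ln (real p) * W (P - {p}))"
   unfolding ln_prod_primes[OF cw P] by (simp add: sum_distrib_left)
 qed simp
 also have "... = (\<Sum>Q\<in>prime_sets j x. \<Sum>p | prime p & real p <= x / real (\<Prod>Q) & p \<notin> Q. w p * ln (real p) * W Q)"
  by (rule sum_pointed_prime_sets)
 also have "... = (\<Sum>Q\<in>prime_sets j x. W Q * g Q)" unfolding g_def u_def by (simp add: sum_distrib_left mult.commute)
 finally have 1: "(\<Sum>P\<in>prime_sets (Suc j) x. W P * ln (real (\<Prod>P))) = (\<Sum>Q\<in>prime_sets j x. W Q * g Q)" .
 have 2: "x * lsum w j x = (\<Sum>Q\<in>prime_sets j x. W Q * u Q)" unfolding W_def u_def by (rule sum_wprod_le[symmetric])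
 have pw_bound: "W Q * \<bar>g Q - u Q\<bar> <= \<delta> * (W Q * u Q) + (if u Q <= T then (K + 1) * (W Q * u Q) else 0)"
  if Q: "Q \<in> prime_sets j x" for Q
 proof -
  have u1: "u Q >= 1" using prime_setsD(4,5)[OF Q] by (simp add: u_def)
  have ux: "u Q <= x" using prime_setsD(6)[OF Q] x by (simp add: u_def divide_le_eq mult_le_cancel_left1)
  have "\<bar>g Q - u Q\<bar> <= \<delta> * u Q + (if u Q <= T then (K + 1) * u Q else 0)"
  proof (cases "u Q <= T")
   case True
   have "0 <= \<delta> * u Q" using d0 u1 by simp
   thus ?thesis using theta_sum_avoiding(2)[OF Q u1] True by (simp add: g_def)
  next
   case False
   hence uT: "u Q >= T" by simp
   have "(1 + ln (u Q)) powr (-1/64) <= (1 + ln T) powr (-1/64)" using uT T u1 by (intro powr_mono2') (auto intro!: add_pos_nonneg)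
   hence a: "K * u Q * (1 + ln (u Q)) powr (-1/64) <= K * u Q * (1 + ln T) powr (-1/64)" using K u1 by (intro mult_left_mono) auto
   have "real j * K * ln (u Q) <= real j * K * ln x" using ux u1 K by (intro mult_left_mono) auto
   also have "... <= real j * K * ln x * (u Q / T)" using mult_left_mono[of 1 "u Q / T" "real j * K * ln x"] uT T x K by simp
   finally have "real j * K * ln (u Q) <= real j * K * ln x / T * u Q" by simp
   hence "K * u Q * (1 + ln (u Q)) powr (-1/64) + real j * K * ln (u Q) <= \<delta> * u Q"
    using a
   proof -
    have "\<delta> * u Q = K * u Q * (1 + ln T) powr (-1/64) + real j * K * ln x / T * u Q"
     unfolding \<delta>_def by (simp add: algebra_simps)
    thus ?thesis using a \<open>real j * K * ln (u Q) <= real j * K * ln x / T * u Q\<close> by linarith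
   qed
   thus ?thesis using theta_sum_avoiding(1)[OF Q u1] False by (simp add: g_def)
  qed
  hence "W Q * \<bar>g Q - u Q\<bar> <= W Q * (\<delta> * u Q + (if u Q <= T then (K + 1) * u Q else 0))" by (intro mult_left_mono W0)
  also have "... = \<delta> * (W Q * u Q) + (if u Q <= T then (K + 1) * (W Q * u Q) else 0)" by (simp add: algebra_simps)
  finally show ?thesis .
 qed
 have "(\<Sum>Q\<in>prime_sets j x. W Q * g Q) - (\<Sum>Q\<in>prime_sets j x. W Q * u Q) = (\<Sum>Q\<in>prime_sets j x. W Q * (g Q - u Q))"
  by (simp add: sum_subtractf right_diff_distrib)
 also have "\<bar>...\<bar> <= (\<Sum>Q\<in>prime_sets j x. \<bar>W Q * (g Q - u Q)\<bar>)" by (rule sum_abs)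
 also have "... = (\<Sum>Q\<in>prime_sets j x. W Q * \<bar>g Q - u Q\<bar>)" using W0 by (simp add: abs_mult)
 also have "... <= (\<Sum>Q\<in>prime_sets j x. \<delta> * (W Q * u Q) + (if u Q <= T then (K + 1) * (W Q * u Q) else 0))"
  by (intro sum_mono pw_bound)
 also have "... = \<delta> * (\<Sum>Q\<in>prime_sets j x. W Q * u Q) + (K + 1) * (\<Sum>Q\<in>{Q\<in>prime_sets j x. u Q <= T}. W Q * u Q)"
  by (auto simp: sum.distrib sum_distrib_left sum.inter_filter finite_prime_sets intro!: sum.cong)
 also have "(\<Sum>Q\<in>{Q\<in>prime_sets j x. u Q <= T}. W Q * u Q) <= x * (16 * K * (ln T + 1) / ln x * lprev w j x)"
 proof (cases j)
  case 0
  have "sqrt x < x" using x by (intro real_less_lsqrt) (auto simp: power2_eq_square)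
  hence "{Q\<in>prime_sets j x. u Q <= T} = {}" using T by (auto simp: 0 prime_sets_0 u_def)
  hence "(\<Sum>Q\<in>{Q\<in>prime_sets j x. u Q <= T}. W Q * u Q) = 0" by (simp only: sum.empty)
  thus ?thesis by (simp add: lprev_def 0)
 next
  case (Suc i)
  have "{Q\<in>prime_sets j x. u Q <= T} = {Q\<in>prime_sets (Suc i) x. real (\<Prod>Q) >= x / T}"
   using T x by (auto simp: Suc u_def field_simps dest: prime_setsD(5))
  moreover have "W Q * u Q = x * (\<Prod>p\<in>Q. w p / real p)" for Q by (simp add: W_def u_def prod_div_primes)
  ultimately have "(\<Sum>Q\<in>{Q\<in>prime_sets j x. u Q <= T}. W Q * u Q) = x * (\<Sum>Q\<in>{Q\<in>prime_sets (Suc i) x. real (\<Prod>Q) >= x / T}. \<Prod>p\<in>Q. w p / real p)"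
   by (simp add: sum_distrib_left)
  also have "... <= x * (16 * K * (ln T + 1) / ln x * lsum w i x)"
   using x by (intro mult_left_mono lsum_short_range[OF cw x T]) auto
  finally show ?thesis by (simp add: lprev_def Suc)
 qed
 finally have "\<bar>(\<Sum>Q\<in>prime_sets j x. W Q * g Q) - (\<Sum>Q\<in>prime_sets j x. W Q * u Q)\<bar> <=
  \<delta> * (\<Sum>Q\<in>prime_sets j x. W Q * u Q) + (K + 1) * (x * (16 * K * (ln T + 1) / ln x * lprev w j x))"
  using K by (simp add: mult_left_mono)
 also have "... = x * (\<delta> * lsum w j x + (K + 1) * (16 * K * (ln T + 1) / ln x) * lprev w j x)"
  unfolding 2[symmetric] by (simp add: algebra_simps)
 finally have "\<bar>(\<Sum>P\<in>prime_sets (Suc j) x. W P * ln (real (\<Prod>P))) - x * lsum w j x\<bar> <= ..." unfolding 1 2 .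
 thus ?thesis unfolding W_def \<delta>_def .
qed

text \<open>Exchanges the weight \<open>ln (\<Prod>P)\<close> for \<open>ln x\<close>. With
  \<open>u = x / \<Prod>P\<close>, either \<open>u <= (ln x)^3\<close> and
  \<open>ln u <= 3 * ln (ln x)\<close>, or \<open>ln u <= ln x <= u / (ln x)^2\<close>; the weighted
  sum of all \<open>u\<close> is \<open>x * lsum w k x\<close>.\<close>

lemma wsum_ln_complement:
 assumes x: "ln x >= 1" "x > 1"
 shows "(\<Sum>P\<in>prime_sets k x. (\<Prod>p\<in>P. w p) * ln (real (\<Prod>P))) <= wsum w k x * ln x"
  and "wsum w k x * ln x <= (\<Sum>P\<in>prime_sets k x. (\<Prod>p\<in>P. w p) * ln (real (\<Prod>P))) + 3 * ln (ln x) * wsum w k x + x / (ln x)\<^sup>2 * lsum w k x"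
proof -
 define W where "W = (%P. \<Prod>p\<in>P. w p)"
 have W0: "W P >= 0" for P unfolding W_def using mw_bound[OF mw cw] by (intro prod_nonneg) auto
 have eq: "wsum w k x * ln x = (\<Sum>P\<in>prime_sets k x. W P * ln x)" by (simp add: wsum_def W_def sum_distrib_right)
 have "(\<Sum>P\<in>prime_sets k x. W P * ln (real (\<Prod>P))) <= (\<Sum>P\<in>prime_sets k x. W P * ln x)"
 proof (intro sum_mono mult_left_mono W0)
  fix P assume "P \<in> prime_sets k x"
  thus "ln (real (\<Prod>P)) <= ln x" using prime_setsD(4,5)[of P k x] by simp
 qed
 thus "(\<Sum>P\<in>prime_sets k x. (\<Prod>p\<in>P. w p) * ln (real (\<Prod>P))) <= wsum w k x * ln x" unfolding eq by (simp add: W_def)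
 have "(\<Sum>P\<in>prime_sets k x. W P * ln x) <= (\<Sum>P\<in>prime_sets k x. W P * (ln (real (\<Prod>P)) + 3 * ln (ln x) + x / real (\<Prod>P) / (ln x)\<^sup>2))"
 proof (intro sum_mono mult_left_mono W0)
  fix P assume P: "P \<in> prime_sets k x"
  define u where "u = x / real (\<Prod>P)"
  have u1: "u >= 1" using prime_setsD(4,5)[OF P] by (simp add: u_def)
  have lu: "ln x = ln (real (\<Prod>P)) + ln u" unfolding u_def using x prime_setsD(5)[OF P] by (simp add: ln_div)
  have q0: "u / (ln x)\<^sup>2 >= 0" "3 * ln (ln x) >= 0" using u1 x by simp_all
  have "ln u <= 3 * ln (ln x) + u / (ln x)\<^sup>2"
  proof (cases "u <= (ln x) ^ 3")
   case True
   hence "ln u <= ln ((ln x) ^ 3)" using u1 x by (subst ln_le_cancel_iff) auto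
   also have "... = 3 * ln (ln x)" using x by (simp add: ln_realpow)
   finally show ?thesis using q0 by linarith
  next
   case False
   have "ln u <= ln x" using lu prime_setsD(6)[OF P] by simp
   also have "... = (ln x) ^ 3 / (ln x)\<^sup>2" using x by (simp add: power2_eq_square power3_eq_cube)
   also have "... <= u / (ln x)\<^sup>2" using False by (intro divide_right_mono) auto
   finally show ?thesis using q0 by linarith
  qed
  thus "ln x <= ln (real (\<Prod>P)) + 3 * ln (ln x) + x / real (\<Prod>P) / (ln x)\<^sup>2" using lu by (simp add: u_def)
 qed
 also have "... = (\<Sum>P\<in>prime_sets k x. W P * ln (real (\<Prod>P))) + 3 * ln (ln x) * wsum w k x + (\<Sum>P\<in>prime_sets k x. W P * (x / real (\<Prod>P))) / (ln x)\<^sup>2"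
  unfolding wsum_def W_def[symmetric] by (simp add: sum.distrib distrib_left sum_distrib_left sum_divide_distrib mult_ac)
 also have "(\<Sum>P\<in>prime_sets k x. W P * (x / real (\<Prod>P))) = x * lsum w k x" unfolding W_def by (rule sum_wprod_le)
 finally show "wsum w k x * ln x <= (\<Sum>P\<in>prime_sets k x. (\<Prod>p\<in>P. w p) * ln (real (\<Prod>P))) + 3 * ln (ln x) * wsum w k x + x / (ln x)\<^sup>2 * lsum w k x"
  unfolding eq by (simp add: W_def)
qed

text \<open>The unknown \<open>a = N * ln x / x\<close> appears on both sides of its upper bound, on
  the right with the small coefficient \<open>\<epsilon>\<close>. It is first bounded by a multiple
  of \<open>L\<close>, and this bound is then inserted again.\<close>

theorem wsum_asymptotics:
 assumes A: "A >= 0"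
 shows "\<exists>C\<ge>0. \<forall>\<^sub>F x in at_top. ALL j. real j <= A * ln (ln x) -->
  lsum w j x > 0 & \<bar>wsum w (Suc j) x * ln x / x - lsum w j x\<bar> <= C / (ln (ln x))\<^sup>2 * lsum w j x"
proof -
 have K: "K >= 1" by (rule mw_K[OF mw cw])
 define R where "R = 2 * (\<bar>b\<bar> + (2 * A + 1) * rec_const b K)"
 define c1 where "c1 = K + A * K + (K + 1) * (16 * K) * (2 * A)"
 have c1: "c1 >= 0" using K A by (simp add: c1_def)
 have "\<forall>\<^sub>F x::real in at_top. x >= 729 & ln (ln x) >= max 2 R & ln x >= 1 & exp (sqrt (ln x)) <= sqrt x"
  by (intro eventually_conj eventually_ge_at_top filterlim_at_top[THEN iffD1, rule_format]; real_asymp)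
 moreover have "\<forall>\<^sub>F x::real in at_top. (1 + sqrt (ln x)) powr (-1/64) <= 1 / (ln (ln x))\<^sup>2" by real_asymp
 moreover have "\<forall>\<^sub>F x::real in at_top. ln (ln x) * ln x / exp (sqrt (ln x)) <= 1 / (ln (ln x))\<^sup>2" by real_asymp
 moreover have "\<forall>\<^sub>F x::real in at_top. (sqrt (ln x) + 1) / ln x <= 1 / (ln (ln x))\<^sup>2" by real_asymp
 moreover have "\<forall>\<^sub>F x::real in at_top. 3 * ln (ln x) / ln x <= 1 / (ln (ln x))\<^sup>2" by real_asymp
 moreover have "\<forall>\<^sub>F x::real in at_top. (ln (1 + ln x) + K) / (ln x)\<^sup>2 <= 1 / (ln (ln x))\<^sup>2" by real_asymp
 ultimately have "\<forall>\<^sub>F x in at_top. ALL j. real j <= A * ln (ln x) -->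
  lsum w j x > 0 & \<bar>wsum w (Suc j) x * ln x / x - lsum w j x\<bar> <= (3 * c1 + 5) / (ln (ln x))\<^sup>2 * lsum w j x"
 proof eventually_elim
  case (elim x)
  define l where "l = ln (ln x)"
  define \<epsilon> where "\<epsilon> = 1 / l\<^sup>2"
  have x: "x >= 729" "x > 1" "x > 0" and l2: "l >= 2" and lR: "l >= R" and lx: "ln x >= 1" "ln x > 0" using elim(1) by (auto simp: l_def)
  have e: "\<epsilon> <= 1/4" "\<epsilon> > 0" using power_mono[OF l2, of 2] l2 by (auto simp: \<epsilon>_def divide_le_eq)
  \<comment> \<open>\<open>exp (sqrt (ln x))\<close> lies below every power of \<open>x\<close>, so
    the short range carries only a proportion of order \<open>sqrt (ln x) / ln x\<close>; and above
    every power of \<open>ln x\<close>, so the \<open>j\<close> excluded primes are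
    harmless.\<close>
  define T where "T = exp (sqrt (ln x))"
  have T: "T >= 1" "T <= sqrt x" using elim(1) lx by (auto simp: T_def)
  show ?case
  proof (intro allI impI)
   fix j assume j: "real j <= A * ln (ln x)"
   define L where "L = lsum w j x"
   define N where "N = wsum w (Suc j) x"
   define S where "S = (\<Sum>P\<in>prime_sets (Suc j) x. (\<Prod>p\<in>P. w p) * ln (real (\<Prod>P)))"
   have g: "L > 0" "lprev w j x <= 2 * real j / l * L"
    using lsum_growth(1,3)[OF mw cw x(1), of A j] l2 lR A j by (simp_all add: l_def L_def R_def)
   have N0: "N >= 0" unfolding N_def using mw_bound[OF mw cw] by (intro wsum_nonneg) auto
   have prev: "lprev w j x <= 2 * A * L"
   proof -
    have "2 * real j / l <= 2 * A" using j l2 by (simp add: l_def divide_le_eq)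
    hence "2 * real j / l * L <= 2 * A * L" using g(1) by (intro mult_right_mono) auto
    thus ?thesis using g(2) by linarith
   qed
   have prev0: "lprev w j x >= 0" using lsum_nonneg[OF mw cw] by (simp add: lprev_def)
   have "\<bar>S - x * L\<bar> <= x * ((K * (1 + ln T) powr (-1/64) + real j * K * ln x / T) * L + (K + 1) * (16 * K * (ln T + 1) / ln x) * lprev w j x)"
    unfolding S_def L_def by (rule wsum_ln_weight[OF x(2) T])
   also have "... <= x * ((K * \<epsilon> + A * K * \<epsilon>) * L + (K + 1) * (16 * K * \<epsilon>) * (2 * A * L))"
   proof -
    have 1: "K * (1 + ln T) powr (-1/64) <= K * \<epsilon>" using elim(2) K by (intro mult_left_mono) (auto simp: T_def \<epsilon>_def l_def)
    have "real j * K * ln x / T <= (A * l) * K * ln x / T" using j K lx T by (intro divide_right_mono mult_right_mono) (auto simp: l_def)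
    also have "... = A * K * (l * ln x / T)" by simp
    also have "... <= A * K * \<epsilon>" using elim(3) A K by (intro mult_left_mono) (auto simp: T_def \<epsilon>_def l_def)
    finally have 2: "real j * K * ln x / T <= A * K * \<epsilon>" .
    have "16 * K * (ln T + 1) / ln x = 16 * K * ((ln T + 1) / ln x)" by simp
    also have "... <= 16 * K * \<epsilon>" using elim(4) K by (intro mult_left_mono) (auto simp: T_def \<epsilon>_def l_def)
    finally have 3: "16 * K * (ln T + 1) / ln x <= 16 * K * \<epsilon>" .
    show ?thesis using x g prev prev0 K e 1 2 3 by (intro mult_left_mono add_mono mult_mono mult_right_mono) auto
   qed
   also have "... = x * (c1 * \<epsilon> * L)" by (simp add: c1_def algebra_simps)
   finally have SL: "\<bar>S / x - L\<bar> <= c1 * \<epsilon> * L"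
   proof -
    assume a: "\<bar>S - x * L\<bar> <= x * (c1 * \<epsilon> * L)"
    have "\<bar>S / x - L\<bar> = \<bar>S - x * L\<bar> / x" using x by (simp add: field_simps abs_divide[symmetric])
    also have "... <= c1 * \<epsilon> * L" using a x by (simp add: pos_divide_le_eq mult.commute)
    finally show ?thesis .
   qed
   define a where "a = N * ln x / x"
   have a0: "a >= 0" using N0 lx x by (simp add: a_def)
   have low: "S / x <= a" unfolding a_def S_def N_def using wsum_ln_complement(1)[OF lx(1) x(2)] x by (intro divide_right_mono) auto
   \<comment> \<open>\<open>wsum_ln_complement\<close> produces \<open>lsum\<close> at
     \<open>Suc j\<close>; returning to \<open>j\<close> costs about \<open>ln (ln x)\<close>, which
     the denominator \<open>(ln x)^2\<close> absorbs.\<close>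
   have nxt: "lsum w (Suc j) x <= (ln (1 + ln x) + K) * L"
   proof -
    have X: "recip_sum w x <= ln (1 + ln x) + K" using mw_D1[OF mw cw, of x] x by (simp add: abs_le_iff)
    have "lsum w (Suc j) x <= real (Suc j) * lsum w (Suc j) x" using lsum_nonneg[OF mw cw, of "Suc j" x] by (simp add: mult_le_cancel_right1)
    also have "... <= (ln (1 + ln x) + K) * L" unfolding L_def by (rule wsum_Suc_le[OF cw_v[OF cw] X])
    finally show ?thesis .
   qed
   have "N * ln x <= S + 3 * l * N + x / (ln x)\<^sup>2 * lsum w (Suc j) x"
    unfolding S_def N_def l_def by (rule wsum_ln_complement(2)[OF lx(1) x(2)])
   also have "... <= S + 3 * l * N + x / (ln x)\<^sup>2 * ((ln (1 + ln x) + K) * L)"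
    using nxt x by (intro add_left_mono mult_left_mono) auto
   finally have "a <= (S + 3 * l * N + x / (ln x)\<^sup>2 * ((ln (1 + ln x) + K) * L)) / x"
    unfolding a_def using x by (intro divide_right_mono) auto
   also have "... = S / x + 3 * l / ln x * a + (ln (1 + ln x) + K) / (ln x)\<^sup>2 * L"
   proof -
    have "(S + 3 * l * N + x / (ln x)\<^sup>2 * (X * L)) / x = S / x + 3 * l / ln x * a + X / (ln x)\<^sup>2 * L" for X
     using x lx by (simp add: a_def add_divide_distrib)
    thus ?thesis .
   qed
   also have "... <= S / x + \<epsilon> * a + \<epsilon> * L"
    using elim(5,6) a0 g by (intro add_mono mult_right_mono) (auto simp: \<epsilon>_def l_def)
   finally have up: "a <= S / x + \<epsilon> * a + \<epsilon> * L" .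
   have ea: "\<epsilon> * a <= 1/4 * a" using e a0 by (intro mult_right_mono) auto
   have eL: "\<epsilon> * L <= 1/4 * L" using e g by (intro mult_right_mono) auto
   have "c1 * \<epsilon> * L <= c1 * 1 * L" using e c1 g by (intro mult_right_mono mult_left_mono) auto
   hence "3/4 * a <= c1 * L + 5/4 * L" using up ea eL SL by (simp add: abs_le_iff)
   moreover have "c1 * L >= 0" using c1 g by simp
   ultimately have "a <= 2 * (c1 * L) + 2 * L" using g by linarith
   hence "a <= (2 * c1 + 2) * L" by (simp add: algebra_simps)
   hence "\<epsilon> * a <= \<epsilon> * ((2 * c1 + 2) * L)" using e by (intro mult_left_mono) auto
   hence "\<bar>a - L\<bar> <= c1 * \<epsilon> * L + \<epsilon> * ((2 * c1 + 2) * L) + \<epsilon> * L"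
   proof (intro abs_leI)
    assume ea2: "\<epsilon> * a <= \<epsilon> * ((2 * c1 + 2) * L)"
    have "0 <= \<epsilon> * L" "0 <= \<epsilon> * ((2 * c1 + 2) * L)" using e g c1 by simp_all
    moreover have "S / x - L <= c1 * \<epsilon> * L" "L - S / x <= c1 * \<epsilon> * L" using SL by (simp_all add: abs_le_iff)
    ultimately show "a - L <= c1 * \<epsilon> * L + \<epsilon> * ((2 * c1 + 2) * L) + \<epsilon> * L" "- (a - L) <= c1 * \<epsilon> * L + \<epsilon> * ((2 * c1 + 2) * L) + \<epsilon> * L"
     using low up ea2 by linarith+
   qed
   also have "... = (3 * c1 + 3) * (\<epsilon> * L)" by (simp add: algebra_simps)
   also have "... <= (3 * c1 + 5) * (\<epsilon> * L)" using e g by (intro mult_right_mono) auto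
   finally show "lsum w j x > 0 & \<bar>wsum w (Suc j) x * ln x / x - lsum w j x\<bar> <= (3 * c1 + 5) / (ln (ln x))\<^sup>2 * lsum w j x"
    using g(1) by (simp add: a_def N_def L_def \<epsilon>_def l_def)
  qed
 qed
 thus ?thesis using c1 by (intro exI[of _ "3 * c1 + 5"]) auto
qed

end

section \<open>Changing the weight at finitely many primes\<close>

text \<open>The constants are hidden because every modified prime changes them, while the limits
  below only use that some constants exist.\<close>

definition admissible :: "(nat => real) => bool" where
 "admissible w \<longleftrightarrow> (EX b K. mertens_weight w b K & chebyshev_weight w K)"

lemma prime_sum_upd:
 "prime_sum (%p. g p ((w(r := c)) p)) u = prime_sum (%p. g p (w p)) u + (if prime r & real r <= u then g r c - g r (w r) else (0::real))"
proof -
 have "prime_sum (%p. g p ((w(r := c)) p)) u - prime_sum (%p. g p (w p)) u = (\<Sum>p | prime p & real p <= u. if p = r then g r c - g r (w r) else 0)"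
  unfolding prime_sum_def sum_subtractf[symmetric] by (intro sum.cong) auto
 also have "... = (if prime r & real r <= u then g r c - g r (w r) else 0)"
  by (subst sum.delta[OF finite_primes_le]) simp
 finally show ?thesis by linarith
qed

lemma admissible_upd:
 assumes "admissible w" and c: "c >= 0"
 shows "admissible (w(r := c))"
proof -
 obtain b K where mw: "mertens_weight w b K" and cw: "chebyshev_weight w K" using assms(1) by (auto simp: admissible_def)
 have K: "K >= 1" by (rule mw_K[OF mw cw])
 define s where "s = (if prime r then c / real r - w r / real r else 0)"
 \<comment> \<open>Below \<open>r\<close> the modified sum has not yet received the shift
   \<open>s\<close> of its Mertens constant; there \<open>\<bar>s\<bar>\<close> is at most
   \<open>\<bar>s\<bar> * Y / ln (ln u)\<close>, since \<open>Y\<close> dominates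
   \<open>ln (ln u)\<close>.\<close>
 define Y where "Y = ln (ln (27 + real r))"
 define K' where "K' = K + c + \<bar>s\<bar> * (1 + Y)"
 have ln3: "ln u >= 1 & ln (ln u) > 0" if "u >= 27" for u :: real
 proof -
  have "ln 27 <= ln u" using that by simp
  moreover have "ln (27::real) >= 3" using exp_27 by (subst ln_ge_iff) auto
  ultimately show ?thesis by simp
 qed
 have Y: "Y >= 0" using ln3[of "27 + real r"] by (simp add: Y_def)
 have sY: "\<bar>s\<bar> * Y >= 0" "\<bar>s\<bar> * (1 + Y) = \<bar>s\<bar> + \<bar>s\<bar> * Y" using Y by (simp_all add: distrib_left)
 have rs: "recip_sum (w(r := c)) u = recip_sum w u + (if real r <= u then s else 0)" for u
  using prime_sum_upd[of "%p y. y / real p" w r c u] by (simp add: s_def)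
 have "mertens_weight (w(r := c)) (b + s) K'"
  unfolding mertens_weight_def
 proof (intro conjI allI impI)
  show "K' >= 1" using K c sY by (simp add: K'_def)
  show "0 <= (w(r := c)) p" for p using c mw_bound[OF mw cw, of p] by simp
  have "K <= K'" "c <= K'" using K c sY by (auto simp: K'_def)
  thus "(w(r := c)) p <= K'" for p using mw_bound[OF mw cw, of p] by auto
  fix u :: real
  show "\<bar>recip_sum (w(r := c)) u - ln (1 + ln u)\<bar> <= K'" if "u >= 1"
  proof -
   have "K + \<bar>s\<bar> <= K'" using c sY by (simp add: K'_def)
   moreover have "\<bar>recip_sum w u + (if real r <= u then s else 0) - ln (1 + ln u)\<bar> <= K + \<bar>s\<bar>"
    using mw_D1[OF mw cw that] by (cases "real r <= u"; simp only: if_True if_False; linarith)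
   ultimately show ?thesis unfolding rs by linarith
  qed
  show "\<bar>recip_sum (w(r := c)) u - (ln (ln u) + (b + s))\<bar> <= K' / ln (ln u)" if u: "u >= 27"
  proof (cases "real r <= u")
   case True
   have "K / ln (ln u) <= K' / ln (ln u)" using \<open>K <= K'\<close> ln3[OF u] by (intro divide_right_mono) auto
   thus ?thesis using mw_D[OF mw cw u] True unfolding rs by (simp add: abs_le_iff, (linarith)?)
  next
   case False
   have lY: "ln (ln u) <= Y" using ln3[OF u] False u by (simp add: Y_def)
   have "\<bar>s\<bar> * ln (ln u) <= \<bar>s\<bar> * Y" using lY by (intro mult_left_mono) auto
   hence "\<bar>s\<bar> <= \<bar>s\<bar> * Y / ln (ln u)" using ln3[OF u] by (simp add: pos_le_divide_eq)
   hence "K / ln (ln u) + \<bar>s\<bar> <= (K + \<bar>s\<bar> * Y) / ln (ln u)" by (simp add: add_divide_distrib)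
   also have "... <= K' / ln (ln u)" using ln3[OF u] c sY by (intro divide_right_mono) (auto simp: K'_def)
   finally show ?thesis using mw_D[OF mw cw u] False unfolding rs by (simp add: abs_le_iff, (linarith)?)
  qed
 qed
 moreover have "chebyshev_weight (w(r := c)) K'"
  unfolding chebyshev_weight_def
 proof (intro conjI allI impI)
  show "0 <= (w(r := c)) p" for p using c mw_bound[OF mw cw, of p] by simp
  fix x :: real assume x: "x >= 0"
  have "(if prime r & real r <= x then c * ln (real r) - w r * ln (real r) else 0) <= c * x"
  proof (cases "prime r & real r <= x")
   case True
   have r: "real r >= 1" using True prime_ge_1_nat[of r] by simp
   have "ln (real r) <= x" using ln_le_minus_one[of "real r"] r True by linarith
   hence "c * ln (real r) <= c * x" using c by (intro mult_left_mono)
   moreover have "w r * ln (real r) >= 0" using mw_bound[OF mw cw, of r] r by simp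
   ultimately show ?thesis using True by simp
  qed (use c x in auto)
  moreover have "theta_sum w x <= K * x" using cw x by (simp add: chebyshev_weight_def)
  ultimately have "theta_sum (w(r := c)) x <= K * x + c * x"
   using prime_sum_upd[of "%p y. y * ln (real p)" w r c x] by linarith
  also have "... <= K' * x" using x sY unfolding K'_def by (simp add: distrib_right)
  finally show "theta_sum (w(r := c)) x <= K' * x" .
 qed
 ultimately show ?thesis unfolding admissible_def by blast
qed

lemma wsum_cong: "(!!p. prime p ==> v p = v' p) ==> wsum v k x = wsum v' k x"
 unfolding wsum_def by (intro sum.cong prod.cong) (auto dest: prime_setsD(2))

text \<open>The sets containing \<open>r\<close> correspond to sets of \<open>j\<close> primes with
  product at most \<open>x / r\<close>, among which \<open>v r = 0\<close> discards those that
  contain \<open>r\<close> again.\<close>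

lemma lsum_upd:
 assumes r: "prime r" and v: "v r = 0"
 shows "lsum (v(r := \<alpha>)) (Suc j) x = lsum v (Suc j) x + \<alpha> / real r * lsum v j (x / real r)"
proof -
 define V where "V = (%P. \<Prod>p\<in>P. v p / real p)"
 define A where "A = {P\<in>prime_sets (Suc j) x. r \<in> P}"
 have r0: "r > 0" using r by (rule prime_gt_0_nat)
 have finA: "finite A" "A <= prime_sets (Suc j) x" unfolding A_def using finite_prime_sets by auto
 have V0: "V P = 0" if "finite P" "r \<in> P" for P using that v by (auto simp: V_def intro!: prod_zero)
 have out: "(\<Prod>p\<in>P. (v(r := \<alpha>)) p / real p) = V P" if "r \<notin> P" for P
  unfolding V_def using that by (intro prod.cong) auto
 have "lsum (v(r := \<alpha>)) (Suc j) x = (\<Sum>P\<in>prime_sets (Suc j) x - A. V P) + (\<Sum>P\<in>A. \<Prod>p\<in>P. (v(r := \<alpha>)) p / real p)"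
  unfolding wsum_def sum.subset_diff[OF finA(2) finite_prime_sets, of "%P. \<Prod>p\<in>P. (v(r := \<alpha>)) p / real p"]
  using out by (intro arg_cong2[where f = "(+)"] sum.cong) (auto simp: A_def)
 also have "(\<Sum>P\<in>prime_sets (Suc j) x - A. V P) = lsum v (Suc j) x"
  unfolding wsum_def V_def[symmetric] by (rule sum.mono_neutral_left) (auto simp: finite_prime_sets A_def V0 dest: prime_setsD(1))
 also have "(\<Sum>P\<in>A. \<Prod>p\<in>P. (v(r := \<alpha>)) p / real p) = (\<Sum>Q\<in>{Q\<in>prime_sets j (x / real r). r \<notin> Q}. \<alpha> / real r * V Q)"
 proof (rule sum.reindex_bij_witness[of _ "insert r" "%P. P - {r}"])
  fix P assume "P \<in> A"
  hence P: "P \<in> prime_sets (Suc j) x" "r \<in> P" by (auto simp: A_def)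
  note D = prime_setsD[OF P(1)]
  show "insert r (P - {r}) = P" using P by auto
  have pr: "\<Prod>P = r * \<Prod>(P - {r})" using D(1) P(2) by (rule prod.remove)
  have "real r * real (\<Prod>(P - {r})) <= x" using D(4) unfolding pr by simp
  hence "real (\<Prod>(P - {r})) <= x / real r" using r0 by (simp add: pos_le_divide_eq mult.commute)
  thus "P - {r} \<in> {Q\<in>prime_sets j (x / real r). r \<notin> Q}" using D P by (auto simp: prime_sets_def)
  have "(\<Prod>p\<in>P. (v(r := \<alpha>)) p / real p) = (v(r := \<alpha>)) r / real r * (\<Prod>p\<in>P - {r}. (v(r := \<alpha>)) p / real p)"
   using D(1) P(2) by (rule prod.remove)
  also have "(\<Prod>p\<in>P - {r}. (v(r := \<alpha>)) p / real p) = V (P - {r})" by (rule out) simp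
  finally show "\<alpha> / real r * V (P - {r}) = (\<Prod>p\<in>P. (v(r := \<alpha>)) p / real p)" by (simp only: fun_upd_same)
 next
  fix Q assume "Q \<in> {Q\<in>prime_sets j (x / real r). r \<notin> Q}"
  hence Q: "Q \<in> prime_sets j (x / real r)" "r \<notin> Q" by auto
  note D = prime_setsD[OF Q(1)]
  show "insert r Q - {r} = Q" using Q by auto
  have "real r * real (\<Prod>Q) <= x" using D(4) r0 by (simp add: pos_le_divide_eq mult.commute)
  thus "insert r Q \<in> A" using D Q r by (auto simp: A_def prime_sets_def)
 qed
 also have "... = \<alpha> / real r * (\<Sum>Q\<in>{Q\<in>prime_sets j (x / real r). r \<notin> Q}. V Q)" by (rule sum_distrib_left[symmetric])
 also have "(\<Sum>Q\<in>{Q\<in>prime_sets j (x / real r). r \<notin> Q}. V Q) = lsum v j (x / real r)"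
  unfolding wsum_def V_def[symmetric] by (rule sum.mono_neutral_left) (auto simp: finite_prime_sets V0 dest: prime_setsD(1))
 finally show ?thesis .
qed

text \<open>Write \<open>L\<close> for the sums of \<open>v\<close>. By \<open>lsum_quotient\<close>
  the quotient \<open>k * L k / L (k - 1)\<close> is asymptotic to \<open>ln (ln x)\<close>, so
  \<open>L (k - 1) / L k\<close> tends to \<open>A\<close>. Passing from \<open>x\<close> to
  \<open>x / r\<close> drops only sets with product above \<open>x / r\<close>, a proportion
  \<open>O(1 / ln x)\<close>.\<close>

lemma lsum_shift_limit:
 assumes "admissible v" and A: "A > 0" and k: "((%x. real (k x) / ln (ln x)) \<longlongrightarrow> A) at_top" and r: "r >= 1"
 shows "\<forall>\<^sub>F x in at_top. k x >= 1 & lsum v (k x) x > 0"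
  and "((%x. lsum v (k x - 1) (x / r) / lsum v (k x) x) \<longlongrightarrow> A) at_top"
proof -
 obtain b K where mw: "mertens_weight v b K" and cw: "chebyshev_weight v K" using assms(1) by (auto simp: admissible_def)
 have K: "K >= 1" by (rule mw_K[OF mw cw])
 define B where "B = A + 1"
 define C where "C = rec_const b K"
 have C: "C >= 0" unfolding C_def using K by (rule rec_const_nonneg)
 define R where "R = 2 * (\<bar>b\<bar> + (2 * B + 1) * C)"
 define l where "l = (%x::real. ln (ln x))"
 have l_top: "filterlim l at_top at_top" unfolding l_def by real_asymp
 define e where "e = (%x. real (k x) * lsum v (k x) x / lsum v (k x - 1) x - (l x + b))"
 define d where "d = (%x. 1 - lsum v (k x - 1) (x / r) / lsum v (k x - 1) x)"
 have "\<forall>\<^sub>F x in at_top. real (k x) / ln (ln x) < B" using order_tendstoD(2)[OF k, of B] by (simp add: B_def)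
 moreover have "\<forall>\<^sub>F x in at_top. real (k x) / ln (ln x) > 0" using order_tendstoD(1)[OF k, of 0] A by simp
 moreover have "\<forall>\<^sub>F x in at_top. l x >= max 2 R" using l_top unfolding filterlim_at_top by blast
 moreover have "\<forall>\<^sub>F x in at_top. x >= max 729 (r^2)" by (rule eventually_ge_at_top)
 ultimately have ev: "\<forall>\<^sub>F x in at_top. k x >= 1 & lsum v (k x) x > 0 & lsum v (k x - 1) x > 0 & l x > 0 & \<bar>e x\<bar> <= 2 * C * B
   & 0 <= d x & d x <= 32 * K * (ln r + 1) * B / ln x"
 proof eventually_elim
  case (elim x)
  have l2: "l x >= 2" "l x >= R" "l x > 0" and x: "x >= 729" "x > 1" "x >= r^2" using elim by auto
  have kB: "real (k x) <= B * l x" using elim(1) l2 by (simp add: l_def pos_divide_less_eq)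
  have k1: "k x >= 1" using elim(2) l2 by (cases "k x = 0") auto
  hence Sk: "Suc (k x - 1) = k x" by simp
  have kB': "real (k x - 1) <= B * l x" using kB by simp
  have B0: "B >= 0" using A by (simp add: B_def)
  have pos: "lsum v (k x) x > 0" "lsum v (k x - 1) x > 0"
   using lsum_growth(1)[OF mw cw x(1), of B "k x"] lsum_growth(1)[OF mw cw x(1), of B "k x - 1"] l2 kB kB' B0
   by (auto simp: l_def R_def C_def)
  have "\<bar>e x\<bar> <= 2 * C * real (k x) / l x"
   using lsum_quotient[OF mw cw x(1), of B "k x - 1"] l2 kB' B0 unfolding Sk by (simp add: e_def l_def R_def C_def)
  also have "... = 2 * C * (real (k x) / l x)" by simp
  also have "... <= 2 * C * B" using elim(1) C by (intro mult_left_mono) (auto simp: l_def)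
  finally have eb: "\<bar>e x\<bar> <= 2 * C * B" .
  define D where "D = lsum v (k x - 1) x - lsum v (k x - 1) (x / r)"
  have xr: "x / r <= x" using r x by (simp add: divide_le_eq mult_le_cancel_left1)
  have D0: "D >= 0" unfolding D_def using wsum_mono[OF cw_v[OF cw] xr, where k = "k x - 1"] by simp
  have lx: "ln x > 0" using x by simp
  have D1: "D <= 16 * K * (ln r + 1) / ln x * (2 * B * lsum v (k x - 1) x)"
  proof (cases "k x - 1")
   case 0
   have "x / r >= 1"
   proof -
    have "r * 1 <= r * r" using r by (intro mult_left_mono) auto
    hence "r <= r\<^sup>2" by (simp add: power2_eq_square)
    hence "r <= x" using x(3) by (rule order.trans)
    thus ?thesis using r by simp
   qed
   hence "D = 0" unfolding D_def 0 using x by (simp add: wsum_0)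
   thus ?thesis unfolding 0 using K r lx B0 by (simp add: wsum_0)
  next
   case (Suc j)
   have sub: "prime_sets (Suc j) (x / r) <= prime_sets (Suc j) x" by (rule prime_sets_mono[OF xr])
   have "D = (\<Sum>P\<in>prime_sets (Suc j) x - prime_sets (Suc j) (x / r). \<Prod>p\<in>P. v p / real p)"
    unfolding D_def Suc wsum_def sum.subset_diff[OF sub finite_prime_sets, of "%P. \<Prod>p\<in>P. v p / real p"] by simp
   also have "... <= (\<Sum>P\<in>{P\<in>prime_sets (Suc j) x. real (\<Prod>P) >= x / r}. \<Prod>p\<in>P. v p / real p)"
   proof (rule sum_mono2)
    show "prime_sets (Suc j) x - prime_sets (Suc j) (x / r) <= {P\<in>prime_sets (Suc j) x. real (\<Prod>P) >= x / r}"
     by (auto simp: prime_sets_def)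
   qed (auto simp: finite_prime_sets intro!: wprod_nonneg[OF cw])
   also have "... <= 16 * K * (ln r + 1) / ln x * lsum v j x"
    using x r by (intro lsum_short_range[OF cw x(2)] real_le_rsqrt) auto
   also have "... <= 16 * K * (ln r + 1) / ln x * (2 * B * lsum v (k x - 1) x)"
   proof (intro mult_left_mono)
    have "lprev v (k x - 1) x <= 2 * real (k x - 1) / l x * lsum v (k x - 1) x"
     using lsum_growth(3)[OF mw cw x(1), of B "k x - 1"] l2 kB' B0 by (auto simp: l_def R_def C_def)
    also have "... <= 2 * B * lsum v (k x - 1) x"
     using kB' l2 pos by (intro mult_right_mono) (auto simp: pos_divide_le_eq)
    finally have "lprev v (k x - 1) x <= 2 * B * lsum v (k x - 1) x" .
    thus "lsum v j x <= 2 * B * lsum v (k x - 1) x" unfolding Suc by (simp add: lprev_def)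
   qed (use K r lx in auto)
   finally show ?thesis .
  qed
  have dD: "d x = D / lsum v (k x - 1) x" using pos by (simp add: d_def D_def diff_divide_distrib)
  have "d x <= 16 * K * (ln r + 1) / ln x * (2 * B)" unfolding dD using D1 pos by (simp only: pos_divide_le_eq mult.assoc[symmetric])
  moreover have "16 * K * (ln r + 1) / ln x * (2 * B) = 32 * K * (ln r + 1) * B / ln x" by (simp add: algebra_simps)
  moreover have "d x >= 0" unfolding dD using D0 pos by simp
  ultimately show ?case using k1 pos eb l2 by simp
 qed
 thus "\<forall>\<^sub>F x in at_top. k x >= 1 & lsum v (k x) x > 0" by (rule eventually_mono) auto
 have d_lim: "(d \<longlongrightarrow> 0) at_top"
 proof (rule tendsto_sandwich)
  show "\<forall>\<^sub>F x in at_top. 0 <= d x" "\<forall>\<^sub>F x in at_top. d x <= 32 * K * (ln r + 1) * B / ln x"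
   using ev by (auto elim!: eventually_mono)
  show "((%x. 32 * K * (ln r + 1) * B / ln x) \<longlongrightarrow> 0) at_top" by real_asymp
 qed simp
 have e_lim: "((%x. e x / l x) \<longlongrightarrow> 0) at_top"
 proof (rule Lim_null_comparison)
  show "\<forall>\<^sub>F x in at_top. norm (e x / l x) <= 2 * C * B / l x"
   using ev by eventually_elim (auto simp: divide_right_mono)
  show "((%x. 2 * C * B / l x) \<longlongrightarrow> 0) at_top" by (intro tendsto_divide_0[OF tendsto_const] filterlim_at_top_imp_at_infinity l_top)
 qed
 have b_lim: "((%x. b / l x) \<longlongrightarrow> 0) at_top" by (intro tendsto_divide_0[OF tendsto_const] filterlim_at_top_imp_at_infinity l_top)
 have "((%x. real (k x) / l x / (1 + b / l x + e x / l x) * (1 - d x)) \<longlongrightarrow> A / (1 + 0 + 0) * (1 - 0)) at_top"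
  using k by (intro tendsto_intros b_lim e_lim d_lim) (auto simp: l_def)
 moreover have "\<forall>\<^sub>F x in at_top. real (k x) / l x / (1 + b / l x + e x / l x) * (1 - d x) = lsum v (k x - 1) (x / r) / lsum v (k x) x"
  using ev
 proof eventually_elim
  case (elim x)
  have "1 + b / l x + e x / l x = (l x + b + e x) / l x" using elim by (simp add: add_divide_distrib)
  also have "... = (real (k x) * lsum v (k x) x / lsum v (k x - 1) x) / l x" by (simp add: e_def)
  finally have "real (k x) / l x / (1 + b / l x + e x / l x) = lsum v (k x - 1) x / lsum v (k x) x"
   using elim by simp
  thus ?case using elim by (simp add: d_def)
 qed
 ultimately show "((%x. lsum v (k x - 1) (x / r) / lsum v (k x) x) \<longlongrightarrow> A) at_top"
  by (simp add: tendsto_cong)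
qed

lemma lsum_upd_limit:
 assumes v: "admissible v" and A: "A > 0" and k: "((%x. real (k x) / ln (ln x)) \<longlongrightarrow> A) at_top"
  and r: "prime r" "v r = 0"
 shows "((%x. lsum (v(r := \<alpha>)) (k x) x / lsum v (k x) x) \<longlongrightarrow> 1 + A * \<alpha> / real r) at_top"
proof -
 have r1: "real r >= 1" using prime_ge_1_nat[OF r(1)] by simp
 note lim = lsum_shift_limit[OF v A k r1]
 have "((%x. 1 + \<alpha> / real r * (lsum v (k x - 1) (x / real r) / lsum v (k x) x)) \<longlongrightarrow> 1 + \<alpha> / real r * A) at_top"
  by (intro tendsto_intros lim)
 moreover have "\<forall>\<^sub>F x in at_top. 1 + \<alpha> / real r * (lsum v (k x - 1) (x / real r) / lsum v (k x) x) = lsum (v(r := \<alpha>)) (k x) x / lsum v (k x) x"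
  using lim(1)
 proof eventually_elim
  case (elim x)
  thus ?case using lsum_upd[of r v \<alpha> "k x - 1" x, OF r] by (simp add: add_divide_distrib)
 qed
 ultimately show ?thesis by (simp add: tendsto_cong mult.commute)
qed

definition glue :: "nat => (nat => real) => (nat => real) => nat => real" where
 "glue y w1 w0 p = (if p <= y then w1 p else w0 p)"

lemma glue_Suc: "glue (Suc y) w1 w0 = (glue y w1 w0)(Suc y := w1 (Suc y))"
 by (auto simp: glue_def fun_eq_iff le_Suc_eq)

lemma glue_0: "glue 0 w1 w0 = w0(0 := w1 0)"
 by (auto simp: glue_def fun_eq_iff)

lemma admissible_nonneg: "admissible w ==> 0 <= w p"
 by (auto simp: admissible_def mertens_weight_def)

lemma admissible_glue:
 assumes "admissible w1" "admissible w0"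
 shows "admissible (glue y w1 w0)"
proof (induction y)
 case 0
 show ?case unfolding glue_0 by (intro admissible_upd assms admissible_nonneg[OF assms(1)])
next
 case (Suc y)
 thus ?case unfolding glue_Suc by (intro admissible_upd admissible_nonneg[OF assms(1)])
qed

definition local_factor :: "real => (nat => real) => (nat => real) => nat => real" where
 "local_factor A w1 w0 p = (if prime p then (1 + A * w1 p / real p) / (1 + A * w0 p / real p) else 1)"

lemma lsum_glue_limit:
 assumes w1: "admissible w1" and w0: "admissible w0" and A: "A > 0" and k: "((%x. real (k x) / ln (ln x)) \<longlongrightarrow> A) at_top"
 shows "((%x. lsum (glue y w1 w0) (k x) x / lsum w0 (k x) x) \<longlongrightarrow> (\<Prod>p\<le>y. local_factor A w1 w0 p)) at_top"
proof (induction y)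
 case 0
 have eq: "lsum (glue 0 w1 w0) j x = lsum w0 j x" for j x
  by (rule wsum_cong) (auto simp: glue_def dest: prime_gt_0_nat)
 have "\<forall>\<^sub>F x in at_top. lsum (glue 0 w1 w0) (k x) x / lsum w0 (k x) x = 1"
  using lsum_shift_limit(1)[OF w0 A k order_refl] unfolding eq by (auto elim!: eventually_mono)
 hence "((%x. lsum (glue 0 w1 w0) (k x) x / lsum w0 (k x) x) \<longlongrightarrow> 1) at_top" by (rule tendsto_eventually)
 thus ?case by (simp add: local_factor_def)
next
 case (Suc y)
 let ?g = "glue y w1 w0" and ?r = "Suc y"
 show ?case
 proof (cases "prime ?r")
  case False
  have "lsum (glue ?r w1 w0) j x = lsum ?g j x" for j x
   by (rule wsum_cong) (use False in \<open>auto simp: glue_Suc\<close>)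
  thus ?thesis using Suc False by (simp add: local_factor_def)
 next
  case True
  \<comment> \<open>With the weight at \<open>Suc y\<close> set to 0, the glued weights for
    \<open>y\<close> and \<open>Suc y\<close> are both updates of \<open>v\<close>; the quotient of
    their two limits is the local factor.\<close>
  define v where "v = ?g(?r := 0)"
  have v: "admissible v" unfolding v_def by (intro admissible_upd admissible_glue w1 w0) simp
  have v0: "v ?r = 0" by (simp add: v_def)
  have up: "glue ?r w1 w0 = v(?r := w1 ?r)" "?g = v(?r := w0 ?r)" by (auto simp: v_def glue_Suc fun_eq_iff glue_def)
  have nz: "1 + A * w0 ?r / real ?r ~= 0"
   using A admissible_nonneg[OF w0, of ?r] by (intro add_pos_nonneg[THEN less_imp_neq, symmetric]) (auto simp del: of_nat_Suc)
  have l1: "((%x. lsum (glue ?r w1 w0) (k x) x / lsum v (k x) x) \<longlongrightarrow> 1 + A * w1 ?r / real ?r) at_top"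
   unfolding up by (rule lsum_upd_limit[OF v A k True v0])
  have l0: "((%x. lsum ?g (k x) x / lsum v (k x) x) \<longlongrightarrow> 1 + A * w0 ?r / real ?r) at_top"
   by (subst up) (rule lsum_upd_limit[OF v A k True v0])
  have "((%x. lsum ?g (k x) x / lsum w0 (k x) x * (lsum (glue ?r w1 w0) (k x) x / lsum v (k x) x / (lsum ?g (k x) x / lsum v (k x) x)))
   \<longlongrightarrow> (\<Prod>p\<le>y. local_factor A w1 w0 p) * ((1 + A * w1 ?r / real ?r) / (1 + A * w0 ?r / real ?r))) at_top"
   by (intro tendsto_mult tendsto_divide Suc l1 l0 nz)
  moreover have "\<forall>\<^sub>F x in at_top. lsum ?g (k x) x / lsum w0 (k x) x * (lsum (glue ?r w1 w0) (k x) x / lsum v (k x) x / (lsum ?g (k x) x / lsum v (k x) x))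
    = lsum (glue ?r w1 w0) (k x) x / lsum w0 (k x) x"
   using lsum_shift_limit(1)[OF v A k order_refl] lsum_shift_limit(1)[OF admissible_glue[OF w1 w0, of y] A k order_refl]
   by eventually_elim auto
  ultimately have "((%x. lsum (glue ?r w1 w0) (k x) x / lsum w0 (k x) x) \<longlongrightarrow> (\<Prod>p\<le>y. local_factor A w1 w0 p) * ((1 + A * w1 ?r / real ?r) / (1 + A * w0 ?r / real ?r))) at_top"
   by (simp only: tendsto_cong)
  thus ?thesis using True by (simp add: local_factor_def del: of_nat_Suc)
 qed
qed

section \<open>Stability under a change of the weight at large primes\<close>

text \<open>The weights are joined by the segment \<open>w' + t * (w - w')\<close>. Its derivative
  is a pointed sum in which the differences \<open>d p\<close> occur only summed up to a bound
  \<open>u\<close>, so their cancellation, lost in a termwise estimate, is kept and gives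
  \<open>\<epsilon>\<close>. The primes of \<open>Q\<close> have to be taken out of this sum; only
  those above \<open>y\<close> contribute, at a cost of \<open>W^2 / y\<close>.\<close>

lemma lsum_close:
 fixes w w' :: "nat => real" and y i :: nat
 assumes w: "!!p. 0 <= w p" "!!p. w p <= W" and w': "!!p. 0 <= w' p" "!!p. w' p <= W"
  and eq: "!!p. p <= y ==> w p = w' p" and y: "y >= 1"
  and \<epsilon>: "!!u. \<bar>recip_sum w u - recip_sum w' u\<bar> <= \<epsilon>"
  and X: "recip_sum w x <= X" "recip_sum w' x <= X"
 shows "\<bar>lsum w (Suc (Suc i)) x - lsum w' (Suc (Suc i)) x\<bar> <= \<epsilon> * (X ^ Suc i / fact (Suc i)) + W\<^sup>2 / real y * (X ^ i / fact i)"
proof -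
 define v where "v = (%t p. (w' p + t * (w p - w' p)) / real p)"
 define d where "d = (%p. (w p - w' p) / real p)"
 define V where "V = (%t P. \<Prod>p\<in>P. v t p)"
 define B where "B = \<epsilon> * (X ^ Suc i / fact (Suc i)) + W\<^sup>2 / real y * (X ^ i / fact i)"
 have W0: "W >= 0" using order.trans[OF w] by blast
 have e0: "\<epsilon> >= 0" using order.trans[OF abs_ge_zero \<epsilon>[of 0]] .
 have dmaj: "\<bar>d p\<bar> <= (if p > y then W / real p else 0)" for p
 proof (cases "p > y")
  case True
  have "\<bar>w p - w' p\<bar> <= W" using w[of p] w'[of p] by (simp add: abs_le_iff)
  thus ?thesis using True unfolding d_def abs_divide by (simp add: divide_right_mono)
 qed (use eq in \<open>auto simp: d_def\<close>)
 define \<phi>' where "\<phi>' = (%t. \<Sum>P\<in>prime_sets (Suc (Suc i)) x. \<Sum>p\<in>P. d p * V t (P - {p}))"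
 have deriv: "((%t. wsum (v t) (Suc (Suc i)) x) has_real_derivative \<phi>' t) (at t)" for t
  unfolding wsum_def \<phi>'_def V_def
 proof (rule DERIV_sum)
  fix P
  have "((%t. v t p) has_real_derivative d p) (at t)" for p
   unfolding v_def d_def by (cases "p = 0") (auto intro!: derivative_eq_intros)
  hence "((%t. \<Prod>p\<in>P. v t p) has_real_derivative (\<Sum>p\<in>P. d p * (\<Prod>p\<in>P - {p}. v t p))) (at t)"
   by (rule has_field_derivative_prod)
  thus "((%t. \<Prod>p\<in>P. v t p) has_real_derivative (\<Sum>p\<in>P. d p * (\<Prod>p\<in>P - {p}. v t p))) (at t)" .
 qed
 have bound: "\<bar>\<phi>' t\<bar> <= B" if t: "0 <= t" "t <= 1" for t
 proof -
  have vt: "w' p + t * (w p - w' p) = (1 - t) * w' p + t * w p" for p by (simp add: algebra_simps)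
  have v0: "v t p >= 0" for p unfolding v_def vt using w w' t by simp
  have v1: "v t p <= W / real p" for p
  proof -
   have "(1 - t) * w' p + t * w p <= (1 - t) * W + t * W" using w w' t by (intro add_mono mult_left_mono) auto
   thus ?thesis unfolding v_def vt by (intro divide_right_mono) (auto simp: algebra_simps)
  qed
  have V0: "V t P >= 0" for P unfolding V_def using v0 by (rule prod_nonneg)
  have "prime_sum (v t) x = (1 - t) * recip_sum w' x + t * recip_sum w x"
   unfolding prime_sum_def v_def vt sum_distrib_left sum.distrib[symmetric] by (simp add: add_divide_distrib)
  also have "... <= (1 - t) * X + t * X" using X t by (intro add_mono mult_left_mono) auto
  finally have vX: "prime_sum (v t) x <= X" by (simp add: algebra_simps)
  define g where "g = (%Q. \<Sum>p | prime p & real p <= x / real (\<Prod>Q) & p \<notin> Q. d p)"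
  have "\<phi>' t = (\<Sum>Q\<in>prime_sets (Suc i) x. \<Sum>p | prime p & real p <= x / real (\<Prod>Q) & p \<notin> Q. d p * V t Q)"
   unfolding \<phi>'_def by (rule sum_pointed_prime_sets)
  hence "\<phi>' t = (\<Sum>Q\<in>prime_sets (Suc i) x. V t Q * g Q)" unfolding g_def by (simp add: sum_distrib_left mult.commute)
  hence "\<bar>\<phi>' t\<bar> <= (\<Sum>Q\<in>prime_sets (Suc i) x. \<bar>V t Q * g Q\<bar>)" by (simp only: sum_abs)
  also have "... <= (\<Sum>Q\<in>prime_sets (Suc i) x. V t Q * \<epsilon> + (\<Sum>p\<in>Q. (if p > y then W / real p * v t p else 0) * V t (Q - {p})))"
  proof (rule sum_mono)
   fix Q assume Q: "Q \<in> prime_sets (Suc i) x"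
   define u where "u = x / real (\<Prod>Q)"
   have "prime_sum d u = g Q + (\<Sum>p\<in>{p\<in>Q. prime p & real p <= u}. d p)"
    unfolding g_def u_def by (rule prime_sum_split_mem[OF prime_setsD(1)[OF Q]])
   moreover have "prime_sum d u = recip_sum w u - recip_sum w' u"
    unfolding prime_sum_def d_def by (simp add: diff_divide_distrib sum_subtractf)
   moreover have "\<bar>\<Sum>p\<in>{p\<in>Q. prime p & real p <= u}. d p\<bar> <= (\<Sum>p\<in>Q. if p > y then W / real p else 0)"
   proof -
    have "\<bar>\<Sum>p\<in>{p\<in>Q. prime p & real p <= u}. d p\<bar> <= (\<Sum>p\<in>{p\<in>Q. prime p & real p <= u}. \<bar>d p\<bar>)" by (rule sum_abs)
    also have "... <= (\<Sum>p\<in>Q. \<bar>d p\<bar>)" using prime_setsD(1)[OF Q] by (intro sum_mono2) auto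
    also have "... <= (\<Sum>p\<in>Q. if p > y then W / real p else 0)" by (intro sum_mono dmaj)
    finally show ?thesis .
   qed
   ultimately have "\<bar>g Q\<bar> <= \<epsilon> + (\<Sum>p\<in>Q. if p > y then W / real p else 0)" using \<epsilon>[of u] by linarith
   hence "V t Q * \<bar>g Q\<bar> <= V t Q * (\<epsilon> + (\<Sum>p\<in>Q. if p > y then W / real p else 0))" using V0 by (rule mult_left_mono)
   also have "... = V t Q * \<epsilon> + (\<Sum>p\<in>Q. V t Q * (if p > y then W / real p else 0))" by (simp only: distrib_left sum_distrib_left)
   also have "(\<Sum>p\<in>Q. V t Q * (if p > y then W / real p else 0)) = (\<Sum>p\<in>Q. (if p > y then W / real p * v t p else 0) * V t (Q - {p}))"
   proof (rule sum.cong)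
    fix p assume "p \<in> Q"
    hence "V t Q = v t p * V t (Q - {p})" unfolding V_def using prime_setsD(1)[OF Q] by (intro prod.remove)
    thus "V t Q * (if p > y then W / real p else 0) = (if p > y then W / real p * v t p else 0) * V t (Q - {p})" by simp
   qed simp
   finally show "\<bar>V t Q * g Q\<bar> <= V t Q * \<epsilon> + (\<Sum>p\<in>Q. (if p > y then W / real p * v t p else 0) * V t (Q - {p}))"
    using V0[of Q] by (simp add: abs_mult)
  qed
  also have "... = wsum (v t) (Suc i) x * \<epsilon> + (\<Sum>Q\<in>prime_sets (Suc i) x. \<Sum>p\<in>Q. (if p > y then W / real p * v t p else 0) * V t (Q - {p}))"
   by (simp add: sum.distrib wsum_def V_def sum_distrib_right)
  also have "(\<Sum>Q\<in>prime_sets (Suc i) x. \<Sum>p\<in>Q. (if p > y then W / real p * v t p else 0) * V t (Q - {p}))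
    <= (\<Sum>R\<in>prime_sets i x. prime_sum (%p. (if p > y then W / real p * v t p else 0) * V t R) (x / real (\<Prod>R)))"
   using v0 V0 W0 by (intro sum_pointed_le) auto
  also have "... <= (\<Sum>R\<in>prime_sets i x. W\<^sup>2 / real y * V t R)"
  proof (rule sum_mono)
   fix R
   have "prime_sum (%p. (if p > y then W / real p * v t p else 0) * V t R) z <= prime_sum (%p. W\<^sup>2 * V t R * (if p > y then 1 / (real p)\<^sup>2 else 0)) z" for z
    unfolding prime_sum_def
   proof (rule sum_mono)
    fix p assume "p \<in> {p. prime p & real p <= z}"
    have "W / real p * v t p <= W / real p * (W / real p)" using v1 W0 by (intro mult_left_mono) auto
    hence "W / real p * v t p * V t R <= W / real p * (W / real p) * V t R" using V0 by (rule mult_right_mono)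
    thus "(if p > y then W / real p * v t p else 0) * V t R <= W\<^sup>2 * V t R * (if p > y then 1 / (real p)\<^sup>2 else 0)"
     by (simp add: power2_eq_square mult_ac)
   qed
   also have "prime_sum (%p. W\<^sup>2 * V t R * (if p > y then 1 / (real p)\<^sup>2 else 0)) (x / real (\<Prod>R)) = W\<^sup>2 * V t R * prime_sum (%p. if p > y then 1 / (real p)\<^sup>2 else 0) (x / real (\<Prod>R))"
    unfolding prime_sum_def by (rule sum_distrib_left[symmetric])
   also have "... <= W\<^sup>2 * V t R * (1 / real y)" using V0 by (intro mult_left_mono prime_sum_recip_squares y) auto
   finally show "prime_sum (%p. (if p > y then W / real p * v t p else 0) * V t R) (x / real (\<Prod>R)) <= W\<^sup>2 / real y * V t R" by simp
  qed
  also have "... = W\<^sup>2 / real y * wsum (v t) i x" by (simp add: wsum_def V_def sum_distrib_left)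
  finally have "\<bar>\<phi>' t\<bar> <= wsum (v t) (Suc i) x * \<epsilon> + W\<^sup>2 / real y * wsum (v t) i x" by simp
  also have "... <= (X ^ Suc i / fact (Suc i)) * \<epsilon> + W\<^sup>2 / real y * (X ^ i / fact i)"
   using e0 by (intro add_mono mult_right_mono mult_left_mono wsum_le_power v0 vX) auto
  finally show ?thesis by (simp add: B_def mult.commute)
 qed
 have "EX z. 0 < z & z < 1 & wsum (v 1) (Suc (Suc i)) x - wsum (v 0) (Suc (Suc i)) x = (1 - 0) * \<phi>' z"
  using deriv by (intro MVT2) auto
 then obtain z where z: "0 < z" "z < 1" "wsum (v 1) (Suc (Suc i)) x - wsum (v 0) (Suc (Suc i)) x = \<phi>' z" by auto
 have "v 1 = (%p. w p / real p)" "v 0 = (%p. w' p / real p)" by (auto simp: v_def)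
 thus ?thesis using z bound[of z] by (simp add: B_def)
qed

text \<open>Compares the error of \<open>lsum_close\<close> with \<open>lsum\<close>. Growth gives
  \<open>lsum w j x >= (l - s) ^ j / fact j\<close>, and \<open>((l + c) / (l - s)) ^ j\<close>
  stays bounded because \<open>j = O(l)\<close>; each lowering of the exponent costs a factor of at
  most \<open>B\<close>.\<close>

lemma power_fact_le_lsum:
 assumes mw: "mertens_weight w b K" and cw: "chebyshev_weight w K" and B: "B >= 1" and c: "c >= 0"
 shows "\<exists>C\<ge>0. \<forall>\<^sub>F x in at_top. ALL i. real (Suc (Suc i)) <= B * ln (ln x) -->
  (ln (ln x) + c) ^ Suc i / fact (Suc i) <= C * lsum w (Suc (Suc i)) x & (ln (ln x) + c) ^ i / fact i <= C * lsum w (Suc (Suc i)) x"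
proof -
 define s where "s = \<bar>b\<bar> + (2 * B + 1) * rec_const b K"
 have s0: "s >= 0" using B rec_const_nonneg[OF mw_K[OF mw cw]] by (simp add: s_def)
 define E where "E = exp (2 * B * (c + s))"
 have "\<forall>\<^sub>F x::real in at_top. x >= 729 & ln (ln x) >= max 2 (2 * s)"
  by (intro eventually_conj eventually_ge_at_top filterlim_at_top[THEN iffD1, rule_format]; real_asymp)
 hence "\<forall>\<^sub>F x in at_top. ALL i. real (Suc (Suc i)) <= B * ln (ln x) -->
  (ln (ln x) + c) ^ Suc i / fact (Suc i) <= (B * B * E) * lsum w (Suc (Suc i)) x & (ln (ln x) + c) ^ i / fact i <= (B * B * E) * lsum w (Suc (Suc i)) x"
 proof eventually_elim
  case (elim x)
  define l where "l = ln (ln x)"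
  define X where "X = l + c"
  have x: "x >= 729" and l2: "l >= 2" and ls: "l >= 2 * s" using elim by (auto simp: l_def)
  have X: "X > 0" "X >= l" "l - s > 0" "l - s >= l / 2" using l2 ls c s0 by (auto simp: X_def)
  have low: "(l - s) ^ j / fact j <= lsum w j x" if "real j <= B * l" for j
   using that
  proof (induction j)
   case 0
   show ?case using x by (simp add: wsum_0)
  next
   case (Suc j)
   have j: "real j <= B * l" using Suc.prems by simp
   have "(l - s) * lsum w j x <= real (Suc j) * lsum w (Suc j) x"
    using lsum_growth(2)[OF mw cw x, of B j] l2 ls B j by (simp add: l_def s_def)
   moreover have "(l - s) * ((l - s) ^ j / fact j) <= (l - s) * lsum w j x" using X Suc.IH[OF j] by (intro mult_left_mono) auto
   ultimately have "(l - s) * ((l - s) ^ j / fact j) <= lsum w (Suc j) x * real (Suc j)" by (simp only: mult.commute[of "lsum w (Suc j) x"])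
   hence "(l - s) * ((l - s) ^ j / fact j) / real (Suc j) <= lsum w (Suc j) x"
    by (subst pos_divide_le_eq) (simp_all only: of_nat_0_less_iff zero_less_Suc)
   thus ?case by (simp add: mult.commute)
  qed
  show ?case
  proof (intro allI impI)
   fix i assume i: "real (Suc (Suc i)) <= B * ln (ln x)"
   define j where "j = Suc (Suc i)"
   have jl: "real j <= B * l" using i by (simp add: j_def l_def)
   have "X / (l - s) = 1 + (c + s) / (l - s)" using X by (simp add: X_def field_simps)
   also have "... <= exp ((c + s) / (l - s))" by (rule exp_ge_add_one_self)
   finally have "(X / (l - s)) ^ j <= exp ((c + s) / (l - s)) ^ j" using X by (intro power_mono) auto
   also have "... = exp (real j * ((c + s) / (l - s)))" by (rule exp_of_nat_mult[symmetric])
   also have "... <= E"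
   proof -
    have "real j * ((c + s) / (l - s)) <= (B * l) * ((c + s) / (l / 2))"
     using jl X c s0 l2 B by (intro mult_mono divide_left_mono) auto
    also have "... = 2 * B * (c + s)" using l2 by simp
    finally show ?thesis by (simp add: E_def)
   qed
   finally have "(X / (l - s)) ^ j * ((l - s) ^ j / fact j) <= E * ((l - s) ^ j / fact j)" using X by (intro mult_right_mono) auto
   also have "... <= E * lsum w j x" using low[OF jl] by (intro mult_left_mono) (auto simp: E_def)
   finally have main: "X ^ j / fact j <= E * lsum w j x" using X by (simp add: power_divide)
   have down: "X ^ n / fact n <= B * (X ^ Suc n / fact (Suc n))" if "real (Suc n) <= B * l" for n
   proof -
    have "real (Suc n) <= B * X" using order.trans[OF that mult_left_mono[OF X(2)]] B by simp
    hence "real (Suc n) * (X ^ n / fact (Suc n)) <= B * X * (X ^ n / fact (Suc n))" using X by (intro mult_right_mono) auto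
    moreover have "real (Suc n) * (X ^ n / fact (Suc n)) = X ^ n / fact n" by (simp del: of_nat_Suc)
    ultimately show ?thesis by (simp add: mult_ac)
   qed
   have E0: "E * lsum w j x >= 0" using order.trans[OF _ main] X by simp
   have 1: "X ^ Suc i / fact (Suc i) <= B * (E * lsum w j x)"
    using order.trans[OF down[of "Suc i"] mult_left_mono[OF main[unfolded j_def]]] jl B by (simp add: j_def)
   have 2: "X ^ i / fact i <= B * (B * (E * lsum w j x))"
    using order.trans[OF down[of i] mult_left_mono[OF 1]] jl B by (simp add: j_def)
   have "B * (E * lsum w j x) <= B * (B * (E * lsum w j x))" using B E0 mult_right_mono[of 1 B "B * (E * lsum w j x)"] by simp
   thus "(ln (ln x) + c) ^ Suc i / fact (Suc i) <= (B * B * E) * lsum w (Suc (Suc i)) x & (ln (ln x) + c) ^ i / fact i <= (B * B * E) * lsum w (Suc (Suc i)) x"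
    using order.trans[OF 1] 2 unfolding X_def l_def j_def by (simp only: mult.assoc simp_thms)
  qed
 qed
 thus ?thesis using B by (intro exI[of _ "B * B * E"]) (auto simp: E_def)
qed

text \<open>The order of choices matters: first \<open>C\<close>, then \<open>\<epsilon>\<close>,
  then \<open>y\<close> so large that the tail of the difference sum is below
  \<open>\<epsilon>\<close> and the partial product is close to \<open>P\<close>, and only then
  \<open>x\<close>. For fixed \<open>y\<close>, \<open>lsum_glue_limit\<close> treats the primes up
  to \<open>y\<close> and \<open>lsum_close\<close> the others.\<close>

theorem lsum_ratio_limit:
 assumes w1: "mertens_weight w1 b1 K" "chebyshev_weight w1 K" and w0: "mertens_weight w0 b0 K" "chebyshev_weight w0 K"
  and A: "A > 0" and k: "((%x. real (k x) / ln (ln x)) \<longlongrightarrow> A) at_top"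
  and conv: "((%u. recip_sum w1 u - recip_sum w0 u) \<longlongrightarrow> c) at_top"
  and P: "(%y. \<Prod>p\<le>y. local_factor A w1 w0 p) \<longlonglongrightarrow> P"
 shows "((%x. lsum w1 (k x) x / lsum w0 (k x) x) \<longlongrightarrow> P) at_top"
proof (rule tendstoI)
 fix e :: real assume e: "e > 0"
 have K: "K >= 1" by (rule mw_K[OF w1])
 have ad: "admissible w1" "admissible w0" using w1 w0 by (auto simp: admissible_def)
 define \<Delta> where "\<Delta> = (%u. recip_sum w1 u - recip_sum w0 u)"
 have Delta_bound: "\<bar>\<Delta> u\<bar> <= 2 * K" for u
 proof (cases "u >= 1")
  case True
  show ?thesis using mw_D1[OF w1 True] mw_D1[OF w0 True] unfolding \<Delta>_def by linarith
 next
  case False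
  hence empty: "{p::nat. prime p & real p <= u} = {}" by (auto dest: prime_gt_0_nat)
  show ?thesis unfolding \<Delta>_def prime_sum_def empty using K by simp
 qed
 have B1: "A + 1 >= 1" "3 * K + 1 >= 0" using A K by simp_all
 obtain C where C: "C >= 0" and evC: "\<forall>\<^sub>F x in at_top. ALL i. real (Suc (Suc i)) <= (A + 1) * ln (ln x) -->
  (ln (ln x) + (3 * K + 1)) ^ Suc i / fact (Suc i) <= C * lsum w0 (Suc (Suc i)) x & (ln (ln x) + (3 * K + 1)) ^ i / fact i <= C * lsum w0 (Suc (Suc i)) x"
  using power_fact_le_lsum[OF w0 B1] by blast
 define \<epsilon> where "\<epsilon> = e / (4 * (C + 1))"
 have eps: "\<epsilon> > 0" using e C by (simp add: \<epsilon>_def)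
 have Ce: "C * \<epsilon> <= e / 4"
 proof -
  have "C * \<epsilon> <= (C + 1) * \<epsilon>" using eps by (intro mult_right_mono) auto
  also have "... = e / 4" using C by (simp add: \<epsilon>_def field_simps)
  finally show ?thesis .
 qed
 have "\<forall>\<^sub>F u in at_top. dist (\<Delta> u) c < \<epsilon> / 2" using tendstoD[OF conv, of "\<epsilon> / 2"] eps by (simp add: \<Delta>_def)
 then obtain U where U: "!!u. u >= U ==> dist (\<Delta> u) c < \<epsilon> / 2" unfolding eventually_at_top_linorder by blast
 have "\<forall>\<^sub>F y in sequentially. dist (\<Prod>p\<le>y. local_factor A w1 w0 p) P < e / 4" using tendstoD[OF P, of "e / 4"] e by simp
 moreover have "\<forall>\<^sub>F y in sequentially. y >= nat \<lceil>max U (K\<^sup>2 / \<epsilon>)\<rceil> + 1" by (rule eventually_ge_at_top)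
 ultimately obtain y where y: "dist (\<Prod>p\<le>y. local_factor A w1 w0 p) P < e / 4" "y >= nat \<lceil>max U (K\<^sup>2 / \<epsilon>)\<rceil> + 1"
  using eventually_happens'[OF sequentially_bot eventually_conj] by blast
 have y1: "y >= 1" using y by simp
 have "max U (K\<^sup>2 / \<epsilon>) <= real y" using y(2) by linarith
 hence yU: "real y >= U" "K\<^sup>2 / \<epsilon> <= real y" by simp_all
 have Ky: "K\<^sup>2 / real y <= \<epsilon>" using yU(2) y1 eps by (simp add: field_simps)
 define v where "v = glue y w1 w0"
 have v: "0 <= v p" "v p <= K" for p using mw_bound[OF w1, of p] mw_bound[OF w0, of p] by (auto simp: v_def glue_def)
 \<comment> \<open>The glued weight follows \<open>w1\<close> up to \<open>y\<close> and freezes the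
   difference \<open>\<Delta>\<close> from there on, so its distance from \<open>w1\<close> is a
   tail of \<open>\<Delta>\<close>.\<close>
 have recip_v: "recip_sum v u = recip_sum w0 u + \<Delta> (min u (real y))" for u
 proof -
  have "recip_sum v u - recip_sum w0 u = (\<Sum>p | prime p & real p <= u. if p <= y then w1 p / real p - w0 p / real p else 0)"
   unfolding prime_sum_def sum_subtractf[symmetric] by (intro sum.cong) (auto simp: v_def glue_def)
  also have "... = (\<Sum>p\<in>{p\<in>{p. prime p & real p <= u}. p <= y}. w1 p / real p - w0 p / real p)"
   by (rule sum.inter_filter[symmetric, OF finite_primes_le])
  also have "{p\<in>{p. prime p & real p <= u}. p <= y} = {p. prime p & real p <= min u (real y)}" by auto
  finally show ?thesis by (simp add: \<Delta>_def prime_sum_def sum_subtractf)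
 qed
 have close: "\<bar>recip_sum w1 u - recip_sum v u\<bar> <= \<epsilon>" for u
 proof (cases "u <= real y")
  case True
  thus ?thesis using eps unfolding recip_v by (simp add: \<Delta>_def min_def)
 next
  case False
  hence "recip_sum w1 u - recip_sum v u = \<Delta> u - \<Delta> (real y)" unfolding recip_v by (simp add: \<Delta>_def)
  moreover have "\<bar>\<Delta> u - c\<bar> < \<epsilon> / 2" "\<bar>\<Delta> (real y) - c\<bar> < \<epsilon> / 2" using U[of u] U[of "real y"] yU False by (auto simp: dist_real_def)
  ultimately show ?thesis by linarith
 qed
 have "\<forall>\<^sub>F x in at_top. real (k x) / ln (ln x) < A + 1" using order_tendstoD(2)[OF k, of "A + 1"] by simp
 moreover have "\<forall>\<^sub>F x in at_top. real (k x) / ln (ln x) > A / 2" using order_tendstoD(1)[OF k, of "A / 2"] A by simp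
 moreover have "\<forall>\<^sub>F x::real in at_top. ln (ln x) >= 4 / A & ln x >= 1 & x >= 1"
  by (intro eventually_conj eventually_ge_at_top filterlim_at_top[THEN iffD1, rule_format]; real_asymp)
 moreover have "\<forall>\<^sub>F x in at_top. dist (lsum v (k x) x / lsum w0 (k x) x) (\<Prod>p\<le>y. local_factor A w1 w0 p) < e / 4"
  unfolding v_def using tendstoD[OF lsum_glue_limit[OF ad A k], of "e / 4"] e by simp
 moreover note evC lsum_shift_limit(1)[OF ad(2) A k order_refl]
 ultimately show "\<forall>\<^sub>F x in at_top. dist (lsum w1 (k x) x / lsum w0 (k x) x) P < e"
 proof eventually_elim
  case (elim x)
  define l where "l = ln (ln x)"
  have l: "l >= 4 / A" "l > 0" "ln x >= 1" "x >= 1" using elim(3) A by (auto simp: l_def intro: less_le_trans[of 0 "4 / A"])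
  have L0: "lsum w0 (k x) x > 0" using elim(6) by simp
  have "2 = A / 2 * (4 / A)" using A by simp
  also have "... <= A / 2 * l" using l A by (intro mult_left_mono) auto
  also have "... < real (k x)" using elim(2) l by (simp add: l_def pos_less_divide_eq)
  finally have "k x > 2" by simp
  then obtain i where i: "k x = Suc (Suc i)" by (metis Suc_leD less_imp_Suc_add numeral_2_eq_2 add_Suc)
  have kB: "real (Suc (Suc i)) <= (A + 1) * ln (ln x)" using elim(1) l unfolding i[symmetric] by (simp add: l_def pos_divide_less_eq)
  define X where "X = l + (3 * K + 1)"
  have lnx: "ln (1 + ln x) <= l + 1"
  proof -
   have x1: "x > 1" using l(3,4) by (cases "x = 1") auto
   have "ln (1 + ln x) <= ln (2 * ln x)" using l x1 by (subst ln_le_cancel_iff) auto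
   also have "... = ln 2 + l" using x1 by (simp add: ln_mult l_def)
   finally show ?thesis using ln_2_less_1 by linarith
  qed
  have X1: "recip_sum w1 x <= X" using abs_le_D1[OF mw_D1[OF w1 l(4)]] lnx K unfolding X_def by argo
  have X0: "recip_sum v x <= X"
   unfolding recip_v using abs_le_D1[OF mw_D1[OF w0 l(4)]] abs_le_D1[OF Delta_bound[of "min x (real y)"]] lnx K unfolding X_def by argo
  have "\<bar>lsum w1 (k x) x - lsum v (k x) x\<bar> <= \<epsilon> * (X ^ Suc i / fact (Suc i)) + K\<^sup>2 / real y * (X ^ i / fact i)"
   unfolding i
  proof (rule lsum_close)
   show "w1 p = v p" if "p <= y" for p using that by (simp add: v_def glue_def)
  qed (use mw_bound[OF w1] v y1 close X1 X0 in auto)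
  also have "... <= \<epsilon> * (C * lsum w0 (k x) x) + \<epsilon> * (C * lsum w0 (k x) x)"
  proof (intro add_mono mult_mono Ky)
   show "X ^ Suc i / fact (Suc i) <= C * lsum w0 (k x) x" "X ^ i / fact i <= C * lsum w0 (k x) x"
    using elim(5) kB unfolding X_def l_def i by blast+
  qed (use eps K l y1 in \<open>auto simp: X_def\<close>)
  also have "... = 2 * (C * \<epsilon>) * lsum w0 (k x) x" by simp
  also have "... <= 2 * (e / 4) * lsum w0 (k x) x" using Ce L0 by (intro mult_right_mono mult_left_mono) auto
  finally have "\<bar>lsum w1 (k x) x - lsum v (k x) x\<bar> / lsum w0 (k x) x <= e / 2" using L0 by (simp add: pos_divide_le_eq)
  hence "\<bar>lsum w1 (k x) x / lsum w0 (k x) x - lsum v (k x) x / lsum w0 (k x) x\<bar> <= e / 2"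
   using L0 by (simp add: diff_divide_distrib[symmetric])
  thus ?case using elim(4) y(1) unfolding dist_real_def by linarith
 qed
qed

section \<open>The prime weights of the theorem\<close>

lemma pnt_weight_mono: "pnt_weight w K ==> K <= K' ==> pnt_weight w K'"
 unfolding pnt_weight_def
proof (intro allI impI)
 fix u :: real assume a: "\<forall>u\<ge>1. \<bar>theta_sum w u - u\<bar> <= K * u * (1 + ln u) powr (-1/64)" "K <= K'" "u >= 1"
 hence "K * u * (1 + ln u) powr (-1/64) <= K' * u * (1 + ln u) powr (-1/64)" by (intro mult_right_mono) auto
 thus "\<bar>theta_sum w u - u\<bar> <= K' * u * (1 + ln u) powr (-1/64)" using a(1)[rule_format, OF a(3)] by linarith
qed

lemma mertens_weight_mono:
 assumes "mertens_weight w b K" "K <= K'"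
 shows "mertens_weight w b K'"
proof -
 have "K / ln (ln u) <= K' / ln (ln u)" if u: "u >= 27" for u
 proof -
  have "ln u >= 1" using u exp_le by (subst ln_ge_iff) auto
  thus ?thesis using assms by (intro divide_right_mono) auto
 qed
 thus ?thesis using assms unfolding mertens_weight_def by (meson order.trans)
qed

lemma chebyshev_weight_mono: "chebyshev_weight w K ==> K <= K' ==> chebyshev_weight w K'"
 unfolding chebyshev_weight_def by (meson mult_right_mono order.trans)

lemma pnt_imp_chebyshev:
 assumes "pnt_weight w K" "!!p. 0 <= w p" "K >= 0"
 shows "chebyshev_weight w (1 + K)"
 unfolding chebyshev_weight_def
proof (intro conjI allI impI assms)
 fix x :: real assume x: "x >= 0"
 show "theta_sum w x <= (1 + K) * x"
 proof (cases "x >= 1")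
  case True
  have "(1 + ln x) powr (-1/64) <= (1 + ln x) powr 0" using True by (intro powr_mono) auto
  also have "... <= 1" by simp
  finally have "K * x * (1 + ln x) powr (-1/64) <= K * x * 1" using assms(3) x by (intro mult_left_mono) auto
  moreover have "\<bar>theta_sum w x - x\<bar> <= K * x * (1 + ln x) powr (-1/64)" using assms(1) True by (simp add: pnt_weight_def)
  ultimately show ?thesis by (simp add: distrib_right)
 next
  case False
  hence empty: "{p::nat. prime p & real p <= x} = {}" by (auto dest: prime_gt_0_nat)
  show ?thesis unfolding prime_sum_def empty using x assms(3) by simp
 qed
qed

definition ap_prime_weight :: "nat => nat => nat => real" where
 "ap_prime_weight q a p = (if [p = a] (mod q) then real (totient q) else 0)"

definition coprime_weight :: "nat => nat => real" where
 "coprime_weight q p = (if coprime p q then 1 else 0)"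

text \<open>A proper prime power \<open>p ^ k <= n\<close> has \<open>p <= sqrt n\<close> and
  \<open>k <= ln n / ln 2\<close>, and carries at most \<open>ln n\<close>.\<close>

lemma sum_mangoldt_nonprime:
 assumes n: "n >= 1"
 shows "(\<Sum>m | m \<in> {1..n} & \<not> prime m. mangoldt m :: real) <= 2 * sqrt (real n) * (ln (real n))\<^sup>2"
proof -
 define N1 N2 where "N1 = nat \<lfloor>sqrt (real n)\<rfloor>" and "N2 = nat \<lfloor>ln (real n) / ln 2\<rfloor>"
 define S where "S = {m\<in>{1..n}. \<not> prime m & primepow m}"
 have sub: "S <= (%(p, k). p ^ k) ` ({1..N1} \<times> {1..N2})"
 proof
  fix m assume "m \<in> S"
  hence m: "1 <= m" "m <= n" "\<not> prime m" "primepow m" by (auto simp: S_def)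
  then obtain p k where pk: "prime p" "k > 0" "m = p ^ k" by (auto simp: primepow_def)
  have "k ~= 1" using pk m by auto
  hence k2: "k >= 2" using pk by simp
  have p2: "p >= 2" using pk(1) by (rule prime_ge_2_nat)
  have "p ^ 2 <= p ^ k" using k2 p2 by (intro power_increasing) auto
  hence "(real p)\<^sup>2 <= real n" using m pk by (metis le_trans of_nat_le_iff of_nat_power)
  hence "real p <= sqrt (real n)" by (rule real_le_rsqrt)
  hence 1: "p <= N1" unfolding N1_def by (rule le_nat_floor)
  have "2 ^ k <= p ^ k" using p2 by (intro power_mono) auto
  hence "2 ^ k <= n" using m(2) pk(3) by linarith
  hence "(2::real) ^ k <= real n" by (metis of_nat_le_iff of_nat_numeral of_nat_power)
  hence "ln ((2::real) ^ k) <= ln (real n)" by (subst ln_le_cancel_iff) (use n in auto)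
  hence "real k <= ln (real n) / ln 2" by (simp add: ln_realpow pos_le_divide_eq)
  hence "k <= N2" unfolding N2_def by (rule le_nat_floor)
  thus "m \<in> (%(p, k). p ^ k) ` ({1..N1} \<times> {1..N2})" using 1 pk k2 p2 by (auto intro!: image_eqI[of _ _ "(p, k)"])
 qed
 have fin: "finite S" unfolding S_def by simp
 have "real (card S) <= real (N1 * N2)"
  using surj_card_le[OF _ sub] by (simp add: card_cartesian_product del: of_nat_mult)
 also have "... <= sqrt (real n) * (ln (real n) / ln 2)"
  unfolding of_nat_mult N1_def N2_def using n by (intro mult_mono) auto
 also have "... <= sqrt (real n) * (ln (real n) * 2)"
 proof -
  have "1/2 <= ln (2::real)" using ln_le_minus_one[of "1/2::real"] by (simp add: ln_div)
  hence "ln (real n) / ln 2 <= ln (real n) / (1/2)" using n by (intro divide_left_mono) auto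
  thus ?thesis by (intro mult_left_mono) auto
 qed
 finally have card: "real (card S) <= 2 * sqrt (real n) * ln (real n)" by simp
 have "(\<Sum>m | m \<in> {1..n} & \<not> prime m. mangoldt m :: real) = (\<Sum>m\<in>S. mangoldt m)"
  unfolding S_def by (rule sum.mono_neutral_right) (auto simp: mangoldt_def)
 also have "... <= real (card S) * ln (real n)"
 proof (rule sum_bounded_above)
  fix m assume "m \<in> S"
  hence m: "m \<in> {1..n}" by (simp add: S_def)
  have "(mangoldt m :: real) <= (\<Sum>d | d dvd m. mangoldt d)"
   using m by (intro member_le_sum) (auto intro: mangoldt_nonneg)
  also have "... = ln (real m)" using mangoldt_sum[of m, where ?'a = real] m by simp
  also have "... <= ln (real n)" using m by simp
  finally show "(mangoldt m :: real) <= ln (real n)" .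
 qed
 also have "... <= 2 * sqrt (real n) * ln (real n) * ln (real n)" using card n by (intro mult_right_mono) auto
 finally show ?thesis by (simp add: power2_eq_square)
qed

lemma ap_theta_sum:
 assumes n: "n >= 1"
 shows "\<bar>theta_sum (ap_prime_weight q a) (real n) - (\<Sum>m=1..n. ap_weight q a m)\<bar> <= real (totient q) * (2 * sqrt (real n) * (ln (real n))\<^sup>2)"
proof -
 have "(\<Sum>m=1..n. ap_weight q a m) = (\<Sum>m | m \<in> {1..n} & prime m. ap_weight q a m) + (\<Sum>m | m \<in> {1..n} & \<not> prime m. ap_weight q a m)"
  by (subst sum.union_disjoint[symmetric]) (auto intro!: sum.cong)
 moreover have "(\<Sum>m | m \<in> {1..n} & prime m. ap_weight q a m) = theta_sum (ap_prime_weight q a) (real n)"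
  unfolding prime_sum_def
  by (rule sum.cong) (auto simp: ap_weight_def ap_prime_weight_def Suc_le_eq prime_gt_0_nat)
 moreover have "0 <= (\<Sum>m | m \<in> {1..n} & \<not> prime m. ap_weight q a m)"
  by (intro sum_nonneg) (auto simp: ap_weight_def mangoldt_nonneg)
 moreover have "(\<Sum>m | m \<in> {1..n} & \<not> prime m. ap_weight q a m) <= real (totient q) * (\<Sum>m | m \<in> {1..n} & \<not> prime m. mangoldt m)"
  unfolding sum_distrib_left by (intro sum_mono) (auto simp: ap_weight_def mangoldt_nonneg)
 moreover have "... <= real (totient q) * (2 * sqrt (real n) * (ln (real n))\<^sup>2)"
  by (intro mult_left_mono sum_mangoldt_nonprime n) auto
 ultimately show ?thesis by linarith
qed

lemma ap_prime_weight_nonneg: "0 <= ap_prime_weight q a p"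
 by (simp add: ap_prime_weight_def)

text \<open>Prime powers and rounding to integers are covered by the estimates beyond a threshold
  \<open>X\<close>; the bounded range up to \<open>X\<close> goes into the constant
  \<open>K2\<close>.\<close>

lemma pnt_weight_ap:
 assumes q: "q > 1" and a: "coprime a q"
 shows "EX K. pnt_weight (ap_prime_weight q a) K"
proof -
 let ?w = "ap_prime_weight q a"
 obtain C where C: "C > 0" "!!n. n >= 2 ==> \<bar>ap_error q a n\<bar> <= C * real n * (ln (real n)) powr (-1/64)"
  using ap_error_bound[OF q a] by blast
 define \<phi> where "\<phi> = real (totient q)"
 have "\<forall>\<^sub>F u::real in at_top. u >= 3 & (ln (u - 1)) powr (-1/64) <= 2 * (1 + ln u) powr (-1/64) &
   sqrt u * (ln u)\<^sup>2 <= u * (1 + ln u) powr (-1/64) & 1 <= u * (1 + ln u) powr (-1/64)"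
  by (intro eventually_conj eventually_ge_at_top; real_asymp)
 then obtain X where X: "!!u. u >= X ==> u >= 3 & (ln (u - 1)) powr (-1/64) <= 2 * (1 + ln u) powr (-1/64) &
   sqrt u * (ln u)\<^sup>2 <= u * (1 + ln u) powr (-1/64) & 1 <= u * (1 + ln u) powr (-1/64)"
  unfolding eventually_at_top_linorder by blast
 define Y where "Y = (%u::real. (1 + ln u) powr (-1/64))"
 have X3: "X >= 3" using X[of X] by simp
 have large: "\<bar>theta_sum ?w u - u\<bar> <= (2 * C + 2 * \<phi> + 1) * (u * Y u)" if u: "u >= X" for u
 proof -
  define n where "n = nat \<lfloor>u\<rfloor>"
  have u3: "u >= 3" using X[OF u] by simp
  have n: "real n <= u" "real n >= u - 1" "n >= 2" using u3 unfolding n_def by linarith+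
  have th: "theta_sum ?w u = theta_sum ?w (real n)" unfolding n_def using u3 by (intro prime_sum_nat) auto
  have er: "(\<Sum>m=1..n. ap_weight q a m) - real n = ap_error q a n" by (simp add: ap_error_def sum_subtractf)
  have "\<bar>ap_error q a n\<bar> <= C * real n * (ln (real n)) powr (-1/64)" by (rule C(2)[OF n(3)])
  also have "... <= C * u * (ln (u - 1)) powr (-1/64)"
   using n u3 C(1) by (intro mult_mono powr_mono2') auto
  also have "... <= C * u * (2 * Y u)" using X[OF u] C(1) u3 by (intro mult_left_mono) (auto simp: Y_def)
  finally have 1: "\<bar>ap_error q a n\<bar> <= 2 * C * (u * Y u)" by (simp add: mult_ac)
  have "\<bar>theta_sum ?w (real n) - (\<Sum>m=1..n. ap_weight q a m)\<bar> <= \<phi> * (2 * sqrt (real n) * (ln (real n))\<^sup>2)"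
   unfolding \<phi>_def using n by (intro ap_theta_sum) auto
  also have "... <= \<phi> * (2 * sqrt u * (ln u)\<^sup>2)" using n u3 by (intro mult_left_mono mult_mono power_mono) (auto simp: \<phi>_def)
  also have "... = 2 * \<phi> * (sqrt u * (ln u)\<^sup>2)" by simp
  also have "... <= 2 * \<phi> * (u * Y u)" using X[OF u] by (intro mult_left_mono) (auto simp: \<phi>_def Y_def)
  finally have 2: "\<bar>theta_sum ?w (real n) - (\<Sum>m=1..n. ap_weight q a m)\<bar> <= 2 * \<phi> * (u * Y u)" .
  have 3: "\<bar>real n - u\<bar> <= u * Y u" using n X[OF u] by (simp add: Y_def abs_le_iff)
  have "\<bar>theta_sum ?w u - u\<bar> <= 2 * \<phi> * (u * Y u) + 2 * C * (u * Y u) + u * Y u"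
   unfolding th using 1 2 3 er by linarith
  thus ?thesis by (simp add: algebra_simps)
 qed
 define K2 where "K2 = (theta_sum ?w X + X) / Y X"
 have "1 + ln X > 0" using X3 by (intro add_pos_nonneg) auto
 hence YX: "Y X > 0" by (simp add: Y_def)
 have th0: "theta_sum ?w u >= 0" for u unfolding prime_sum_def
  using ap_prime_weight_nonneg by (intro sum_nonneg mult_nonneg_nonneg ln_ge_zero) (auto dest: prime_gt_0_nat)
 have small: "\<bar>theta_sum ?w u - u\<bar> <= K2 * (u * Y u)" if u: "u >= 1" "u <= X" for u
 proof -
  have "theta_sum ?w u <= theta_sum ?w X" unfolding prime_sum_def
   using ap_prime_weight_nonneg u by (intro sum_mono2 finite_primes_le mult_nonneg_nonneg ln_ge_zero) (auto dest: prime_gt_0_nat)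
  hence "\<bar>theta_sum ?w u - u\<bar> <= theta_sum ?w X + X" using th0[of u] u by (simp add: abs_le_iff)
  also have "... = K2 * (1 * Y X)" using YX by (simp add: K2_def)
  also have "... <= K2 * (u * Y u)"
  proof (intro mult_left_mono mult_mono)
   show "Y X <= Y u" unfolding Y_def using u by (intro powr_mono2') (auto intro!: add_pos_nonneg)
  qed (use u YX th0[of X] X3 in \<open>auto simp: K2_def\<close>)
  finally show ?thesis .
 qed
 have "pnt_weight ?w (2 * C + 2 * \<phi> + 1 + K2)"
  unfolding pnt_weight_def
 proof (intro allI impI)
  fix u :: real assume u: "u >= 1"
  have nn: "0 <= u * Y u" "K2 >= 0" "\<phi> >= 0" using u YX th0[of X] X3 by (auto simp: Y_def K2_def \<phi>_def)
  have "\<bar>theta_sum ?w u - u\<bar> <= (2 * C + 2 * \<phi> + 1 + K2) * (u * Y u)"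
  proof (cases "u >= X")
   case True
   have "(2 * C + 2 * \<phi> + 1) * (u * Y u) <= (2 * C + 2 * \<phi> + 1 + K2) * (u * Y u)" using nn by (intro mult_right_mono) auto
   thus ?thesis using large[OF True] by linarith
  next
   case False
   have "K2 * (u * Y u) <= (2 * C + 2 * \<phi> + 1 + K2) * (u * Y u)" using nn C(1) by (intro mult_right_mono) auto
   thus ?thesis using small[of u] u False by linarith
  qed
  thus "\<bar>theta_sum ?w u - u\<bar> <= (2 * C + 2 * \<phi> + 1 + K2) * u * (1 + ln u) powr (-1/64)" by (simp add: Y_def mult.assoc)
 qed
 thus ?thesis by blast
qed

text \<open>Averaging over the reduced residue classes lets the prime number theorem for
  progressions serve the coprime weight as well.\<close>

lemma coprime_weight_eq_average:
 assumes q: "q > 1"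
 shows "real (totient q) * coprime_weight q p = (\<Sum>a\<in>totatives q. ap_prime_weight q a p)"
proof (cases "coprime p q")
 case True
 have m: "p mod q \<in> totatives q"
 proof -
  have "coprime (p mod q) q" using True q by (simp add: coprime_mod_left_iff)
  moreover from this have "p mod q > 0" using q by (cases "p mod q = 0") auto
  moreover have "p mod q < q" using q by simp
  ultimately show ?thesis by (simp add: totatives_def)
 qed
 have "ap_prime_weight q a p = (if a = p mod q then real (totient q) else 0)" if "a \<in> totatives q" for a
 proof -
  have "a < q" using that q totatives_less by blast
  thus ?thesis by (auto simp: ap_prime_weight_def Cong.cong_def)
 qed
 hence "(\<Sum>a\<in>totatives q. ap_prime_weight q a p) = (\<Sum>a\<in>totatives q. if a = p mod q then real (totient q) else 0)" by (intro sum.cong) auto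
 also have "... = real (totient q)" using m by simp
 finally show ?thesis using True by (simp add: coprime_weight_def)
next
 case False
 have "ap_prime_weight q a p = 0" if "a \<in> totatives q" for a
 proof -
  have "coprime a q" using that by (simp add: totatives_def)
  hence "\<not> [p = a] (mod q)" using False cong_imp_coprime[of a p q] by (auto simp: cong_sym_eq coprime_commute)
  thus ?thesis by (simp add: ap_prime_weight_def)
 qed
 thus ?thesis using False by (simp add: coprime_weight_def)
qed

lemma pnt_weight_coprime:
 assumes q: "q > 1"
 shows "EX K. pnt_weight (coprime_weight q) K"
proof -
 have "\<forall>a\<in>totatives q. EX K. pnt_weight (ap_prime_weight q a) K" using pnt_weight_ap[OF q] by (auto simp: totatives_def)
 then obtain K where K: "!!a. a \<in> totatives q ==> pnt_weight (ap_prime_weight q a) (K a)" by metis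
 have fin: "finite (totatives q)" by simp
 define \<phi> where "\<phi> = real (totient q)"
 have phi: "\<phi> >= 1" using q by (simp add: \<phi>_def Suc_le_eq)
 have "pnt_weight (coprime_weight q) (\<Sum>a\<in>totatives q. K a)"
  unfolding pnt_weight_def
 proof (intro allI impI)
  fix u :: real assume u: "u >= 1"
  have "\<phi> * theta_sum (coprime_weight q) u = (\<Sum>a\<in>totatives q. theta_sum (ap_prime_weight q a) u)"
  proof -
   have "\<phi> * theta_sum (coprime_weight q) u = (\<Sum>p | prime p & real p <= u. (\<phi> * coprime_weight q p) * ln (real p))"
    by (simp only: prime_sum_def sum_distrib_left mult.assoc)
   also have "... = (\<Sum>p | prime p & real p <= u. \<Sum>a\<in>totatives q. ap_prime_weight q a p * ln (real p))"
    by (simp only: \<phi>_def coprime_weight_eq_average[OF q] sum_distrib_right)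
   also have "... = (\<Sum>a\<in>totatives q. theta_sum (ap_prime_weight q a) u)" unfolding prime_sum_def by (rule sum.swap)
   finally show ?thesis .
  qed
  hence "\<phi> * (theta_sum (coprime_weight q) u - u) = (\<Sum>a\<in>totatives q. theta_sum (ap_prime_weight q a) u - u)"
   by (simp add: sum_subtractf right_diff_distrib \<phi>_def totient_def)
  hence "\<bar>\<phi> * (theta_sum (coprime_weight q) u - u)\<bar> = \<bar>\<Sum>a\<in>totatives q. theta_sum (ap_prime_weight q a) u - u\<bar>" by (rule arg_cong)
  moreover have "\<bar>\<phi> * (theta_sum (coprime_weight q) u - u)\<bar> = \<phi> * \<bar>theta_sum (coprime_weight q) u - u\<bar>"
   using phi by (simp add: abs_mult)
  ultimately have "\<phi> * \<bar>theta_sum (coprime_weight q) u - u\<bar> = \<bar>\<Sum>a\<in>totatives q. theta_sum (ap_prime_weight q a) u - u\<bar>" by simp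
  also have "... <= (\<Sum>a\<in>totatives q. \<bar>theta_sum (ap_prime_weight q a) u - u\<bar>)" by (rule sum_abs)
  also have "... <= (\<Sum>a\<in>totatives q. K a * u * (1 + ln u) powr (-1/64))"
   using K u by (intro sum_mono) (auto simp: pnt_weight_def)
  also have "... = (\<Sum>a\<in>totatives q. K a) * u * (1 + ln u) powr (-1/64)" by (simp add: sum_distrib_right)
  finally have A: "\<phi> * \<bar>theta_sum (coprime_weight q) u - u\<bar> <= (\<Sum>a\<in>totatives q. K a) * u * (1 + ln u) powr (-1/64)" .
  have B: "1 * \<bar>theta_sum (coprime_weight q) u - u\<bar> <= \<phi> * \<bar>theta_sum (coprime_weight q) u - u\<bar>" using phi by (intro mult_right_mono) auto
  show "\<bar>theta_sum (coprime_weight q) u - u\<bar> <= (\<Sum>a\<in>totatives q. K a) * u * (1 + ln u) powr (-1/64)"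
   by (rule order.trans[OF B[unfolded mult_1] A])
 qed
 thus ?thesis by blast
qed

definition regular_weight :: "(nat => real) => real => real => bool" where
 "regular_weight w b K \<longleftrightarrow> mertens_weight w b K & chebyshev_weight w K & pnt_weight w K"

lemma regular_weight_mono: "regular_weight w b K ==> K <= K' ==> regular_weight w b K'"
 unfolding regular_weight_def by (blast intro: mertens_weight_mono chebyshev_weight_mono pnt_weight_mono)

lemma pnt_imp_regular:
 assumes "!!p. 0 <= w p" "!!p. w p <= W" "pnt_weight w K"
 shows "EX b K'. regular_weight w b K'"
proof -
 obtain b K1 where "mertens_weight w b K1" using pnt_imp_mertens[OF assms] by blast
 moreover have "pnt_weight w \<bar>K\<bar>" using assms(3) by (rule pnt_weight_mono) simp
 moreover from this have "chebyshev_weight w (1 + \<bar>K\<bar>)" by (rule pnt_imp_chebyshev) (auto simp: assms)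
 ultimately have "regular_weight w b (\<bar>K1\<bar> + 1 + \<bar>K\<bar>)"
  unfolding regular_weight_def by (auto intro: mertens_weight_mono chebyshev_weight_mono pnt_weight_mono)
 thus ?thesis by blast
qed

theorem regular_weights:
 assumes q: "q > 1" and a: "coprime a q"
 shows "EX b1 b0 K. regular_weight (ap_prime_weight q a) b1 K & regular_weight (coprime_weight q) b0 K"
proof -
 have "EX b K. regular_weight (ap_prime_weight q a) b K"
  using pnt_weight_ap[OF q a] by (auto intro!: pnt_imp_regular[of _ "real (totient q)"] simp: ap_prime_weight_def)
 then obtain b1 K1 where 1: "regular_weight (ap_prime_weight q a) b1 K1" by blast
 have "EX b K. regular_weight (coprime_weight q) b K"
  using pnt_weight_coprime[OF q] by (auto intro!: pnt_imp_regular[of _ 1] simp: coprime_weight_def)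
 then obtain b0 K0 where 0: "regular_weight (coprime_weight q) b0 K0" by blast
 show ?thesis
  by (intro exI[of _ b1] exI[of _ b0] exI[of _ "max K1 K0"] conjI regular_weight_mono[OF 1] regular_weight_mono[OF 0]) auto
qed

section \<open>Translation of the counts, the constant and the Euler product\<close>

text \<open>Unique factorisation: \<open>P\<close> consists of the prime divisors of
  \<open>\<Prod>P\<close>.\<close>

lemma prime_sets_prod_inj: "inj_on (%P. \<Prod>P) (prime_sets k x)"
proof (rule inj_onI)
 have mem: "p \<in> P \<longleftrightarrow> prime p & p dvd \<Prod>P" if P: "P \<in> prime_sets k x" for P p
 proof -
  have "p dvd \<Prod>P \<longleftrightarrow> p \<in> P" if p: "prime p" for p
  proof -
   have "p dvd \<Prod>P \<longleftrightarrow> (\<exists>r\<in>P. p dvd r)" using prime_dvd_prod_iff[OF prime_setsD(1)[OF P] p, of "%r. r"] by simp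
   thus ?thesis using primes_dvd_imp_eq[OF p] prime_setsD(2)[OF P] by (metis dvd_refl)
  qed
  thus ?thesis using prime_setsD(2)[OF P] by blast
 qed
 fix P Q assume h: "P \<in> prime_sets k x" "Q \<in> prime_sets k x" "\<Prod>P = \<Prod>Q"
 have "p \<in> P \<longleftrightarrow> p \<in> Q" for p using mem[OF h(1), of p] mem[OF h(2), of p] h(3) by simp
 thus "P = Q" by blast
qed

text \<open>The range of an injective vector is a set, and every set can be enumerated; as the
  integers \<open>n\<close> are counted, the order of the factors disappears.\<close>

lemma prime_products_count:
 "card {n. real n <= x & (\<exists>p :: nat => nat. n = (\<Prod>j=1..k. p j) & inj_on p {1..k} & (\<forall>j\<in>{1..k}. prime (p j) & G (p j)))}
 = card {P\<in>prime_sets k x. \<forall>p\<in>P. G p}"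
proof -
 have eq: "{n. real n <= x & (\<exists>p :: nat => nat. n = (\<Prod>j=1..k. p j) & inj_on p {1..k} & (\<forall>j\<in>{1..k}. prime (p j) & G (p j)))}
   = (%P. \<Prod>P) ` {P\<in>prime_sets k x. \<forall>p\<in>P. G p}" (is "?L = ?R")
 proof (intro equalityI subsetI)
  fix n assume "n \<in> ?L"
  then obtain p where p: "real n <= x" "n = (\<Prod>j=1..k. p j)" "inj_on p {1..k}" "\<forall>j\<in>{1..k}. prime (p j) & G (p j)" by blast
  have n: "n = \<Prod>(p ` {1..k})" using p(2,3) by (simp add: prod.reindex)
  have "p ` {1..k} \<in> {P\<in>prime_sets k x. \<forall>p\<in>P. G p}" using p n by (auto simp: prime_sets_def card_image)
  thus "n \<in> ?R" using n by blast
 next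
  fix n assume "n \<in> ?R"
  then obtain P where P: "P \<in> prime_sets k x" "\<forall>p\<in>P. G p" "n = \<Prod>P" by blast
  note D = prime_setsD[OF P(1)]
  obtain h where h: "bij_betw h {1..k} P" using ex_bij_betw_nat_finite_1[OF D(1)] D(3) by blast
  have "n = (\<Prod>j=1..k. h j)" using prod.reindex_bij_betw[OF h, of "%p. p"] P(3) by simp
  moreover have "h j \<in> P" if "j \<in> {1..k}" for j using h that bij_betwE by blast
  ultimately have "n = (\<Prod>j=1..k. h j) & inj_on h {1..k} & (\<forall>j\<in>{1..k}. prime (h j) & G (h j))"
   using h D(2) P(2) by (auto simp: bij_betw_def)
  moreover have "real n <= x" using D(4) P(3) by simp
  ultimately show "n \<in> ?L" by (intro CollectI conjI exI[of _ h]) auto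
 qed
 show ?thesis unfolding eq by (intro card_image inj_on_subset[OF prime_sets_prod_inj]) blast
qed

lemma wsum_indicator:
 "wsum (%p. if G p then c else 0) k x = c ^ k * real (card {P\<in>prime_sets k x. \<forall>p\<in>P. G p})"
proof -
 have "(\<Prod>p\<in>P. if G p then c else 0) = (if \<forall>p\<in>P. G p then c ^ k else 0)" if "P \<in> prime_sets k x" for P
  using prime_setsD(1,3)[OF that] by (auto intro: prod_zero)
 hence "wsum (%p. if G p then c else 0) k x = (\<Sum>P\<in>prime_sets k x. if \<forall>p\<in>P. G p then c ^ k else 0)"
  unfolding wsum_def by (intro sum.cong) auto
 also have "... = (\<Sum>P\<in>{P\<in>prime_sets k x. \<forall>p\<in>P. G p}. c ^ k)" by (rule sum.inter_filter[symmetric, OF finite_prime_sets])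
 finally show ?thesis by simp
qed

lemma S_count_eq: "real (S_count q k x) = wsum (coprime_weight q) k x"
proof -
 have "(\<forall>j\<in>{1..k}. prime (p j)) & coprime (\<Prod>j=1..k. p j) q \<longleftrightarrow> (\<forall>j\<in>{1..k}. prime (p j) & coprime (p j) q)" for p :: "nat => nat"
 proof -
  have "coprime (p j) q" if "coprime (\<Prod>j=1..k. p j) q" "j \<in> {1..k}" for j
   using that by (meson coprime_divisors dvd_prodI dvd_refl finite_atLeastAtMost)
  thus ?thesis by (auto intro: prod_coprime_left)
 qed
 hence "S_count q k x = card {P\<in>prime_sets k x. \<forall>p\<in>P. coprime p q}"
  unfolding S_count_def prime_products_count[symmetric] by simp
 thus ?thesis unfolding coprime_weight_def wsum_indicator by simp
qed

text \<open>The weight \<open>totient q\<close> at each of the \<open>k\<close> primes puts the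
  normalising power into the sum, so the ratio of the theorem becomes a ratio of two sums
  \<open>wsum\<close>.\<close>

lemma M_count_eq: "real (totient q) ^ k * real (M_count q k x (%_. int a)) = wsum (ap_prime_weight q a) k x"
 unfolding M_count_def ap_prime_weight_def wsum_indicator cong_int_iff
 by (simp only: prime_products_count[of x k "%p. [p = a] (mod q)"])

lemma count_ratio_eq:
 assumes "q > 0"
 shows "real (M_count q k x (%_. int a)) / (1 / real (totient q) ^ k * real (S_count q k x)) = wsum (ap_prime_weight q a) k x / wsum (coprime_weight q) k x"
 using assms by (simp add: S_count_eq M_count_eq[symmetric] mult.commute)

text \<open>The analysis works with natural residues; this lemma and the next two reduce an integer
  \<open>a\<close> to its least nonnegative residue.\<close>

lemma M_count_mod: "M_count q k x (%_. a) = M_count q k x (%_. int (nat (a mod int q)))" if "q > 0"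
 using that by (simp add: M_count_def Cong.cong_def)

lemma C_const_mod: "C_const q a = C_const q (int (nat (a mod int q)))" if "q > 0"
 using that by (simp add: C_const_def Cong.cong_def)

lemma euler_prod_mod: "euler_prod q a A = euler_prod q (int (nat (a mod int q))) A" if "q > 0"
proof -
 have "residue_indicator q a p = residue_indicator q (int (nat (a mod int q))) p" for p
  using that by (simp add: residue_indicator_def Cong.cong_def)
 thus ?thesis unfolding euler_prod_def by presburger
qed

lemma mertens_diff_limit:
 assumes w1: "mertens_weight w1 b1 K" and w0: "mertens_weight w0 b0 K"
 shows "((%u. recip_sum w1 u - recip_sum w0 u) \<longlongrightarrow> b1 - b0) at_top"
proof -
 have "((%u. (recip_sum w1 u - recip_sum w0 u) - (b1 - b0)) \<longlongrightarrow> 0) at_top"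
 proof (rule Lim_null_comparison)
  show "\<forall>\<^sub>F u in at_top. norm ((recip_sum w1 u - recip_sum w0 u) - (b1 - b0)) <= 2 * K / ln (ln u)"
   using eventually_ge_at_top[of 27]
  proof eventually_elim
   case (elim u)
   have "\<bar>recip_sum w1 u - (ln (ln u) + b1)\<bar> <= K / ln (ln u)" "\<bar>recip_sum w0 u - (ln (ln u) + b0)\<bar> <= K / ln (ln u)"
    using w1 w0 elim by (auto simp: mertens_weight_def)
   moreover have "2 * K / ln (ln u) = K / ln (ln u) + K / ln (ln u)" by simp
   ultimately show ?case unfolding real_norm_def by linarith
  qed
  show "((%u. 2 * K / ln (ln u)) \<longlongrightarrow> 0) at_top" by real_asymp
 qed
 thus ?thesis by (rule LIM_zero_cancel)
qed

lemma C_const_eq: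
 assumes "mertens_weight (ap_prime_weight q a) b1 K" "mertens_weight (coprime_weight q) b0 K"
 shows "C_const q (int a) = b1 - b0"
proof -
 have "real (totient q) * (\<Sum>p | prime p & real p <= x & [int p = int a] (mod int q). 1 / real p) = recip_sum (ap_prime_weight q a) x" for x
 proof -
  have "recip_sum (ap_prime_weight q a) x = (\<Sum>p | prime p & real p <= x. if [p = a] (mod q) then real (totient q) / real p else 0)"
   unfolding prime_sum_def ap_prime_weight_def by (intro sum.cong) auto
  also have "... = (\<Sum>p\<in>{p\<in>{p. prime p & real p <= x}. [p = a] (mod q)}. real (totient q) / real p)"
   by (rule sum.inter_filter[symmetric, OF finite_primes_le])
  also have "{p\<in>{p. prime p & real p <= x}. [p = a] (mod q)} = {p. prime p & real p <= x & [int p = int a] (mod int q)}"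
   by (auto simp: cong_int_iff)
  finally show ?thesis by (simp add: sum_distrib_left)
 qed
 moreover have "(\<Sum>p | prime p & real p <= x & coprime p q. 1 / real p) = recip_sum (coprime_weight q) x" for x
 proof -
  have "recip_sum (coprime_weight q) x = (\<Sum>p | prime p & real p <= x. if coprime p q then 1 / real p else 0)"
   unfolding prime_sum_def coprime_weight_def by (intro sum.cong) auto
  also have "... = (\<Sum>p\<in>{p\<in>{p. prime p & real p <= x}. coprime p q}. 1 / real p)"
   by (rule sum.inter_filter[symmetric, OF finite_primes_le])
  also have "{p\<in>{p. prime p & real p <= x}. coprime p q} = {p. prime p & real p <= x & coprime p q}" by auto
  finally show ?thesis by simp
 qed
 ultimately have "C_const q (int a) = Lim at_top (%x. recip_sum (ap_prime_weight q a) x - recip_sum (coprime_weight q) x)"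
  by (simp add: C_const_def)
 also have "... = b1 - b0" by (intro tendsto_Lim mertens_diff_limit[OF assms]) simp
 finally show ?thesis .
qed

lemma abs_ln_one_plus_diff: "x >= 0 ==> \<bar>ln (1 + x) - x\<bar> <= (x::real)\<^sup>2"
proof -
 assume x: "x >= 0"
 have "ln (1 + x) <= x" using x by (rule ln_add_one_self_le_self)
 moreover have "x - x\<^sup>2 <= ln (1 + x)"
 proof (cases "x <= 1")
  case True
  thus ?thesis using x by (intro ln_one_plus_pos_lower_bound)
 next
  case False
  hence "x <= x\<^sup>2" by (simp add: power2_eq_square)
  moreover have "ln (1 + x) >= 0" using x by simp
  ultimately show ?thesis by linarith
 qed
 ultimately show ?thesis by (simp add: abs_le_iff)
qed

text \<open>After taking logarithms, the linear terms converge by \<open>conv\<close>, possibly only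
  conditionally, and the remainders are \<open>O(1 / p^2)\<close>. The limit is an exponential,
  hence nonzero, as \<open>euler_prod_eqI\<close> demands.\<close>

lemma local_factor_prod_converges:
 assumes w: "!!p. 0 <= w1 p & w1 p <= K" "!!p. 0 <= w0 p & w0 p <= K" and A: "A > 0"
  and conv: "((%u. recip_sum w1 u - recip_sum w0 u) \<longlongrightarrow> c) at_top"
 shows "EX P. P ~= 0 & (%y. \<Prod>p\<le>y. local_factor A w1 w0 p) \<longlonglongrightarrow> P"
proof -
 define a b where "a = (%p. A * w1 p / real p)" and "b = (%p. A * w0 p / real p)"
 have ab0: "a p >= 0" "b p >= 0" for p using w[of p] A by (auto simp: a_def b_def)
 define g where "g = (%p. if prime p then ln (1 + a p) - ln (1 + b p) else 0)"
 define r where "r = (%p. if prime p then (ln (1 + a p) - a p) - (ln (1 + b p) - b p) else 0)"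
 have sq: "(a p)\<^sup>2 <= (A * K)\<^sup>2 * (1 / (real p)\<^sup>2)" "(b p)\<^sup>2 <= (A * K)\<^sup>2 * (1 / (real p)\<^sup>2)" for p
 proof -
  have "(A * w1 p)\<^sup>2 <= (A * K)\<^sup>2" "(A * w0 p)\<^sup>2 <= (A * K)\<^sup>2" using w[of p] A by (intro power_mono mult_left_mono; simp)+
  thus "(a p)\<^sup>2 <= (A * K)\<^sup>2 * (1 / (real p)\<^sup>2)" "(b p)\<^sup>2 <= (A * K)\<^sup>2 * (1 / (real p)\<^sup>2)"
   by (simp_all add: a_def b_def power_divide divide_right_mono)
 qed
 have "summable r"
 proof (rule summable_comparison_test')
  show "summable (%p. 2 * (A * K)\<^sup>2 * (1 / (real p)\<^sup>2))"
   using inverse_power_summable[of 2, where ?'a = real] by (intro summable_mult) (simp add: inverse_eq_divide)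
  fix p :: nat
  have "\<bar>(ln (1 + a p) - a p) - (ln (1 + b p) - b p)\<bar> <= (a p)\<^sup>2 + (b p)\<^sup>2"
   using abs_ln_one_plus_diff[OF ab0(1)[of p]] abs_ln_one_plus_diff[OF ab0(2)[of p]] by linarith
  also have "... <= 2 * (A * K)\<^sup>2 * (1 / (real p)\<^sup>2)" using sq[of p] by simp
  finally show "norm (r p) <= 2 * (A * K)\<^sup>2 * (1 / (real p)\<^sup>2)" by (simp add: r_def)
 qed
 hence r: "(%y. \<Sum>p\<le>y. r p) \<longlonglongrightarrow> suminf r" by (rule summable_LIMSEQ')
 have "((%y. recip_sum w1 (real y) - recip_sum w0 (real y)) \<longlongrightarrow> c) sequentially"
  by (rule filterlim_compose[OF conv filterlim_real_sequentially])
 hence "(%y. A * (recip_sum w1 (real y) - recip_sum w0 (real y)) + (\<Sum>p\<le>y. r p)) \<longlonglongrightarrow> A * c + suminf r"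
  by (intro tendsto_intros r)
 moreover have "A * (recip_sum w1 (real y) - recip_sum w0 (real y)) + (\<Sum>p\<le>y. r p) = (\<Sum>p\<le>y. g p)" for y
 proof -
  have "A * (recip_sum w1 (real y) - recip_sum w0 (real y)) = (\<Sum>p | prime p & real p <= real y. a p - b p)"
   unfolding prime_sum_def sum_subtractf[symmetric] sum_distrib_left by (intro sum.cong) (auto simp: a_def b_def right_diff_distrib)
  also have "{p. prime p & real p <= real y} = {p\<in>{..y}. prime p}" by auto
  also have "(\<Sum>p\<in>{p\<in>{..y}. prime p}. a p - b p) = (\<Sum>p\<le>y. if prime p then a p - b p else 0)" by (rule sum.inter_filter) simp
  finally have eq: "A * (recip_sum w1 (real y) - recip_sum w0 (real y)) = (\<Sum>p\<le>y. if prime p then a p - b p else 0)" .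
  show ?thesis unfolding eq sum.distrib[symmetric] by (intro sum.cong) (auto simp: g_def r_def)
 qed
 ultimately have "(%y. \<Sum>p\<le>y. g p) \<longlonglongrightarrow> A * c + suminf r" by simp
 hence "(%y. exp (\<Sum>p\<le>y. g p)) \<longlonglongrightarrow> exp (A * c + suminf r)" by (rule tendsto_exp)
 moreover have "exp (\<Sum>p\<le>y. g p) = (\<Prod>p\<le>y. local_factor A w1 w0 p)" for y
 proof -
  have "exp (g p) = local_factor A w1 w0 p" for p
  proof -
   have "1 + a p > 0" "1 + b p > 0" using ab0[of p] by linarith+
   thus ?thesis by (auto simp: g_def local_factor_def exp_diff a_def b_def)
  qed
  thus ?thesis by (simp add: exp_sum)
 qed
 ultimately show ?thesis by (intro exI[of _ "exp (A * c + suminf r)"]) simp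
qed

lemma euler_prod_eqI:
 assumes "(%y. \<Prod>p\<le>y. local_factor A (ap_prime_weight q a) (coprime_weight q) p) \<longlonglongrightarrow> P" "P ~= 0"
 shows "euler_prod q (int a) A = P"
proof -
 have eq: "(if prime p then (1 + A * real (totient q) * residue_indicator q (int a) p / real p) / (1 + A * principal_char q p / real p) else 1)
   = local_factor A (ap_prime_weight q a) (coprime_weight q) p" for p
  by (simp add: local_factor_def residue_indicator_def principal_char_def ap_prime_weight_def coprime_weight_def cong_int_iff)
 have "local_factor A (ap_prime_weight q a) (coprime_weight q) has_prod P"
  unfolding has_prod_def raw_has_prod_def using assms by simp
 thus ?thesis unfolding euler_prod_def eq by (rule has_prod_unique[symmetric])
qed

section \<open>Assembly of the three statements\<close>

text \<open>The factor \<open>x / ln x\<close> in \<open>wsum_asymptotics\<close> is the same for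
  both weights and cancels.\<close>

lemma wsum_ratio:
 assumes w1: "regular_weight w1 b1 K" and w0: "regular_weight w0 b0 K" and A: "A >= 0"
 shows "\<exists>C\<ge>0. \<forall>\<^sub>F x in at_top. ALL j. real j <= A * ln (ln x) -->
  \<bar>wsum w1 (Suc j) x / wsum w0 (Suc j) x - lsum w1 j x / lsum w0 j x\<bar> <= C / (ln (ln x))\<^sup>2 * \<bar>lsum w1 j x / lsum w0 j x\<bar>"
proof -
 obtain C1 where C1: "C1 >= 0" "\<forall>\<^sub>F x in at_top. ALL j. real j <= A * ln (ln x) -->
  lsum w1 j x > 0 & \<bar>wsum w1 (Suc j) x * ln x / x - lsum w1 j x\<bar> <= C1 / (ln (ln x))\<^sup>2 * lsum w1 j x"
  using wsum_asymptotics[of w1 b1 K A] w1 A by (auto simp: regular_weight_def)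
 obtain C0 where C0: "C0 >= 0" "\<forall>\<^sub>F x in at_top. ALL j. real j <= A * ln (ln x) -->
  lsum w0 j x > 0 & \<bar>wsum w0 (Suc j) x * ln x / x - lsum w0 j x\<bar> <= C0 / (ln (ln x))\<^sup>2 * lsum w0 j x"
  using wsum_asymptotics[of w0 b0 K A] w0 A by (auto simp: regular_weight_def)
 have "\<forall>\<^sub>F x::real in at_top. x >= 1 & ln x >= 1 & C0 / (ln (ln x))\<^sup>2 <= 1/2"
  by (intro eventually_conj eventually_ge_at_top filterlim_at_top[THEN iffD1, rule_format]; real_asymp)
 with C1(2) C0(2) have "\<forall>\<^sub>F x in at_top. ALL j. real j <= A * ln (ln x) -->
  \<bar>wsum w1 (Suc j) x / wsum w0 (Suc j) x - lsum w1 j x / lsum w0 j x\<bar> <= (2 * (C1 + C0)) / (ln (ln x))\<^sup>2 * \<bar>lsum w1 j x / lsum w0 j x\<bar>"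
 proof eventually_elim
  case (elim x)
  show ?case
  proof (intro allI impI)
   fix j assume j: "real j <= A * ln (ln x)"
   define h where "h = 1 / (ln (ln x))\<^sup>2"
   define L1 L0 where "L1 = lsum w1 j x" and "L0 = lsum w0 j x"
   define d1 d0 where "d1 = wsum w1 (Suc j) x * ln x / x / L1 - 1" and "d0 = wsum w0 (Suc j) x * ln x / x / L0 - 1"
   have pos: "L1 > 0" "L0 > 0" using elim(1,2) j by (auto simp: L1_def L0_def)
   have b: "\<bar>wsum w1 (Suc j) x * ln x / x - L1\<bar> <= C1 * h * L1" "\<bar>wsum w0 (Suc j) x * ln x / x - L0\<bar> <= C0 * h * L0"
    using elim(1,2) j by (auto simp: L1_def L0_def h_def)
   have "d1 = (wsum w1 (Suc j) x * ln x / x - L1) / L1" "d0 = (wsum w0 (Suc j) x * ln x / x - L0) / L0"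
    using pos by (simp_all add: d1_def d0_def diff_divide_distrib)
   hence d: "\<bar>d1\<bar> <= C1 * h" "\<bar>d0\<bar> <= C0 * h" using b pos by (simp_all add: abs_divide pos_divide_le_eq)
   have "C0 * h <= 1/2" using elim(3) by (simp add: h_def)
   hence d0: "1 + d0 >= 1/2" using d(2) by linarith
   have xx: "x > 0" "ln x > 0" using elim(3) by linarith+
   have N: "wsum w1 (Suc j) x * ln x / x = L1 * (1 + d1)" "wsum w0 (Suc j) x * ln x / x = L0 * (1 + d0)"
    using pos by (simp_all add: d1_def d0_def)
   have "wsum w1 (Suc j) x / wsum w0 (Suc j) x = (wsum w1 (Suc j) x * ln x / x) / (wsum w0 (Suc j) x * ln x / x)" using xx by simp
   also have "... = L1 / L0 * ((1 + d1) / (1 + d0))" unfolding N by simp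
   finally have "wsum w1 (Suc j) x / wsum w0 (Suc j) x - L1 / L0 = L1 / L0 * ((1 + d1) / (1 + d0) - 1)" by (simp add: algebra_simps)
   also have "(1 + d1) / (1 + d0) - 1 = (d1 - d0) / (1 + d0)" using d0 by (simp add: field_simps)
   finally have "\<bar>wsum w1 (Suc j) x / wsum w0 (Suc j) x - L1 / L0\<bar> = \<bar>L1 / L0\<bar> * (\<bar>d1 - d0\<bar> / (1 + d0))" using d0 by (simp add: abs_mult)
   also have "... <= \<bar>L1 / L0\<bar> * ((C1 * h + C0 * h) / (1/2))"
    using d d0 by (intro mult_left_mono frac_le) auto
   also have "... = 2 * (C1 + C0) * h * \<bar>L1 / L0\<bar>" by (simp add: algebra_simps)
   finally have "\<bar>wsum w1 (Suc j) x / wsum w0 (Suc j) x - L1 / L0\<bar> <= 2 * (C1 + C0) * h * \<bar>L1 / L0\<bar>" .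
   thus "\<bar>wsum w1 (Suc j) x / wsum w0 (Suc j) x - lsum w1 j x / lsum w0 j x\<bar> <= (2 * (C1 + C0)) / (ln (ln x))\<^sup>2 * \<bar>lsum w1 j x / lsum w0 j x\<bar>"
    by (simp add: L1_def L0_def h_def)
  qed
 qed
 thus ?thesis using C1 C0 by (intro exI[of _ "2 * (C1 + C0)"]) auto
qed

text \<open>In \<open>1 + j^2\<close> the 1 is the error of passing from \<open>wsum\<close> to
  \<open>lsum\<close>, and \<open>j^2\<close> that of the iterated recursion.\<close>

lemma wsum_ratio_expansion:
 assumes w1: "regular_weight w1 b1 K" and w0: "regular_weight w0 b0 K"
 shows "\<exists>C\<ge>0. \<forall>\<^sub>F x in at_top. ALL j. real j <= ln (ln x) -->
  \<bar>wsum w1 (Suc j) x / wsum w0 (Suc j) x - (1 + real j * (b1 - b0) / ln (ln x))\<bar> <= C * (1 + (real j)\<^sup>2) / (ln (ln x))\<^sup>2"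
proof -
 obtain C where C: "C >= 0" "\<forall>\<^sub>F x in at_top. ALL j. real j <= ln (ln x) -->
  \<bar>lsum w1 j x / lsum w0 j x - (1 + real j * (b1 - b0) / ln (ln x))\<bar> <= C * (real j)\<^sup>2 / (ln (ln x))\<^sup>2"
  using lsum_ratio[of w1 b1 K w0 b0] w1 w0 by (auto simp: regular_weight_def)
 obtain D where D: "D >= 0" "\<forall>\<^sub>F x in at_top. ALL j. real j <= 1 * ln (ln x) -->
  \<bar>wsum w1 (Suc j) x / wsum w0 (Suc j) x - lsum w1 j x / lsum w0 j x\<bar> <= D / (ln (ln x))\<^sup>2 * \<bar>lsum w1 j x / lsum w0 j x\<bar>"
  using wsum_ratio[OF w1 w0, of 1] by auto
 define E where "E = D * (1 + \<bar>b1 - b0\<bar> + C) + C"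
 have "\<forall>\<^sub>F x::real in at_top. ln (ln x) >= 1" by real_asymp
 with C(2) D(2) have "\<forall>\<^sub>F x in at_top. ALL j. real j <= ln (ln x) -->
  \<bar>wsum w1 (Suc j) x / wsum w0 (Suc j) x - (1 + real j * (b1 - b0) / ln (ln x))\<bar> <= E * (1 + (real j)\<^sup>2) / (ln (ln x))\<^sup>2"
 proof eventually_elim
  case (elim x)
  show ?case
  proof (intro allI impI)
   fix j assume j: "real j <= ln (ln x)"
   define l where "l = ln (ln x)"
   have l: "l >= 1" "real j <= l" using elim j by (auto simp: l_def)
   define \<rho> where "\<rho> = lsum w1 j x / lsum w0 j x"
   have 1: "\<bar>\<rho> - (1 + real j * (b1 - b0) / l)\<bar> <= C * (real j)\<^sup>2 / l\<^sup>2" using elim(1) j by (simp add: \<rho>_def l_def)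
   have jl: "(real j)\<^sup>2 / l\<^sup>2 <= 1" "real j / l <= 1" using l power_mono[OF l(2), of 2] by (auto simp: divide_le_eq)
   have "\<bar>real j * (b1 - b0) / l\<bar> = \<bar>b1 - b0\<bar> * (real j / l)" using l by (simp add: abs_mult)
   also have "... <= \<bar>b1 - b0\<bar> * 1" using jl by (intro mult_left_mono) auto
   finally have 2: "\<bar>real j * (b1 - b0) / l\<bar> <= \<bar>b1 - b0\<bar>" by simp
   have "C * (real j)\<^sup>2 / l\<^sup>2 <= C * 1" using mult_left_mono[OF jl(1) C(1)] by simp
   hence "\<bar>\<rho> - (1 + real j * (b1 - b0) / l)\<bar> <= C" using 1 by linarith
   moreover have "\<bar>\<rho>\<bar> <= 1 + v + c" if "\<bar>\<rho> - (1 + t)\<bar> <= c" "\<bar>t\<bar> <= v" for t v c :: real using that by linarith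
   ultimately have rho: "\<bar>\<rho>\<bar> <= 1 + \<bar>b1 - b0\<bar> + C" using 2 by blast
   have "\<bar>wsum w1 (Suc j) x / wsum w0 (Suc j) x - \<rho>\<bar> <= D / l\<^sup>2 * \<bar>\<rho>\<bar>" using elim(2) j by (simp add: \<rho>_def l_def)
   also have "... <= D / l\<^sup>2 * (1 + \<bar>b1 - b0\<bar> + C)" using D rho by (intro mult_left_mono) auto
   finally have "\<bar>wsum w1 (Suc j) x / wsum w0 (Suc j) x - (1 + real j * (b1 - b0) / l)\<bar> <= D / l\<^sup>2 * (1 + \<bar>b1 - b0\<bar> + C) + C * (real j)\<^sup>2 / l\<^sup>2"
    using 1 by linarith
   also have "... = (D * (1 + \<bar>b1 - b0\<bar> + C) * 1 + C * (real j)\<^sup>2) / l\<^sup>2" by (simp add: add_divide_distrib)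
   also have "... <= (D * (1 + \<bar>b1 - b0\<bar> + C) * (1 + (real j)\<^sup>2) + C * (1 + (real j)\<^sup>2)) / l\<^sup>2"
    using C D by (intro divide_right_mono add_mono mult_left_mono) auto
   also have "... = E * (1 + (real j)\<^sup>2) / l\<^sup>2" unfolding E_def by (simp only: distrib_right)
   finally show "\<bar>wsum w1 (Suc j) x / wsum w0 (Suc j) x - (1 + real j * (b1 - b0) / ln (ln x))\<bar> <= E * (1 + (real j)\<^sup>2) / (ln (ln x))\<^sup>2"
    by (simp add: l_def)
  qed
 qed
 thus ?thesis using C D by (intro exI[of _ E]) (auto simp: E_def)
qed

lemma count_ratio_expansion:
 assumes q: "q > 1" and a: "coprime a (int q)"
 shows "\<exists>C\<ge>0. \<forall>\<^sub>F x in at_top. \<forall>k\<ge>1. real (k - 1) <= ln (ln x) -->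
  \<bar>real (M_count q k x (%_. a)) / (1 / real (totient q) ^ k * real (S_count q k x)) - (1 + real (k - 1) * C_const q a / ln (ln x))\<bar>
   <= C * (1 + (real (k - 1))\<^sup>2) / (ln (ln x))\<^sup>2"
proof -
 define a' where "a' = nat (a mod int q)"
 have a': "coprime a' q"
 proof -
  have "coprime (int a') (int q)" using a q by (simp add: a'_def coprime_mod_left_iff)
  thus ?thesis by simp
 qed
 have q0: "q > 0" using q by simp
 obtain b1 b0 K where w: "regular_weight (ap_prime_weight q a') b1 K" "regular_weight (coprime_weight q) b0 K"
  using regular_weights[OF q a'] by blast
 have c: "C_const q a = b1 - b0"
  unfolding C_const_mod[OF q0, of a] a'_def[symmetric] using w by (intro C_const_eq[of q a' b1 K]) (auto simp: regular_weight_def)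
 obtain C where C: "C >= 0" "\<forall>\<^sub>F x in at_top. ALL j. real j <= ln (ln x) -->
  \<bar>wsum (ap_prime_weight q a') (Suc j) x / wsum (coprime_weight q) (Suc j) x - (1 + real j * (b1 - b0) / ln (ln x))\<bar> <= C * (1 + (real j)\<^sup>2) / (ln (ln x))\<^sup>2"
  using wsum_ratio_expansion[OF w] by blast
 show ?thesis
 proof (intro exI[of _ C] conjI C(1))
  show "\<forall>\<^sub>F x in at_top. \<forall>k\<ge>1. real (k - 1) <= ln (ln x) -->
   \<bar>real (M_count q k x (%_. a)) / (1 / real (totient q) ^ k * real (S_count q k x)) - (1 + real (k - 1) * C_const q a / ln (ln x))\<bar>
   <= C * (1 + (real (k - 1))\<^sup>2) / (ln (ln x))\<^sup>2"
   using C(2)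
  proof eventually_elim
   case (elim x)
   show ?case
   proof (intro allI impI)
    fix k :: nat assume k: "k >= 1" "real (k - 1) <= ln (ln x)"
    hence "Suc (k - 1) = k" by simp
    thus "\<bar>real (M_count q k x (%_. a)) / (1 / real (totient q) ^ k * real (S_count q k x)) - (1 + real (k - 1) * C_const q a / ln (ln x))\<bar>
     <= C * (1 + (real (k - 1))\<^sup>2) / (ln (ln x))\<^sup>2"
     using elim[rule_format, OF k(2)] unfolding M_count_mod[OF q0, of k x a] a'_def[symmetric] count_ratio_eq[OF q0] c by simp
   qed
  qed
 qed
qed

text \<open>The index \<open>j = k - 1\<close> of \<open>lsum\<close> grows like
  \<open>A * ln (ln x)\<close> just as \<open>k\<close> does, so \<open>lsum_ratio_limit\<close>
  applies to it. The product being nonzero is what turns a limit into an asymptotic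
  equivalence.\<close>

lemma count_ratio_limit:
 assumes q: "q > 1" and a: "coprime a (int q)" and A: "A > 0"
  and k: "((%x. real (k x) / ln (ln x)) \<longlongrightarrow> A) at_top"
 shows "((%x. real (M_count q (k x) x (%_. a)) / (1 / real (totient q) ^ k x * real (S_count q (k x) x))) \<longlongrightarrow> euler_prod q a A) at_top"
  and "euler_prod q a A ~= 0"
proof -
 define a' where "a' = nat (a mod int q)"
 have a': "coprime a' q"
 proof -
  have "coprime (int a') (int q)" using a q by (simp add: a'_def coprime_mod_left_iff)
  thus ?thesis by simp
 qed
 have q0: "q > 0" using q by simp
 let ?w1 = "ap_prime_weight q a'" and ?w0 = "coprime_weight q"
 obtain b1 b0 K where w: "regular_weight ?w1 b1 K" "regular_weight ?w0 b0 K"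
  using regular_weights[OF q a'] by blast
 have mc: "mertens_weight ?w1 b1 K" "chebyshev_weight ?w1 K" "mertens_weight ?w0 b0 K" "chebyshev_weight ?w0 K"
  using w by (auto simp: regular_weight_def)
 note conv = mertens_diff_limit[OF mc(1,3)]
 obtain P where P: "P ~= 0" "(%y. \<Prod>p\<le>y. local_factor A ?w1 ?w0 p) \<longlonglongrightarrow> P"
  using local_factor_prod_converges[OF mw_bound[OF mc(1,2)] mw_bound[OF mc(3,4)] A conv] by blast
 have eP: "euler_prod q a A = P" unfolding euler_prod_mod[OF q0, of a] a'_def[symmetric] by (rule euler_prod_eqI[OF P(2,1)])
 thus "euler_prod q a A ~= 0" using P by simp
 define j where "j = (%x. k x - 1)"
 have inv: "((%x. 1 / ln (ln x)) \<longlongrightarrow> (0::real)) at_top" by real_asymp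
 have kl: "\<forall>\<^sub>F x in at_top. real (k x) / ln (ln x) > 0" using order_tendstoD(1)[OF k, of 0] A by simp
 have lpos: "\<forall>\<^sub>F x::real in at_top. ln (ln x) > 0" by real_asymp
 have kj: "\<forall>\<^sub>F x in at_top. k x = Suc (j x)"
  using kl
 proof eventually_elim
  case (elim x)
  thus ?case by (cases "k x = 0") (simp_all add: j_def)
 qed
 have "((%x. real (k x) / ln (ln x) - 1 / ln (ln x)) \<longlongrightarrow> A - 0) at_top" by (intro tendsto_diff k inv)
 moreover have "\<forall>\<^sub>F x in at_top. real (k x) / ln (ln x) - 1 / ln (ln x) = real (j x) / ln (ln x)"
  using kj by eventually_elim (simp add: diff_divide_distrib[symmetric])
 ultimately have jA: "((%x. real (j x) / ln (ln x)) \<longlongrightarrow> A) at_top" by (simp add: tendsto_cong)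
 have \<rho>: "((%x. lsum ?w1 (j x) x / lsum ?w0 (j x) x) \<longlongrightarrow> P) at_top"
  by (rule lsum_ratio_limit[OF mc A jA conv P(2)])
 have A1: "A + 1 >= 0" using A by simp
 obtain C where C: "C >= 0" "\<forall>\<^sub>F x in at_top. ALL j. real j <= (A + 1) * ln (ln x) -->
  \<bar>wsum ?w1 (Suc j) x / wsum ?w0 (Suc j) x - lsum ?w1 j x / lsum ?w0 j x\<bar> <= C / (ln (ln x))\<^sup>2 * \<bar>lsum ?w1 j x / lsum ?w0 j x\<bar>"
  using wsum_ratio[OF w A1] by blast
 have "((%x. wsum ?w1 (k x) x / wsum ?w0 (k x) x - lsum ?w1 (j x) x / lsum ?w0 (j x) x) \<longlongrightarrow> 0) at_top"
 proof (rule Lim_null_comparison)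
  have "\<forall>\<^sub>F x in at_top. real (j x) / ln (ln x) < A + 1" using order_tendstoD(2)[OF jA, of "A + 1"] by simp
  with C(2) kj lpos
  show "\<forall>\<^sub>F x in at_top. norm (wsum ?w1 (k x) x / wsum ?w0 (k x) x - lsum ?w1 (j x) x / lsum ?w0 (j x) x) <= C / (ln (ln x))\<^sup>2 * \<bar>lsum ?w1 (j x) x / lsum ?w0 (j x) x\<bar>"
  proof eventually_elim
   case (elim x)
   have "real (j x) <= (A + 1) * ln (ln x)" using elim(3,4) by (simp add: pos_divide_less_eq)
   thus ?case using elim(1)[rule_format, of "j x"] by (simp add: elim(2))
  qed
  have "((%x. C / (ln (ln x))\<^sup>2) \<longlongrightarrow> 0) at_top" by real_asymp
  from tendsto_mult[OF this tendsto_rabs[OF \<rho>]]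
  show "((%x. C / (ln (ln x))\<^sup>2 * \<bar>lsum ?w1 (j x) x / lsum ?w0 (j x) x\<bar>) \<longlongrightarrow> 0) at_top" by simp
 qed
 from tendsto_add[OF this \<rho>] have "((%x. wsum ?w1 (k x) x / wsum ?w0 (k x) x) \<longlongrightarrow> P) at_top" by simp
 thus "((%x. real (M_count q (k x) x (%_. a)) / (1 / real (totient q) ^ k x * real (S_count q (k x) x))) \<longlongrightarrow> euler_prod q a A) at_top"
  unfolding eP M_count_mod[OF q0, of _ _ a] a'_def[symmetric] count_ratio_eq[OF q0] .
qed

theorem theorem1:
  fixes q :: nat
  assumes "q \<ge> 3"
  shows
    "(\<forall>k\<ge>2. \<exists>K :: real. \<forall>\<^sub>F x :: real in at_top. \<forall>a :: int. coprime a (int q) \<longrightarrow>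
        \<bar>real (M_count q k x (\<lambda>_. a)) / (1 / real (totient q) ^ k * real (S_count q k x))
          - (1 + (real k - 1) * C_const q a / ln (ln x))\<bar> \<le> K * (1 / (ln (ln x))\<^sup>2))
     \<and>
     (\<forall>(a :: int) (k :: real \<Rightarrow> nat).
        coprime a (int q) \<longrightarrow> (\<forall>\<^sub>F x in at_top. k x \<ge> 2) \<longrightarrow>
        (\<lambda>x. real (k x)) \<in> o[at_top](\<lambda>x. ln (ln x)) \<longrightarrow>
        (\<exists>\<epsilon> :: real \<Rightarrow> real. (\<epsilon> \<longlongrightarrow> 0) at_top \<and>
          (\<forall>\<^sub>F x in at_top.
             real (M_count q (k x) x (\<lambda>_. a))
               / (1 / real (totient q) ^ k x * real (S_count q (k x) x))
             = 1 + (real (k x) - 1) * (C_const q a + \<epsilon> x) / ln (ln x))))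
     \<and>
     (\<forall>(a :: int) (A :: real) (k :: real \<Rightarrow> nat).
        coprime a (int q) \<longrightarrow> A > 0 \<longrightarrow> (\<forall>\<^sub>F x in at_top. k x \<ge> 2) \<longrightarrow>
        (\<lambda>x. real (k x)) \<sim>[at_top] (\<lambda>x. A * ln (ln x)) \<longrightarrow>
        (\<lambda>x. real (M_count q (k x) x (\<lambda>_. a))
               / (1 / real (totient q) ^ k x * real (S_count q (k x) x)))
          \<sim>[at_top] (\<lambda>_. euler_prod q a A))"
proof (intro conjI allI impI)
 have q: "q > 1" and q0: "q > 0" using assms by simp_all
 define R where "R = (%a k x. real (M_count q k x (%_. a)) / (1 / real (totient q) ^ k * real (S_count q k x)))"
 have l1: "\<forall>\<^sub>F x::real in at_top. ln (ln x) >= 1" by real_asymp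
 {
  fix k :: nat assume k: "k >= 2"
  have k1: "k >= 1" "real (k - 1) = real k - 1" using k by auto
  have "\<exists>C\<ge>0. \<forall>\<^sub>F x in at_top. \<bar>R a k x - (1 + (real k - 1) * C_const q a / ln (ln x))\<bar> <= C * (1 / (ln (ln x))\<^sup>2)"
   if a: "coprime a (int q)" for a
  proof -
   obtain C where C: "C >= 0" "\<forall>\<^sub>F x in at_top. \<forall>k\<ge>1. real (k - 1) <= ln (ln x) -->
    \<bar>R a k x - (1 + real (k - 1) * C_const q a / ln (ln x))\<bar> <= C * (1 + (real (k - 1))\<^sup>2) / (ln (ln x))\<^sup>2"
    using count_ratio_expansion[OF q a] unfolding R_def by blast
   have "\<forall>\<^sub>F x::real in at_top. ln (ln x) >= real (k - 1)"
    by (rule filterlim_at_top[THEN iffD1, rule_format]) real_asymp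
   with C(2) have "\<forall>\<^sub>F x in at_top. \<bar>R a k x - (1 + (real k - 1) * C_const q a / ln (ln x))\<bar> <= (C * (1 + (real k - 1)\<^sup>2)) * (1 / (ln (ln x))\<^sup>2)"
   proof eventually_elim
    case (elim x)
    thus ?case using k1 by simp
   qed
   thus ?thesis using C(1) by (intro exI[of _ "C * (1 + (real k - 1)\<^sup>2)"]) auto
  qed
  hence "ALL a. EX C. coprime a (int q) --> C >= 0 & (\<forall>\<^sub>F x in at_top. \<bar>R a k x - (1 + (real k - 1) * C_const q a / ln (ln x))\<bar> <= C * (1 / (ln (ln x))\<^sup>2))" by blast
  from choice[OF this] obtain C where C: "!!a. coprime a (int q) ==> C a >= 0 & (\<forall>\<^sub>F x in at_top. \<bar>R a k x - (1 + (real k - 1) * C_const q a / ln (ln x))\<bar> <= C a * (1 / (ln (ln x))\<^sup>2))"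
   by blast
  \<comment> \<open>The constant in (i) must not depend on \<open>a\<close>: there are finitely many
    residue classes, and the sum of their nonnegative constants dominates each of them.\<close>
  define S where "S = {a\<in>{0..<int q}. coprime a (int q)}"
  have fin: "finite S" unfolding S_def by (rule finite_subset[of _ "{0..<int q}"]) auto
  have "\<forall>\<^sub>F x in at_top. \<forall>a\<in>S. \<bar>R a k x - (1 + (real k - 1) * C_const q a / ln (ln x))\<bar> <= C a * (1 / (ln (ln x))\<^sup>2)"
   using C by (intro eventually_ball_finite fin) (auto simp: S_def)
  hence "\<forall>\<^sub>F x in at_top. ALL a. coprime a (int q) --> \<bar>R a k x - (1 + (real k - 1) * C_const q a / ln (ln x))\<bar> <= sum C S * (1 / (ln (ln x))\<^sup>2)"
  proof eventually_elim
   case (elim x)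
   show ?case
   proof (intro allI impI)
    fix a assume a: "coprime a (int q)"
    define b where "b = int (nat (a mod int q))"
    have bS: "b \<in> S" using a q by (simp add: S_def b_def coprime_mod_left_iff)
    have "C b <= sum C S" using C bS by (intro member_le_sum fin) (auto simp: S_def)
    hence "C b * (1 / (ln (ln x))\<^sup>2) <= sum C S * (1 / (ln (ln x))\<^sup>2)" by (intro mult_right_mono) auto
    moreover have "R a k x = R b k x" unfolding R_def b_def by (subst M_count_mod[OF q0]) simp
    moreover have "C_const q a = C_const q b" unfolding b_def by (rule C_const_mod[OF q0])
    ultimately show "\<bar>R a k x - (1 + (real k - 1) * C_const q a / ln (ln x))\<bar> <= sum C S * (1 / (ln (ln x))\<^sup>2)"
     using bspec[OF elim bS] by simp
   qed
  qed
  thus "\<exists>K :: real. \<forall>\<^sub>F x :: real in at_top. \<forall>a :: int. coprime a (int q) -->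
    \<bar>real (M_count q k x (%_. a)) / (1 / real (totient q) ^ k * real (S_count q k x))
     - (1 + (real k - 1) * C_const q a / ln (ln x))\<bar> <= K * (1 / (ln (ln x))\<^sup>2)"
   unfolding R_def by blast
 next
  fix a :: int and k :: "real => nat"
  assume a: "coprime a (int q)" and k2: "\<forall>\<^sub>F x in at_top. k x >= 2" and ko: "(%x. real (k x)) \<in> o[at_top](%x. ln (ln x))"
  obtain C where C: "C >= 0" "\<forall>\<^sub>F x in at_top. \<forall>k\<ge>1. real (k - 1) <= ln (ln x) -->
   \<bar>R a k x - (1 + real (k - 1) * C_const q a / ln (ln x))\<bar> <= C * (1 + (real (k - 1))\<^sup>2) / (ln (ln x))\<^sup>2"
   using count_ratio_expansion[OF q a] unfolding R_def by blast
  have klim: "((%x. real (k x) / ln (ln x)) \<longlongrightarrow> 0) at_top" by (rule smalloD_tendsto[OF ko])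
  \<comment> \<open>The claimed identity solved for the error term; the division by
    \<open>k x - 1\<close> is sound where \<open>k x >= 2\<close>, that is, eventually.\<close>
  define \<epsilon> where "\<epsilon> = (%x. (R a (k x) x - 1) * ln (ln x) / (real (k x) - 1) - C_const q a)"
  have "(\<epsilon> \<longlongrightarrow> 0) at_top"
  proof (rule Lim_null_comparison)
   have "\<forall>\<^sub>F x in at_top. real (k x) / ln (ln x) < 1" using order_tendstoD(2)[OF klim, of 1] by simp
   with C(2) k2 l1 show "\<forall>\<^sub>F x in at_top. norm (\<epsilon> x) <= 2 * C * (real (k x) / ln (ln x))"
   proof eventually_elim
    case (elim x)
    define l where "l = ln (ln x)"
    define j where "j = real (k x) - 1"
    have l: "l >= 1" using elim by (simp add: l_def)
    have j: "j >= 1" "real (k x - 1) = j" "j <= real (k x)" using elim(2) by (auto simp: j_def)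
    have kl: "real (k x) <= l" using elim(4) l by (simp add: l_def pos_divide_less_eq)
    have jl: "real (k x - 1) <= ln (ln x)" using kl j by (simp add: l_def)
    have kx: "k x >= 1" using elim(2) by simp
    \<comment> \<open>Solving for \<open>\<epsilon>\<close> multiplies this error by
      \<open>l / j\<close>; since \<open>j >= 1\<close>, what is left is at most
      \<open>2 * C * k / l\<close>, which tends to 0.\<close>
    have main: "\<bar>R a (k x) x - (1 + j * C_const q a / l)\<bar> <= C * (1 + j\<^sup>2) / l\<^sup>2"
     using elim(1)[rule_format, OF kx jl] unfolding j(2) by (simp add: l_def)
    have "\<epsilon> x = (R a (k x) x - (1 + j * C_const q a / l)) * (l / j)"
    proof -
     have c: "(j * C_const q a / l) * (l / j) = C_const q a" using j l by simp
     have "(r - (1 + t)) * (l / j) = (r - 1) * l / j - t * (l / j)" for r t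
      by (simp add: left_diff_distrib distrib_right diff_divide_distrib add_divide_distrib)
     thus ?thesis unfolding \<epsilon>_def j_def[symmetric] l_def[symmetric] by (simp only: c)
    qed
    hence "\<bar>\<epsilon> x\<bar> = \<bar>R a (k x) x - (1 + j * C_const q a / l)\<bar> * (l / j)" using j l by (simp add: abs_mult)
    also have "... <= (C * (1 + j\<^sup>2) / l\<^sup>2) * (l / j)" using main j l by (intro mult_right_mono) auto
    also have "... = C / l * ((1 + j\<^sup>2) / j)" using l by (simp add: power2_eq_square)
    also have "... <= C / l * (2 * real (k x))"
    proof (intro mult_left_mono)
     have "1 <= j * j" using mult_mono[OF j(1) j(1)] j by simp
     hence "1 + j\<^sup>2 <= (2 * j) * j" by (simp add: power2_eq_square)
     hence "(1 + j\<^sup>2) / j <= 2 * j" using j by (simp add: pos_divide_le_eq)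
     thus "(1 + j\<^sup>2) / j <= 2 * real (k x)" using j by linarith
    qed (use C l in auto)
    finally show ?case by (simp add: l_def mult_ac)
   qed
   show "((%x. 2 * C * (real (k x) / ln (ln x))) \<longlongrightarrow> 0) at_top" by (rule tendsto_mult_right_zero[OF klim])
  qed
  moreover have "\<forall>\<^sub>F x in at_top. R a (k x) x = 1 + (real (k x) - 1) * (C_const q a + \<epsilon> x) / ln (ln x)"
   using k2 l1 by eventually_elim (auto simp: \<epsilon>_def)
  ultimately show "\<exists>\<epsilon> :: real => real. (\<epsilon> \<longlongrightarrow> 0) at_top & (\<forall>\<^sub>F x in at_top.
   real (M_count q (k x) x (%_. a)) / (1 / real (totient q) ^ k x * real (S_count q (k x) x))
      = 1 + (real (k x) - 1) * (C_const q a + \<epsilon> x) / ln (ln x))"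
   unfolding R_def by blast
 next
  fix a :: int and A :: real and k :: "real => nat"
  assume a: "coprime a (int q)" and A: "A > 0" and kA: "(%x. real (k x)) \<sim>[at_top] (%x. A * ln (ln x))"
  have "\<forall>\<^sub>F x in at_top. real (k x) ~= 0 \<or> A * ln (ln x) ~= 0" using l1 by eventually_elim (use A in auto)
  from asymp_equivD_strong[OF kA this] have "((%x. A * (real (k x) / (A * ln (ln x)))) \<longlongrightarrow> A * 1) at_top"
   by (rule tendsto_mult_left)
  hence k: "((%x. real (k x) / ln (ln x)) \<longlongrightarrow> A) at_top" using A by simp
  show "(%x. real (M_count q (k x) x (%_. a)) / (1 / real (totient q) ^ k x * real (S_count q (k x) x))) \<sim>[at_top] (%_. euler_prod q a A)"
   by (rule tendsto_imp_asymp_equiv_const[OF count_ratio_limit[OF q a A k]])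
 }
qed

end
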